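(* Let $N\ge3$ and let $\Omega\subset\mathbb{R}^N$ be an exterior domain. The problem $$-\Delta u+u=u\log u^2\ \text{ in }\Omega,\qquad u\in H_0^1(\Omega),$$ has no ground state solution; that is, there is no positive solution $u_0$ of this problem such that $I(u_0)=d_0$.
   Context: An exterior domain is a domain $\Omega\subset\mathbb{R}^N$ whose complement $\mathbb{R}^N\setminus\Omega$ is a bounded smooth domain (i.e. the closure of a nonempty bounded smooth domain). Fix $\delta>0$ sufficiently small and let $F_1(0)=0$, $F_1(s)=-\frac12 s^2\log s^2$ for $0<|s|<\delta$, $F_1(s)=-\frac12 s^2(\log\delta^2+3)+2\delta|s|-\frac{\delta^2}{2}$ for $|s|\ge\delta$; and $F_2(s)=0$ for $|s|<\delta$, $F_2(s)=\frac12 s^2\log(s^2/\delta^2)+2\delta|s|-\frac32s^2-\frac{\delta^2}{2}$ for $|s|\ge\delta$, so that $F_2(s)-F_1(s)=\frac12s^2\log s^2$. For $\delta$ small, $F_1$ is a convex even $C^1$ function and an $N$-function. $L^{F_1}(\Omega)=\{u\in L^1_{loc}(\Omega):\int_\Omega F_1(|u|/\lambda)<\infty\text{ for some }\lambda>0\}$ is the Orlicz space with Luxemburg norm $\|\cdot\|_{F_1}$. Let $X=H_0^1(\Omega)\cap L^{F_1}(\Omega)$ with norm $\|\cdot\|_X=\|\cdot\|_{H_0^1(\Omega)}+\|\cdot\|_{F_1}$, where $\|u\|_{H_0^1(\Omega)}^2=\int_\Omega(|\nabla u|^2+2|u|^2)$. The $C^1$ energy functional is $$I(u)=\frac12\int_\Omega(|\nabla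 u|^2+2|u|^2)+\int_\Omega F_1(u)-\int_\Omega F_2(u),\quad u\in X,$$ and solutions of the problem are the critical points of $I$ in $X$. Let $\mathcal{N}=\{u\in X\setminus\{0\}:I'(u)u=0\}$ and $d_0=\inf_{u\in\mathcal{N}}I(u)$. *)

theory Defs
  imports "HOL-Analysis.Analysis"
begin

section \<open>Smooth functions and exterior domains\<close>

primrec Ck_on :: "nat \<Rightarrow> ('a::real_normed_vector \<Rightarrow> 'b::real_normed_vector) \<Rightarrow> 'a set \<Rightarrow> bool" where
  "Ck_on 0 f S \<longleftrightarrow> continuous_on S f"
| "Ck_on (Suc k) f S \<longleftrightarrow>
     (\<forall>x\<in>S. f differentiable (at x)) \<and> (\<forall>v. Ck_on k (\<lambda>x. frechet_derivative f (at x) v) S)"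

text \<open>Intended for open \<open>S\<close>, since \<open>Ck_on\<close> uses derivatives at \<open>x\<close> and not within \<open>S\<close>.\<close>
definition smooth_on :: "('a::real_normed_vector \<Rightarrow> 'b::real_normed_vector) \<Rightarrow> 'a set \<Rightarrow> bool" where
  "smooth_on f S \<longleftrightarrow> (\<forall>k. Ck_on k f S)"

text \<open>Near each boundary point the set is, after a rotation of the coordinates, the region strictly
  above the graph of a smooth function of the coordinates orthogonal to the unit vector \<open>e\<close>.\<close>
definition smooth_boundary :: "'a::euclidean_space set \<Rightarrow> bool" where
  "smooth_boundary D \<longleftrightarrow>
     (\<forall>p\<in>frontier D. \<exists>r>0. \<exists>e \<gamma>. norm e = 1 \<and> smooth_on \<gamma> (UNIV :: 'a set) \<and>
        D \<inter> ball p r = {x \<in> ball p r. x \<bullet> e > (\<gamma> (x - (x \<bullet> e) *\<^sub>R e) :: real)})"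

definition bounded_smooth_domain :: "'a::euclidean_space set \<Rightarrow> bool" where
  "bounded_smooth_domain D \<longleftrightarrow>
     open D \<and> connected D \<and> D \<noteq> {} \<and> bounded D \<and> smooth_boundary D"

definition exterior_domain :: "'a::euclidean_space set \<Rightarrow> bool" where
  "exterior_domain \<Omega> \<longleftrightarrow>
     open \<Omega> \<and> connected \<Omega> \<and> (\<exists>D. bounded_smooth_domain D \<and> - \<Omega> = closure D)"


section \<open>The Sobolev space with zero boundary values\<close>

text \<open>Elements of the function spaces below are represented by functions on the whole space of which
  only the values on \<open>\<Omega>\<close>, up to Lebesgue null sets, are relevant.\<close>

definition L1_loc :: "'a::euclidean_space set \<Rightarrow> ('a \<Rightarrow> 'b::{banach,second_countable_topology}) set" where
  "L1_loc \<Omega> = {u. \<forall>K. compact K \<and> K \<subseteq> \<Omega> \<longrightarrow> set_integrable lebesgue K u}"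

definition test_functions :: "'a::euclidean_space set \<Rightarrow> ('a \<Rightarrow> real) set" where
  "test_functions \<Omega> = {\<phi>. smooth_on \<phi> UNIV \<and>
     compact (closure {x. \<phi> x \<noteq> 0}) \<and> closure {x. \<phi> x \<noteq> 0} \<subseteq> \<Omega>}"

definition is_weak_gradient :: "'a::euclidean_space set \<Rightarrow> ('a \<Rightarrow> real) \<Rightarrow> ('a \<Rightarrow> 'a) \<Rightarrow> bool" where
  "is_weak_gradient \<Omega> u g \<longleftrightarrow> u \<in> L1_loc \<Omega> \<and> g \<in> L1_loc \<Omega> \<and>
     (\<forall>\<phi>\<in>test_functions \<Omega>. \<forall>i\<in>Basis.
        (LINT x:\<Omega>|lebesgue. u x * frechet_derivative \<phi> (at x) i)
          = - (LINT x:\<Omega>|lebesgue. (g x \<bullet> i) * \<phi> x))"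

text \<open>The weak gradient is unique up to null sets, and it is only used under integrals.\<close>
definition weak_gradient :: "'a::euclidean_space set \<Rightarrow> ('a \<Rightarrow> real) \<Rightarrow> 'a \<Rightarrow> 'a" where
  "weak_gradient \<Omega> u = (SOME g. is_weak_gradient \<Omega> u g)"

definition H1 :: "'a::euclidean_space set \<Rightarrow> ('a \<Rightarrow> real) set" where
  "H1 \<Omega> = {u. u \<in> L1_loc \<Omega> \<and> set_integrable lebesgue \<Omega> (\<lambda>x. (u x)\<^sup>2) \<and>
     (\<exists>g. is_weak_gradient \<Omega> u g \<and> set_integrable lebesgue \<Omega> (\<lambda>x. (norm (g x))\<^sup>2))}"

text \<open>The zero-order term is weighted by 2; this is equivalent to the usual norm on \<open>H1\<close>.\<close>
definition H_norm :: "'a::euclidean_space set \<Rightarrow> ('a \<Rightarrow> real) \<Rightarrow> real" where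
  "H_norm \<Omega> u = sqrt (LINT x:\<Omega>|lebesgue. (norm (weak_gradient \<Omega> u x))\<^sup>2 + 2 * (u x)\<^sup>2)"

text \<open>The closure of the test functions in \<open>H1\<close>.\<close>
definition H10 :: "'a::euclidean_space set \<Rightarrow> ('a \<Rightarrow> real) set" where
  "H10 \<Omega> = {u \<in> H1 \<Omega>. \<forall>\<epsilon>>0. \<exists>\<phi>\<in>test_functions \<Omega>. H_norm \<Omega> (\<lambda>x. u x - \<phi> x) < \<epsilon>}"


section \<open>Splitting of the nonlinearity and the Orlicz space\<close>

definition F1 :: "real \<Rightarrow> real \<Rightarrow> real" where
  "F1 \<delta> s =
     (if s = 0 then 0
      else if \<bar>s\<bar> < \<delta> then - (1/2) * s\<^sup>2 * ln (s\<^sup>2)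
      else - (1/2) * s\<^sup>2 * (ln (\<delta>\<^sup>2) + 3) + 2 * \<delta> * \<bar>s\<bar> - \<delta>\<^sup>2 / 2)"

definition F2 :: "real \<Rightarrow> real \<Rightarrow> real" where
  "F2 \<delta> s =
     (if \<bar>s\<bar> < \<delta> then 0
      else (1/2) * s\<^sup>2 * ln (s\<^sup>2 / \<delta>\<^sup>2) + 2 * \<delta> * \<bar>s\<bar> - (3/2) * s\<^sup>2 - \<delta>\<^sup>2 / 2)"

lemma F2_minus_F1:
  assumes "\<delta> > 0"
  shows "F2 \<delta> s - F1 \<delta> s = (1/2) * s\<^sup>2 * ln (s\<^sup>2)"
  using assms by (auto simp: F1_def F2_def ln_div algebra_simps)

text \<open>\<open>F1 \<delta>\<close> is nonnegative for small \<open>\<delta>\<close>, so the modular may be taken as a nonnegative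
  integral; unlike the Bochner integral it is infinite when the integrand is not integrable.\<close>
definition modular :: "real \<Rightarrow> 'a::euclidean_space set \<Rightarrow> ('a \<Rightarrow> real) \<Rightarrow> ennreal" where
  "modular \<delta> \<Omega> u = (\<integral>\<^sup>+x\<in>\<Omega>. ennreal (F1 \<delta> \<bar>u x\<bar>) \<partial>lebesgue)"

definition Orlicz :: "real \<Rightarrow> 'a::euclidean_space set \<Rightarrow> ('a \<Rightarrow> real) set" where
  "Orlicz \<delta> \<Omega> = {u \<in> L1_loc \<Omega>. \<exists>c>0. modular \<delta> \<Omega> (\<lambda>x. u x / c) < \<infinity>}"

definition Luxemburg_norm :: "real \<Rightarrow> 'a::euclidean_space set \<Rightarrow> ('a \<Rightarrow> real) \<Rightarrow> real" where
  "Luxemburg_norm \<delta> \<Omega> u = Inf {c. c > 0 \<and> modular \<delta> \<Omega> (\<lambda>x. u x / c) \<le> 1}"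


section \<open>The energy functional, its critical points and the Nehari set\<close>

definition X :: "real \<Rightarrow> 'a::euclidean_space set \<Rightarrow> ('a \<Rightarrow> real) set" where
  "X \<delta> \<Omega> = H10 \<Omega> \<inter> Orlicz \<delta> \<Omega>"

definition X_norm :: "real \<Rightarrow> 'a::euclidean_space set \<Rightarrow> ('a \<Rightarrow> real) \<Rightarrow> real" where
  "X_norm \<delta> \<Omega> u = H_norm \<Omega> u + Luxemburg_norm \<delta> \<Omega> u"

definition energy :: "real \<Rightarrow> 'a::euclidean_space set \<Rightarrow> ('a \<Rightarrow> real) \<Rightarrow> real" where
  "energy \<delta> \<Omega> u =
     (1/2) * (LINT x:\<Omega>|lebesgue. (norm (weak_gradient \<Omega> u x))\<^sup>2 + 2 * (u x)\<^sup>2)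
     + (LINT x:\<Omega>|lebesgue. F1 \<delta> (u x)) - (LINT x:\<Omega>|lebesgue. F2 \<delta> (u x))"

text \<open>\<open>L\<close> is the Frechet derivative at \<open>u\<close> of the energy on the normed space \<open>X\<close>.\<close>
definition has_energy_derivative ::
  "real \<Rightarrow> 'a::euclidean_space set \<Rightarrow> ('a \<Rightarrow> real) \<Rightarrow> (('a \<Rightarrow> real) \<Rightarrow> real) \<Rightarrow> bool" where
  "has_energy_derivative \<delta> \<Omega> u L \<longleftrightarrow>
     (\<forall>v\<in>X \<delta> \<Omega>. \<forall>w\<in>X \<delta> \<Omega>. \<forall>a b. L (\<lambda>x. a * v x + b * w x) = a * L v + b * L w) \<and>
     (\<exists>C. \<forall>v\<in>X \<delta> \<Omega>. \<bar>L v\<bar> \<le> C * X_norm \<delta> \<Omega> v) \<and>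
     (\<forall>\<epsilon>>0. \<exists>\<eta>>0. \<forall>h\<in>X \<delta> \<Omega>. X_norm \<delta> \<Omega> h < \<eta> \<longrightarrow>
        \<bar>energy \<delta> \<Omega> (\<lambda>x. u x + h x) - energy \<delta> \<Omega> u - L h\<bar> \<le> \<epsilon> * X_norm \<delta> \<Omega> h)"

text \<open>Solution of \<open>-\<Delta>u + u = u log u\<^sup>2\<close> in \<open>\<Omega>\<close> with zero boundary values, that is,
  a critical point of the energy in \<open>X\<close>.\<close>
definition is_solution :: "real \<Rightarrow> 'a::euclidean_space set \<Rightarrow> ('a \<Rightarrow> real) \<Rightarrow> bool" where
  "is_solution \<delta> \<Omega> u \<longleftrightarrow> u \<in> X \<delta> \<Omega> \<and> has_energy_derivative \<delta> \<Omega> u (\<lambda>v. 0)"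

definition positive_on :: "'a::euclidean_space set \<Rightarrow> ('a \<Rightarrow> real) \<Rightarrow> bool" where
  "positive_on \<Omega> u \<longleftrightarrow> (AE x in lebesgue. x \<in> \<Omega> \<longrightarrow> u x > 0)"

definition Nehari :: "real \<Rightarrow> 'a::euclidean_space set \<Rightarrow> ('a \<Rightarrow> real) set" where
  "Nehari \<delta> \<Omega> = {u \<in> X \<delta> \<Omega>. \<not> (AE x in lebesgue. x \<in> \<Omega> \<longrightarrow> u x = 0) \<and>
     (\<exists>L. has_energy_derivative \<delta> \<Omega> u L \<and> L u = 0)}"

definition d0 :: "real \<Rightarrow> 'a::euclidean_space set \<Rightarrow> real" where
  "d0 \<delta> \<Omega> = (INF u\<in>Nehari \<delta> \<Omega>. energy \<delta> \<Omega> u)"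

end

theory Submission
  imports Defs "HOL-Probability.Distributions"
begin

text \<open>For a function \<open>u\<close> write \<open>m\<close> for the integral of \<open>u\<^sup>2\<close>, \<open>D\<close> for that of \<open>\<bar>\<nabla>u\<bar>\<^sup>2\<close> and \<open>E\<close> for
  that of \<open>u\<^sup>2 log u\<^sup>2\<close>. Since \<open>F2 - F1\<close> is half the entropy density, the energy of \<open>u\<close> is
  \<open>D / 2 + m - E / 2\<close>, and the energy of \<open>t u\<close> is \<open>t\<^sup>2 (energy u - m log t)\<close>. Differentiating in
  \<open>t\<close> at 1 shows that \<open>2 energy u = m\<close> on the Nehari set (\<open>Nehari_energy\<close>), that is,
  \<open>E = D + m\<close>.

  The problem is thereby reduced to the sharp logarithmic Sobolev inequality
  \<open>E + N (1 + log \<pi> / 2) m \<le> D + m log m\<close>, which is an equality for the Gaussian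
  \<open>exp (- \<bar>x\<bar>\<^sup>2 / 2)\<close>. On the Nehari set it reads \<open>log m \<ge> 1 + N (1 + log \<pi> / 2)\<close>, so that the
  energy, being \<open>m / 2\<close>, is at least \<open>\<pi>\<^bsup>N/2\<^esup> e\<^bsup>N+1\<^esup> / 2\<close>. This number is also an upper bound for
  \<open>d0\<close> (\<open>d0_le_gauss\<close>): an exterior domain contains arbitrarily large cubes, hence smooth
  cut-offs of translated Gaussians, and suitable multiples of these lie on the Nehari set. A
  ground state would therefore be a case of equality. But extended by zero it vanishes on a ball
  inside the complement of the domain and is positive near infinity, and for such a function the
  inequality is strict (\<open>log_sobolev_strict\<close>). Thus no ground state exists.

  The inequality and its strict form both come from dimension one. On the line
  (\<open>log_sobolev_line\<close>) the measure \<open>f\<^sup>2 dx\<close> is transported monotonically to a Gaussian measure.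
  If \<open>f\<close> vanishes on an interval, the inequality may be applied to the parts of \<open>f\<close> on the two
  sides separately; their masses \<open>a\<close> and \<open>b\<close> then give the positive gain
  \<open>(a + b) log (a + b) - a log a - b log b\<close> (\<open>log_sobolev_line_gap\<close>). Integrating over lines and
  applying the inequality in the remaining variables to the \<open>L\<^sup>2\<close> norms of the slices of \<open>f\<close>
  gives the inequality in any dimension (\<open>log_sobolev_PiM\<close>), with a strictly positive gain if a
  set of lines of positive measure meets a hole of \<open>f\<close> and mass on both sides of it
  (\<open>log_sobolev_PiM_gap\<close>, \<open>gapint_pos\<close>).

  Gradients enter these inequalities only through upper bounds for the \<open>L\<^sup>2\<close> norms of difference
  quotients. Such bounds pass to slices, truncations, cut-offs and absolute values, and for the
  extension by zero of a function in \<open>H10\<close> they hold with the weak gradient (\<open>H10_extension\<close>).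

  The remaining point is that membership in the Nehari set requires a Frechet derivative of the
  energy on \<open>X\<close>. It is computed at test functions (\<open>test_energy_derivative\<close>), where the
  remainder of the entropy is controlled for small values of the increment by the Luxemburg norm
  and for large ones by the logarithmic Sobolev inequality itself.\<close>

section \<open>The logarithmic Sobolev inequality on the line\<close>

lemma has_bochner_integral_gauss: "has_bochner_integral lborel (\<lambda>x::real. exp (- x\<^sup>2)) (sqrt pi)"
proof -
  have "has_bochner_integral lborel (\<lambda>x::real. exp (- x\<^sup>2)) (2 *\<^sub>R (sqrt pi / 2))"
    by (rule has_bochner_integral_even_function[OF gaussian_moment_0]) simp
  then show ?thesis by simp
qed

lemma has_bochner_integral_gauss_sq:
  "has_bochner_integral lborel (\<lambda>x::real. exp (- x\<^sup>2) * x\<^sup>2) (sqrt pi / 2)"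
proof -
  have "has_bochner_integral lborel (\<lambda>x::real. exp (- x\<^sup>2) * x^(2*1)) (2 *\<^sub>R ((sqrt pi / 2) * (fact (2 * 1) / (2 ^ (2 * 1) * fact 1))))"
    by (rule has_bochner_integral_even_function[OF gaussian_moment_even_pos]) simp
  then show ?thesis by (simp add: fact_2)
qed

text \<open>The inverse of the distribution function of the measure \<open>exp (- x\<^sup>2) dx\<close>, whose total mass is
  \<open>sqrt pi\<close>, characterized by its differential equation.\<close>
lemma gauss_quantile:
  obtains \<Psi> :: "real \<Rightarrow> real" where
    "\<And>s. 0 < s \<Longrightarrow> s < sqrt pi \<Longrightarrow> (\<Psi> has_real_derivative exp ((\<Psi> s)\<^sup>2)) (at s)"
proof -
  define g where "g = (\<lambda>x::real. exp (- x\<^sup>2))"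
  define \<Phi> where "\<Phi> = (\<lambda>t. LINT x|lborel. indicator {..t} x *\<^sub>R g x)"
  have gi: "integrable lborel g" and gI: "integral\<^sup>L lborel g = sqrt pi"
    using has_bochner_integral_gauss unfolding g_def has_bochner_integral_iff by auto
  have gs: "set_integrable lborel A g" if "A \<in> sets borel" for A
    using gi that unfolding set_integrable_def by (intro integrable_mult_indicator) auto
  have diff: "\<Phi> t = \<Phi> a + integral {a..t} g" if "a \<le> t" for a t
  proof -
    have "\<Phi> t - \<Phi> a = (LINT x|lborel. indicator {..t} x *\<^sub>R g x - indicator {..a} x *\<^sub>R g x)"
      unfolding \<Phi>_def using gs unfolding set_integrable_def
      by (intro Bochner_Integration.integral_diff[symmetric]) auto
    also have "\<dots> = (LINT x:{a..t}|lborel. g x)"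
      unfolding set_lebesgue_integral_def
    proof (rule integral_cong_AE)
      have "AE x in lborel. x \<noteq> a" by (rule AE_lborel_singleton)
      then show "AE x in lborel. indicator {..t} x *\<^sub>R g x - indicator {..a} x *\<^sub>R g x = indicator {a..t} x *\<^sub>R g x"
        by eventually_elim (use that in \<open>auto simp: indicator_def\<close>)
    qed (auto simp: g_def)
    also have "\<dots> = integral {a..t} g"
      by (rule set_borel_integral_eq_integral) (simp add: gs)
    finally show ?thesis by simp
  qed
  have der: "(\<Phi> has_real_derivative g t) (at t)" for t
  proof -
    have "((\<lambda>u. integral {t-1..u} g) has_vector_derivative g t) (at t within {t-1..t+1})"
      by (rule integral_has_vector_derivative) (auto simp: g_def intro!: continuous_intros)
    then have "((\<lambda>u. \<Phi> (t-1) + integral {t-1..u} g) has_vector_derivative g t) (at t within {t-1..t+1})"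
      by (auto intro!: derivative_eq_intros)
    then have "((\<lambda>u. \<Phi> (t-1) + integral {t-1..u} g) has_real_derivative g t) (at t)"
      by (simp add: has_real_derivative_iff_has_vector_derivative at_within_Icc_at)
    moreover have "eventually (\<lambda>u. \<Phi> (t-1) + integral {t-1..u} g = \<Phi> u) (nhds t)"
      using eventually_nhds_in_open[of "{t-1<..}" t] by (auto elim!: eventually_mono intro!: diff[symmetric])
    ultimately show ?thesis
      by (subst (asm) DERIV_cong_ev[OF refl _ refl]) auto
  qed
  have cont: "isCont \<Phi> t" for t using der DERIV_isCont by blast
  have gpos: "g t > 0" for t by (simp add: g_def)
  have smono: "\<Phi> a < \<Phi> b" if "a < b" for a b
    using DERIV_pos_imp_increasing[OF that] der gpos by blast
  have top: "(\<Phi> \<longlongrightarrow> sqrt pi) at_top"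
    unfolding \<Phi>_def gI[symmetric] by (rule tendsto_integral_at_top) (use gi in auto)
  have bot: "(\<lambda>n. \<Phi> (- real n)) \<longlonglongrightarrow> (LINT (x::real)|lborel. (0::real))"
    unfolding \<Phi>_def
  proof (rule integral_dominated_convergence[where w=g])
    show "AE x in lborel. (\<lambda>n. indicator {..- real n} x *\<^sub>R g x) \<longlonglongrightarrow> 0"
    proof (rule AE_I2, rule tendsto_eventually)
      fix x :: real
      obtain m :: nat where m: "- x < real m" using reals_Archimedean2 by blast
      show "\<forall>\<^sub>F n in sequentially. indicator {..- real n} x *\<^sub>R g x = 0"
        using eventually_ge_at_top[of m] by eventually_elim (use m in \<open>auto simp: indicator_def\<close>)
    qed
  qed (use gi in \<open>auto simp: g_def indicator_def\<close>)
  have ex: "\<exists>t. \<Phi> t = s" if s: "0 < s" "s < sqrt pi" for s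
  proof -
    have "eventually (\<lambda>t. \<Phi> t > s) at_top" using order_tendstoD(1)[OF top s(2)] .
    then obtain b where b: "\<And>t. t \<ge> b \<Longrightarrow> \<Phi> t > s" by (auto simp: eventually_at_top_linorder)
    have "eventually (\<lambda>n. \<Phi> (- real n) < s) sequentially"
      using order_tendstoD(2)[OF bot, of s] s by simp
    then obtain n where n: "\<Phi> (- real n) < s" by (auto simp: eventually_sequentially)
    let ?b = "max b (- real n)"
    have "\<exists>x\<ge>- real n. x \<le> ?b \<and> \<Phi> x = s"
      by (rule IVT) (use n b[of ?b] cont in auto)
    then show ?thesis by blast
  qed
  define \<Psi> where "\<Psi> = (\<lambda>s. THE t. \<Phi> t = s)"
  have \<Psi>\<Phi>: "\<Psi> (\<Phi> t) = t" for t
    unfolding \<Psi>_def by (rule the_equality) (use smono in \<open>auto, metis linorder_neq_iff order_less_irrefl\<close>)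
  have \<Phi>\<Psi>: "\<Phi> (\<Psi> s) = s" if "0 < s" "s < sqrt pi" for s
    using ex[OF that] \<Psi>\<Phi> by auto
  have "(\<Psi> has_real_derivative exp ((\<Psi> s)\<^sup>2)) (at s)" if s: "0 < s" "s < sqrt pi" for s
  proof -
    have ic: "isCont \<Psi> (\<Phi> (\<Psi> s))"
      by (rule isCont_inverse_function[of 1]) (auto simp: \<Psi>\<Phi> cont)
    have "(\<Psi> has_real_derivative inverse (g (\<Psi> s))) (at s)"
      by (rule DERIV_inverse_function[where f=\<Phi> and a=0 and b="sqrt pi"])
         (use s ic gpos[of "\<Psi> s"] der \<Phi>\<Psi> in auto)
    then show ?thesis by (simp add: g_def exp_minus)
  qed
  then show ?thesis using that by blast
qed

definition ent :: "real \<Rightarrow> real" where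
  "ent s = s\<^sup>2 * ln (s\<^sup>2)"

lemma ent_0 [simp]: "ent 0 = 0" by (simp add: ent_def)

text \<open>From \<open>ln y \<le> y\<close> at \<open>y = s\<^sup>2\<close>, and at \<open>y = 1 / \<bar>s\<bar>\<close> for the bound from below.\<close>
lemma abs_ent_le: "\<bar>ent s\<bar> \<le> s ^ 4 + 2 * \<bar>s\<bar>"
proof (cases "s = 0")
  case False
  then have s: "s\<^sup>2 > 0" by simp
  have "ln (s\<^sup>2) \<le> s\<^sup>2" using ln_le_minus_one[OF s] by linarith
  then have 1: "s\<^sup>2 * ln (s\<^sup>2) \<le> s\<^sup>2 * s\<^sup>2" by (rule mult_left_mono) simp
  have "ln (1 / \<bar>s\<bar>) \<le> 1 / \<bar>s\<bar>" using ln_le_minus_one[of "1 / \<bar>s\<bar>"] False by simp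
  then have "s\<^sup>2 * (2 * ln (1 / \<bar>s\<bar>)) \<le> s\<^sup>2 * (2 * (1 / \<bar>s\<bar>))" by (intro mult_left_mono) auto
  moreover have "2 * ln (1 / \<bar>s\<bar>) = - ln (s\<^sup>2)"
    using False ln_realpow[of "\<bar>s\<bar>" 2] by (simp add: ln_div)
  moreover have "s\<^sup>2 * (2 * (1 / \<bar>s\<bar>)) = 2 * \<bar>s\<bar>"
    using False by (simp add: power2_eq_square field_simps abs_if)
  ultimately have "- (s\<^sup>2 * ln (s\<^sup>2)) \<le> 2 * \<bar>s\<bar>" by simp
  moreover have "s\<^sup>2 * s\<^sup>2 = s ^ 4" by (simp add: power2_eq_square power4_eq_xxxx)
  moreover have "0 \<le> s ^ 4" by simp
  ultimately show ?thesis using 1 unfolding ent_def by linarith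
qed simp

lemma borel_measurable_ent [measurable]: "ent \<in> borel_measurable borel"
  unfolding ent_def by measurable

lemma integrable_bounded_support:
  fixes f :: "real \<Rightarrow> real"
  assumes [measurable]: "f \<in> borel_measurable borel" and "\<And>x. \<bar>f x\<bar> \<le> M" "\<And>x. \<bar>x\<bar> > R \<Longrightarrow> f x = 0"
  shows "integrable lborel f"
proof (rule Bochner_Integration.integrable_bound[where f="\<lambda>x. M * indicator {-R..R} x"])
  show "AE x in lborel. norm (f x) \<le> norm (M * indicator {-R..R} x)"
  proof (rule AE_I2)
    fix x show "norm (f x) \<le> norm (M * indicator {-R..R} x)"
      using assms(2)[of x] assms(3)[of x] by (cases "\<bar>x\<bar> > R") (auto simp: indicator_def abs_le_iff)
  qed
qed (auto intro!: integrable_real_mult_indicator simp: less_top[symmetric] emeasure_lborel_Icc_eq)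

text \<open>Step sizes of difference quotients, also used as a positive null sequence.\<close>
definition stp :: "nat \<Rightarrow> real" where "stp n = 1 / real (Suc n)"

lemma stp_pos [simp]: "0 < stp n" "0 \<le> stp n" "stp n \<noteq> 0"
  by (simp_all add: stp_def)

lemma tendsto_stp: "stp \<longlonglongrightarrow> 0"
  unfolding stp_def by (rule LIMSEQ_Suc[OF lim_1_over_n])

lemma translate_integral:
  fixes f :: "real \<Rightarrow> real"
  shows "(LINT x|lborel. f (x + h)) = (LINT x|lborel. f x)" "integrable lborel (\<lambda>x. f (x + h)) \<longleftrightarrow> integrable lborel f"
  using lborel_integral_real_affine[of 1 f h] lborel_integrable_real_affine_iff[of 1 f h]
  by (simp_all add: add.commute)

text \<open>Let \<open>T\<close> transport \<open>f\<^sup>2 dx\<close>, normalized, to the Gaussian measure with density proportional to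
  \<open>exp (- x\<^sup>2)\<close>. The change of variables formula is \<open>exp (T\<^sup>2) c f\<^sup>2 = T'\<close> with \<open>c = sqrt pi / m\<close>,
  so \<open>log f\<^sup>2 = log T' - T\<^sup>2 - log c \<le> T' - 1 - T\<^sup>2 - log c\<close>. Multiplying by \<open>f\<^sup>2\<close>, integrating, and
  using \<open>\<integral> f\<^sup>2 T' = - 2 \<integral> f f' T \<le> \<integral> f'\<^sup>2 + \<integral> f\<^sup>2 T\<^sup>2\<close> gives the claim.

  The integration by parts is carried out for difference quotients, since \<open>f\<close> is merely
  measurable. To keep \<open>T\<close> bounded and Lipschitz, the distribution function of \<open>f\<^sup>2\<close> is mapped
  into a compact part of the domain of the quantile function by means of a small parameter \<open>\<epsilon>\<close>;
  this costs only the term \<open>m log (1 + \<epsilon>)\<close>.\<close>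
lemma log_sobolev_line:
  fixes f :: "real \<Rightarrow> real"
  assumes [measurable]: "f \<in> borel_measurable borel"
    and nn: "\<And>x. 0 \<le> f x" and bd: "\<And>x. f x \<le> M" and supp: "\<And>x. \<bar>x\<bar> > R \<Longrightarrow> f x = 0"
  defines "m \<equiv> LINT x|lborel. (f x)\<^sup>2"
  shows "ennreal ((LINT x|lborel. ent (f x)) + (1 + ln pi / 2) * m - m * ln m)
    \<le> liminf (\<lambda>n. \<integral>\<^sup>+x. ennreal (((f (x + stp n) - f x) / stp n)\<^sup>2) \<partial>lborel)"
    (is "ennreal ?K \<le> liminf ?D")
proof (cases "m = 0")
  case True
  have i2: "integrable lborel (\<lambda>x. (f x)\<^sup>2)"
    by (rule integrable_bounded_support[where M="M\<^sup>2" and R=R]) (use nn bd supp in \<open>auto intro: power_mono\<close>)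
  have "AE x in lborel. (f x)\<^sup>2 = 0"
    using integral_nonneg_eq_0_iff_AE[OF i2] True by (auto simp: m_def)
  then have "(LINT x|lborel. ent (f x)) = (LINT (x::real)|lborel. 0)"
    by (intro integral_cong_AE) auto
  then show ?thesis using True by simp
next
  case False
  have i2: "integrable lborel (\<lambda>x. (f x)\<^sup>2)"
    by (rule integrable_bounded_support[where M="M\<^sup>2" and R=R]) (use nn bd supp in \<open>auto intro: power_mono\<close>)
  have "m \<ge> 0" unfolding m_def by simp
  then have m: "m > 0" using False by simp
  have M0: "M \<ge> 0" using nn bd order_trans by blast
  obtain \<Psi> :: "real \<Rightarrow> real" where \<Psi>:
    "\<And>s. 0 < s \<Longrightarrow> s < sqrt pi \<Longrightarrow> (\<Psi> has_real_derivative exp ((\<Psi> s)\<^sup>2)) (at s)"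
    using gauss_quantile by blast
  define G where "G = (\<lambda>x. LINT t|lborel. indicator {..x} t *\<^sub>R (f t)\<^sup>2)"
  have si: "set_integrable lborel A (\<lambda>x. (f x)\<^sup>2)" if "A \<in> sets borel" for A
    using i2 that unfolding set_integrable_def by (intro integrable_mult_indicator) auto
  have Gdiff: "G b - G a = (LINT x:{a..b}|lborel. (f x)\<^sup>2)" if "a \<le> b" for a b
  proof -
    have "G b - G a = (LINT x|lborel. indicator {..b} x *\<^sub>R (f x)\<^sup>2 - indicator {..a} x *\<^sub>R (f x)\<^sup>2)"
      unfolding G_def using si unfolding set_integrable_def
      by (intro Bochner_Integration.integral_diff[symmetric]) auto
    also have "\<dots> = (LINT x:{a..b}|lborel. (f x)\<^sup>2)"
      unfolding set_lebesgue_integral_def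
    proof (rule integral_cong_AE)
      have "AE x in lborel. x \<noteq> a" by (rule AE_lborel_singleton)
      then show "AE x in lborel. indicator {..b} x *\<^sub>R (f x)\<^sup>2 - indicator {..a} x *\<^sub>R (f x)\<^sup>2 = indicator {a..b} x *\<^sub>R (f x)\<^sup>2"
        by eventually_elim (use that in \<open>auto simp: indicator_def\<close>)
    qed auto
    finally show ?thesis .
  qed
  have Gmono: "G a \<le> G b" if "a \<le> b" for a b
    using Gdiff[OF that] by (smt (verit) integral_nonneg_AE AE_I2 set_lebesgue_integral_def
        indicator_pos_le scaleR_nonneg_nonneg zero_le_power2)
  have GLip1: "G b - G a \<le> M\<^sup>2 * (b - a)" if "a \<le> b" for a b
  proof -
    have "G b - G a \<le> (LINT x:{a..b}|lborel. M\<^sup>2)"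
      unfolding Gdiff[OF that] 
    proof (rule set_integral_mono)
      show "set_integrable lborel {a..b} (\<lambda>x. M\<^sup>2)" unfolding set_integrable_def
        by (intro integrable_bounded_support[where M="M\<^sup>2" and R="max \<bar>a\<bar> \<bar>b\<bar>"]) (auto simp: indicator_def)
    qed (use nn bd in \<open>auto intro: power_mono si\<close>)
    also have "\<dots> = M\<^sup>2 * (b - a)" using that by (simp add: set_integral_const emeasure_lborel_Icc_eq)
    finally show ?thesis .
  qed
  have G0: "0 \<le> G x" for x unfolding G_def by (intro integral_nonneg_AE AE_I2) auto
  have G1: "G x \<le> m" for x unfolding G_def m_def
    by (rule integral_mono) (use si[of "{..x}"] i2 in \<open>auto simp: set_integrable_def indicator_def\<close>)
  \<comment> \<open>Lebesgue differentiation of the distribution function.\<close>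
  obtain N where N: "negligible N" and Nd: "\<And>x e. \<lbrakk>x \<notin> N; 0 < e\<rbrakk> \<Longrightarrow>
      \<exists>d>0. \<forall>h. 0 < h \<and> h < d \<longrightarrow>
        norm (integral (cbox x (x + h *\<^sub>R One)) (\<lambda>x. (f x)\<^sup>2) /\<^sub>R h ^ DIM(real) - (f x)\<^sup>2) < e"
  proof (rule integrable_ccontinuous_explicit[of "\<lambda>x. (f x)\<^sup>2"])
    show "(\<lambda>x. (f x)\<^sup>2) integrable_on cbox a b" for a b
      by (rule set_borel_integral_eq_integral(1)) (simp add: si)
  qed blast
  have Gder: "(\<lambda>n. (G (x + stp n) - G x) / stp n) \<longlonglongrightarrow> (f x)\<^sup>2" if "x \<notin> N" for x
  proof (rule LIMSEQ_I)
    fix e :: real assume "0 < e"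
    from Nd[OF that this] obtain d where d: "d > 0" and
      dd: "\<And>h. 0 < h \<Longrightarrow> h < d \<Longrightarrow> norm (integral (cbox x (x + h *\<^sub>R One)) (\<lambda>x. (f x)\<^sup>2) /\<^sub>R h ^ DIM(real) - (f x)\<^sup>2) < e"
      by blast
    have "eventually (\<lambda>n. stp n < d) sequentially" using order_tendstoD(2)[OF tendsto_stp d] .
    then obtain n0 where n0: "\<And>n. n \<ge> n0 \<Longrightarrow> stp n < d" by (auto simp: eventually_sequentially)
    have "norm ((G (x + stp n) - G x) / stp n - (f x)\<^sup>2) < e" if "n \<ge> n0" for n
    proof -
      have "G (x + stp n) - G x = integral {x..x + stp n} (\<lambda>x. (f x)\<^sup>2)"
        by (subst Gdiff) (auto intro!: set_borel_integral_eq_integral(2) si)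
      then show ?thesis using dd[of "stp n"] n0[OF that] by (simp add: divide_inverse mult.commute)
    qed
    then show "\<exists>no. \<forall>n\<ge>no. norm ((G (x + stp n) - G x) / stp n - (f x)\<^sup>2) < e" by blast
  qed
  have AEN: "AE x in lborel. x \<notin> N"
    using AE_not_in[of N lebesgue] N unfolding negligible_iff_null_sets AE_completion_iff by blast
  have main: "ennreal (?K - m * ln (1 + \<epsilon>)) \<le> liminf ?D" if e: "\<epsilon> > 0" for \<epsilon>
  proof -
    \<comment> \<open>\<open>S\<close> takes values in a compact subinterval of the domain of \<open>\<Psi>\<close>: mass \<open>\<epsilon> m / 2\<close>
        is added to both ends.\<close>
    define c where "c = sqrt pi / (m * (1 + \<epsilon>))"
    have c: "c > 0" using m e by (simp add: c_def)
    define S where "S = (\<lambda>x. c * (\<epsilon> * m / 2 + G x))"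
    define T where "T = (\<lambda>x. \<Psi> (S x))"
    define s0 where "s0 = c * (\<epsilon> * m / 2)"
    define s1 where "s1 = c * (\<epsilon> * m / 2 + m)"
    have s0: "0 < s0" using c e m by (simp add: s0_def)
    have "m * (1 + \<epsilon>) \<noteq> 0" using m e by auto
    then have "sqrt pi = c * (\<epsilon> * m + m)" unfolding c_def by (simp add: divide_simps) (simp add: algebra_simps)
    then have s1: "s1 < sqrt pi" unfolding s1_def using c e m by (smt (verit) mult_strict_left_mono mult_pos_pos field_sum_of_halves)
    have S01: "s0 \<le> S x" "S x \<le> s1" for x
      using G0[of x] G1[of x] c by (auto simp: S_def s0_def s1_def)
    have contP: "continuous_on {s0..s1} \<Psi>"
      by (intro continuous_at_imp_continuous_on ballI DERIV_isCont[OF \<Psi>]) (use s0 s1 in auto)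
    have "bounded (\<Psi> ` {s0..s1})"
      by (intro compact_imp_bounded compact_continuous_image contP) auto
    then obtain B where B: "\<And>s. s0 \<le> s \<Longrightarrow> s \<le> s1 \<Longrightarrow> \<bar>\<Psi> s\<bar> \<le> B"
      unfolding bounded_iff by (force simp: image_iff)
    have TB: "\<bar>T x\<bar> \<le> B" for x unfolding T_def using B S01 by blast
    have B0: "B \<ge> 0" using TB[of 0] by linarith
    have PsiLip: "\<bar>\<Psi> b - \<Psi> a\<bar> \<le> exp (B\<^sup>2) * (b - a)" if ab: "s0 \<le> a" "a \<le> b" "b \<le> s1" for a b
    proof (cases "a = b")
      case False
      then have "a < b" using ab by simp
      have "\<exists>z. a < z \<and> z < b \<and> \<Psi> b - \<Psi> a = (b - a) * exp ((\<Psi> z)\<^sup>2)"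
        by (rule MVT2[OF \<open>a < b\<close>]) (use \<Psi> ab s0 s1 in auto)
      then obtain z where z: "a < z" "z < b" "\<Psi> b - \<Psi> a = (b - a) * exp ((\<Psi> z)\<^sup>2)" by blast
      have "\<bar>\<Psi> z\<bar> \<le> B" using B z ab by auto
      then have "(\<Psi> z)\<^sup>2 \<le> B\<^sup>2" by (simp add: abs_le_square_iff[symmetric] B0)
      then have "(b - a) * exp ((\<Psi> z)\<^sup>2) \<le> (b - a) * exp (B\<^sup>2)" using ab by (intro mult_left_mono) auto
      then show ?thesis using z ab by (simp add: abs_mult mult.commute)
    qed simp
    define Lp where "Lp = exp (B\<^sup>2) * (c * M\<^sup>2)"
    have TLip: "\<bar>T (x + h) - T x\<bar> \<le> Lp * h" if h: "h \<ge> 0" for x h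
    proof -
      have "\<bar>T (x + h) - T x\<bar> \<le> exp (B\<^sup>2) * (S (x + h) - S x)"
        unfolding T_def by (rule PsiLip) (use S01 Gmono[of x "x+h"] h c in \<open>auto simp: S_def\<close>)
      also have "\<dots> \<le> exp (B\<^sup>2) * (c * (M\<^sup>2 * h))"
        using GLip1[of x "x+h"] h c by (auto simp: S_def right_diff_distrib[symmetric] simp del: mult_le_cancel_left_pos intro!: mult_left_mono)
      finally show ?thesis by (simp add: Lp_def mult_ac)
    qed
    have contT: "continuous_on UNIV T"
    proof (rule lipschitz_on_continuous_on)
      show "Lp-lipschitz_on UNIV T"
      proof (rule lipschitz_onI)
        fix x y :: real
        show "dist (T x) (T y) \<le> Lp * dist x y"
          using TLip[of "y - x" x] TLip[of "x - y" y] by (cases "x \<le> y") (auto simp: dist_real_def abs_minus_commute)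
      qed (use c in \<open>simp add: Lp_def\<close>)
    qed
    then have [measurable]: "T \<in> borel_measurable borel" by (rule borel_measurable_continuous_onI)
    have Tc: "(\<lambda>n. T (x + stp n)) \<longlonglongrightarrow> T x" for x
    proof -
      have "isCont T x" using contT by (simp add: continuous_on_eq_continuous_at)
      moreover have "(\<lambda>n. x + stp n) \<longlonglongrightarrow> x" using tendsto_add[OF tendsto_const[of x] tendsto_stp] by simp
      ultimately show ?thesis by (rule isCont_tendsto_compose)
    qed
    have Tder: "(\<lambda>n. (T (x + stp n) - T x) / stp n) \<longlonglongrightarrow> exp ((T x)\<^sup>2) * (c * (f x)\<^sup>2)" if "x \<notin> N" for x
    proof -
      obtain \<phi> where \<phi>: "\<And>z. \<Psi> z - \<Psi> (S x) = \<phi> z * (z - S x)" "isCont \<phi> (S x)" "\<phi> (S x) = exp ((\<Psi> (S x))\<^sup>2)"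
        using \<Psi>[of "S x"] S01[of x] s0 s1 unfolding CARAT_DERIV by auto
      have "(\<lambda>n. S (x + stp n)) \<longlonglongrightarrow> S x"
      proof -
        have "(\<lambda>n. G x + (G (x + stp n) - G x) / stp n * stp n) \<longlonglongrightarrow> G x + (f x)\<^sup>2 * 0"
          by (intro tendsto_intros Gder that tendsto_stp)
        then have "(\<lambda>n. G (x + stp n)) \<longlonglongrightarrow> G x" by simp
        then show ?thesis unfolding S_def by (intro tendsto_intros)
      qed
      then have "(\<lambda>n. \<phi> (S (x + stp n))) \<longlonglongrightarrow> \<phi> (S x)" by (rule isCont_tendsto_compose[OF \<phi>(2)])
      then have "(\<lambda>n. \<phi> (S (x + stp n)) * (c * ((G (x + stp n) - G x) / stp n))) \<longlonglongrightarrow> \<phi> (S x) * (c * (f x)\<^sup>2)"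
        by (intro tendsto_intros Gder that)
      moreover have "(T (x + stp n) - T x) / stp n = \<phi> (S (x + stp n)) * (c * ((G (x + stp n) - G x) / stp n))" for n
        unfolding T_def \<phi>(1) by (simp add: S_def field_simps)
      ultimately show ?thesis by (simp add: \<phi>(3) T_def)
    qed
    \<comment> \<open>Discrete form of \<open>f\<^sup>2 (T' - T\<^sup>2)\<close>; averaging \<open>T\<^sup>2\<close> over the two points matches the
        average of \<open>f\<^sup>2\<close> that arises from completing the square below.\<close>
    define b where "b = (\<lambda>n x. (f x)\<^sup>2 * ((T (x + stp n) - T x) / stp n - (T (x + stp n))\<^sup>2 / 2 - (T x)\<^sup>2 / 2))"
    have T2: "(T x)\<^sup>2 \<le> B\<^sup>2" for x using TB[of x] by (simp add: abs_le_square_iff[symmetric] B0)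
    have lim: "(\<lambda>n. LINT x|lborel. b n x) \<longlonglongrightarrow> (LINT x|lborel. (f x)\<^sup>2 * (exp ((T x)\<^sup>2) * (c * (f x)\<^sup>2) - (T x)\<^sup>2))"
    proof (rule integral_dominated_convergence[where w="\<lambda>x. (f x)\<^sup>2 * (Lp + B\<^sup>2)"])
      show "AE x in lborel. (\<lambda>n. b n x) \<longlonglongrightarrow> (f x)\<^sup>2 * (exp ((T x)\<^sup>2) * (c * (f x)\<^sup>2) - (T x)\<^sup>2)"
        using AEN
      proof eventually_elim
        case (elim x)
        have "(\<lambda>n. b n x) \<longlonglongrightarrow> (f x)\<^sup>2 * (exp ((T x)\<^sup>2) * (c * (f x)\<^sup>2) - (T x)\<^sup>2 / 2 - (T x)\<^sup>2 / 2)"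
          unfolding b_def by (intro tendsto_intros Tder elim Tc) simp
        then show ?case by simp
      qed
      show "AE x in lborel. norm (b n x) \<le> (f x)\<^sup>2 * (Lp + B\<^sup>2)" for n
      proof (rule AE_I2)
        fix x
        have "\<bar>(T (x + stp n) - T x) / stp n\<bar> \<le> Lp"
          using TLip[of "stp n" x] by (simp add: abs_divide pos_divide_le_eq)
        then have "\<bar>(T (x + stp n) - T x) / stp n - (T (x + stp n))\<^sup>2 / 2 - (T x)\<^sup>2 / 2\<bar> \<le> Lp + B\<^sup>2"
          using T2[of x] T2[of "x + stp n"] zero_le_power2[of "T x"] zero_le_power2[of "T (x + stp n)"] by linarith
        then show "norm (b n x) \<le> (f x)\<^sup>2 * (Lp + B\<^sup>2)"
          unfolding b_def by (auto simp: abs_mult intro!: mult_left_mono)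
      qed
      show "integrable lborel (\<lambda>x. (f x)\<^sup>2 * (Lp + B\<^sup>2))" using i2 by simp
    qed (auto simp: b_def)
    \<comment> \<open>The inequality \<open>1 + ln y \<le> y\<close> for \<open>y = T'\<close>.\<close>
    have ge: "?K - m * ln (1 + \<epsilon>) \<le> (LINT x|lborel. (f x)\<^sup>2 * (exp ((T x)\<^sup>2) * (c * (f x)\<^sup>2) - (T x)\<^sup>2))"
    proof -
      have C: "\<bar>ent t\<bar> \<le> M ^ 4 + 2 * M" if "0 \<le> t" "t \<le> M" for t
        using abs_ent_le[of t] power_mono[OF that(2,1), of 4] that by linarith
      have ie: "integrable lborel (\<lambda>x. ent (f x))"
        by (rule integrable_bounded_support[where M="M ^ 4 + 2 * M" and R=R]) (use C nn bd supp in auto)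
      define q where "q = 1 + ln pi / 2 - ln m - ln (1 + \<epsilon>)"
      have "?K - m * ln (1 + \<epsilon>) = (LINT x|lborel. ent (f x) + q * (f x)\<^sup>2)"
        using ie i2 by (simp add: m_def[symmetric] q_def algebra_simps)
      also have "\<dots> \<le> (LINT x|lborel. (f x)\<^sup>2 * (exp ((T x)\<^sup>2) * (c * (f x)\<^sup>2) - (T x)\<^sup>2))"
      proof (rule integral_mono)
        show "integrable lborel (\<lambda>x. ent (f x) + q * (f x)\<^sup>2)" using ie i2 by auto
        have "norm ((f x)\<^sup>2 * (exp ((T x)\<^sup>2) * (c * (f x)\<^sup>2) - (T x)\<^sup>2)) \<le> norm ((f x)\<^sup>2 * (exp (B\<^sup>2) * (c * M\<^sup>2) + B\<^sup>2))" for x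
        proof -
          have "exp ((T x)\<^sup>2) * (c * (f x)\<^sup>2) \<le> exp (B\<^sup>2) * (c * M\<^sup>2)"
            using c T2[of x] nn[of x] bd[of x] by (intro mult_mono power_mono) auto
          then have "\<bar>exp ((T x)\<^sup>2) * (c * (f x)\<^sup>2) - (T x)\<^sup>2\<bar> \<le> exp (B\<^sup>2) * (c * M\<^sup>2) + B\<^sup>2"
            using T2[of x] c by (smt (verit) exp_gt_zero mult_nonneg_nonneg zero_le_power2)
          then show ?thesis by (auto simp: abs_mult intro!: mult_left_mono)
        qed
        note bnd = this
        show "integrable lborel (\<lambda>x. (f x)\<^sup>2 * (exp ((T x)\<^sup>2) * (c * (f x)\<^sup>2) - (T x)\<^sup>2))"
        proof (rule Bochner_Integration.integrable_bound[OF _ _ AE_I2[OF bnd]])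
          show "integrable lborel (\<lambda>x. (f x)\<^sup>2 * (exp (B\<^sup>2) * (c * M\<^sup>2) + B\<^sup>2))"
            by (rule integrable_mult_left[OF i2])
        qed measurable
        fix x
        show "ent (f x) + q * (f x)\<^sup>2 \<le> (f x)\<^sup>2 * (exp ((T x)\<^sup>2) * (c * (f x)\<^sup>2) - (T x)\<^sup>2)"
        proof (cases "f x = 0")
          case fx: False
          define y where "y = exp ((T x)\<^sup>2) * (c * (f x)\<^sup>2)"
          have "y > 0" using c fx by (simp add: y_def)
          have "ln y = (T x)\<^sup>2 + (ln c + ln ((f x)\<^sup>2))"
            using c fx by (simp add: y_def ln_mult)
          moreover have "ln c = ln pi / 2 - ln m - ln (1 + \<epsilon>)"
            using m e by (simp add: c_def ln_div ln_mult ln_sqrt)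
          moreover have "1 + ln y \<le> y" using ln_le_minus_one[OF \<open>y > 0\<close>] by simp
          ultimately have "ln ((f x)\<^sup>2) + q \<le> y - (T x)\<^sup>2" by (simp add: q_def)
          then have "(f x)\<^sup>2 * (ln ((f x)\<^sup>2) + q) \<le> (f x)\<^sup>2 * (y - (T x)\<^sup>2)" by (rule mult_left_mono) simp
          then show ?thesis by (simp add: ent_def y_def algebra_simps)
        qed simp
      qed
      finally show ?thesis .
    qed
    \<comment> \<open>Summation by parts and completion of the square, for a fixed step size.\<close>
    have Db: "ennreal (LINT x|lborel. b n x) \<le> ?D n" for n
    proof -
      define h where "h = stp n"
      have h: "h > 0" by (simp add: h_def)
      have im: "integrable lborel (\<lambda>x. (f x)\<^sup>2 * t x)" if [measurable]: "t \<in> borel_measurable borel" and "\<And>x. \<bar>t x\<bar> \<le> C" for t C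
        by (rule integrable_bounded_support[where M="M\<^sup>2 * C" and R=R])
           (use that nn bd supp in \<open>auto simp: abs_mult intro!: mult_mono power_mono\<close>)
      have im': "integrable lborel (\<lambda>x. (f (x - h))\<^sup>2 * t x)" if [measurable]: "t \<in> borel_measurable borel" and "\<And>x. \<bar>t x\<bar> \<le> C" for t C
        using translate_integral(2)[of "\<lambda>x. (f (x - h))\<^sup>2 * t x" h] im[of "\<lambda>x. t (x + h)" C] that by simp
      have tr: "(LINT x|lborel. (f (x - h))\<^sup>2 * t x) = (LINT x|lborel. (f x)\<^sup>2 * t (x + h))" for t
        using translate_integral(1)[of "\<lambda>x. (f (x - h))\<^sup>2 * t x" h] by simp
      have d2: "integrable lborel (\<lambda>x. ((f x - f (x - h)) / h)\<^sup>2)"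
      proof (rule integrable_bounded_support[where M="(M / h)\<^sup>2" and R="R + h"])
        fix x
        have "\<bar>f x - f (x - h)\<bar> \<le> M" using nn[of x] nn[of "x - h"] bd[of x] bd[of "x - h"] by linarith
        then have "\<bar>(f x - f (x - h)) / h\<bar> \<le> \<bar>M / h\<bar>" using h M0 by (simp add: abs_divide divide_right_mono)
        then show "\<bar>((f x - f (x - h)) / h)\<^sup>2\<bar> \<le> (M / h)\<^sup>2" by (simp only: abs_power2 abs_le_square_iff)
        assume "R + h < \<bar>x\<bar>"
        then have "\<bar>x\<bar> > R" "\<bar>x - h\<bar> > R" using h by linarith+
        then show "((f x - f (x - h)) / h)\<^sup>2 = 0" by (simp add: supp)
      qed measurable
      have "?D n = (\<integral>\<^sup>+x. ennreal (((f x - f (x - h)) / h)\<^sup>2) \<partial>lborel)"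
        using nn_integral_real_affine[of "\<lambda>x. ennreal (((f (x + h) - f x) / h)\<^sup>2)" 1 "- h"] by (simp add: h_def)
      also have "\<dots> = ennreal (LINT x|lborel. ((f x - f (x - h)) / h)\<^sup>2)"
        by (rule nn_integral_eq_integral[OF d2]) simp
      finally have D: "?D n = ennreal (LINT x|lborel. ((f x - f (x - h)) / h)\<^sup>2)" .
      have TB2: "\<bar>(T x)\<^sup>2\<bar> \<le> B\<^sup>2" for x using T2[of x] by simp
      note ints = im[of T B, OF _ TB] im'[of T B, OF _ TB] im[of "\<lambda>x. (T x)\<^sup>2", OF _ TB2] im'[of "\<lambda>x. (T x)\<^sup>2", OF _ TB2]
        im[of "\<lambda>x. T (x + h)" B, OF _ TB] im[of "\<lambda>x. (T (x + h))\<^sup>2", OF _ TB2]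
      have "(LINT x|lborel. b n x) = ((LINT x|lborel. (f x)\<^sup>2 * T (x + h)) - (LINT x|lborel. (f x)\<^sup>2 * T x)) / h
          - (LINT x|lborel. (f x)\<^sup>2 * (T (x + h))\<^sup>2) / 2 - (LINT x|lborel. (f x)\<^sup>2 * (T x)\<^sup>2) / 2"
      proof -
        have "b n = (\<lambda>x. ((f x)\<^sup>2 * T (x + h) - (f x)\<^sup>2 * T x) / h - (f x)\<^sup>2 * (T (x + h))\<^sup>2 / 2 - (f x)\<^sup>2 * (T x)\<^sup>2 / 2)"
          unfolding b_def h_def by (auto simp: field_simps)
        then show ?thesis using ints by simp
      qed
      also have "\<dots> = (LINT x|lborel. ((f (x - h))\<^sup>2 * T x - (f x)\<^sup>2 * T x) / h - (f (x - h))\<^sup>2 * (T x)\<^sup>2 / 2 - (f x)\<^sup>2 * (T x)\<^sup>2 / 2)"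
        unfolding tr[of T, symmetric] tr[of "\<lambda>x. (T x)\<^sup>2", symmetric] using ints by simp
      also have "\<dots> \<le> (LINT x|lborel. ((f x - f (x - h)) / h)\<^sup>2)"
      proof (rule integral_mono[OF _ d2])
        fix x
        define p where "p = (f x - f (x - h)) / h"
        define r where "r = f x + f (x - h)"
        have "((f (x - h))\<^sup>2 - (f x)\<^sup>2) / h = - p * r"
          by (simp add: p_def r_def power2_eq_square algebra_simps diff_divide_distrib add_divide_distrib)
        moreover have "((f (x - h))\<^sup>2 * T x - (f x)\<^sup>2 * T x) / h = ((f (x - h))\<^sup>2 - (f x)\<^sup>2) / h * T x"
          by (simp add: left_diff_distrib diff_divide_distrib)
        ultimately have "((f (x - h))\<^sup>2 * T x - (f x)\<^sup>2 * T x) / h = - p * (r * T x)" by simp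
        also have "\<dots> \<le> p\<^sup>2 + (r * T x)\<^sup>2 / 4"
          using zero_le_power2[of "p + r * T x / 2"] by (simp add: power2_eq_square algebra_simps)
        also have "(r * T x)\<^sup>2 / 4 \<le> ((f x)\<^sup>2 + (f (x - h))\<^sup>2) / 2 * (T x)\<^sup>2"
        proof -
          have "r\<^sup>2 \<le> 2 * ((f x)\<^sup>2 + (f (x - h))\<^sup>2)"
            using zero_le_power2[of "f x - f (x - h)"] by (simp add: r_def power2_eq_square algebra_simps)
          then have "r\<^sup>2 * (T x)\<^sup>2 \<le> 2 * ((f x)\<^sup>2 + (f (x - h))\<^sup>2) * (T x)\<^sup>2" by (rule mult_right_mono) simp
          then show ?thesis unfolding power_mult_distrib by (simp add: algebra_simps)
        qed
        finally show "((f (x - h))\<^sup>2 * T x - (f x)\<^sup>2 * T x) / h - (f (x - h))\<^sup>2 * (T x)\<^sup>2 / 2 - (f x)\<^sup>2 * (T x)\<^sup>2 / 2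
            \<le> ((f x - f (x - h)) / h)\<^sup>2"
          by (simp add: p_def algebra_simps add_divide_distrib)
      qed (use ints in simp)
      finally show ?thesis unfolding D by (rule ennreal_leI)
    qed
    have "ennreal (?K - m * ln (1 + \<epsilon>)) \<le> ennreal (LINT x|lborel. (f x)\<^sup>2 * (exp ((T x)\<^sup>2) * (c * (f x)\<^sup>2) - (T x)\<^sup>2))"
      by (rule ennreal_leI[OF ge])
    also have "\<dots> = liminf (\<lambda>n. ennreal (LINT x|lborel. b n x))"
      by (rule lim_imp_Liminf[symmetric]) (auto intro: tendsto_ennrealI lim)
    also have "\<dots> \<le> liminf ?D" by (intro Liminf_mono always_eventually allI Db)
    finally show ?thesis .
  qed
  have "(\<lambda>n. ennreal (?K - m * ln (1 + stp n))) \<longlonglongrightarrow> ennreal (?K - m * ln (1 + 0))"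
    by (intro tendsto_intros tendsto_ennrealI tendsto_stp) simp
  then show ?thesis
    by (intro LIMSEQ_le_const2[where X="\<lambda>n. ennreal (?K - m * ln (1 + stp n))"]) (use main in auto)
qed

section \<open>Tensorization over finite products\<close>

abbreviation LL :: "'i set \<Rightarrow> ('i \<Rightarrow> real) measure" where
  "LL I \<equiv> Pi\<^sub>M I (\<lambda>_. lborel)"

text \<open>Fatou's lemma on a space of two points.\<close>
lemma ennreal_add_le_liminf:
  fixes u v :: "nat \<Rightarrow> ennreal"
  shows "liminf u + liminf v \<le> liminf (\<lambda>n. u n + v n)"
proof -
  have *: "(\<integral>\<^sup>+b. g b \<partial>count_space (UNIV :: bool set)) = g True + g False" for g :: "bool \<Rightarrow> ennreal"
    by (subst nn_integral_count_space_finite) (auto simp: UNIV_bool add.commute)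
  show ?thesis
    using nn_integral_liminf[of "\<lambda>n b. if b then u n else v n" "count_space (UNIV :: bool set)"]
    unfolding * by simp
qed

lemma ennreal_plus_le: "ennreal (a + b) \<le> ennreal a + ennreal b"
proof (cases "a \<ge> 0 \<and> b \<ge> 0")
  case False
  then have "a + b \<le> a \<or> a + b \<le> b" by auto
  then show ?thesis
    by (metis add_increasing add_increasing2 ennreal_leI order_refl zero_le)
qed simp

text \<open>Once the step size is below \<open>r\<close>, the difference quotients of the parts of \<open>f\<close> to the left and
  right of \<open>p\<close> have disjoint supports, so their squares add up to the square of the difference
  quotient of \<open>f\<close>. The inequality on the line then applies to both parts. Compared with the
  inequality for \<open>f\<close>, the term \<open>m ln m\<close> is replaced by the smaller \<open>a ln a + b ln b\<close>.\<close>
lemma log_sobolev_line_gap: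
  fixes f :: "real \<Rightarrow> real"
  assumes [measurable]: "f \<in> borel_measurable borel"
    and nn: "\<And>x. 0 \<le> f x" and bd: "\<And>x. f x \<le> M" and supp: "\<And>x. \<bar>x\<bar> > R \<Longrightarrow> f x = 0"
    and r: "r > 0" and gap: "\<And>x. \<bar>x - p\<bar> < r \<Longrightarrow> f x = 0"
  defines "a \<equiv> LINT x|lborel. indicator {p<..} x * (f x)\<^sup>2"
  defines "b \<equiv> LINT x|lborel. indicator {..<p} x * (f x)\<^sup>2"
  shows "ennreal ((LINT x|lborel. ent (f x)) + (1 + ln pi / 2) * (a + b) - a * ln a - b * ln b)
    \<le> liminf (\<lambda>n. \<integral>\<^sup>+x. ennreal (((f (x + stp n) - f x) / stp n)\<^sup>2) \<partial>lborel)"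
    and "(LINT x|lborel. (f x)\<^sup>2) = a + b"
proof -
  have M0: "M \<ge> 0" using nn bd order_trans by blast
  define f1 where "f1 = (\<lambda>x. indicator {p<..} x * f x)"
  define f2 where "f2 = (\<lambda>x. indicator {..<p} x * f x)"
  have [measurable]: "f1 \<in> borel_measurable borel" "f2 \<in> borel_measurable borel"
    by (auto simp: f1_def f2_def)
  have a: "a = (LINT x|lborel. (f1 x)\<^sup>2)" and b: "b = (LINT x|lborel. (f2 x)\<^sup>2)"
    unfolding a_def b_def f1_def f2_def by (auto intro!: Bochner_Integration.integral_cong simp: indicator_def)
  have fp: "f p = 0" using gap[of p] r by simp
  have f1: "0 \<le> f1 x" "f1 x \<le> M" "\<bar>x\<bar> > R \<Longrightarrow> f1 x = 0"
   and f2: "0 \<le> f2 x" "f2 x \<le> M" "\<bar>x\<bar> > R \<Longrightarrow> f2 x = 0" for x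
    using nn[of x] bd[of x] supp[of x] M0 by (auto simp: f1_def f2_def indicator_def)
  have i2: "integrable lborel (\<lambda>x. (f1 x)\<^sup>2)" "integrable lborel (\<lambda>x. (f2 x)\<^sup>2)"
    by (rule integrable_bounded_support[where M="M\<^sup>2" and R=R]; use f1 f2 in \<open>auto intro: power_mono\<close>)+
  have eb: "\<bar>ent t\<bar> \<le> M ^ 4 + 2 * M" if "0 \<le> t" "t \<le> M" for t
    using abs_ent_le[of t] power_mono[OF that(2,1), of 4] that by linarith
  have ie: "integrable lborel (\<lambda>x. ent (f1 x))" "integrable lborel (\<lambda>x. ent (f2 x))"
    by (rule integrable_bounded_support[where M="M ^ 4 + 2 * M" and R=R]; use f1 f2 eb in auto)+
  have sq: "(f x)\<^sup>2 = (f1 x)\<^sup>2 + (f2 x)\<^sup>2" and en: "ent (f x) = ent (f1 x) + ent (f2 x)" for x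
    using fp by (cases x p rule: linorder_cases; simp add: f1_def f2_def)+
  show m: "(LINT x|lborel. (f x)\<^sup>2) = a + b"
    unfolding sq a b using i2 by simp
  let ?D = "\<lambda>f n. \<integral>\<^sup>+x. ennreal (((f (x + stp n) - f x) / stp n)\<^sup>2) \<partial>lborel"
  have "ennreal ((LINT x|lborel. ent (f x)) + (1 + ln pi / 2) * (a + b) - a * ln a - b * ln b)
    = ennreal (((LINT x|lborel. ent (f1 x)) + (1 + ln pi / 2) * a - a * ln a) +
               ((LINT x|lborel. ent (f2 x)) + (1 + ln pi / 2) * b - b * ln b))"
    unfolding en using ie by (simp add: algebra_simps add_divide_distrib)
  also have "\<dots> \<le> ennreal ((LINT x|lborel. ent (f1 x)) + (1 + ln pi / 2) * a - a * ln a) +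
                  ennreal ((LINT x|lborel. ent (f2 x)) + (1 + ln pi / 2) * b - b * ln b)"
    by (rule ennreal_plus_le)
  also have "\<dots> \<le> liminf (?D f1) + liminf (?D f2)"
    unfolding a b by (intro add_mono log_sobolev_line[where M=M and R=R]) (use f1 f2 in auto)
  also have "\<dots> \<le> liminf (\<lambda>n. ?D f1 n + ?D f2 n)" by (rule ennreal_add_le_liminf)
  also have "\<dots> \<le> liminf (?D f)"
  proof (rule Liminf_mono)
    have "eventually (\<lambda>n. stp n < r) sequentially" using order_tendstoD(2)[OF tendsto_stp r] .
    then show "eventually (\<lambda>n. ?D f1 n + ?D f2 n \<le> ?D f n) sequentially"
    proof eventually_elim
      case (elim n)
      define h where "h = stp n"
      have h: "0 < h" "h < r" using elim by (auto simp: h_def)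
      have "((f1 (x + h) - f1 x) / h)\<^sup>2 + ((f2 (x + h) - f2 x) / h)\<^sup>2 = ((f (x + h) - f x) / h)\<^sup>2" for x
      proof (cases "x + h < p + r")
        case True
        then have "f (x + h) = 0 \<or> x + h < p" "f x = 0 \<or> x < p"
          using gap[of x] gap[of "x + h"] h by (smt (verit))+
        then have "f1 (x + h) = 0" "f1 x = 0" "f2 (x + h) = f (x + h)" "f2 x = f x"
          by (auto simp: f1_def f2_def indicator_def)
        then show ?thesis by simp
      next
        case False
        then have "f2 (x + h) = 0" "f2 x = 0" "f1 (x + h) = f (x + h)" "f1 x = f x"
          using h by (auto simp: f1_def f2_def indicator_def)
        then show ?thesis by simp
      qed
      then have "ennreal (((f1 (x + h) - f1 x) / h)\<^sup>2) + ennreal (((f2 (x + h) - f2 x) / h)\<^sup>2) = ennreal (((f (x + h) - f x) / h)\<^sup>2)" for x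
        by (subst ennreal_plus[symmetric]) auto
      then show ?case unfolding h_def[symmetric] by (subst nn_integral_add[symmetric]) auto
    qed
  qed
  finally show "ennreal ((LINT x|lborel. ent (f x)) + (1 + ln pi / 2) * (a + b) - a * ln a - b * ln b) \<le> liminf (?D f)" .
qed

lemma integrable_LL_bounded:
  fixes g :: "('i \<Rightarrow> real) \<Rightarrow> real"
  assumes "finite I" and [measurable]: "g \<in> borel_measurable (LL I)"
    and bd: "\<And>x. x \<in> space (LL I) \<Longrightarrow> \<bar>g x\<bar> \<le> C"
    and supp: "\<And>x j. x \<in> space (LL I) \<Longrightarrow> j \<in> I \<Longrightarrow> \<bar>x j\<bar> > R \<Longrightarrow> g x = 0"
  shows "integrable (LL I) g"
proof -
  interpret product_sigma_finite "\<lambda>_::'i. lborel :: real measure" by standard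
  let ?A = "PiE I (\<lambda>_. {-R..R})"
  have A: "?A \<in> sets (LL I)" using assms(1) by (intro sets_PiM_I_finite) auto
  have "emeasure (LL I) ?A = (\<Prod>i\<in>I. emeasure lborel {-R..R})"
    by (rule emeasure_PiM) (use assms(1) in auto)
  also have "\<dots> < \<infinity>" by (simp add: less_top[symmetric] ennreal_prod_eq_top emeasure_lborel_Icc_eq power_eq_top_ennreal)
  finally have fin: "emeasure (LL I) ?A < \<infinity>" .
  show ?thesis
  proof (rule Bochner_Integration.integrable_bound[where f="\<lambda>x. C * indicator ?A x"])
    show "integrable (LL I) (\<lambda>x. C * indicator ?A x)" using A fin by simp
    show "AE x in LL I. norm (g x) \<le> norm (C * indicator ?A x)"
    proof (rule AE_I2)
      fix x assume x: "x \<in> space (LL I)"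
      show "norm (g x) \<le> norm (C * indicator ?A x)"
      proof (cases "x \<in> ?A")
        case True then show ?thesis using bd[OF x] by simp
      next
        case False
        then have "\<not> (\<forall>j\<in>I. x j \<in> {-R..R})" using x by (auto simp: space_PiM PiE_iff)
        then obtain j where "j \<in> I" "\<not> (-R \<le> x j \<and> x j \<le> R)" by auto
        then show ?thesis using supp[OF x, of j] by (auto simp: abs_le_iff not_le[symmetric])
      qed
    qed
  qed measurable
qed

lemma slice_space: "y \<in> space (LL I) \<Longrightarrow> y(i := x) \<in> space (LL (insert i I))"
  by (auto simp: space_PiM PiE_def extensional_def)

lemma slice_integral:
  fixes g :: "('i \<Rightarrow> real) \<Rightarrow> real"
  assumes fin: "finite I" and i: "i \<notin> I" and [measurable]: "g \<in> borel_measurable (LL (insert i I))"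
    and bd': "\<forall>x\<in>space (LL (insert i I)). \<bar>g x\<bar> \<le> C"
    and supp': "\<forall>x\<in>space (LL (insert i I)). \<forall>j\<in>insert i I. \<bar>x j\<bar> > R \<longrightarrow> g x = 0"
  defines "G \<equiv> \<lambda>y. LINT x|lborel. g (y(i := x))"
  shows "G \<in> borel_measurable (LL I)"
    and "\<And>y. y \<in> space (LL I) \<Longrightarrow> \<bar>G y\<bar> \<le> C * (2 * \<bar>R\<bar>)"
    and "\<And>y j. y \<in> space (LL I) \<Longrightarrow> j \<in> I \<Longrightarrow> \<bar>y j\<bar> > R \<Longrightarrow> G y = 0"
    and "integrable (LL I) G"
    and "(LINT x|LL (insert i I). g x) = (LINT y|LL I. G y)"
    and "\<And>y. y \<in> space (LL I) \<Longrightarrow> (\<lambda>x. g (y(i := x))) \<in> borel_measurable borel"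
proof -
  interpret product_sigma_finite "\<lambda>_::'i. lborel :: real measure" by standard
  have bd: "\<bar>g x\<bar> \<le> C" if "x \<in> space (LL (insert i I))" for x using bd' that by blast
  have supp: "g x = 0" if "x \<in> space (LL (insert i I))" "j \<in> insert i I" "\<bar>x j\<bar> > R" for x j using supp' that by blast
  show meas: "G \<in> borel_measurable (LL I)" unfolding G_def by measurable
  show slm: "(\<lambda>x. g (y(i := x))) \<in> borel_measurable borel" if y: "y \<in> space (LL I)" for y
    using measurable_comp[OF measurable_component_update[OF y i] assms(3)] by (simp add: comp_def)
  show bnd: "\<bar>G y\<bar> \<le> C * (2 * \<bar>R\<bar>)" if y: "y \<in> space (LL I)" for y
  proof -
    have C0: "C \<ge> 0" using bd[OF slice_space[OF y]] abs_ge_zero order_trans by blast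
    have "\<bar>G y\<bar> \<le> (LINT x|lborel. C * indicator {-\<bar>R\<bar>..\<bar>R\<bar>} x)"
      unfolding G_def
    proof (rule integral_abs_bound_integral)
      show "integrable lborel (\<lambda>x. g (y(i := x)))"
        by (rule integrable_bounded_support[where M=C and R=R]) (use slm[OF y] bd[OF slice_space[OF y]] supp[OF slice_space[OF y], of i] in auto)
      show "integrable lborel (\<lambda>x. C * indicator {-\<bar>R\<bar>..\<bar>R\<bar>} x)"
        by (rule integrable_bounded_support[where M=C and R="\<bar>R\<bar>"]) (use C0 in \<open>auto simp: indicator_def\<close>)
      fix x
      show "\<bar>g (y(i := x))\<bar> \<le> C * indicator {-\<bar>R\<bar>..\<bar>R\<bar>} x"
        using bd[OF slice_space[OF y], of x] supp[OF slice_space[OF y], of i x] C0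
        by (cases "\<bar>x\<bar> > R") (auto simp: indicator_def)
    qed
    also have "\<dots> = C * (2 * \<bar>R\<bar>)" by simp
    finally show ?thesis .
  qed
  show z: "G y = 0" if "y \<in> space (LL I)" "j \<in> I" "\<bar>y j\<bar> > R" for y j
  proof -
    have "g (y(i := x)) = 0" for x
    proof -
      have "j \<noteq> i" using that i by blast
      then show ?thesis using supp[OF slice_space[OF that(1)], of j x] that by simp
    qed
    then show ?thesis by (simp add: G_def)
  qed
  show "integrable (LL I) G" by (rule integrable_LL_bounded[OF fin meas bnd z])
  have gi: "integrable (LL (insert i I)) g"
    by (rule integrable_LL_bounded[where C=C and R=R]) (use fin bd supp in auto)
  show "(LINT x|LL (insert i I). g x) = (LINT y|LL I. G y)"
    unfolding G_def by (rule product_integral_insert[OF fin i gi])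
qed

text \<open>Bounded measurable functions with support in a cube: a class on which all integrals below
  converge and which is preserved by passing to slices and their \<open>L\<^sup>2\<close> norms.\<close>
definition box_bounded :: "'i set \<Rightarrow> real \<Rightarrow> real \<Rightarrow> (('i \<Rightarrow> real) \<Rightarrow> real) \<Rightarrow> bool" where
  "box_bounded I M R f \<longleftrightarrow> f \<in> borel_measurable (LL I) \<and>
     (\<forall>x\<in>space (LL I). 0 \<le> f x \<and> f x \<le> M \<and> (\<forall>j\<in>I. \<bar>x j\<bar> > R \<longrightarrow> f x = 0))"

lemma box_boundedD:
  assumes "box_bounded I M R f"
  shows "f \<in> borel_measurable (LL I)" "x \<in> space (LL I) \<Longrightarrow> 0 \<le> f x" "x \<in> space (LL I) \<Longrightarrow> f x \<le> M"
    "x \<in> space (LL I) \<Longrightarrow> j \<in> I \<Longrightarrow> \<bar>x j\<bar> > R \<Longrightarrow> f x = 0"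
  using assms unfolding box_bounded_def by blast+

lemma box_bounded_slice:
  assumes f: "box_bounded (insert i I) M R f" and i: "i \<notin> I" and y: "y \<in> space (LL I)"
  shows "(\<lambda>x. f (y(i := x))) \<in> borel_measurable borel"
    "0 \<le> f (y(i := x))" "f (y(i := x)) \<le> M" "\<bar>x\<bar> > R \<Longrightarrow> f (y(i := x)) = 0"
proof -
  show "(\<lambda>x. f (y(i := x))) \<in> borel_measurable borel"
    using measurable_comp[OF measurable_component_update[OF y i] box_boundedD(1)[OF f]] by (simp add: comp_def)
  show "0 \<le> f (y(i := x))" "f (y(i := x)) \<le> M" using box_boundedD(2,3)[OF f slice_space[OF y]] by auto
  show "f (y(i := x)) = 0" if "\<bar>x\<bar> > R"
    by (rule box_boundedD(4)[OF f slice_space[OF y], of i]) (use that in auto)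
qed

definition dq :: "'i \<Rightarrow> nat \<Rightarrow> (('i \<Rightarrow> real) \<Rightarrow> real) \<Rightarrow> ('i \<Rightarrow> real) \<Rightarrow> real" where
  "dq i n f x = (f (x(i := x i + stp n)) - f x) / stp n"

lemma measurable_dq:
  assumes "i \<in> I" and [measurable]: "f \<in> borel_measurable (LL I)"
  shows "dq i n f \<in> borel_measurable (LL I)"
proof -
  have [measurable]: "(\<lambda>x. x(i := x i + stp n)) \<in> measurable (LL I) (LL I)"
    by (rule measurable_fun_upd[where J=I]) (use assms(1) in auto)
  show ?thesis unfolding dq_def[abs_def] by measurable
qed

text \<open>One step of the tensorization. The function \<open>k\<close> is the gain in the one-dimensional inequality
  on each line; \<open>k = 0\<close> gives the plain inequality. On each line the mass times its logarithm is
  \<open>ent (F y)\<close>, so integrating over \<open>y\<close> reduces the entropy of \<open>f\<close> to that of the slice norm \<open>F\<close>,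
  which depends on one variable less. Fatou's lemma moves the limit inferior out of the
  integral.\<close>
lemma entropy_marginal:
  fixes f :: "('i \<Rightarrow> real) \<Rightarrow> real"
  assumes fin: "finite I" and i: "i \<notin> I"
    and bb: "box_bounded (insert i I) M R f"
    and E: "\<forall>n. (\<integral>\<^sup>+x. ennreal ((dq i n f x)\<^sup>2) \<partial>LL (insert i I)) \<le> ennreal e" and e: "e \<ge> 0"
    and k: "integrable (LL I) k"
    and line: "\<forall>y\<in>space (LL I).
      ennreal ((LINT x|lborel. ent (f (y(i := x)))) + (1 + ln pi / 2) * (LINT x|lborel. (f (y(i := x)))\<^sup>2)
         - (LINT x|lborel. (f (y(i := x)))\<^sup>2) * ln (LINT x|lborel. (f (y(i := x)))\<^sup>2) + k y)
      \<le> liminf (\<lambda>n. \<integral>\<^sup>+x. ennreal (((f (y(i := x + stp n)) - f (y(i := x))) / stp n)\<^sup>2) \<partial>lborel)"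
  defines "F \<equiv> \<lambda>y. sqrt (LINT x|lborel. (f (y(i := x)))\<^sup>2)"
  shows "(LINT x|LL (insert i I). ent (f x)) + (1 + ln pi / 2) * (LINT x|LL (insert i I). (f x)\<^sup>2) + (LINT y|LL I. k y)
    \<le> e + (LINT y|LL I. ent (F y))"
    and "box_bounded I (sqrt (M\<^sup>2 * (2 * \<bar>R\<bar>))) R F"
    and "(LINT y|LL I. (F y)\<^sup>2) = (LINT x|LL (insert i I). (f x)\<^sup>2)"
proof -
  interpret product_sigma_finite "\<lambda>_::'i. lborel :: real measure" by standard
  have fm[measurable]: "f \<in> borel_measurable (LL (insert i I))" using box_boundedD(1)[OF bb] .
  have nn: "0 \<le> f x" if "x \<in> space (LL (insert i I))" for x using box_boundedD(2)[OF bb that] .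
  have bd: "f x \<le> M" if "x \<in> space (LL (insert i I))" for x using box_boundedD(3)[OF bb that] .
  have supp: "f x = 0" if "x \<in> space (LL (insert i I))" "j \<in> insert i I" "\<bar>x j\<bar> > R" for x j using box_boundedD(4)[OF bb that] .
  have eb: "\<bar>ent t\<bar> \<le> B ^ 4 + 2 * B" if "0 \<le> t" "t \<le> B" for t B
    using abs_ent_le[of t] power_mono[OF that(2,1), of 4] that by linarith
  have sb: "\<forall>x\<in>space (LL (insert i I)). \<bar>(f x)\<^sup>2\<bar> \<le> M\<^sup>2"
    using nn bd by (auto intro!: power_mono)
  have sbe: "\<forall>x\<in>space (LL (insert i I)). \<bar>ent (f x)\<bar> \<le> M ^ 4 + 2 * M"
    using nn bd eb by blast
  have sz: "\<forall>x\<in>space (LL (insert i I)). \<forall>j\<in>insert i I. \<bar>x j\<bar> > R \<longrightarrow> (f x)\<^sup>2 = 0"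
    "\<forall>x\<in>space (LL (insert i I)). \<forall>j\<in>insert i I. \<bar>x j\<bar> > R \<longrightarrow> ent (f x) = 0"
    using supp by auto
  have em: "(\<lambda>x. ent (f x)) \<in> borel_measurable (LL (insert i I))" "(\<lambda>x. (f x)\<^sup>2) \<in> borel_measurable (LL (insert i I))"
    by measurable
  have [measurable]: "dq i n f \<in> borel_measurable (LL (insert i I))" for n
    by (rule measurable_dq) auto
  note S = slice_integral[OF fin i em(2) sb sz(1)]
  note T = slice_integral[OF fin i em(1) sbe sz(2)]
  define m where "m = (\<lambda>y. LINT x|lborel. (f (y(i := x)))\<^sup>2)"
  define t where "t = (\<lambda>y. LINT x|lborel. ent (f (y(i := x))))"
  have m0: "m y \<ge> 0" for y unfolding m_def by simp
  have F2: "(F y)\<^sup>2 = m y" for y unfolding F_def m_def by simp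
  have eF: "ent (F y) = m y * ln (m y)" for y unfolding ent_def F2 ..
  have Fm: "F \<in> borel_measurable (LL I)" unfolding F_def using S(1) by measurable
  have F0: "0 \<le> F y" for y using m0[of y] by (simp add: F_def m_def)
  have Fb: "F y \<le> sqrt (M\<^sup>2 * (2 * \<bar>R\<bar>))" if "y \<in> space (LL I)" for y
    unfolding F_def using S(2)[OF that] by (intro real_sqrt_le_mono) (simp add: abs_le_iff)
  have Fs: "F y = 0" if "y \<in> space (LL I)" "j \<in> I" "\<bar>y j\<bar> > R" for y j
    unfolding F_def using S(3)[OF that] by simp
  show "box_bounded I (sqrt (M\<^sup>2 * (2 * \<bar>R\<bar>))) R F"
    unfolding box_bounded_def using Fm F0 Fb Fs by blast
  show "(LINT y|LL I. (F y)\<^sup>2) = (LINT x|LL (insert i I). (f x)\<^sup>2)"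
    unfolding F2 m_def S(5) ..
  have iF: "integrable (LL I) (\<lambda>y. ent (F y))"
    by (rule integrable_LL_bounded[OF fin, where R=R and C="(sqrt (M\<^sup>2 * (2 * \<bar>R\<bar>)))^4 + 2 * sqrt (M\<^sup>2 * (2 * \<bar>R\<bar>))"])
       (use Fm eb F0 Fb Fs in auto)
  define K where "K = (\<lambda>y. t y + (1 + ln pi / 2) * m y - ent (F y) + k y)"
  have iK: "integrable (LL I) K"
    unfolding K_def t_def m_def using S(4) T(4) iF k by auto
  have K: "ennreal (K y) \<le> liminf (\<lambda>n. \<integral>\<^sup>+x. ennreal ((dq i n f (y(i := x)))\<^sup>2) \<partial>lborel)" if "y \<in> space (LL I)" for y
    using bspec[OF line that] unfolding K_def eF t_def m_def dq_def by simp
  \<comment> \<open>Fatou's lemma needs a nonnegative integrand, while \<open>K\<close> may be negative.\<close>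
  have "ennreal (LINT y|LL I. K y) \<le> ennreal (LINT y|LL I. max 0 (K y))"
    using iK by (intro ennreal_leI integral_mono) auto
  also have "\<dots> = (\<integral>\<^sup>+y. ennreal (max 0 (K y)) \<partial>LL I)"
    using iK by (intro nn_integral_eq_integral[symmetric]) auto
  also have "\<dots> = (\<integral>\<^sup>+y. ennreal (K y) \<partial>LL I)"
    by (intro nn_integral_cong) (auto simp: max_def ennreal_neg)
  also have "\<dots> \<le> (\<integral>\<^sup>+y. liminf (\<lambda>n. \<integral>\<^sup>+x. ennreal ((dq i n f (y(i := x)))\<^sup>2) \<partial>lborel) \<partial>LL I)"
    by (intro nn_integral_mono K)
  also have "\<dots> \<le> liminf (\<lambda>n. \<integral>\<^sup>+y. (\<integral>\<^sup>+x. ennreal ((dq i n f (y(i := x)))\<^sup>2) \<partial>lborel) \<partial>LL I)"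
    by (rule nn_integral_liminf) measurable
  also have "\<dots> = liminf (\<lambda>n. \<integral>\<^sup>+x. ennreal ((dq i n f x)\<^sup>2) \<partial>LL (insert i I))"
    by (subst product_nn_integral_insert[OF fin i]) simp_all
  also have "\<dots> \<le> liminf (\<lambda>n. ennreal e)" by (intro Liminf_mono always_eventually allI spec[OF E])
  also have "\<dots> = ennreal e" by (simp add: Liminf_const)
  finally have "(LINT y|LL I. K y) \<le> e" using e by (simp add: ennreal_le_iff)
  moreover have "(LINT y|LL I. K y) = (LINT y|LL I. t y) + (1 + ln pi / 2) * (LINT y|LL I. m y) - (LINT y|LL I. ent (F y)) + (LINT y|LL I. k y)"
    unfolding K_def t_def m_def using S(4) T(4) iF k by simp
  ultimately show "(LINT x|LL (insert i I). ent (f x)) + (1 + ln pi / 2) * (LINT x|LL (insert i I). (f x)\<^sup>2) + (LINT y|LL I. k y)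
    \<le> e + (LINT y|LL I. ent (F y))"
    unfolding S(5) T(5) t_def m_def by simp
qed

text \<open>The reverse triangle inequality in \<open>L\<^sup>2\<close>.\<close>
lemma L2_norm_diff_sq_le:
  fixes u v :: "real \<Rightarrow> real"
  assumes [measurable]: "u \<in> borel_measurable lborel" "v \<in> borel_measurable lborel"
    and u: "integrable lborel (\<lambda>x. (u x)\<^sup>2)" and v: "integrable lborel (\<lambda>x. (v x)\<^sup>2)"
    and uv: "integrable lborel (\<lambda>x. u x * v x)"
  shows "(sqrt (LINT x|lborel. (u x)\<^sup>2) - sqrt (LINT x|lborel. (v x)\<^sup>2))\<^sup>2 \<le> (LINT x|lborel. (u x - v x)\<^sup>2)"
proof -
  define A where "A = (LINT x|lborel. (u x)\<^sup>2)"
  define B where "B = (LINT x|lborel. (v x)\<^sup>2)"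
  have AB: "A \<ge> 0" "B \<ge> 0" by (auto simp: A_def B_def)
  have cs: "(LINT x|lborel. u x * v x) \<le> sqrt A * sqrt B"
  proof (cases "A = 0 \<or> B = 0")
    case True
    then have "(AE x in lborel. (u x)\<^sup>2 = 0) \<or> (AE x in lborel. (v x)\<^sup>2 = 0)"
      using integral_nonneg_eq_0_iff_AE[OF u] integral_nonneg_eq_0_iff_AE[OF v] by (auto simp: A_def B_def)
    then have "AE x in lborel. u x * v x = 0" by auto
    then have "(LINT x|lborel. u x * v x) = (LINT (x::real)|lborel. (0::real))" by (intro integral_cong_AE) auto
    then show ?thesis using AB by simp
  next
    case False
    define a where "a = sqrt A" define b where "b = sqrt B"
    have ab: "a > 0" "b > 0" "a\<^sup>2 = A" "b\<^sup>2 = B" using False AB by (auto simp: a_def b_def)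
    have "(LINT x|lborel. u x * v x) \<le> (LINT x|lborel. b / (2 * a) * (u x)\<^sup>2 + a / (2 * b) * (v x)\<^sup>2)"
    proof (rule integral_mono[OF uv])
      show "integrable lborel (\<lambda>x. b / (2 * a) * (u x)\<^sup>2 + a / (2 * b) * (v x)\<^sup>2)" using u v by auto
      fix x
      have "0 \<le> (b * u x - a * v x)\<^sup>2 / (2 * a * b)" using ab by simp
      also have "\<dots> = b / (2 * a) * (u x)\<^sup>2 + a / (2 * b) * (v x)\<^sup>2 - u x * v x"
        using ab(1,2) by (simp add: power2_eq_square field_simps)
      finally show "u x * v x \<le> b / (2 * a) * (u x)\<^sup>2 + a / (2 * b) * (v x)\<^sup>2" by simp
    qed
    also have "\<dots> = b / (2 * a) * A + a / (2 * b) * B" using u v by (simp add: A_def B_def)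
    also have "\<dots> = a * b" unfolding ab(3,4)[symmetric] using ab(1,2) by (simp add: power2_eq_square field_simps)
    finally show ?thesis by (simp add: a_def b_def)
  qed
  have "(LINT x|lborel. (u x - v x)\<^sup>2) = (LINT x|lborel. (u x)\<^sup>2 + (v x)\<^sup>2 - 2 * (u x * v x))"
    by (simp add: power2_diff mult.assoc)
  also have "\<dots> = A + B - 2 * (LINT x|lborel. u x * v x)" using u v uv by (simp add: A_def B_def)
  finally show ?thesis using cs AB unfolding A_def[symmetric] B_def[symmetric]
    by (simp add: power2_diff)
qed

text \<open>By the reverse triangle inequality on each line, taking slice norms does not increase the \<open>L\<^sup>2\<close>
  norm of difference quotients in the remaining directions. This lets the induction over the
  dimension proceed with the same constants \<open>E\<close>.\<close>
lemma dq_marginal_le: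
  fixes f :: "('i \<Rightarrow> real) \<Rightarrow> real"
  assumes fin: "finite I" and i: "i \<notin> I" and j: "j \<in> I"
    and bb: "box_bounded (insert i I) M R f"
  defines "F \<equiv> \<lambda>y. sqrt (LINT x|lborel. (f (y(i := x)))\<^sup>2)"
  shows "(\<integral>\<^sup>+y. ennreal ((dq j n F y)\<^sup>2) \<partial>LL I) \<le> (\<integral>\<^sup>+x. ennreal ((dq j n f x)\<^sup>2) \<partial>LL (insert i I))"
proof -
  interpret product_sigma_finite "\<lambda>_::'i. lborel :: real measure" by standard
  have fm[measurable]: "f \<in> borel_measurable (LL (insert i I))" using box_boundedD(1)[OF bb] .
  have ji: "j \<noteq> i" using i j by blast
  have [measurable]: "dq j n f \<in> borel_measurable (LL (insert i I))"
    by (rule measurable_dq) (use j in auto)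
  note slm = box_bounded_slice(1)[OF bb i] and sl = box_bounded_slice(2-)[OF bb i]
  have "ennreal ((dq j n F y)\<^sup>2) \<le> (\<integral>\<^sup>+x. ennreal ((dq j n f (y(i := x)))\<^sup>2) \<partial>lborel)" if y: "y \<in> space (LL I)" for y
  proof -
    define z where "z = y(j := y j + stp n)"
    have z: "z \<in> space (LL I)" using y j by (auto simp: z_def space_PiM PiE_def extensional_def)
    note [measurable] = slm[OF y] slm[OF z]
    have prod: "integrable lborel (\<lambda>x. f (v(i := x)) * f (w(i := x)))" if v: "v \<in> space (LL I)" and w: "w \<in> space (LL I)" for v w
    proof (rule integrable_bounded_support[where M="M * M" and R=R])
      show "\<bar>f (v(i := x)) * f (w(i := x))\<bar> \<le> M * M" for x
        using sl(1,2)[OF v, of x] sl(1,2)[OF w, of x] by (auto simp: abs_mult intro!: mult_mono)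
    qed (use slm[OF v] slm[OF w] sl(3)[OF v] in auto)
    have df: "dq j n f (y(i := x)) = (f (z(i := x)) - f (y(i := x))) / stp n" for x
      unfolding dq_def z_def using ji by (simp add: fun_upd_twist)
    have i2: "integrable lborel (\<lambda>x. (f (z(i := x)) - f (y(i := x)))\<^sup>2)"
      using prod[OF z z] prod[OF z y] prod[OF y y] unfolding power2_diff by (simp add: power2_eq_square mult.assoc)
    have "(dq j n F y)\<^sup>2 = (F z - F y)\<^sup>2 / (stp n)\<^sup>2" unfolding dq_def z_def by (simp add: power_divide)
    also have "\<dots> \<le> (LINT x|lborel. (f (z(i := x)) - f (y(i := x)))\<^sup>2) / (stp n)\<^sup>2"
      unfolding F_def using prod[OF z z] prod[OF z y] prod[OF y y]
      by (intro divide_right_mono L2_norm_diff_sq_le) (auto simp: power2_eq_square)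
    also have "\<dots> = (LINT x|lborel. (dq j n f (y(i := x)))\<^sup>2)"
      unfolding df power_divide by simp
    finally have "ennreal ((dq j n F y)\<^sup>2) \<le> ennreal (LINT x|lborel. (dq j n f (y(i := x)))\<^sup>2)" by (rule ennreal_leI)
    also have "\<dots> = (\<integral>\<^sup>+x. ennreal ((dq j n f (y(i := x)))\<^sup>2) \<partial>lborel)"
      using i2 by (intro nn_integral_eq_integral[symmetric]) (auto simp: df power_divide)
    finally show ?thesis .
  qed
  then have "(\<integral>\<^sup>+y. ennreal ((dq j n F y)\<^sup>2) \<partial>LL I) \<le> (\<integral>\<^sup>+y. (\<integral>\<^sup>+x. ennreal ((dq j n f (y(i := x)))\<^sup>2) \<partial>lborel) \<partial>LL I)"
    by (intro nn_integral_mono)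
  also have "\<dots> = (\<integral>\<^sup>+x. ennreal ((dq j n f x)\<^sup>2) \<partial>LL (insert i I))"
    by (subst product_nn_integral_insert[OF fin i]) simp_all
  finally show ?thesis .
qed

text \<open>Induction over the coordinates: the inequality on lines in direction \<open>i\<close> reduces \<open>f\<close> to its
  slice norm, to which the induction hypothesis applies.\<close>
theorem log_sobolev_PiM:
  fixes f :: "('i \<Rightarrow> real) \<Rightarrow> real"
  assumes "finite I" and "box_bounded I M R f"
    and "\<forall>i\<in>I. \<forall>n. (\<integral>\<^sup>+x. ennreal ((dq i n f x)\<^sup>2) \<partial>LL I) \<le> ennreal (E i)"
    and "\<forall>i\<in>I. 0 \<le> E i"
  shows "(LINT x|LL I. ent (f x)) + (1 + ln pi / 2) * card I * (LINT x|LL I. (f x)\<^sup>2)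
    \<le> (\<Sum>i\<in>I. E i) + (LINT x|LL I. (f x)\<^sup>2) * ln (LINT x|LL I. (f x)\<^sup>2)"
  using assms
proof (induction I arbitrary: f M rule: finite_induct)
  case empty
  have *: "(LINT x|LL {}. g x) = g (\<lambda>_. undefined)" for g :: "('i \<Rightarrow> real) \<Rightarrow> real"
    by (simp add: PiM_empty lebesgue_integral_count_space_finite)
  show ?case unfolding * by (simp add: ent_def)
next
  case (insert i I f M)
  define F where "F = (\<lambda>y. sqrt (LINT x|lborel. (f (y(i := x)))\<^sup>2))"
  note sl = box_bounded_slice[OF insert.prems(1) insert.hyps(2)]
  have line: "\<forall>y\<in>space (LL I). ennreal ((LINT x|lborel. ent (f (y(i := x)))) + (1 + ln pi / 2) * (LINT x|lborel. (f (y(i := x)))\<^sup>2)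
         - (LINT x|lborel. (f (y(i := x)))\<^sup>2) * ln (LINT x|lborel. (f (y(i := x)))\<^sup>2) + 0)
      \<le> liminf (\<lambda>n. \<integral>\<^sup>+x. ennreal (((f (y(i := x + stp n)) - f (y(i := x))) / stp n)\<^sup>2) \<partial>lborel)"
  proof
    fix y :: "'i \<Rightarrow> real" assume y: "y \<in> space (LL I)"
    show "ennreal ((LINT x|lborel. ent (f (y(i := x)))) + (1 + ln pi / 2) * (LINT x|lborel. (f (y(i := x)))\<^sup>2)
         - (LINT x|lborel. (f (y(i := x)))\<^sup>2) * ln (LINT x|lborel. (f (y(i := x)))\<^sup>2) + 0)
      \<le> liminf (\<lambda>n. \<integral>\<^sup>+x. ennreal (((f (y(i := x + stp n)) - f (y(i := x))) / stp n)\<^sup>2) \<partial>lborel)"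
      unfolding add_0_right by (rule log_sobolev_line[where M=M and R=R]) (rule sl[OF y], assumption?)+
  qed
  have Ei: "\<forall>n. (\<integral>\<^sup>+x. ennreal ((dq i n f x)\<^sup>2) \<partial>LL (insert i I)) \<le> ennreal (E i)" "0 \<le> E i"
    using insert.prems(2,3) by auto
  note em = entropy_marginal[OF insert.hyps insert.prems(1) Ei integrable_zero line]
  have M: "(LINT x|LL (insert i I). ent (f x)) + (1 + ln pi / 2) * (LINT x|LL (insert i I). (f x)\<^sup>2) + (LINT (y::'i \<Rightarrow> real)|LL I. 0)
      \<le> E i + (LINT y|LL I. ent (F y))"
    "box_bounded I (sqrt (M\<^sup>2 * (2 * \<bar>R\<bar>))) R F"
    "(LINT y|LL I. (F y)\<^sup>2) = (LINT x|LL (insert i I). (f x)\<^sup>2)"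
    unfolding F_def by (rule em)+
  have "(LINT y|LL I. ent (F y)) + (1 + ln pi / 2) * card I * (LINT y|LL I. (F y)\<^sup>2)
    \<le> (\<Sum>i\<in>I. E i) + (LINT y|LL I. (F y)\<^sup>2) * ln (LINT y|LL I. (F y)\<^sup>2)"
  proof (rule insert.IH[OF M(2)])
    show "\<forall>j\<in>I. \<forall>n. (\<integral>\<^sup>+x. ennreal ((dq j n F x)\<^sup>2) \<partial>LL I) \<le> ennreal (E j)"
      using order_trans[OF dq_marginal_le[OF insert.hyps _ insert.prems(1)]] insert.prems(2)
      unfolding F_def by blast
  qed (use insert.prems in auto)
  moreover have "(LINT x|LL (insert i I). ent (f x)) + (1 + ln pi / 2) * (LINT x|LL (insert i I). (f x)\<^sup>2)
    \<le> E i + (LINT y|LL I. ent (F y))" using M(1) by simp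
  ultimately show ?case unfolding M(3) using insert.hyps by (simp add: algebra_simps add_divide_distrib)
qed

text \<open>The binary entropy of the two masses, scaled by the total mass: the gain from splitting a
  function on the line at an interval where it vanishes.\<close>
definition Hgap :: "real \<Rightarrow> real \<Rightarrow> real" where
  "Hgap a b = (a + b) * ln (a + b) - a * ln a - b * ln b"

lemma Hgap_0 [simp]: "Hgap 0 b = 0" "Hgap a 0 = 0" by (simp_all add: Hgap_def)

lemma Hgap_commute: "Hgap a b = Hgap b a" by (simp add: Hgap_def add.commute)

lemma Hgap_pos: assumes "a > 0" "b > 0" shows "Hgap a b > 0"
proof -
  have "a * ln a < a * ln (a + b)" "b * ln b < b * ln (a + b)" using assms by auto
  then show ?thesis by (simp add: Hgap_def distrib_right)
qed

lemma Hgap_nonneg: assumes "a \<ge> 0" "b \<ge> 0" shows "Hgap a b \<ge> 0"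
  using Hgap_pos[of a b] assms by (cases "a = 0"; cases "b = 0") auto

lemma Hgap_mono1: assumes "0 \<le> a" "a \<le> a'" "0 \<le> b" shows "Hgap a b \<le> Hgap a' b"
proof (cases "a = 0 \<or> b = 0")
  case True then show ?thesis using Hgap_nonneg[of a' b] assms by auto
next
  case False
  then have "a > 0" "b > 0" using assms by auto
  have "\<exists>y. ((\<lambda>a. Hgap a b) has_real_derivative y) (at x) \<and> 0 \<le> y" if "a \<le> x" for x
  proof (intro exI conjI)
    have x: "x > 0" using that \<open>a > 0\<close> by simp
    show "((\<lambda>a. Hgap a b) has_real_derivative (ln (x + b) - ln x)) (at x)"
      unfolding Hgap_def using x \<open>b > 0\<close> by (auto intro!: derivative_eq_intros simp: add_pos_pos less_imp_neq[symmetric])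
    show "0 \<le> ln (x + b) - ln x" using x \<open>b > 0\<close> by simp
  qed
  then show ?thesis by (intro DERIV_nonneg_imp_nondecreasing[OF assms(2)]) blast
qed

lemma Hgap_mono: "0 \<le> a \<Longrightarrow> a \<le> a' \<Longrightarrow> 0 \<le> b \<Longrightarrow> b \<le> b' \<Longrightarrow> Hgap a b \<le> Hgap a' b'"
  using Hgap_mono1[of a a' b] Hgap_mono1[of b b' a'] by (simp add: Hgap_commute)

definition halfmass :: "'i \<Rightarrow> real set \<Rightarrow> (('i \<Rightarrow> real) \<Rightarrow> real) \<Rightarrow> ('i \<Rightarrow> real) \<Rightarrow> real" where
  "halfmass i A g y = (LINT x|lborel. indicator A x * (g (y(i := x)))\<^sup>2)"

text \<open>The gain on the line through \<open>y\<close>, for lines in a set \<open>Y\<close>. Truncation at 1 makes it integrable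
  and keeps its sign.\<close>
definition gapfun :: "'i \<Rightarrow> real \<Rightarrow> ('i \<Rightarrow> real) set \<Rightarrow> (('i \<Rightarrow> real) \<Rightarrow> real) \<Rightarrow> ('i \<Rightarrow> real) \<Rightarrow> real" where
  "gapfun i p Y g y = indicator Y y * min 1 (Hgap (halfmass i {p<..} g y) (halfmass i {..<p} g y))"

lemma halfmass_nonneg: "0 \<le> halfmass i A g y"
  unfolding halfmass_def by (intro integral_nonneg_AE AE_I2) (auto simp: indicator_def)

lemma halfmass_facts:
  fixes g :: "('i \<Rightarrow> real) \<Rightarrow> real"
  assumes fin: "finite I" and i: "i \<notin> I"
    and bb: "box_bounded (insert i I) M R g" and A[measurable]: "A \<in> sets borel"
  shows "halfmass i A g \<in> borel_measurable (LL I)"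
    and "\<And>y j. y \<in> space (LL I) \<Longrightarrow> j \<in> I \<Longrightarrow> \<bar>y j\<bar> > R \<Longrightarrow> halfmass i A g y = 0"
    and "\<And>y. y \<in> space (LL I) \<Longrightarrow> integrable lborel (\<lambda>x. indicator A x * (g (y(i := x)))\<^sup>2)"
proof -
  have gm[measurable]: "g \<in> borel_measurable (LL (insert i I))" using box_boundedD(1)[OF bb] .
  have m: "(\<lambda>x. indicator A (x i) * (g x)\<^sup>2) \<in> borel_measurable (LL (insert i I))" by measurable
  have b: "\<forall>x\<in>space (LL (insert i I)). \<bar>indicator A (x i) * (g x)\<^sup>2\<bar> \<le> M\<^sup>2"
    using box_boundedD(2,3)[OF bb] by (auto simp: indicator_def intro!: power_mono)
  have s: "\<forall>x\<in>space (LL (insert i I)). \<forall>j\<in>insert i I. \<bar>x j\<bar> > R \<longrightarrow> indicator A (x i) * (g x)\<^sup>2 = 0"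
    using box_boundedD(4)[OF bb] by (auto simp: indicator_def)
  note S = slice_integral[OF fin i m b s, unfolded fun_upd_same]
  show "halfmass i A g \<in> borel_measurable (LL I)" unfolding halfmass_def[abs_def] by (rule S(1))
  show "halfmass i A g y = 0" if "y \<in> space (LL I)" "j \<in> I" "\<bar>y j\<bar> > R" for y j
    unfolding halfmass_def using that by (rule S(3))
  show "integrable lborel (\<lambda>x. indicator A x * (g (y(i := x)))\<^sup>2)" if y: "y \<in> space (LL I)" for y
  proof (rule integrable_bounded_support[where M="M\<^sup>2" and R=R])
    show "(\<lambda>x. indicator A x * (g (y(i := x)))\<^sup>2) \<in> borel_measurable borel" using S(6)[OF y] .
    show "\<bar>indicator A x * (g (y(i := x)))\<^sup>2\<bar> \<le> M\<^sup>2" for x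
      using bspec[OF b slice_space[OF y], of x] by simp
    show "indicator A x * (g (y(i := x)))\<^sup>2 = 0" if "\<bar>x\<bar> > R" for x
      using box_bounded_slice(4)[OF bb i y that] by simp
  qed
qed

text \<open>Only the first of the one-dimensional inequalities, in direction \<open>i\<close>, is improved. The gain is
  measured by a smaller function \<open>g\<close>, which later stays fixed while \<open>f\<close> runs through a sequence
  of truncations: the gain is then independent of the truncation.\<close>
theorem log_sobolev_PiM_gap:
  fixes f :: "('i \<Rightarrow> real) \<Rightarrow> real"
  assumes fin: "finite I" and i: "i \<notin> I"
    and bb: "box_bounded (insert i I) M R f"
    and E: "\<forall>j\<in>insert i I. \<forall>n. (\<integral>\<^sup>+x. ennreal ((dq j n f x)\<^sup>2) \<partial>LL (insert i I)) \<le> ennreal (E j)"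
    and E0: "\<forall>j\<in>insert i I. 0 \<le> E j"
    and r: "r > 0" and Y: "Y \<in> sets (LL I)"
    and gap: "\<And>y x. y \<in> Y \<Longrightarrow> \<bar>x - p\<bar> < r \<Longrightarrow> f (y(i := x)) = 0"
    and gb: "box_bounded (insert i I) M' R' g" and gf: "\<And>x. x \<in> space (LL (insert i I)) \<Longrightarrow> g x \<le> f x"
  shows "(LINT x|LL (insert i I). ent (f x)) + (1 + ln pi / 2) * card (insert i I) * (LINT x|LL (insert i I). (f x)\<^sup>2)
      + (LINT y|LL I. gapfun i p Y g y)
    \<le> (\<Sum>j\<in>insert i I. E j) + (LINT x|LL (insert i I). (f x)\<^sup>2) * ln (LINT x|LL (insert i I). (f x)\<^sup>2)"
    and "integrable (LL I) (gapfun i p Y g)"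
proof -
  define F where "F = (\<lambda>y. sqrt (LINT x|lborel. (f (y(i := x)))\<^sup>2))"
  note hg = halfmass_facts[OF fin i gb] and hf = halfmass_facts[OF fin i bb]
  have [measurable]: "halfmass i {p<..} g \<in> borel_measurable (LL I)" "halfmass i {..<p} g \<in> borel_measurable (LL I)"
    by (rule hg(1); simp)+
  have gapm: "gapfun i p Y g \<in> borel_measurable (LL I)"
    unfolding gapfun_def[abs_def] Hgap_def using Y by measurable
  have gap0: "0 \<le> gapfun i p Y g y" "gapfun i p Y g y \<le> 1" for y
    using Hgap_nonneg[OF halfmass_nonneg halfmass_nonneg, of i "{p<..}" g y i "{..<p}" g y] unfolding gapfun_def by (auto simp: indicator_def)
  show gapi: "integrable (LL I) (gapfun i p Y g)"
  proof (rule integrable_LL_bounded[OF fin gapm, where C=1 and R=R'])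
    show "\<bar>gapfun i p Y g y\<bar> \<le> 1" for y using gap0[of y] by simp
    show "gapfun i p Y g y = 0" if "y \<in> space (LL I)" "j \<in> I" "\<bar>y j\<bar> > R'" for y j
      unfolding gapfun_def using hg(2)[OF _ that, where A="{p<..}"] by simp
  qed
  note sl = box_bounded_slice[OF bb i]
  have line: "ennreal ((LINT x|lborel. ent (f (y(i := x)))) + (1 + ln pi / 2) * (LINT x|lborel. (f (y(i := x)))\<^sup>2)
         - (LINT x|lborel. (f (y(i := x)))\<^sup>2) * ln (LINT x|lborel. (f (y(i := x)))\<^sup>2) + gapfun i p Y g y)
      \<le> liminf (\<lambda>n. \<integral>\<^sup>+x. ennreal (((f (y(i := x + stp n)) - f (y(i := x))) / stp n)\<^sup>2) \<partial>lborel)"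
    if y: "y \<in> space (LL I)" for y
  proof (cases "y \<in> Y")
    case False
    then show ?thesis
      unfolding gapfun_def indicator_simps(2)[OF False] mult_zero_left add_0_right
      by (intro log_sobolev_line[where M=M and R=R]) (rule sl[OF y], assumption?)+
  next
    case True
    let ?a = "halfmass i {p<..} f y" and ?b = "halfmass i {..<p} f y"
    have supp: "\<And>x. \<bar>x\<bar> > R \<Longrightarrow> f (y(i := x)) = 0" and gap': "\<And>x. \<bar>x - p\<bar> < r \<Longrightarrow> f (y(i := x)) = 0"
      using sl(4)[OF y] gap[OF True] by blast+
    have G: "ennreal ((LINT x|lborel. ent (f (y(i := x)))) + (1 + ln pi / 2) * (?a + ?b) - ?a * ln ?a - ?b * ln ?b)
        \<le> liminf (\<lambda>n. \<integral>\<^sup>+x. ennreal (((f (y(i := x + stp n)) - f (y(i := x))) / stp n)\<^sup>2) \<partial>lborel)"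
      "(LINT x|lborel. (f (y(i := x)))\<^sup>2) = ?a + ?b"
      unfolding halfmass_def
      by (rule log_sobolev_line_gap[OF sl(1)[OF y] sl(2)[OF y] sl(3)[OF y] _ r]; use supp gap' in blast)+
    have hm: "halfmass i A g y \<le> halfmass i A f y" if "A \<in> sets borel" for A
      unfolding halfmass_def
    proof (rule integral_mono)
      show "integrable lborel (\<lambda>x. indicator A x * (g (y(i := x)))\<^sup>2)" "integrable lborel (\<lambda>x. indicator A x * (f (y(i := x)))\<^sup>2)"
        using hg(3)[OF that y] hf(3)[OF that y] by auto
      show "indicator A x * (g (y(i := x)))\<^sup>2 \<le> indicator A x * (f (y(i := x)))\<^sup>2" for x
        using gf[OF slice_space[OF y], of x] box_boundedD(2)[OF gb slice_space[OF y], of x] by (intro mult_left_mono power_mono) auto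
    qed
    have "gapfun i p Y g y \<le> Hgap (halfmass i {p<..} g y) (halfmass i {..<p} g y)"
      unfolding gapfun_def using True by simp
    also have "\<dots> \<le> Hgap (halfmass i {p<..} f y) (halfmass i {..<p} f y)"
      by (intro Hgap_mono halfmass_nonneg hm) auto
    finally have le: "gapfun i p Y g y \<le> Hgap (halfmass i {p<..} f y) (halfmass i {..<p} f y)" .
    show ?thesis
      by (rule order_trans[OF ennreal_leI G(1)]) (use le[unfolded Hgap_def] in \<open>unfold G(2), linarith\<close>)
  qed
  have Ei: "\<forall>n. (\<integral>\<^sup>+x. ennreal ((dq i n f x)\<^sup>2) \<partial>LL (insert i I)) \<le> ennreal (E i)" "0 \<le> E i"
    using E E0 by auto
  have line': "\<forall>y\<in>space (LL I). ennreal ((LINT x|lborel. ent (f (y(i := x)))) + (1 + ln pi / 2) * (LINT x|lborel. (f (y(i := x)))\<^sup>2)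
         - (LINT x|lborel. (f (y(i := x)))\<^sup>2) * ln (LINT x|lborel. (f (y(i := x)))\<^sup>2) + gapfun i p Y g y)
      \<le> liminf (\<lambda>n. \<integral>\<^sup>+x. ennreal (((f (y(i := x + stp n)) - f (y(i := x))) / stp n)\<^sup>2) \<partial>lborel)"
    using line by blast
  note em = entropy_marginal[OF fin i bb Ei gapi line']
  have M: "(LINT x|LL (insert i I). ent (f x)) + (1 + ln pi / 2) * (LINT x|LL (insert i I). (f x)\<^sup>2) + (LINT y|LL I. gapfun i p Y g y)
      \<le> E i + (LINT y|LL I. ent (F y))"
    "box_bounded I (sqrt (M\<^sup>2 * (2 * \<bar>R\<bar>))) R F"
    "(LINT y|LL I. (F y)\<^sup>2) = (LINT x|LL (insert i I). (f x)\<^sup>2)"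
    unfolding F_def by (rule em)+
  have "(LINT y|LL I. ent (F y)) + (1 + ln pi / 2) * card I * (LINT y|LL I. (F y)\<^sup>2)
    \<le> (\<Sum>i\<in>I. E i) + (LINT y|LL I. (F y)\<^sup>2) * ln (LINT y|LL I. (F y)\<^sup>2)"
  proof (rule log_sobolev_PiM[OF fin M(2)])
    show "\<forall>j\<in>I. \<forall>n. (\<integral>\<^sup>+x. ennreal ((dq j n F x)\<^sup>2) \<partial>LL I) \<le> ennreal (E j)"
      using order_trans[OF dq_marginal_le[OF fin i _ bb]] E
      unfolding F_def by blast
  qed (use E0 in auto)
  moreover have "(LINT x|LL (insert i I). ent (f x)) + (1 + ln pi / 2) * (LINT x|LL (insert i I). (f x)\<^sup>2) + (LINT y|LL I. gapfun i p Y g y)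
    \<le> E i + (LINT y|LL I. ent (F y))" using M(1) by simp
  ultimately show "(LINT x|LL (insert i I). ent (f x)) + (1 + ln pi / 2) * card (insert i I) * (LINT x|LL (insert i I). (f x)\<^sup>2)
      + (LINT y|LL I. gapfun i p Y g y)
    \<le> (\<Sum>j\<in>insert i I. E j) + (LINT x|LL (insert i I). (f x)\<^sup>2) * ln (LINT x|LL (insert i I). (f x)\<^sup>2)"
    unfolding M(3) using fin i by (simp add: algebra_simps add_divide_distrib)
qed

section \<open>The logarithmic Sobolev inequality on Euclidean space\<close>

text \<open>Identifies functions on the basis with points of the space, so that Lebesgue measure becomes a
  product measure.\<close>
definition vec :: "('a::euclidean_space \<Rightarrow> real) \<Rightarrow> 'a" where
  "vec y = (\<Sum>b\<in>Basis. y b *\<^sub>R b)"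

lemma measurable_vec [measurable]: "vec \<in> measurable (LL Basis) borel"
  unfolding vec_def by measurable

lemma lborel_eq_distr_vec: "lborel = distr (LL Basis) borel vec"
  unfolding vec_def by (rule lborel_eq)

lemma vec_inner: "b \<in> Basis \<Longrightarrow> vec y \<bullet> b = y b"
  unfolding vec_def by (simp add: inner_sum_left inner_Basis if_distrib cong: if_cong)

lemma vec_upd: assumes "b \<in> Basis" shows "vec (y(b := y b + t)) = vec y + t *\<^sub>R b"
proof (rule euclidean_eqI)
  fix c :: 'a assume "c \<in> Basis"
  then show "vec (y(b := y b + t)) \<bullet> c = (vec y + t *\<^sub>R b) \<bullet> c"
    using assms by (cases "c = b") (simp_all add: vec_inner inner_left_distrib inner_Basis)
qed

lemma AE_vec: "AE x in lborel. P x \<Longrightarrow> AE y in LL Basis. P (vec y)"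
  by (rule AE_distrD[OF measurable_vec], subst lborel_eq_distr_vec[symmetric])

lemma nn_integral_vec:
  assumes [measurable]: "f \<in> borel_measurable borel"
  shows "(\<integral>\<^sup>+x. f x \<partial>lborel) = (\<integral>\<^sup>+y. f (vec y) \<partial>LL Basis)"
  by (subst lborel_eq_distr_vec) (simp add: nn_integral_distr)

lemma integral_vec:
  fixes f :: "'a::euclidean_space \<Rightarrow> real"
  assumes [measurable]: "f \<in> borel_measurable borel"
  shows "(LINT x|lborel. f x) = (LINT y|LL Basis. f (vec y))"
  by (subst lborel_eq_distr_vec) (simp add: integral_distr)

definition diffq :: "'a::euclidean_space \<Rightarrow> nat \<Rightarrow> ('a \<Rightarrow> real) \<Rightarrow> 'a \<Rightarrow> real" where
  "diffq b n f x = (f (x + stp n *\<^sub>R b) - f x) / stp n"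

lemma measurable_diffq [measurable]:
  assumes [measurable]: "f \<in> borel_measurable borel"
  shows "diffq b n f \<in> borel_measurable borel"
  unfolding diffq_def[abs_def] by measurable

lemma dq_vec: "b \<in> Basis \<Longrightarrow> dq b n (\<lambda>y. f (vec y)) y = diffq b n f (vec y)"
  unfolding dq_def diffq_def by (simp add: vec_upd)

lemma box_bounded_vec:
  fixes f :: "'a::euclidean_space \<Rightarrow> real"
  assumes [measurable]: "f \<in> borel_measurable borel" and "\<And>x. 0 \<le> f x" "\<And>x. f x \<le> M" "\<And>x. norm x > R \<Longrightarrow> f x = 0"
  shows "box_bounded Basis M R (\<lambda>y. f (vec y))"
proof -
  have "f (vec y) = 0" if "b \<in> Basis" "\<bar>y b\<bar> > R" for y b
    using assms(4)[of "vec y"] Basis_le_norm[OF that(1), of "vec y"] that by (auto simp: vec_inner)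
  then show ?thesis unfolding box_bounded_def using assms by auto
qed

lemma log_sobolev_compact:
  fixes f :: "'a::euclidean_space \<Rightarrow> real"
  assumes fm: "f \<in> borel_measurable borel" and f: "\<And>x. 0 \<le> f x" "\<And>x. f x \<le> M" "\<And>x. norm x > R \<Longrightarrow> f x = 0"
    and E: "\<And>b n. b \<in> Basis \<Longrightarrow> (\<integral>\<^sup>+x. ennreal ((diffq b n f x)\<^sup>2) \<partial>lborel) \<le> ennreal (E b)"
    and E0: "\<And>b. b \<in> Basis \<Longrightarrow> 0 \<le> E b"
  shows "(LINT x|lborel. ent (f x)) + (1 + ln pi / 2) * DIM('a) * (LINT x|lborel. (f x)\<^sup>2)
    \<le> (\<Sum>b\<in>Basis. E b) + (LINT x|lborel. (f x)\<^sup>2) * ln (LINT x|lborel. (f x)\<^sup>2)"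
proof -
  note [measurable] = fm
  show ?thesis
    using log_sobolev_PiM[OF finite_Basis box_bounded_vec[OF fm f], where E=E] E E0
    by (simp add: integral_vec nn_integral_vec dq_vec)
qed

text \<open>Parameters of the lines in direction \<open>i\<close> that pass through the cube with centre \<open>p\<close> and half
  side \<open>r\<close>.\<close>
definition slab :: "'a::euclidean_space \<Rightarrow> 'a \<Rightarrow> real \<Rightarrow> ('a \<Rightarrow> real) set" where
  "slab i p r = PiE (Basis - {i}) (\<lambda>b. {p \<bullet> b - r<..<p \<bullet> b + r})"

definition gapint :: "'a::euclidean_space \<Rightarrow> 'a \<Rightarrow> real \<Rightarrow> ('a \<Rightarrow> real) \<Rightarrow> real" where
  "gapint i p r g = (LINT y|LL (Basis - {i}). gapfun i (p \<bullet> i) (slab i p r) (\<lambda>y. g (vec y)) y)"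

lemma slab_sets: "slab i p r \<in> sets (LL (Basis - {i}))"
  unfolding slab_def by (intro sets_PiM_I_finite) auto

lemma log_sobolev_compact_gap:
  fixes f :: "'a::euclidean_space \<Rightarrow> real"
  assumes fm: "f \<in> borel_measurable borel" and f: "\<And>x. 0 \<le> f x" "\<And>x. f x \<le> M" "\<And>x. norm x > R \<Longrightarrow> f x = 0"
    and E: "\<And>b n. b \<in> Basis \<Longrightarrow> (\<integral>\<^sup>+x. ennreal ((diffq b n f x)\<^sup>2) \<partial>lborel) \<le> ennreal (E b)"
    and E0: "\<And>b. b \<in> Basis \<Longrightarrow> 0 \<le> E b"
    and i: "i \<in> Basis" and r: "r > 0" and gap: "\<And>x. (\<And>b. b \<in> Basis \<Longrightarrow> \<bar>(x - p) \<bullet> b\<bar> < r) \<Longrightarrow> f x = 0"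
    and gm: "g \<in> borel_measurable borel" and g: "\<And>x. 0 \<le> g x" "\<And>x. g x \<le> f x"
  shows "(LINT x|lborel. ent (f x)) + (1 + ln pi / 2) * DIM('a) * (LINT x|lborel. (f x)\<^sup>2) + gapint i p r g
    \<le> (\<Sum>b\<in>Basis. E b) + (LINT x|lborel. (f x)\<^sup>2) * ln (LINT x|lborel. (f x)\<^sup>2)"
proof -
  note [measurable] = fm gm
  define I where "I = Basis - {i}"
  have I: "finite I" "i \<notin> I" "insert i I = Basis" using i by (auto simp: I_def)
  have bf: "box_bounded (insert i I) M R (\<lambda>y. f (vec y))" unfolding I(3) by (rule box_bounded_vec[OF fm f])
  have bg: "box_bounded (insert i I) M R (\<lambda>y. g (vec y))"
    unfolding I(3)
  proof (rule box_bounded_vec[OF gm g(1)])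
    show "g x \<le> M" for x using f(2)[of x] g(2)[of x] by linarith
    show "g x = 0" if "norm x > R" for x using f(3)[OF that] g[of x] by linarith
  qed
  have E': "\<forall>j\<in>insert i I. \<forall>n. (\<integral>\<^sup>+x. ennreal ((dq j n (\<lambda>y. f (vec y)) x)\<^sup>2) \<partial>LL (insert i I)) \<le> ennreal (E j)"
    unfolding I(3) using E by (simp add: nn_integral_vec dq_vec)
  have gap': "f (vec (y(i := x))) = 0" if y: "y \<in> slab i p r" and x: "\<bar>x - p \<bullet> i\<bar> < r" for y x
  proof (rule gap)
    fix b :: 'a assume b: "b \<in> Basis"
    have "b \<noteq> i \<Longrightarrow> y b \<in> {p \<bullet> b - r<..<p \<bullet> b + r}" using b y by (auto simp: slab_def PiE_iff)
    then show "\<bar>(vec (y(i := x)) - p) \<bullet> b\<bar> < r"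
      using b x by (cases "b = i") (auto simp: inner_diff_left vec_inner abs_less_iff)
  qed
  have E0': "\<forall>j\<in>insert i I. 0 \<le> E j" unfolding I(3) using E0 by blast
  have "(LINT x|LL (insert i I). ent (f (vec x))) + (1 + ln pi / 2) * card (insert i I) * (LINT x|LL (insert i I). (f (vec x))\<^sup>2)
      + (LINT y|LL I. gapfun i (p \<bullet> i) (slab i p r) (\<lambda>y. g (vec y)) y)
    \<le> (\<Sum>j\<in>insert i I. E j) + (LINT x|LL (insert i I). (f (vec x))\<^sup>2) * ln (LINT x|LL (insert i I). (f (vec x))\<^sup>2)"
    by (rule log_sobolev_PiM_gap(1)[OF I(1,2) bf E' E0' r _ _ bg])
       (use slab_sets[of i p r] gap' g in \<open>auto simp: I_def\<close>)
  then show ?thesis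
    unfolding I(3) by (simp add: integral_vec gapint_def I_def)
qed

lemma AE_slices:
  assumes fin: "finite I" and i: "i \<notin> I" and P: "AE x in LL (insert i I). P x"
  shows "AE y in LL I. AE t in lborel. P (y(i := t))"
proof -
  interpret product_sigma_finite "\<lambda>_. lborel :: real measure" by standard
  obtain N where N: "{x \<in> space (LL (insert i I)). \<not> P x} \<subseteq> N" "emeasure (LL (insert i I)) N = 0" "N \<in> sets (LL (insert i I))"
    using AE_E[OF P] by blast
  note [measurable] = N(3)
  have "0 = (\<integral>\<^sup>+x. indicator N x \<partial>LL (insert i I))" using N by simp
  also have "\<dots> = (\<integral>\<^sup>+y. (\<integral>\<^sup>+t. indicator N (y(i := t)) \<partial>lborel) \<partial>LL I)"
    by (rule product_nn_integral_insert[OF fin i]) simp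
  finally have 0: "(\<integral>\<^sup>+y. (\<integral>\<^sup>+t. indicator N (y(i := t)) \<partial>lborel) \<partial>LL I) = 0" by simp
  have "AE y in LL I. (\<integral>\<^sup>+t. indicator N (y(i := t)) \<partial>lborel) = 0"
    using 0 by (subst (asm) nn_integral_0_iff_AE) auto
  with AE_space show ?thesis
  proof eventually_elim
    case (elim y)
    note y = elim(1)
    have m: "(\<lambda>t. indicator N (y(i := t)) :: ennreal) \<in> borel_measurable lborel"
      using measurable_comp[OF measurable_component_update[OF y i], of "indicator N" "borel :: ennreal measure"] N(3)
      by (simp add: comp_def)
    have "AE t in lborel. (indicator N (y(i := t)) :: ennreal) = 0"
      using elim(2) m by (subst (asm) nn_integral_0_iff_AE) auto
    then show ?case
    proof eventually_elim
      case (elim t)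
      then show ?case using N(1) slice_space[OF y, of i t] by (auto simp: indicator_def split: if_splits)
    qed
  qed
qed

text \<open>The lines through the cube form a set of positive measure. Almost every one of them meets the
  region where \<open>g\<close> is positive on either side of the cube, so both of its half masses are
  positive.\<close>
lemma gapint_pos:
  fixes g :: "'a::euclidean_space \<Rightarrow> real"
  assumes gm: "g \<in> borel_measurable borel" and g: "\<And>x. 0 \<le> g x" "\<And>x. g x \<le> M" "\<And>x. norm x > R \<Longrightarrow> g x = 0"
    and i: "i \<in> Basis" and r: "r > 0" and s: "s > 0"
    and pos: "AE x in lborel. (\<forall>b\<in>Basis - {i}. \<bar>(x - p) \<bullet> b\<bar> < r) \<and> s < \<bar>(x - p) \<bullet> i\<bar> \<and> \<bar>(x - p) \<bullet> i\<bar> < s + 1 \<longrightarrow> g x > 0"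
  shows "gapint i p r g > 0"
proof (rule ccontr)
  interpret product_sigma_finite "\<lambda>_::'a. lborel :: real measure" by standard
  assume neg: "\<not> gapint i p r g > 0"
  note [measurable] = gm
  define I where "I = Basis - {i}"
  have I: "finite I" "i \<notin> I" "insert i I = Basis" using i by (auto simp: I_def)
  have bg: "box_bounded (insert i I) M R (\<lambda>y. g (vec y))" unfolding I(3) by (rule box_bounded_vec[OF gm g])
  let ?k = "gapfun i (p \<bullet> i) (slab i p r) (\<lambda>y. g (vec y))"
  note hg = halfmass_facts[OF I(1,2) bg]
  let ?a = "halfmass i {p \<bullet> i<..} (\<lambda>y. g (vec y))" and ?b = "halfmass i {..<p \<bullet> i} (\<lambda>y. g (vec y))"
  have k0: "0 \<le> ?k y" "?k y \<le> 1" for y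
    using Hgap_nonneg[OF halfmass_nonneg halfmass_nonneg] unfolding gapfun_def by (auto simp: indicator_def)
  have [measurable]: "?a \<in> borel_measurable (LL I)" "?b \<in> borel_measurable (LL I)" by (rule hg(1); simp)+
  have km: "?k \<in> borel_measurable (LL I)"
    unfolding gapfun_def[abs_def] Hgap_def using slab_sets[of i p r] unfolding I_def[symmetric] by measurable
  have ki: "integrable (LL I) ?k"
  proof (rule integrable_LL_bounded[OF I(1) km, where C=1 and R=R])
    show "\<bar>?k y\<bar> \<le> 1" for y using k0[of y] by simp
    show "?k y = 0" if "y \<in> space (LL I)" "j \<in> I" "\<bar>y j\<bar> > R" for y j
      unfolding gapfun_def using hg(2)[OF _ that, where A="{p \<bullet> i<..}"] by simp
  qed
  have "gapint i p r g = 0" using neg k0 unfolding gapint_def by (intro antisym integral_nonneg_AE AE_I2) auto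
  then have "AE y in LL I. ?k y = 0"
    unfolding gapint_def I_def[symmetric] using integral_nonneg_eq_0_iff_AE[OF ki] k0 by simp
  moreover have "AE y in LL I. AE t in lborel.
      (\<forall>b\<in>Basis - {i}. \<bar>(vec (y(i := t)) - p) \<bullet> b\<bar> < r) \<and> s < \<bar>(vec (y(i := t)) - p) \<bullet> i\<bar> \<and> \<bar>(vec (y(i := t)) - p) \<bullet> i\<bar> < s + 1 \<longrightarrow> g (vec (y(i := t))) > 0"
    by (rule AE_slices[OF I(1,2), unfolded I(3), OF AE_vec[OF pos]])
  ultimately have "AE y in LL I. y \<notin> slab i p r"
  proof eventually_elim
    case (elim y)
    show ?case
    proof
      assume y: "y \<in> slab i p r"
      then have ysp: "y \<in> space (LL I)" by (auto simp: slab_def space_PiM I_def PiE_iff)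
      have AEt: "AE t in lborel. s < \<bar>t - p \<bullet> i\<bar> \<and> \<bar>t - p \<bullet> i\<bar> < s + 1 \<longrightarrow> g (vec (y(i := t))) > 0"
        using elim(2)
      proof eventually_elim
        case (elim t)
        have "\<forall>b\<in>Basis - {i}. \<bar>(vec (y(i := t)) - p) \<bullet> b\<bar> < r"
        proof
          fix b assume b: "b \<in> Basis - {i}"
          then have "y b \<in> {p \<bullet> b - r<..<p \<bullet> b + r}" using y by (auto simp: slab_def PiE_iff)
          then show "\<bar>(vec (y(i := t)) - p) \<bullet> b\<bar> < r"
            using b by (auto simp: inner_diff_left vec_inner abs_less_iff)
        qed
        then show ?case using elim i by (simp add: inner_diff_left vec_inner)
      qed
      have hpos: "halfmass i A (\<lambda>y. g (vec y)) y > 0"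
        if A: "A \<in> sets borel" and c: "{c<..<c + 1} \<subseteq> A" "\<And>t. c < t \<Longrightarrow> t < c + 1 \<Longrightarrow> s < \<bar>t - p \<bullet> i\<bar> \<and> \<bar>t - p \<bullet> i\<bar> < s + 1" for A c
      proof (rule ccontr)
        assume "\<not> halfmass i A (\<lambda>y. g (vec y)) y > 0"
        then have "halfmass i A (\<lambda>y. g (vec y)) y = 0" using halfmass_nonneg[of i A "\<lambda>y. g (vec y)" y] by linarith
        then have "AE t in lborel. indicator A t * (g (vec (y(i := t))))\<^sup>2 = 0"
          unfolding halfmass_def using integral_nonneg_eq_0_iff_AE[OF hg(3)[OF A ysp]] by (simp add: indicator_def)
        with AEt have "AE t in lborel. t \<notin> {c<..<c + 1}"
        proof eventually_elim
          case (elim t)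
          then show ?case using c by (auto simp: indicator_def split: if_splits)
        qed
        then have "emeasure lborel {c<..<c+1} = 0"
          by (subst (asm) AE_iff_measurable[where N="{c<..<c+1}"]) auto
        then show False by simp
      qed
      have "?a y > 0" by (rule hpos[where c="p \<bullet> i + s"]) (use s in auto)
      moreover have "?b y > 0" by (rule hpos[where c="p \<bullet> i - s - 1"]) (use s in auto)
      ultimately have "Hgap (?a y) (?b y) > 0" by (rule Hgap_pos)
      then show False using elim(1) y by (auto simp: gapfun_def min_def split: if_splits)
    qed
  qed
  then have "emeasure (LL I) (slab i p r) = 0"
    using slab_sets[of i p r] sets.sets_into_space[OF slab_sets[of i p r]] unfolding I_def[symmetric]
    by (subst (asm) AE_iff_measurable[where N="slab i p r"]) auto
  moreover have "emeasure (LL I) (slab i p r) = (\<Prod>b\<in>I. emeasure lborel {p \<bullet> b - r<..<p \<bullet> b + r})"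
    unfolding slab_def I_def[symmetric] by (rule emeasure_PiM) (use I in auto)
  ultimately show False using I r by simp
qed

text \<open>The negative part of the entropy density is not monotone, but with \<open>a\<^sup>2 = q b\<^sup>2\<close>, \<open>q \<le> 1\<close>, it
  grows at most by \<open>b\<^sup>2 (- q ln q) \<le> b\<^sup>2\<close>. This provides a dominating function for the entropies
  of truncations.\<close>
lemma neg_ent_le:
  assumes "0 \<le> a" "a \<le> b"
  shows "- ent a \<le> max 0 (- ent b) + b\<^sup>2"
proof (cases "a = 0")
  case False
  then have a: "a > 0" "b > 0" using assms by auto
  define q where "q = (a / b)\<^sup>2"
  have q: "0 < q" "q \<le> 1" using a assms by (auto simp: q_def power_le_one)
  have aq: "a\<^sup>2 = q * b\<^sup>2" using a by (simp add: q_def power_divide)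
  have "- ent a = q * (- ent b) + b\<^sup>2 * (- (q * ln q))"
    unfolding ent_def aq using q a by (simp add: ln_mult algebra_simps)
  moreover have "q * (- ent b) \<le> max 0 (- ent b)"
    using q mult_left_le_one_le[of "- ent b" q] mult_nonneg_nonpos[of q "- ent b"] by (cases "- ent b \<ge> 0") auto
  moreover have "- (q * ln q) \<le> 1"
  proof -
    have "ln (1 / q) \<le> 1 / q - 1" using q by (intro ln_le_minus_one) simp
    then have "q * - ln q \<le> q * (1 / q - 1)" using q by (intro mult_left_mono) (auto simp: ln_div)
    then show ?thesis using q by (simp add: algebra_simps)
  qed
  then have "b\<^sup>2 * (- (q * ln q)) \<le> b\<^sup>2" using mult_left_mono[of "- (q * ln q)" 1 "b\<^sup>2"] by simp
  ultimately show ?thesis by linarith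
qed simp

text \<open>Truncation at height \<open>1 / stp k\<close> together with a Lipschitz cut-off at distance of order
  \<open>1 / stp k\<close>.\<close>
definition cutoff :: "nat \<Rightarrow> ('a::euclidean_space \<Rightarrow> real) \<Rightarrow> 'a \<Rightarrow> real" where
  "cutoff k f x = min (f x) (1 / stp k) * max 0 (min 1 (2 - stp k * norm x))"

lemma cutoff_facts:
  fixes f :: "'a::euclidean_space \<Rightarrow> real"
  assumes f0: "\<forall>x. 0 \<le> f x"
  shows "0 \<le> cutoff k f x" "cutoff k f x \<le> f x" "cutoff k f x \<le> 1 / stp k" "norm x > 2 / stp k \<Longrightarrow> cutoff k f x = 0"
    and "f x = 0 \<Longrightarrow> cutoff k f x = 0"
    and "eventually (\<lambda>k. cutoff k f x = f x) sequentially"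
    and "k \<le> l \<Longrightarrow> cutoff k f x \<le> cutoff l f x"
proof -
  define \<eta> where "\<eta> k = max 0 (min 1 (2 - stp k * norm x))" for k
  have \<eta>: "0 \<le> \<eta> k" "\<eta> k \<le> 1" for k by (auto simp: \<eta>_def)
  have c: "cutoff k f x = min (f x) (1 / stp k) * \<eta> k" for k by (simp add: cutoff_def \<eta>_def)
  have m: "0 \<le> min (f x) (1 / stp k)" for k using f0 by simp
  show "0 \<le> cutoff k f x" unfolding c using m \<eta> by (intro mult_nonneg_nonneg)
  have "cutoff k f x \<le> min (f x) (1 / stp k)" unfolding c using m \<eta> by (intro mult_left_le)
  then show "cutoff k f x \<le> f x" "cutoff k f x \<le> 1 / stp k" by auto
  show "cutoff k f x = 0" if "norm x > 2 / stp k"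
  proof -
    have "stp k * norm x > 2" using that by (simp add: pos_divide_less_eq mult.commute)
    then show ?thesis unfolding cutoff_def by simp
  qed
  show "f x = 0 \<Longrightarrow> cutoff k f x = 0" by (simp add: cutoff_def min_def)
  show "eventually (\<lambda>k. cutoff k f x = f x) sequentially"
  proof -
    have "(\<lambda>k. stp k * (norm x + f x)) \<longlonglongrightarrow> 0 * (norm x + f x)" by (intro tendsto_intros tendsto_stp)
    then have "eventually (\<lambda>k. stp k * (norm x + f x) < 1) sequentially" by (rule order_tendstoD) simp
    then show ?thesis
    proof eventually_elim
      case (elim k)
      have "stp k * norm x \<ge> 0" "stp k * f x \<ge> 0" using f0 by auto
      moreover have "stp k * norm x + stp k * f x < 1" using elim by (simp add: distrib_left)
      ultimately have "stp k * norm x \<le> 1" "stp k * f x \<le> 1" by linarith+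
      then have "f x \<le> 1 / stp k" by (simp add: pos_le_divide_eq mult.commute)
      then show ?case using \<open>stp k * norm x \<le> 1\<close> by (simp add: cutoff_def)
    qed
  qed
  show "cutoff k f x \<le> cutoff l f x" if "k \<le> l"
  proof -
    have s: "stp l \<le> stp k" using that by (simp add: stp_def divide_simps)
    have "stp l * norm x \<le> stp k * norm x" using s by (rule mult_right_mono) simp
    then have "\<eta> k \<le> \<eta> l" by (auto simp: \<eta>_def)
    moreover have "1 / stp k \<le> 1 / stp l" using s by (simp add: frac_le)
    then have "min (f x) (1 / stp k) \<le> min (f x) (1 / stp l)" by auto
    ultimately show ?thesis unfolding c using m \<eta> by (intro mult_mono) auto
  qed
qed

lemma measurable_cutoff [measurable]:
  assumes [measurable]: "f \<in> borel_measurable borel"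
  shows "cutoff k f \<in> borel_measurable borel"
  unfolding cutoff_def[abs_def] by measurable

lemma young_sq: "s > 0 \<Longrightarrow> (a + b)\<^sup>2 \<le> (1 + s) * a\<^sup>2 + (1 + 1 / s) * (b::real)\<^sup>2"
proof -
  assume s: "s > 0"
  have "0 \<le> (s * a - b)\<^sup>2 / s" using s by simp
  also have "\<dots> = s * a\<^sup>2 + b\<^sup>2 / s - 2 * a * b" using s by (simp add: power2_eq_square field_simps)
  finally show ?thesis by (simp add: power2_sum algebra_simps)
qed

text \<open>The cut-off factor has Lipschitz constant \<open>stp k\<close>, so it contributes a multiple of \<open>stp k\<close> to
  the difference quotient; Young's inequality with parameter \<open>stp k\<close> makes all error terms
  vanish as \<open>k\<close> tends to infinity.\<close>
lemma diffq_cutoff_le: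
  fixes f :: "'a::euclidean_space \<Rightarrow> real"
  assumes [measurable]: "f \<in> borel_measurable borel" and f0: "\<And>x. 0 \<le> f x" and i2: "integrable lborel (\<lambda>x. (f x)\<^sup>2)"
    and b: "b \<in> Basis" and E: "(\<integral>\<^sup>+x. ennreal ((diffq b n f x)\<^sup>2) \<partial>lborel) \<le> ennreal e" and e: "0 \<le> e"
  shows "(\<integral>\<^sup>+x. ennreal ((diffq b n (cutoff k f) x)\<^sup>2) \<partial>lborel)
    \<le> ennreal ((1 + stp k) * e + ((stp k)\<^sup>2 + stp k) * (LINT x|lborel. (f x)\<^sup>2))"
proof -
  define s where "s = stp k" define h where "h = stp n"
  have s: "s > 0" and h: "h > 0" by (auto simp: s_def h_def)
  have pw: "(diffq b n (cutoff k f) x)\<^sup>2 \<le> (1 + s) * (diffq b n f x)\<^sup>2 + (s\<^sup>2 + s) * (f x)\<^sup>2" for x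
  proof -
    define u where "u x = min (f x) (1 / s)" for x
    define \<eta> where "\<eta> x = max 0 (min 1 (2 - s * norm x))" for x :: 'a
    let ?x = "x + h *\<^sub>R b"
    have "\<bar>norm ?x - norm x\<bar> \<le> h" using norm_triangle_ineq3[of ?x x] h b by simp
    then have "\<bar>s * norm ?x - s * norm x\<bar> \<le> s * h" using s by (simp add: right_diff_distrib[symmetric] abs_mult)
    then have de: "\<bar>\<eta> ?x - \<eta> x\<bar> \<le> s * h" unfolding \<eta>_def by linarith
    have du: "\<bar>u ?x - u x\<bar> \<le> \<bar>f ?x - f x\<bar>" unfolding u_def by linarith
    have e1: "0 \<le> \<eta> ?x" "\<eta> ?x \<le> 1" by (auto simp: \<eta>_def)
    have u1: "0 \<le> u x" "u x \<le> f x" using f0[of x] s by (auto simp: u_def)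
    \<comment> \<open>The discrete product rule.\<close>
    define A where "A = \<eta> ?x * (u ?x - u x)"
    define B where "B = u x * (\<eta> ?x - \<eta> x)"
    have A: "A\<^sup>2 \<le> (f ?x - f x)\<^sup>2"
    proof -
      have "\<bar>A\<bar> \<le> 1 * \<bar>f ?x - f x\<bar>" unfolding A_def abs_mult by (intro mult_mono) (use e1 du in auto)
      then show ?thesis by (simp add: abs_le_square_iff[symmetric])
    qed
    have B: "B\<^sup>2 \<le> (f x * (s * h))\<^sup>2"
    proof -
      have "\<bar>B\<bar> \<le> f x * (s * h)" unfolding B_def abs_mult by (intro mult_mono) (use u1 de in auto)
      then show ?thesis by (simp add: abs_le_square_iff[symmetric])
    qed
    have "(A + B)\<^sup>2 \<le> (1 + s) * A\<^sup>2 + (1 + 1 / s) * B\<^sup>2" by (rule young_sq[OF s])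
    also have "\<dots> \<le> (1 + s) * (f ?x - f x)\<^sup>2 + (1 + 1 / s) * (f x * (s * h))\<^sup>2"
      using s A B by (intro add_mono mult_left_mono) auto
    finally have "(A + B)\<^sup>2 / h\<^sup>2 \<le> ((1 + s) * (f ?x - f x)\<^sup>2 + (1 + 1 / s) * (f x * (s * h))\<^sup>2) / h\<^sup>2"
      by (rule divide_right_mono) simp
    also have "\<dots> = (1 + s) * ((f ?x - f x) / h)\<^sup>2 + (s\<^sup>2 + s) * (f x)\<^sup>2"
      using s h by (simp add: power2_eq_square field_simps)
    also have "(A + B)\<^sup>2 / h\<^sup>2 = (diffq b n (cutoff k f) x)\<^sup>2"
    proof -
      have "cutoff k f ?x - cutoff k f x = A + B"
        by (simp add: cutoff_def A_def B_def u_def \<eta>_def s_def[symmetric] algebra_simps)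
      then show ?thesis unfolding diffq_def h_def[symmetric] by (simp add: power_divide)
    qed
    finally show ?thesis by (simp add: diffq_def h_def[symmetric])
  qed
  have "(\<integral>\<^sup>+x. ennreal ((diffq b n (cutoff k f) x)\<^sup>2) \<partial>lborel)
    \<le> (\<integral>\<^sup>+x. ennreal (1 + s) * ennreal ((diffq b n f x)\<^sup>2) + ennreal ((s\<^sup>2 + s) * (f x)\<^sup>2) \<partial>lborel)"
    by (intro nn_integral_mono) (use pw s in \<open>auto simp: ennreal_mult[symmetric] ennreal_plus[symmetric] simp del: ennreal_plus intro!: ennreal_leI\<close>)
  also have "\<dots> = ennreal (1 + s) * (\<integral>\<^sup>+x. ennreal ((diffq b n f x)\<^sup>2) \<partial>lborel) + (\<integral>\<^sup>+x. ennreal ((s\<^sup>2 + s) * (f x)\<^sup>2) \<partial>lborel)"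
    by (subst nn_integral_add) (auto simp: nn_integral_cmult)
  also have "(\<integral>\<^sup>+x. ennreal ((s\<^sup>2 + s) * (f x)\<^sup>2) \<partial>lborel) = ennreal ((s\<^sup>2 + s) * (LINT x|lborel. (f x)\<^sup>2))"
    using i2 s by (subst nn_integral_eq_integral) auto
  also have "ennreal (1 + s) * (\<integral>\<^sup>+x. ennreal ((diffq b n f x)\<^sup>2) \<partial>lborel) \<le> ennreal (1 + s) * ennreal e"
    by (intro mult_left_mono E) simp
  also have "ennreal (1 + s) * ennreal e + ennreal ((s\<^sup>2 + s) * (LINT x|lborel. (f x)\<^sup>2))
      = ennreal ((1 + s) * e + (s\<^sup>2 + s) * (LINT x|lborel. (f x)\<^sup>2))"
    using s e by (simp add: ennreal_mult[symmetric] ennreal_plus[symmetric] del: ennreal_plus)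
  finally show ?thesis by (simp add: s_def)
qed

text \<open>The limit of the inequalities for the truncations. The masses converge by dominated
  convergence. Adding the integrable function \<open>G\<close> makes the entropy densities nonnegative, and
  Fatou's lemma shows at the same time that the entropy of \<open>f\<close> is integrable and that the
  inequality holds.\<close>
lemma log_sobolev_cutoff_limit:
  fixes f :: "'a::euclidean_space \<Rightarrow> real"
  assumes [measurable]: "f \<in> borel_measurable borel" and f0: "\<And>x. 0 \<le> f x" and i2: "integrable lborel (\<lambda>x. (f x)\<^sup>2)"
    and neg: "integrable lborel (\<lambda>x. max 0 (- ent (f x)))"
  defines "m \<equiv> LINT x|lborel. (f x)\<^sup>2"
  assumes ev: "eventually (\<lambda>k. (LINT x|lborel. ent (cutoff k f x)) + c * (LINT x|lborel. (cutoff k f x)\<^sup>2) + \<kappa>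
      \<le> (\<Sum>b\<in>Basis. (1 + stp k) * E b + ((stp k)\<^sup>2 + stp k) * m)
        + (LINT x|lborel. (cutoff k f x)\<^sup>2) * ln (LINT x|lborel. (cutoff k f x)\<^sup>2)) sequentially"
  shows "integrable lborel (\<lambda>x. ent (f x))"
    and "(LINT x|lborel. ent (f x)) + c * m + \<kappa> \<le> (\<Sum>b\<in>(Basis::'a set). E b) + m * ln m"
proof -
  define G where "G x = max 0 (- ent (f x)) + (f x)\<^sup>2" for x
  have G: "integrable lborel G" unfolding G_def using neg i2 by auto
  define mk where "mk k = (LINT x|lborel. (cutoff k f x)\<^sup>2)" for k
  have f0': "\<forall>x. 0 \<le> f x" using f0 by blast
  note cf = cutoff_facts[OF f0']
  have sqle: "(cutoff k f x)\<^sup>2 \<le> (f x)\<^sup>2" for k x using cf(1,2) by (rule power_mono[rotated])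
  have mlim: "mk \<longlonglongrightarrow> m" unfolding mk_def m_def
  proof (rule integral_dominated_convergence[where w="\<lambda>x. (f x)\<^sup>2"])
    show "AE x in lborel. (\<lambda>k. (cutoff k f x)\<^sup>2) \<longlonglongrightarrow> (f x)\<^sup>2"
    proof (intro AE_I2 tendsto_eventually)
      fix x show "eventually (\<lambda>k. (cutoff k f x)\<^sup>2 = (f x)\<^sup>2) sequentially"
        using cf(6)[of x] by eventually_elim simp
    qed
  qed (use i2 sqle in auto)
  \<comment> \<open>The case \<open>m = 0\<close> is separate because \<open>ln\<close> is not continuous at 0; then all \<open>mk k\<close>
      vanish.\<close>
  have mmlim: "(\<lambda>k. mk k * ln (mk k)) \<longlonglongrightarrow> m * ln m"
  proof (cases "m = 0")
    case True
    have "mk k \<le> m" for k unfolding mk_def m_def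
      by (rule integral_mono) (use i2 sqle in \<open>auto intro: Bochner_Integration.integrable_bound[OF i2]\<close>)
    moreover have "mk k \<ge> 0" for k unfolding mk_def by simp
    ultimately have "mk k = 0" for k using True by (metis antisym)
    then show ?thesis using True by simp
  next
    case False
    then show ?thesis by (intro tendsto_intros mlim)
  qed
  define h where "h k x = ent (cutoff k f x) + G x" for k x
  have h0: "0 \<le> h k x" for k x
    using neg_ent_le[OF cf(1) cf(2), of k x] by (simp add: h_def G_def)
  have ei: "integrable lborel (\<lambda>x. ent (cutoff k f x))" for k
  proof (rule Bochner_Integration.integrable_bound)
    show "integrable lborel (\<lambda>x. G x + ((1 / stp k) ^ 2) * (f x)\<^sup>2)" using G i2 by auto
    show "AE x in lborel. norm (ent (cutoff k f x)) \<le> norm (G x + ((1 / stp k) ^ 2) * (f x)\<^sup>2)"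
    proof (rule AE_I2)
      fix x
      have G0: "G x \<ge> 0" by (simp add: G_def)
      have lo: "- ent (cutoff k f x) \<le> G x" using h0[of k x] by (simp add: h_def)
      have hi: "ent (cutoff k f x) \<le> (1 / stp k)^2 * (f x)\<^sup>2"
      proof (cases "cutoff k f x = 0")
        case False
        then have p: "(cutoff k f x)\<^sup>2 > 0" by simp
        have "ln ((cutoff k f x)\<^sup>2) \<le> (cutoff k f x)\<^sup>2" using ln_le_minus_one[OF p] by linarith
        also have "\<dots> \<le> (1 / stp k)^2" using cf(1,3) by (intro power_mono) auto
        finally have "(cutoff k f x)\<^sup>2 * ln ((cutoff k f x)\<^sup>2) \<le> (cutoff k f x)\<^sup>2 * (1 / stp k)^2"
          by (rule mult_left_mono) simp
        also have "\<dots> \<le> (f x)\<^sup>2 * (1 / stp k)^2" by (intro mult_right_mono sqle) simp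
        finally show ?thesis by (simp add: ent_def mult.commute)
      qed simp
      have "0 \<le> (1 / stp k)^2 * (f x)\<^sup>2" by simp
      then show "norm (ent (cutoff k f x)) \<le> norm (G x + ((1 / stp k) ^ 2) * (f x)\<^sup>2)"
        using G0 lo hi unfolding real_norm_def by linarith
    qed
  qed measurable
  define Bk where "Bk k = (\<Sum>b\<in>(Basis::'a set). (1 + stp k) * E b + ((stp k)\<^sup>2 + stp k) * m) + mk k * ln (mk k) - c * mk k - \<kappa>" for k
  define B where "B = (\<Sum>b\<in>(Basis::'a set). E b) + m * ln m - c * m - \<kappa>"
  have Blim: "Bk \<longlonglongrightarrow> B"
  proof -
    have "Bk \<longlonglongrightarrow> (\<Sum>b\<in>(Basis::'a set). (1 + 0) * E b + (0\<^sup>2 + 0) * m) + m * ln m - c * m - \<kappa>"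
      unfolding Bk_def by (intro tendsto_intros mlim mmlim tendsto_stp)
    then show ?thesis by (simp add: B_def)
  qed
  have hint: "(LINT x|lborel. h k x) = (LINT x|lborel. ent (cutoff k f x)) + (LINT x|lborel. G x)" for k
    unfolding h_def using ei G by simp
  have evB: "eventually (\<lambda>k. (LINT x|lborel. h k x) \<le> Bk k + (LINT x|lborel. G x)) sequentially"
    using ev by eventually_elim (simp add: hint Bk_def mk_def)
  have BG: "0 \<le> B + (LINT x|lborel. G x)"
  proof (rule tendsto_lowerbound)
    show "(\<lambda>k. Bk k + (LINT x|lborel. G x)) \<longlonglongrightarrow> B + (LINT x|lborel. G x)" by (intro tendsto_intros Blim)
    show "eventually (\<lambda>k. 0 \<le> Bk k + (LINT x|lborel. G x)) sequentially"
      using evB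
    proof eventually_elim
      case (elim k)
      have "0 \<le> (LINT x|lborel. h k x)" using h0 by (intro integral_nonneg_AE AE_I2)
      then show ?case using elim by linarith
    qed
  qed simp
  have "(\<integral>\<^sup>+x. ennreal (ent (f x) + G x) \<partial>lborel) = (\<integral>\<^sup>+x. liminf (\<lambda>k. ennreal (h k x)) \<partial>lborel)"
  proof (rule nn_integral_cong)
    fix x
    have "(\<lambda>k. ennreal (h k x)) \<longlonglongrightarrow> ennreal (ent (f x) + G x)"
      by (intro tendsto_eventually eventually_mono[OF cf(6)[of x]]) (simp add: h_def)
    then show "ennreal (ent (f x) + G x) = liminf (\<lambda>k. ennreal (h k x))"
      by (simp add: lim_imp_Liminf)
  qed
  also have "\<dots> \<le> liminf (\<lambda>k. \<integral>\<^sup>+x. ennreal (h k x) \<partial>lborel)"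
    by (rule nn_integral_liminf) (simp add: h_def G_def)
  also have "\<dots> = liminf (\<lambda>k. ennreal (LINT x|lborel. h k x))"
    by (intro arg_cong[where f=liminf] ext nn_integral_eq_integral) (use ei G h0 in \<open>auto simp: h_def\<close>)
  also have "\<dots> \<le> liminf (\<lambda>k. ennreal (Bk k + (LINT x|lborel. G x)))"
    by (intro Liminf_mono eventually_mono[OF evB] ennreal_leI)
  also have "\<dots> = ennreal (B + (LINT x|lborel. G x))"
    by (intro lim_imp_Liminf tendsto_ennrealI tendsto_intros Blim) simp
  finally have le: "(\<integral>\<^sup>+x. ennreal (ent (f x) + G x) \<partial>lborel) \<le> ennreal (B + (LINT x|lborel. G x))" .
  have nn: "0 \<le> ent (f x) + G x" for x by (auto simp: G_def max_def)
  have int: "integrable lborel (\<lambda>x. ent (f x) + G x)"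
  proof (rule integrableI_nonneg)
    show "(\<integral>\<^sup>+x. ennreal (ent (f x) + G x) \<partial>lborel) < \<infinity>" using le by (rule le_less_trans) simp
  qed (use nn in \<open>auto simp: G_def\<close>)
  then show ie: "integrable lborel (\<lambda>x. ent (f x))" using Bochner_Integration.integrable_diff[OF int G] by simp
  have "ennreal (LINT x|lborel. ent (f x) + G x) \<le> ennreal (B + (LINT x|lborel. G x))"
    using le nn_integral_eq_integral[OF int] nn by simp
  then have "(LINT x|lborel. ent (f x) + G x) \<le> B + (LINT x|lborel. G x)"
    using BG by (simp add: ennreal_le_iff)
  then show "(LINT x|lborel. ent (f x)) + c * m + \<kappa> \<le> (\<Sum>b\<in>(Basis::'a set). E b) + m * ln m"
    using ie G by (simp add: B_def)
qed

theorem log_sobolev: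
  fixes f :: "'a::euclidean_space \<Rightarrow> real"
  assumes fm[measurable]: "f \<in> borel_measurable borel" and f0: "\<And>x. 0 \<le> f x" and i2: "integrable lborel (\<lambda>x. (f x)\<^sup>2)"
    and neg: "integrable lborel (\<lambda>x. max 0 (- ent (f x)))"
    and E: "\<And>b n. b \<in> Basis \<Longrightarrow> (\<integral>\<^sup>+x. ennreal ((diffq b n f x)\<^sup>2) \<partial>lborel) \<le> ennreal (E b)"
    and E0: "\<And>b. b \<in> Basis \<Longrightarrow> 0 \<le> E b"
  defines "m \<equiv> LINT x|lborel. (f x)\<^sup>2"
  shows "integrable lborel (\<lambda>x. ent (f x))"
    and "(LINT x|lborel. ent (f x)) + (1 + ln pi / 2) * DIM('a) * m \<le> (\<Sum>b\<in>(Basis::'a set). E b) + m * ln m"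
proof -
  have f0': "\<forall>x. 0 \<le> f x" using f0 by blast
  note cf = cutoff_facts[OF f0']
  have m0: "0 \<le> m" by (simp add: m_def)
  have "(LINT x|lborel. ent (cutoff k f x)) + ((1 + ln pi / 2) * DIM('a)) * (LINT x|lborel. (cutoff k f x)\<^sup>2) + 0
      \<le> (\<Sum>b\<in>(Basis::'a set). (1 + stp k) * E b + ((stp k)\<^sup>2 + stp k) * m)
        + (LINT x|lborel. (cutoff k f x)\<^sup>2) * ln (LINT x|lborel. (cutoff k f x)\<^sup>2)" for k
    unfolding add_0_right
    by (rule log_sobolev_compact[where M="1 / stp k" and R="2 / stp k"])
       (use cf diffq_cutoff_le[OF fm f0 i2 _ E E0] E0 m0 in \<open>auto simp: m_def\<close>)
  note L = log_sobolev_cutoff_limit[OF fm f0 i2 neg always_eventually[OF allI[OF this[unfolded m_def]]]]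
  show "integrable lborel (\<lambda>x. ent (f x))" by (rule L(1))
  show "(LINT x|lborel. ent (f x)) + (1 + ln pi / 2) * DIM('a) * m \<le> (\<Sum>b\<in>(Basis::'a set). E b) + m * ln m"
    using L(2) by (simp add: m_def)
qed

text \<open>A hole of \<open>f\<close> around \<open>p\<close> and positivity of \<open>f\<close> far away produce a gain. It is bounded below by
  that of one fixed truncation \<open>g\<close>, since truncations increase with \<open>k\<close>, and thus survives in
  the limit.\<close>
theorem log_sobolev_strict:
  fixes f :: "'a::euclidean_space \<Rightarrow> real"
  assumes fm[measurable]: "f \<in> borel_measurable borel" and f0: "\<And>x. 0 \<le> f x" and i2: "integrable lborel (\<lambda>x. (f x)\<^sup>2)"
    and neg: "integrable lborel (\<lambda>x. max 0 (- ent (f x)))"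
    and E: "\<And>b n. b \<in> Basis \<Longrightarrow> (\<integral>\<^sup>+x. ennreal ((diffq b n f x)\<^sup>2) \<partial>lborel) \<le> ennreal (E b)"
    and E0: "\<And>b. b \<in> Basis \<Longrightarrow> 0 \<le> E b"
    and r: "r > 0" and gap: "\<And>x. norm (x - p) < r \<Longrightarrow> f x = 0"
    and pos: "AE x in lborel. norm (x - p) > s \<longrightarrow> f x > 0"
  defines "m \<equiv> LINT x|lborel. (f x)\<^sup>2"
  shows "(LINT x|lborel. ent (f x)) + (1 + ln pi / 2) * DIM('a) * m < (\<Sum>b\<in>(Basis::'a set). E b) + m * ln m"
proof -
  have f0': "\<forall>x. 0 \<le> f x" using f0 by blast
  note cf = cutoff_facts[OF f0']
  have m0: "0 \<le> m" by (simp add: m_def)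
  \<comment> \<open>Half the side of a cube contained in the ball of radius \<open>r\<close>.\<close>
  define r' where "r' = r / DIM('a)"
  have r': "r' > 0" using r by (simp add: r'_def)
  obtain i :: 'a where i: "i \<in> Basis" using nonempty_Basis by blast
  define s' where "s' = max s 1"
  \<comment> \<open>With this \<open>k0\<close> the cut-off equals 1 on the region in which \<open>g\<close> has to be positive.\<close>
  obtain k0 :: nat where k0: "norm p + DIM('a) * (r' + s' + 1) < real k0" using reals_Archimedean2 by blast
  define g where "g = cutoff k0 f"
  define \<kappa> where "\<kappa> = gapint i p r' g"
  have gap': "f x = 0" if "\<And>b. b \<in> Basis \<Longrightarrow> \<bar>(x - p) \<bullet> b\<bar> < r'" for x
  proof (rule gap)
    have "norm (x - p) \<le> (\<Sum>b\<in>Basis. \<bar>(x - p) \<bullet> b\<bar>)" by (rule norm_le_l1)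
    also have "\<dots> < (\<Sum>b\<in>(Basis::'a set). r')" by (rule sum_strict_mono) (use that in auto)
    also have "\<dots> = r" by (simp add: r'_def)
    finally show "norm (x - p) < r" .
  qed
  have Psi_factor: "\<kappa> > 0" unfolding \<kappa>_def
  proof (rule gapint_pos[where M="1 / stp k0" and R="2 / stp k0" and s=s'])
    show "AE x in lborel. (\<forall>b\<in>Basis - {i}. \<bar>(x - p) \<bullet> b\<bar> < r') \<and> s' < \<bar>(x - p) \<bullet> i\<bar> \<and> \<bar>(x - p) \<bullet> i\<bar> < s' + 1 \<longrightarrow> 0 < g x"
      using pos
    proof eventually_elim
      case (elim x)
      show ?case
      proof (intro impI, elim conjE)
        assume a: "\<forall>b\<in>Basis - {i}. \<bar>(x - p) \<bullet> b\<bar> < r'" "s' < \<bar>(x - p) \<bullet> i\<bar>" "\<bar>(x - p) \<bullet> i\<bar> < s' + 1"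
        have "norm (x - p) > s" using a(2) Basis_le_norm[OF i, of "x - p"] by (simp add: s'_def)
        then have fx: "f x > 0" using elim by blast
        have "norm (x - p) \<le> (\<Sum>b\<in>Basis. \<bar>(x - p) \<bullet> b\<bar>)" by (rule norm_le_l1)
        also have "\<dots> \<le> (\<Sum>b\<in>(Basis::'a set). r' + s' + 1)"
        proof (rule sum_mono)
          fix b :: 'a assume "b \<in> Basis"
          then show "\<bar>(x - p) \<bullet> b\<bar> \<le> r' + s' + 1"
          proof (cases "b = i")
            case True then show ?thesis using a(3) r' by simp
          next
            case False
            then have "\<bar>(x - p) \<bullet> b\<bar> < r'" using a(1) \<open>b \<in> Basis\<close> by blast
            moreover have "1 \<le> s'" by (simp add: s'_def)
            ultimately show ?thesis by linarith
          qed
        qed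
        also have "\<dots> = DIM('a) * (r' + s' + 1)" by simp
        finally have "norm x < real k0" using k0 norm_triangle_ineq2[of x p] by linarith
        then have "stp k0 * norm x < 1" by (simp add: stp_def)
        then show "g x > 0" using fx by (simp add: g_def cutoff_def)
      qed
    qed
  qed (use cf i r' in \<open>auto simp: g_def s'_def\<close>)
  have "eventually (\<lambda>k. (LINT x|lborel. ent (cutoff k f x)) + ((1 + ln pi / 2) * DIM('a)) * (LINT x|lborel. (cutoff k f x)\<^sup>2) + \<kappa>
      \<le> (\<Sum>b\<in>(Basis::'a set). (1 + stp k) * E b + ((stp k)\<^sup>2 + stp k) * (LINT x|lborel. (f x)\<^sup>2))
        + (LINT x|lborel. (cutoff k f x)\<^sup>2) * ln (LINT x|lborel. (cutoff k f x)\<^sup>2)) sequentially"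
    using eventually_ge_at_top[of k0]
  proof eventually_elim
    case (elim k)
    have z: "cutoff k f x = 0" if "\<And>b. b \<in> Basis \<Longrightarrow> \<bar>(x - p) \<bullet> b\<bar> < r'" for x
    proof -
      have "f x = 0" by (rule gap') (rule that)
      then show ?thesis by (rule cf(5))
    qed
    have gk: "g x \<le> cutoff k f x" for x using cf(7)[OF elim] by (simp add: g_def)
    have Ek: "(\<integral>\<^sup>+x. ennreal ((diffq b n (cutoff k f) x)\<^sup>2) \<partial>lborel)
      \<le> ennreal ((1 + stp k) * E b + ((stp k)\<^sup>2 + stp k) * (LINT x|lborel. (f x)\<^sup>2))" if "b \<in> Basis" for b n
      by (rule diffq_cutoff_le[OF fm f0 i2 that E[OF that] E0[OF that]])
    have Ek0: "0 \<le> (1 + stp k) * E b + ((stp k)\<^sup>2 + stp k) * (LINT x|lborel. (f x)\<^sup>2)" if "b \<in> Basis" for b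
      using E0[OF that] by simp
    show ?case unfolding \<kappa>_def
      by (rule log_sobolev_compact_gap[where M="1 / stp k" and R="2 / stp k", OF _ cf(1) cf(3) cf(4) Ek Ek0 i r' z _ _ gk])
         (use cf in \<open>auto simp: g_def\<close>)
  qed
  note L = log_sobolev_cutoff_limit[OF fm f0 i2 neg this]
  show ?thesis using L(2) Psi_factor by (simp add: m_def)
qed

section \<open>Smooth functions\<close>

text \<open>Differentiability classes are defined by recursion over \<open>frechet_derivative\<close>; this rule allows
  any known derivative to be used instead.\<close>
lemma Ck_SucI:
  assumes "\<And>x. (f has_derivative f' x) (at x)" and "\<And>v. Ck_on k (\<lambda>x. f' x v) UNIV"
  shows "Ck_on (Suc k) f UNIV"
proof -
  have "frechet_derivative f (at x) = f' x" for x using frechet_derivative_at[OF assms(1)] by simp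
  then show ?thesis using assms by (auto simp: differentiable_def)
qed

lemma Ck_SucD:
  assumes "Ck_on (Suc k) f UNIV"
  shows "(f has_derivative frechet_derivative f (at x)) (at x)" "Ck_on k (\<lambda>x. frechet_derivative f (at x) v) UNIV"
  using assms by (auto simp: frechet_derivative_works)

lemma Ck_Suc_imp: "Ck_on (Suc k) f UNIV \<Longrightarrow> Ck_on k f UNIV"
proof (induction k arbitrary: f)
  case 0
  then have "f differentiable (at x)" for x by auto
  then show ?case by (auto intro!: continuous_at_imp_continuous_on differentiable_imp_continuous_within)
next
  case (Suc k)
  show ?case
    by (rule Ck_SucI[OF Ck_SucD(1)[OF Suc.prems]]) (rule Suc.IH[OF Ck_SucD(2)[OF Suc.prems]])
qed

lemma Ck_const: "Ck_on k (\<lambda>x. c) UNIV"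
proof (induction k arbitrary: c)
  case (Suc k) show ?case by (rule Ck_SucI[where f'="\<lambda>x v. 0"]) (auto intro: Suc)
qed auto

lemma Ck_bounded_linear: "bounded_linear f \<Longrightarrow> Ck_on k f UNIV"
proof (cases k)
  case 0 then show "bounded_linear f \<Longrightarrow> ?thesis" by (simp add: linear_continuous_on)
next
  case (Suc j) then show "bounded_linear f \<Longrightarrow> ?thesis"
    by (auto intro!: Ck_SucI[where f'="\<lambda>x. f"] Ck_const bounded_linear_imp_has_derivative simp del: Ck_on.simps)
qed

lemma Ck_add: "Ck_on k f UNIV \<Longrightarrow> Ck_on k g UNIV \<Longrightarrow> Ck_on k (\<lambda>x. f x + g x) UNIV"
proof (induction k arbitrary: f g)
  case (Suc k)
  show ?case
    by (rule Ck_SucI[OF has_derivative_add[OF Ck_SucD(1)[OF Suc.prems(1)] Ck_SucD(1)[OF Suc.prems(2)]]])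
       (intro Suc.IH Ck_SucD(2) Suc.prems)
qed (auto intro: continuous_intros)

lemma Ck_mult:
  fixes f g :: "'a::real_normed_vector \<Rightarrow> real"
  shows "Ck_on k f UNIV \<Longrightarrow> Ck_on k g UNIV \<Longrightarrow> Ck_on k (\<lambda>x. f x * g x) UNIV"
proof (induction k arbitrary: f g)
  case (Suc k)
  show ?case
    by (rule Ck_SucI[OF has_derivative_mult[OF Ck_SucD(1)[OF Suc.prems(1)] Ck_SucD(1)[OF Suc.prems(2)]]])
       (intro Ck_add Suc.IH Ck_SucD(2) Suc.prems Ck_Suc_imp[OF Suc.prems(1)] Ck_Suc_imp[OF Suc.prems(2)])
qed (auto intro: continuous_intros)

lemma Ck_compose_real:
  fixes F :: "real \<Rightarrow> real" and u :: "'a::real_normed_vector \<Rightarrow> real"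
  shows "Ck_on k F UNIV \<Longrightarrow> Ck_on k u UNIV \<Longrightarrow> Ck_on k (\<lambda>x. F (u x)) UNIV"
proof (induction k arbitrary: F)
  case 0
  then show ?case by (auto intro: continuous_on_compose2)
next
  case (Suc k)
  have lin: "frechet_derivative F (at t) s = s * frechet_derivative F (at t) 1" for t s
  proof -
    have "linear (frechet_derivative F (at t))"
      using has_derivative_bounded_linear[OF Ck_SucD(1)[OF Suc.prems(1)]] bounded_linear.linear by blast
    from linear_scale[OF this, of s 1] show ?thesis by simp
  qed
  show ?case
  proof (rule Ck_SucI)
    fix x
    show "((\<lambda>x. F (u x)) has_derivative (\<lambda>v. frechet_derivative u (at x) v * frechet_derivative F (at (u x)) 1)) (at x)"
      using has_derivative_compose[OF Ck_SucD(1)[OF Suc.prems(2)] Ck_SucD(1)[OF Suc.prems(1)]]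
      by (subst (asm) lin)
    fix v
    show "Ck_on k (\<lambda>x. frechet_derivative u (at x) v * frechet_derivative F (at (u x)) 1) UNIV"
      by (intro Ck_mult Ck_SucD(2) Suc.prems Suc.IH[of "\<lambda>t. frechet_derivative F (at t) 1"] Ck_Suc_imp[OF Suc.prems(2)])
  qed
qed

lemma Ck_real_derivI:
  fixes f g :: "real \<Rightarrow> real"
  assumes "\<And>x. (f has_real_derivative g x) (at x)" "Ck_on k g UNIV"
  shows "Ck_on (Suc k) f UNIV"
  by (rule Ck_SucI[where f'="\<lambda>x v. g x * v"])
     (use assms in \<open>auto simp: has_field_derivative_def intro!: Ck_mult Ck_const\<close>)

lemma smooth_on_real_derivI:
  fixes f g :: "real \<Rightarrow> real"
  assumes "\<And>x. (f has_real_derivative g x) (at x)" "smooth_on g UNIV"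
  shows "smooth_on f UNIV"
  unfolding smooth_on_def
proof
  fix k show "Ck_on k f UNIV"
    using Ck_real_derivI[OF assms(1), of k] assms(2) Ck_Suc_imp unfolding smooth_on_def by blast
qed

lemma smooth_on_const: "smooth_on (\<lambda>x. c) UNIV"
  and smooth_on_bounded_linear: "bounded_linear h \<Longrightarrow> smooth_on h UNIV"
  and smooth_on_add: "smooth_on f UNIV \<Longrightarrow> smooth_on g UNIV \<Longrightarrow> smooth_on (\<lambda>x. f x + g x) UNIV"
  unfolding smooth_on_def by (auto intro: Ck_const Ck_bounded_linear Ck_add)

lemma smooth_on_mult: "smooth_on f UNIV \<Longrightarrow> smooth_on g UNIV \<Longrightarrow> smooth_on (\<lambda>x. f x * g x :: real) UNIV"
  and smooth_on_compose_real: "smooth_on F UNIV \<Longrightarrow> smooth_on u UNIV \<Longrightarrow> smooth_on (\<lambda>x. F (u x) :: real) UNIV"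
  for F :: "real \<Rightarrow> real"
  unfolding smooth_on_def by (auto intro: Ck_mult Ck_compose_real)

lemma smooth_on_diff_real: "smooth_on f UNIV \<Longrightarrow> smooth_on g UNIV \<Longrightarrow> smooth_on (\<lambda>x. f x - g x :: real) UNIV"
  using smooth_on_add[OF _ smooth_on_mult[OF smooth_on_const[of "-1"]], of f g] by simp

lemma smooth_on_prod: "(\<And>i. i \<in> I \<Longrightarrow> smooth_on (f i) UNIV) \<Longrightarrow> smooth_on (\<lambda>x. \<Prod>i\<in>I. f i x :: real) UNIV"
  by (induction I rule: infinite_finite_induct) (auto intro: smooth_on_const smooth_on_mult)

lemma smooth_on_exp: "smooth_on (exp :: real \<Rightarrow> real) UNIV"
  unfolding smooth_on_def
proof
  fix k show "Ck_on k (exp :: real \<Rightarrow> real) UNIV"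
  proof (induction k)
    case 0 show ?case by (auto intro: continuous_intros)
  next
    case (Suc k) show ?case by (rule Ck_real_derivI[OF DERIV_exp Suc])
  qed
qed

lemma smooth_on_imp_has_derivative:
  "smooth_on f UNIV \<Longrightarrow> (f has_derivative frechet_derivative f (at x)) (at x)"
  and smooth_on_frechet: "smooth_on f UNIV \<Longrightarrow> smooth_on (\<lambda>x. frechet_derivative f (at x) v) UNIV"
  and smooth_on_imp_continuous: "smooth_on f UNIV \<Longrightarrow> continuous_on UNIV f"
proof -
  assume f: "smooth_on f UNIV"
  then show "(f has_derivative frechet_derivative f (at x)) (at x)" unfolding smooth_on_def using Ck_SucD(1) by blast
  show "smooth_on (\<lambda>x. frechet_derivative f (at x) v) UNIV" using f Ck_SucD(2) unfolding smooth_on_def by blast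
  show "continuous_on UNIV f" using f unfolding smooth_on_def by (metis Ck_on.simps(1))
qed

text \<open>A class of functions flat at 0 that is closed under differentiation, which makes smoothness of
  \<open>exp (- 1 / t)\<close> an induction.\<close>
definition flat :: "real poly \<Rightarrow> real \<Rightarrow> real" where
  "flat p t = (if t > 0 then poly p (1 / t) * exp (- (1 / t)) else 0)"

lemma poly_exp_tendsto_0: "((\<lambda>x. poly p x * exp (- x)) \<longlongrightarrow> (0::real)) at_top"
proof -
  have "((\<lambda>x. \<Sum>i\<le>degree p. coeff p i * (x ^ i / exp x)) \<longlongrightarrow> (\<Sum>i\<le>degree p. coeff p i * 0)) at_top"
    by (intro tendsto_intros tendsto_power_div_exp_0)
  then show ?thesis
    by (simp add: poly_altdef exp_minus divide_inverse sum_distrib_right mult.assoc)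
qed

lemma flat_has_derivative:
  "(flat p has_real_derivative flat ([:0, 0, 1:] * (p - pderiv p)) t) (at t)"
proof (cases t "0::real" rule: linorder_cases)
  case greater
  have "((\<lambda>t. poly p (1 / t) * exp (- (1 / t))) has_real_derivative
      (poly (pderiv p) (1 / t) * (- 1 / t\<^sup>2) * exp (- (1 / t)) + poly p (1 / t) * (exp (- (1 / t)) * (1 / t\<^sup>2)))) (at t)"
    using greater by (auto intro!: derivative_eq_intros DERIV_chain'[of "\<lambda>t. 1 / t" _ t UNIV "poly p"] poly_DERIV simp: power2_eq_square)
  moreover have "poly (pderiv p) (1 / t) * (- 1 / t\<^sup>2) * exp (- (1 / t)) + poly p (1 / t) * (exp (- (1 / t)) * (1 / t\<^sup>2))
      = flat ([:0, 0, 1:] * (p - pderiv p)) t"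
    using greater by (simp add: flat_def power2_eq_square algebra_simps divide_inverse)
  ultimately have "((\<lambda>t. poly p (1 / t) * exp (- (1 / t))) has_real_derivative flat ([:0, 0, 1:] * (p - pderiv p)) t) (at t)" by simp
  moreover have "eventually (\<lambda>s. poly p (1 / s) * exp (- (1 / s)) = flat p s) (nhds t)"
    using eventually_nhds_in_open[of "{0<..}" t] greater by (auto elim!: eventually_mono simp: flat_def)
  ultimately show ?thesis by (subst (asm) DERIV_cong_ev[OF refl _ refl]) auto
next
  case less
  have "((\<lambda>t. 0) has_real_derivative flat ([:0, 0, 1:] * (p - pderiv p)) t) (at t)"
    using less by (simp add: flat_def)
  moreover have "eventually (\<lambda>s. 0 = flat p s) (nhds t)"
    using eventually_nhds_in_open[of "{..<0}" t] less by (auto elim!: eventually_mono simp: flat_def)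
  ultimately show ?thesis by (subst (asm) DERIV_cong_ev[OF refl _ refl]) auto
next
  case equal
  have "((\<lambda>h. flat p h / h) \<longlongrightarrow> 0) (at 0)"
  proof (rule filterlim_split_at)
    show "((\<lambda>h. flat p h / h) \<longlongrightarrow> 0) (at_left 0)"
      by (rule tendsto_eventually) (auto simp: flat_def eventually_at_left_field intro!: exI[of _ "-1"])
    have "((\<lambda>h. poly ([:0, 1:] * p) (inverse h) * exp (- inverse h)) \<longlongrightarrow> 0) (at_right (0::real))"
      using filterlim_compose[OF poly_exp_tendsto_0 filterlim_inverse_at_top_right] .
    moreover have "eventually (\<lambda>h. poly ([:0, 1:] * p) (inverse h) * exp (- inverse h) = flat p h / h) (at_right (0::real))"
      by (auto simp: eventually_at_right_field flat_def divide_inverse intro!: exI[of _ 1])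
    ultimately show "((\<lambda>h. flat p h / h) \<longlongrightarrow> 0) (at_right 0)"
      by (rule Lim_transform_eventually)
  qed
  then show ?thesis using equal by (simp add: DERIV_def flat_def)
qed

lemma smooth_on_flat: "smooth_on (flat p) UNIV"
  unfolding smooth_on_def
proof
  fix k show "Ck_on k (flat p) UNIV"
  proof (induction k arbitrary: p)
    case 0
    have "isCont (flat p) x" for x using flat_has_derivative[of p x] by (rule DERIV_isCont)
    then show ?case by (auto intro!: continuous_at_imp_continuous_on)
  next
    case (Suc k) show ?case by (rule Ck_real_derivI[OF flat_has_derivative Suc])
  qed
qed

text \<open>The normalized integral of a smooth bump on the unit interval.\<close>
lemma smooth_step:
  obtains S S' :: "real \<Rightarrow> real" and C where "smooth_on S UNIV" "\<And>t. t \<le> 0 \<Longrightarrow> S t = 0" "\<And>t. t \<ge> 1 \<Longrightarrow> S t = 1"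
    "\<And>t. 0 \<le> S t" "\<And>t. S t \<le> 1" "\<And>t. (S has_real_derivative S' t) (at t)" "\<And>t. \<bar>S' t\<bar> \<le> C" "continuous_on UNIV S'"
proof -
  define e where "e t = flat 1 t * flat 1 (1 - t)" for t
  have e: "smooth_on e UNIV" unfolding e_def
    by (intro smooth_on_mult smooth_on_compose_real[OF smooth_on_flat] smooth_on_diff_real smooth_on_const smooth_on_bounded_linear bounded_linear_ident smooth_on_flat)
  have ec: "continuous_on A e" for A using smooth_on_imp_continuous[OF e] continuous_on_subset by blast
  have e0: "0 \<le> e t" for t by (simp add: e_def flat_def)
  have epos: "0 < e t" if "0 < t" "t < 1" for t using that by (simp add: e_def flat_def)
  have ez: "e t = 0" if "t \<le> 0 \<or> t \<ge> 1" for t using that by (auto simp: e_def flat_def)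
  define c where "c = integral {0..1} e"
  have ei: "e integrable_on {a..b}" for a b by (intro integrable_continuous_interval ec)
  have c: "c > 0"
  proof -
    have "c \<ge> 0" unfolding c_def by (intro integral_nonneg ei) (use e0 in auto)
    moreover have "c \<noteq> 0"
    proof
      assume "c = 0"
      then have "(e has_integral 0) (cbox 0 1)" using ei[of 0 1] by (simp add: c_def has_integral_integral)
      then have "e (1/2) = 0" by (rule has_integral_0_cbox_imp_0[rotated 2]) (use ec e0 in auto)
      then show False using epos[of "1/2"] by simp
    qed
    ultimately show ?thesis by simp
  qed
  define T where "T t = integral {0..max t 0} e" for t
  have T1: "T t = c" if "t \<ge> 1" for t
  proof -
    have "integral {0..1} e + integral {1..t} e = integral {0..t} e"
      by (rule Henstock_Kurzweil_Integration.integral_combine) (use that ei in auto)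
    moreover have "integral {1..t} e = integral {1..t} (\<lambda>x. 0)" by (rule integral_cong) (simp add: ez)
    ultimately show ?thesis using that by (simp add: T_def c_def max_def)
  qed
  have Td: "(T has_real_derivative e t) (at t)" for t
  proof -
    have a: "T u = integral {-\<bar>t\<bar>-1..u} e" if "u \<ge> -\<bar>t\<bar>-1" for u
    proof -
      have z: "integral {a..b} e = 0" if "b \<le> 0" for a b
        using that by (subst integral_cong[where g="\<lambda>x. 0"]) (auto simp: ez)
      show ?thesis
      proof (cases "u \<ge> 0")
        case True
        have "integral {-\<bar>t\<bar>-1..0} e + integral {0..u} e = integral {-\<bar>t\<bar>-1..u} e"
          by (rule Henstock_Kurzweil_Integration.integral_combine) (use True ei in auto)
        then show ?thesis using True z[of 0] by (simp add: T_def)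
      next
        case False
        then show ?thesis using z[of u] by (simp add: T_def)
      qed
    qed
    have "((\<lambda>u. integral {-\<bar>t\<bar>-1..u} e) has_vector_derivative e t) (at t within {-\<bar>t\<bar>-1..\<bar>t\<bar>+1})"
      by (rule integral_has_vector_derivative) (auto intro: ec)
    then have "((\<lambda>u. integral {-\<bar>t\<bar>-1..u} e) has_real_derivative e t) (at t)"
      by (subst (asm) at_within_Icc_at) (auto simp: has_real_derivative_iff_has_vector_derivative)
    moreover have "eventually (\<lambda>u. u \<in> {-\<bar>t\<bar>-1<..}) (nhds t)"
      by (rule eventually_nhds_in_open) auto
    then have "eventually (\<lambda>u. integral {-\<bar>t\<bar>-1..u} e = T u) (nhds t)"
      by eventually_elim (simp add: a)
    ultimately show ?thesis by (subst (asm) DERIV_cong_ev[OF refl _ refl]) auto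
  qed
  have Tmono: "T a \<le> T b" if "a \<le> b" for a b
    by (rule DERIV_nonneg_imp_nondecreasing[OF that]) (use Td e0 in blast)
  have T0: "T t = 0" if "t \<le> 0" for t using that by (simp add: T_def max_def)
  define S where "S t = T t / c" for t
  define S' where "S' t = e t / c" for t
  have Sd: "(S has_real_derivative S' t) (at t)" for t unfolding S_def S'_def by (intro DERIV_cdivide Td)
  have S'c: "continuous_on UNIV S'" unfolding S'_def using c by (intro continuous_intros ec) auto
  have Ss: "smooth_on S UNIV"
  proof (rule smooth_on_real_derivI[OF Sd])
    show "smooth_on S' UNIV" using smooth_on_mult[OF e smooth_on_const[of "1 / c"]] by (simp add: S'_def[abs_def])
  qed
  have "bounded (S' ` {0..1})" by (intro compact_imp_bounded compact_continuous_image continuous_on_subset[OF S'c]) auto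
  then obtain C where C: "\<And>t. t \<in> {0..1} \<Longrightarrow> \<bar>S' t\<bar> \<le> C" by (force simp: bounded_iff)
  have "\<bar>S' t\<bar> \<le> C" for t
  proof (cases "t \<in> {0..1}")
    case False
    have "\<bar>S' 0\<bar> \<le> C" by (rule C) simp
    then have "0 \<le> C" using abs_ge_zero order_trans by blast
    then show ?thesis using ez[of t] False by (auto simp: S'_def)
  qed (rule C)
  moreover have "0 \<le> S t" for t using Tmono[of "min t 0" t] T0[of "min t 0"] c by (simp add: S_def)
  moreover have "S t \<le> 1" for t using Tmono[of t "max t 1"] T1[of "max t 1"] c by (simp add: S_def)
  moreover have "S t = 0" if "t \<le> 0" for t using T0[OF that] by (simp add: S_def)
  moreover have "S t = 1" if "t \<ge> 1" for t using T1[OF that] c by (simp add: S_def)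
  ultimately show ?thesis using Ss Sd S'c that by blast
qed

section \<open>Uniqueness of weak gradients\<close>

text \<open>Besides the support property, the derivatives vanish off \<open>K\<close>, since its complement is open.\<close>
lemma test_functionsE:
  assumes "\<phi> \<in> test_functions \<Omega>"
  obtains K where "compact K" "K \<subseteq> \<Omega>" "smooth_on \<phi> UNIV" "\<And>x. x \<notin> K \<Longrightarrow> \<phi> x = 0"
    "\<And>x v. x \<notin> K \<Longrightarrow> frechet_derivative \<phi> (at x) v = 0"
proof
  let ?K = "closure {x. \<phi> x \<noteq> 0}"
  show "compact ?K" "?K \<subseteq> \<Omega>" and sm: "smooth_on \<phi> UNIV" using assms by (auto simp: test_functions_def)
  show z: "\<phi> x = 0" if "x \<notin> ?K" for x
    using that closure_subset[of "{x. \<phi> x \<noteq> 0}"] by (cases "\<phi> x = 0") auto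
  show "frechet_derivative \<phi> (at x) v = 0" if x: "x \<notin> ?K" for x v
  proof -
    have "((\<lambda>x. 0) has_derivative (\<lambda>v. 0)) (at x)" by simp
    then have "(\<phi> has_derivative (\<lambda>v. 0)) (at x)"
    proof (rule has_derivative_transform_within_open[where s="- ?K"])
      show "x \<in> - ?K" using x by simp
      show "0 = \<phi> y" if "y \<in> - ?K" for y using z[of y] that by simp
    qed (rule open_Compl, rule closed_closure)
    then show ?thesis by (simp add: frechet_derivative_at[symmetric])
  qed
qed

lemma test_functionsI:
  assumes "smooth_on \<phi> UNIV" "compact K" "K \<subseteq> \<Omega>" "\<And>x. x \<notin> K \<Longrightarrow> \<phi> x = 0"
  shows "\<phi> \<in> test_functions \<Omega>"
proof -
  have "closure {x. \<phi> x \<noteq> 0} \<subseteq> K" using assms(2,4) by (intro closure_minimal compact_imp_closed) auto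
  then have "compact (closure {x. \<phi> x \<noteq> 0})"
    using assms(2) by (metis closed_closure compact_Int_closed inf.absorb_iff2)
  then show ?thesis
    using assms \<open>closure {x. \<phi> x \<noteq> 0} \<subseteq> K\<close> by (auto simp: test_functions_def)
qed

lemma test_functions_zero:
  assumes "\<phi> \<in> test_functions \<Omega>" "x \<notin> \<Omega>"
  shows "\<phi> x = 0" "frechet_derivative \<phi> (at x) v = 0"
  by (rule test_functionsE[OF assms(1)]; use assms(2) in blast)+

lemma continuous_frechet: "smooth_on \<phi> UNIV \<Longrightarrow> continuous_on UNIV (\<lambda>x. frechet_derivative \<phi> (at x) v)"
  by (rule smooth_on_imp_continuous[OF smooth_on_frechet])

lemma bounded_if_compact_support:
  fixes h :: "'a::euclidean_space \<Rightarrow> real"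
  assumes "continuous_on UNIV h" "compact K" "\<And>x. x \<notin> K \<Longrightarrow> h x = 0"
  obtains C where "\<And>x. \<bar>h x\<bar> \<le> C" "C \<ge> 0"
proof -
  have "bounded (h ` K)" by (intro compact_imp_bounded compact_continuous_image continuous_on_subset[OF assms(1)] assms) auto
  then obtain C where C: "\<And>x. x \<in> K \<Longrightarrow> \<bar>h x\<bar> \<le> C" by (force simp: bounded_iff)
  show ?thesis
  proof (rule that[of "max C 0"])
    show "\<bar>h x\<bar> \<le> max C 0" for x using C[of x] assms(3)[of x] by (cases "x \<in> K") auto
  qed simp
qed

lemma borel_if_continuous: "continuous_on UNIV h \<Longrightarrow> h \<in> borel_measurable borel"
  by (rule borel_measurable_continuous_onI)

lemma measurable_lebesgueI: "h \<in> borel_measurable borel \<Longrightarrow> h \<in> borel_measurable lebesgue"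
  by (intro measurable_completion) simp

lemma integrable_compact_support:
  fixes h :: "'a::euclidean_space \<Rightarrow> real"
  assumes "continuous_on UNIV h" "compact K" "\<And>x. x \<notin> K \<Longrightarrow> h x = 0"
  shows "integrable lborel h"
proof -
  have "integrable lborel (\<lambda>x. indicator K x *\<^sub>R h x)"
    by (rule borel_integrable_compact[OF assms(2) continuous_on_subset[OF assms(1)]]) simp
  moreover have "(\<lambda>x. indicator K x *\<^sub>R h x) = h" using assms(3) by (auto simp: indicator_def fun_eq_iff)
  ultimately show ?thesis by simp
qed

lemma L1_loc_mult_integrable:
  fixes u :: "'a::euclidean_space \<Rightarrow> real"
  assumes u: "u \<in> L1_loc \<Omega>" and h: "h \<in> borel_measurable borel" "\<And>x. \<bar>h x\<bar> \<le> C" and K: "compact K" "K \<subseteq> \<Omega>" "\<And>x. x \<notin> K \<Longrightarrow> h x = 0"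
  shows "integrable lebesgue (\<lambda>x. u x * h x)"
proof -
  have i: "integrable lebesgue (\<lambda>x. indicator K x *\<^sub>R u x)" using u K unfolding L1_loc_def set_integrable_def by blast
  note [measurable] = measurable_lebesgueI[OF h(1)] borel_measurable_integrable[OF i]
  have eq: "(\<lambda>x. u x * h x) = (\<lambda>x. h x * (indicator K x *\<^sub>R u x))" using K(3) by (auto simp: fun_eq_iff indicator_def)
  show ?thesis unfolding eq
  proof (rule Bochner_Integration.integrable_bound[OF integrable_mult_right[OF i, of C]])
    show "AE x in lebesgue. norm (h x * (indicator K x *\<^sub>R u x)) \<le> norm (C * (indicator K x *\<^sub>R u x))"
    proof (rule AE_I2)
      fix x
      have "\<bar>h x\<bar> \<le> \<bar>C\<bar>" using h(2)[of x] by linarith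
      then show "norm (h x * (indicator K x *\<^sub>R u x)) \<le> norm (C * (indicator K x *\<^sub>R u x))"
        unfolding norm_mult by (intro mult_right_mono) auto
    qed
  qed measurable
qed

lemma set_lebesgue_integral_eq_if_support:
  fixes h :: "'a::euclidean_space \<Rightarrow> real"
  assumes "\<And>x. x \<notin> \<Omega> \<Longrightarrow> h x = 0"
  shows "(LINT x:\<Omega>|lebesgue. h x) = (LINT x|lebesgue. h x)"
  unfolding set_lebesgue_integral_def using assms by (intro Bochner_Integration.integral_cong) (auto simp: indicator_def)

lemma L1_loc_inner: "g \<in> L1_loc \<Omega> \<Longrightarrow> (\<lambda>x. g x \<bullet> i) \<in> L1_loc \<Omega>" for i :: "'a::euclidean_space"
  unfolding L1_loc_def set_integrable_def by (auto simp: inner_scaleR_left[symmetric] simp del: inner_scaleR_left)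

lemma L1_loc_combine: 
  fixes u v :: "'a::euclidean_space \<Rightarrow> 'b::euclidean_space"
  shows "u \<in> L1_loc \<Omega> \<Longrightarrow> v \<in> L1_loc \<Omega> \<Longrightarrow> (\<lambda>x. a *\<^sub>R u x + b *\<^sub>R v x) \<in> L1_loc \<Omega>"
  unfolding L1_loc_def by (auto intro!: set_integral_add set_integrable_scaleR_right)

lemma weak_gradient_integrals:
  assumes "is_weak_gradient \<Omega> u g" "\<phi> \<in> test_functions \<Omega>" "i \<in> Basis"
  shows "integrable lebesgue (\<lambda>x. u x * frechet_derivative \<phi> (at x) i)" (is ?A)
    and "integrable lebesgue (\<lambda>x. (g x \<bullet> i) * \<phi> x)" (is ?B)
    and "(LINT x|lebesgue. u x * frechet_derivative \<phi> (at x) i) = - (LINT x|lebesgue. (g x \<bullet> i) * \<phi> x)"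
    and "(LINT x:\<Omega>|lebesgue. u x * frechet_derivative \<phi> (at x) i) = (LINT x|lebesgue. u x * frechet_derivative \<phi> (at x) i)"
    and "(LINT x:\<Omega>|lebesgue. (g x \<bullet> i) * \<phi> x) = (LINT x|lebesgue. (g x \<bullet> i) * \<phi> x)"
proof -
  obtain K where K: "compact K" "K \<subseteq> \<Omega>" "smooth_on \<phi> UNIV" "\<And>x. x \<notin> K \<Longrightarrow> \<phi> x = 0"
    "\<And>x v. x \<notin> K \<Longrightarrow> frechet_derivative \<phi> (at x) v = 0" using test_functionsE[OF assms(2)] by metis
  note c = smooth_on_imp_continuous[OF K(3)] continuous_frechet[OF K(3), of i]
  obtain C where C: "\<And>x. \<bar>\<phi> x\<bar> \<le> C" using bounded_if_compact_support[OF c(1) K(1,4)] by metis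
  obtain D where D: "\<And>x. \<bar>frechet_derivative \<phi> (at x) i\<bar> \<le> D" using bounded_if_compact_support[OF c(2) K(1) K(5)[of _ i]] by metis
  have u: "u \<in> L1_loc \<Omega>" "g \<in> L1_loc \<Omega>" using assms(1) by (auto simp: is_weak_gradient_def)
  show ?A by (rule L1_loc_mult_integrable[OF u(1) borel_if_continuous[OF c(2)] D K(1,2) K(5)])
  show ?B by (rule L1_loc_mult_integrable[OF L1_loc_inner[OF u(2)] borel_if_continuous[OF c(1)] C K(1,2,4)])
  show a: "(LINT x:\<Omega>|lebesgue. u x * frechet_derivative \<phi> (at x) i) = (LINT x|lebesgue. u x * frechet_derivative \<phi> (at x) i)"
    and b: "(LINT x:\<Omega>|lebesgue. (g x \<bullet> i) * \<phi> x) = (LINT x|lebesgue. (g x \<bullet> i) * \<phi> x)"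
    by (auto intro!: set_lebesgue_integral_eq_if_support simp: test_functions_zero[OF assms(2)])
  show "(LINT x|lebesgue. u x * frechet_derivative \<phi> (at x) i) = - (LINT x|lebesgue. (g x \<bullet> i) * \<phi> x)"
    using assms a b by (auto simp: is_weak_gradient_def)
qed

lemma is_weak_gradient_combine:
  fixes \<Omega> :: "'a::euclidean_space set"
  assumes "is_weak_gradient \<Omega> u g" "is_weak_gradient \<Omega> v h"
  shows "is_weak_gradient \<Omega> (\<lambda>x. a * u x + b * v x) (\<lambda>x. a *\<^sub>R g x + b *\<^sub>R h x)"
  unfolding is_weak_gradient_def
proof (intro conjI ballI)
  show "(\<lambda>x. a * u x + b * v x) \<in> L1_loc \<Omega>" "(\<lambda>x. a *\<^sub>R g x + b *\<^sub>R h x) \<in> L1_loc \<Omega>"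
    using assms L1_loc_combine[of u \<Omega> v a b] L1_loc_combine[of g \<Omega> h a b] by (auto simp: is_weak_gradient_def)
  fix \<phi> and i :: 'a assume \<phi>: "\<phi> \<in> test_functions \<Omega>" and i: "i \<in> Basis"
  note U = weak_gradient_integrals[OF assms(1) \<phi> i] and V = weak_gradient_integrals[OF assms(2) \<phi> i]
  have "(LINT x:\<Omega>|lebesgue. (a * u x + b * v x) * frechet_derivative \<phi> (at x) i)
     = (LINT x|lebesgue. a * (u x * frechet_derivative \<phi> (at x) i) + b * (v x * frechet_derivative \<phi> (at x) i))"
    by (subst set_lebesgue_integral_eq_if_support) (auto simp: test_functions_zero[OF \<phi>] algebra_simps)
  also have "\<dots> = a * (LINT x|lebesgue. u x * frechet_derivative \<phi> (at x) i) + b * (LINT x|lebesgue. v x * frechet_derivative \<phi> (at x) i)"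
    using U(1) V(1) by simp
  also have "\<dots> = - (a * (LINT x|lebesgue. (g x \<bullet> i) * \<phi> x) + b * (LINT x|lebesgue. (h x \<bullet> i) * \<phi> x))"
    unfolding U(3) V(3) by simp
  also have "a * (LINT x|lebesgue. (g x \<bullet> i) * \<phi> x) + b * (LINT x|lebesgue. (h x \<bullet> i) * \<phi> x)
     = (LINT x|lebesgue. a * ((g x \<bullet> i) * \<phi> x) + b * ((h x \<bullet> i) * \<phi> x))"
    using U(2) V(2) by simp
  also have "\<dots> = (LINT x:\<Omega>|lebesgue. ((a *\<^sub>R g x + b *\<^sub>R h x) \<bullet> i) * \<phi> x)"
    by (subst set_lebesgue_integral_eq_if_support) (auto simp: test_functions_zero[OF \<phi>] algebra_simps inner_left_distrib)
  finally show "(LINT x:\<Omega>|lebesgue. (a * u x + b * v x) * frechet_derivative \<phi> (at x) i)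
     = - (LINT x:\<Omega>|lebesgue. ((a *\<^sub>R g x + b *\<^sub>R h x) \<bullet> i) * \<phi> x)" .
qed

text \<open>Products over the coordinates of smooth steps that become steep at the faces of the box.\<close>
lemma box_bump:
  fixes a b :: "'a::euclidean_space"
  assumes "cbox a b \<subseteq> \<Omega>"
  obtains \<phi> :: "nat \<Rightarrow> 'a \<Rightarrow> real" where "\<And>n. \<phi> n \<in> test_functions \<Omega>" "\<And>n x. \<bar>\<phi> n x\<bar> \<le> 1"
    "\<And>n x. x \<notin> cbox a b \<Longrightarrow> \<phi> n x = 0" "\<And>x. (\<lambda>n. \<phi> n x) \<longlonglongrightarrow> indicator (box a b) x"
proof -
  obtain S S' C where S: "smooth_on S UNIV" "\<And>t. t \<le> 0 \<Longrightarrow> S t = 0" "\<And>t. t \<ge> 1 \<Longrightarrow> S t = (1::real)"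
    "\<And>t. 0 \<le> S t" "\<And>t. S t \<le> 1" "\<And>t. (S has_real_derivative S' t) (at t)" "\<And>t. \<bar>S' t\<bar> \<le> C" "continuous_on UNIV S'"
    using smooth_step by blast
  define \<phi> where "\<phi> n x = (\<Prod>i\<in>Basis. S (real n * (x \<bullet> i - a \<bullet> i)) * S (real n * (b \<bullet> i - x \<bullet> i)))" for n and x :: 'a
  have z: "\<phi> n x = 0" if x: "x \<notin> box a b" for n x
  proof -
    obtain i where i: "i \<in> Basis" "x \<bullet> i \<le> a \<bullet> i \<or> b \<bullet> i \<le> x \<bullet> i" using x by (auto simp: mem_box not_less)
    then have "real n * (x \<bullet> i - a \<bullet> i) \<le> 0 \<or> real n * (b \<bullet> i - x \<bullet> i) \<le> 0" by (auto intro: mult_nonneg_nonpos)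
    then show ?thesis unfolding \<phi>_def using S(2) i by (intro prod_zero) auto
  qed
  have lin: "smooth_on (\<lambda>x::'a. x \<bullet> i) UNIV" for i
    by (intro smooth_on_bounded_linear bounded_linear_inner_left)
  have sm: "smooth_on (\<phi> n) UNIV" for n
    unfolding \<phi>_def by (intro smooth_on_prod smooth_on_mult smooth_on_compose_real[OF S(1)] smooth_on_diff_real smooth_on_const lin)
  show ?thesis
  proof
    show zc: "\<phi> n x = 0" if "x \<notin> cbox a b" for n x using z that box_subset_cbox by blast
    show "\<phi> n \<in> test_functions \<Omega>" for n
      by (rule test_functionsI[OF sm _ assms zc]) auto
    show "\<bar>\<phi> n x\<bar> \<le> 1" for n x
      unfolding \<phi>_def abs_prod by (rule prod_le_1) (use S in \<open>auto simp: abs_mult intro: mult_le_one\<close>)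
    show "(\<lambda>n. \<phi> n x) \<longlonglongrightarrow> indicator (box a b) x" for x
    proof (cases "x \<in> box a b")
      case True
      have "(\<lambda>n. \<phi> n x) \<longlonglongrightarrow> (\<Prod>i\<in>(Basis::'a set). 1 * 1)"
        unfolding \<phi>_def
      proof (intro tendsto_prod tendsto_mult)
        have one: "(\<lambda>n. S (real n * d)) \<longlonglongrightarrow> 1" if "d > 0" for d
        proof (rule tendsto_eventually)
          obtain k :: nat where k: "1 / d < real k" using reals_Archimedean2 by blast
          show "eventually (\<lambda>n. S (real n * d) = 1) sequentially"
            using eventually_ge_at_top[of k]
          proof eventually_elim
            case (elim n)
            then have "1 / d \<le> real n" using k by simp
            then show ?case using that by (intro S(3)) (simp add: pos_divide_le_eq)
          qed
        qed
        fix i :: 'a assume "i \<in> Basis"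
        then show "(\<lambda>n. S (real n * (x \<bullet> i - a \<bullet> i))) \<longlonglongrightarrow> 1" "(\<lambda>n. S (real n * (b \<bullet> i - x \<bullet> i))) \<longlonglongrightarrow> 1"
          using True by (auto intro!: one simp: mem_box)
      qed
      then show ?thesis using True by simp
    next
      case False then show ?thesis by (simp add: z)
    qed
  qed
qed

text \<open>The fundamental lemma of the calculus of variations. The integrals of \<open>d\<close> over boxes vanish by
  approximation of their indicator functions, and \<open>d\<close> is almost everywhere the limit of its
  averages over small boxes.\<close>
lemma AE_eq_0_if_orthogonal:
  fixes d :: "'a::euclidean_space \<Rightarrow> real"
  assumes \<Omega>: "open \<Omega>" and d: "d \<in> L1_loc \<Omega>" and orth: "\<And>\<phi>. \<phi> \<in> test_functions \<Omega> \<Longrightarrow> (LINT x|lebesgue. d x * \<phi> x) = 0"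
  shows "AE x in lebesgue. x \<in> \<Omega> \<longrightarrow> d x = 0"
proof -
  have box0: "(LINT x|lebesgue. indicator (box a b) x *\<^sub>R d x) = 0" if ab: "cbox a b \<subseteq> \<Omega>" for a b
  proof -
    obtain \<phi> where \<phi>: "\<And>n. \<phi> n \<in> test_functions \<Omega>" "\<And>n x. \<bar>\<phi> n x\<bar> \<le> 1"
      "\<And>n x. x \<notin> cbox a b \<Longrightarrow> \<phi> n x = 0" "\<And>x. (\<lambda>n. \<phi> n x) \<longlonglongrightarrow> indicator (box a b) x"
      using box_bump[OF ab] by blast
    have i: "integrable lebesgue (\<lambda>x. indicator (cbox a b) x *\<^sub>R d x)" using d ab unfolding L1_loc_def set_integrable_def by auto
    have \<phi>m: "\<phi> n \<in> borel_measurable borel" for n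
      using \<phi>(1)[of n] by (auto simp: test_functions_def intro!: borel_if_continuous smooth_on_imp_continuous)
    have meas: "(\<lambda>x. d x * \<phi> n x) \<in> borel_measurable lebesgue" for n
      by (rule borel_measurable_integrable, rule L1_loc_mult_integrable[OF d \<phi>m \<phi>(2) compact_cbox ab \<phi>(3)])
    have "(\<lambda>n. LINT x|lebesgue. d x * \<phi> n x) \<longlonglongrightarrow> (LINT x|lebesgue. d x * indicator (box a b) x)"
    proof (rule integral_dominated_convergence[where w="\<lambda>x. norm (indicator (cbox a b) x *\<^sub>R d x)"])
      have "(\<lambda>x. indicator (box a b) x * (indicator (cbox a b) x *\<^sub>R d x)) \<in> borel_measurable lebesgue"
        by (intro borel_measurable_times borel_measurable_integrable[OF i] measurable_lebesgueI borel_measurable_indicator) simp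
      moreover have "(\<lambda>x. indicator (box a b) x * (indicator (cbox a b) x *\<^sub>R d x)) = (\<lambda>x. d x * indicator (box a b) x)"
        using box_subset_cbox[of a b] by (auto simp: indicator_def fun_eq_iff)
      ultimately show "(\<lambda>x. d x * indicator (box a b) x) \<in> borel_measurable lebesgue" by simp
      show "AE x in lebesgue. norm (d x * \<phi> n x) \<le> norm (indicator (cbox a b) x *\<^sub>R d x)" for n
      proof (rule AE_I2)
        fix x show "norm (d x * \<phi> n x) \<le> norm (indicator (cbox a b) x *\<^sub>R d x)"
          using \<phi>(2)[of n x] \<phi>(3)[of x n] by (cases "x \<in> cbox a b") (auto simp: abs_mult mult_left_le)
      qed
    qed (use i meas \<phi>(4) in \<open>auto intro!: tendsto_intros\<close>)
    then show ?thesis using orth[OF \<phi>(1)] by (simp add: LIMSEQ_const_iff mult.commute)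
  qed
  \<comment> \<open>Lebesgue differentiation is applied on each member of a compact exhaustion, where
      \<open>d\<close> is integrable.\<close>
  obtain C where C: "\<And>n. compact (C n)" "\<And>n. C n \<subseteq> \<Omega>" "\<And>n. C n \<subseteq> interior (C (Suc n))" "\<Union>(range C) = \<Omega>"
    using open_Union_compact_subsets[OF \<Omega>] by metis
  have "AE x in lebesgue. x \<in> interior (C n) \<longrightarrow> d x = 0" for n
  proof -
    define f where "f x = indicator (C n) x *\<^sub>R d x" for x
    have fi: "integrable lebesgue f" using d C(1,2)[of n] unfolding L1_loc_def set_integrable_def f_def by blast
    have si: "set_integrable lebesgue A f" if "A \<in> sets lebesgue" for A
      unfolding set_integrable_def using fi that by (intro integrable_mult_indicator)
    have abs: "f absolutely_integrable_on cbox a b" for a b by (intro si) auto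
    obtain N where N: "negligible N" "\<And>x e. \<lbrakk>x \<notin> N; 0 < e\<rbrakk> \<Longrightarrow>
      \<exists>\<delta>>0. \<forall>h. 0 < h \<and> h < \<delta> \<longrightarrow> norm (integral (cbox x (x + h *\<^sub>R One)) f /\<^sub>R h ^ DIM('a) - f x) < e"
      using integrable_ccontinuous_explicit[of f] set_lebesgue_integral_eq_integral(1)[OF abs] by metis
    have "f x = 0" if x: "x \<notin> N" "x \<in> interior (C n)" for x
    proof (rule ccontr)
      assume fx: "f x \<noteq> 0"
      then obtain \<delta> where \<delta>: "\<delta> > 0" "\<And>h. 0 < h \<Longrightarrow> h < \<delta> \<Longrightarrow> norm (integral (cbox x (x + h *\<^sub>R One)) f /\<^sub>R h ^ DIM('a) - f x) < \<bar>f x\<bar>"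
        using N(2)[OF x(1), of "\<bar>f x\<bar>"] by auto
      obtain r where r: "r > 0" "ball x r \<subseteq> interior (C n)" using x(2) open_contains_ball by blast
      define h where "h = min (\<delta> / 2) (r / (2 * DIM('a)))"
      have h: "0 < h" "h < \<delta>" "h * DIM('a) < r" using \<delta>(1) r(1) by (auto simp: h_def min_def field_simps)
      have sub: "cbox x (x + h *\<^sub>R One) \<subseteq> C n"
      proof
        fix y assume y: "y \<in> cbox x (x + h *\<^sub>R One)"
        have "norm (y - x) \<le> (\<Sum>i\<in>Basis. \<bar>(y - x) \<bullet> i\<bar>)" by (rule norm_le_l1)
        also have "\<dots> \<le> (\<Sum>i\<in>(Basis::'a set). h)"
          using y by (intro sum_mono) (auto simp: mem_box inner_diff_left inner_add_left)
        also have "\<dots> < r" using h by (simp add: mult.commute)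
        finally show "y \<in> C n" using r(2) interior_subset[of "C n"] by (auto simp: dist_norm norm_minus_commute subset_iff)
      qed
      have "integral (cbox x (x + h *\<^sub>R One)) f = (LINT y:cbox x (x + h *\<^sub>R One)|lebesgue. f y)"
        by (rule set_lebesgue_integral_eq_integral(2)[OF abs, symmetric])
      also have "\<dots> = (LINT y|lebesgue. indicator (box x (x + h *\<^sub>R One)) y *\<^sub>R d y)"
        unfolding set_lebesgue_integral_def
      proof (rule integral_cong_AE)
        have "negligible (cbox x (x + h *\<^sub>R One) - box x (x + h *\<^sub>R One))" by (rule negligible_frontier_interval)
        then have ae: "AE y in lebesgue. y \<notin> cbox x (x + h *\<^sub>R One) - box x (x + h *\<^sub>R One)"
          unfolding negligible_iff_null_sets by (rule AE_not_in)
        have bc: "box x (x + h *\<^sub>R One) \<subseteq> cbox x (x + h *\<^sub>R One)" by (rule box_subset_cbox)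
        show "AE y in lebesgue. indicator (cbox x (x + h *\<^sub>R One)) y *\<^sub>R f y = indicator (box x (x + h *\<^sub>R One)) y *\<^sub>R d y"
          using ae by eventually_elim (use sub bc in \<open>auto simp: f_def indicator_def\<close>)
        show "(\<lambda>y. indicator (cbox x (x + h *\<^sub>R One)) y *\<^sub>R f y) \<in> borel_measurable lebesgue"
          using borel_measurable_integrable[OF si[unfolded set_integrable_def, of "cbox x (x + h *\<^sub>R One)"]] by simp
        have "(\<lambda>y. indicator (box x (x + h *\<^sub>R One)) y *\<^sub>R f y) \<in> borel_measurable lebesgue"
          using borel_measurable_integrable[OF si[unfolded set_integrable_def, of "box x (x + h *\<^sub>R One)"]] by simp
        moreover have "(\<lambda>y. indicator (box x (x + h *\<^sub>R One)) y *\<^sub>R f y) = (\<lambda>y. indicator (box x (x + h *\<^sub>R One)) y *\<^sub>R d y)"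
          using sub bc by (auto simp: f_def indicator_def fun_eq_iff)
        ultimately show "(\<lambda>y. indicator (box x (x + h *\<^sub>R One)) y *\<^sub>R d y) \<in> borel_measurable lebesgue" by simp
      qed
      also have "\<dots> = 0" using sub C(2)[of n] by (intro box0) auto
      finally show False using \<delta>(2)[OF h(1,2)] by simp
    qed
    moreover have "AE x in lebesgue. x \<notin> N" using N(1) unfolding negligible_iff_null_sets by (rule AE_not_in)
    ultimately show ?thesis
    proof (elim eventually_mono, intro impI)
      fix x assume "x \<notin> N" "x \<in> interior (C n)"
      then have "f x = 0" "x \<in> C n" using \<open>\<And>x. x \<notin> N \<Longrightarrow> x \<in> interior (C n) \<Longrightarrow> f x = 0\<close> interior_subset by auto
      then show "d x = 0" by (simp add: f_def)
    qed
  qed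
  then have "AE x in lebesgue. \<forall>n. x \<in> interior (C n) \<longrightarrow> d x = 0" by (subst AE_all_countable) blast
  then show ?thesis
    by eventually_elim (use C(3,4) in blast)
qed

lemma weak_gradient_unique:
  fixes \<Omega> :: "'a::euclidean_space set"
  assumes "open \<Omega>" "is_weak_gradient \<Omega> u g" "is_weak_gradient \<Omega> u h"
  shows "AE x in lebesgue. x \<in> \<Omega> \<longrightarrow> g x = h x"
proof -
  have "AE x in lebesgue. x \<in> \<Omega> \<longrightarrow> (g x - h x) \<bullet> i = 0" if i: "i \<in> Basis" for i
  proof (rule AE_eq_0_if_orthogonal[OF assms(1)])
    have "(\<lambda>x. 1 *\<^sub>R g x + (-1) *\<^sub>R h x) \<in> L1_loc \<Omega>"
      using assms(2,3) by (intro L1_loc_combine) (auto simp: is_weak_gradient_def)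
    then show "(\<lambda>x. (g x - h x) \<bullet> i) \<in> L1_loc \<Omega>" by (intro L1_loc_inner) simp
    fix \<phi> assume \<phi>: "\<phi> \<in> test_functions \<Omega>"
    note G = weak_gradient_integrals[OF assms(2) \<phi> i] and H = weak_gradient_integrals[OF assms(3) \<phi> i]
    have "(LINT x|lebesgue. (g x - h x) \<bullet> i * \<phi> x) = (LINT x|lebesgue. (g x \<bullet> i) * \<phi> x - (h x \<bullet> i) * \<phi> x)"
      by (simp add: inner_diff_left left_diff_distrib)
    also have "\<dots> = 0" using G(2,3) H(2,3) by simp
    finally show "(LINT x|lebesgue. (g x - h x) \<bullet> i * \<phi> x) = 0" .
  qed
  then have "AE x in lebesgue. \<forall>i\<in>Basis. x \<in> \<Omega> \<longrightarrow> (g x - h x) \<bullet> i = 0" by (intro AE_finite_allI) auto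
  then show ?thesis
    by eventually_elim (auto intro!: euclidean_eqI[where 'a='a] simp: inner_diff_left)
qed

text \<open>The chosen weak gradient may be replaced by any other one under integrals.\<close>
lemma weak_gradient_eq:
  assumes "open \<Omega>" "is_weak_gradient \<Omega> u g"
  shows "AE x in lebesgue. x \<in> \<Omega> \<longrightarrow> weak_gradient \<Omega> u x = g x" "is_weak_gradient \<Omega> u (weak_gradient \<Omega> u)"
proof -
  show w: "is_weak_gradient \<Omega> u (weak_gradient \<Omega> u)" unfolding weak_gradient_def by (rule someI[where P="is_weak_gradient \<Omega> u", OF assms(2)])
  show "AE x in lebesgue. x \<in> \<Omega> \<longrightarrow> weak_gradient \<Omega> u x = g x" by (rule weak_gradient_unique[OF assms(1) w assms(2)])
qed

section \<open>Difference quotients of test functions\<close>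

lemma nn_integral_translate:
  fixes f :: "'a::euclidean_space \<Rightarrow> ennreal"
  assumes [measurable]: "f \<in> borel_measurable borel"
  shows "(\<integral>\<^sup>+x. f (x + a) \<partial>lborel) = (\<integral>\<^sup>+x. f x \<partial>lborel)"
proof -
  have "(\<integral>\<^sup>+x. f x \<partial>lborel) = (\<integral>\<^sup>+x. f x \<partial>distr lborel borel ((+) a))" by (simp add: lborel_distr_plus)
  also have "\<dots> = (\<integral>\<^sup>+x. f (a + x) \<partial>lborel)" by (subst nn_integral_distr) auto
  finally show ?thesis by (simp add: add.commute)
qed

lemma integral_translate:
  fixes f :: "'a::euclidean_space \<Rightarrow> real"
  assumes [measurable]: "f \<in> borel_measurable borel"
  shows "(LINT x|lborel. f (x + a)) = (LINT x|lborel. f x)"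
proof -
  have "(LINT x|lborel. f x) = (LINT x|distr lborel borel ((+) a). f x)" by (simp add: lborel_distr_plus)
  also have "\<dots> = (LINT x|lborel. f (a + x))" by (subst integral_distr) auto
  finally show ?thesis by (simp add: add.commute)
qed

lemma integrable_translate:
  fixes f :: "'a::euclidean_space \<Rightarrow> real"
  assumes "integrable lborel f" shows "integrable lborel (\<lambda>x. f (x + a))"
proof -
  have "integrable (distr lborel borel ((+) a)) f" using assms by (simp add: lborel_distr_plus)
  then have "integrable lborel (\<lambda>x. f (a + x))" by (subst (asm) integrable_distr_eq) (use assms in auto)
  then show ?thesis by (simp add: add.commute)
qed

lemma line_derivative:
  fixes \<phi> :: "'a::euclidean_space \<Rightarrow> real"
  assumes "smooth_on \<phi> UNIV"
  shows "((\<lambda>t. \<phi> (x + t *\<^sub>R b)) has_real_derivative frechet_derivative \<phi> (at (x + t *\<^sub>R b)) b) (at t)"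
proof -
  have d: "(\<phi> has_derivative frechet_derivative \<phi> (at (x + t *\<^sub>R b))) (at (x + t *\<^sub>R b))"
    by (rule smooth_on_imp_has_derivative[OF assms])
  have "((\<lambda>t. x + t *\<^sub>R b) has_derivative (\<lambda>s. s *\<^sub>R b)) (at t)" by (auto intro!: derivative_eq_intros)
  from has_derivative_compose[OF this d]
  have "((\<lambda>t. \<phi> (x + t *\<^sub>R b)) has_derivative (\<lambda>s. frechet_derivative \<phi> (at (x + t *\<^sub>R b)) (s *\<^sub>R b))) (at t)" .
  moreover have "frechet_derivative \<phi> (at (x + t *\<^sub>R b)) (s *\<^sub>R b) = frechet_derivative \<phi> (at (x + t *\<^sub>R b)) b * s" for s
    using linear_scale[OF bounded_linear.linear[OF has_derivative_bounded_linear[OF d]], of s b] by (simp add: mult.commute)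
  ultimately show ?thesis unfolding has_field_derivative_def by simp
qed

text \<open>The integral of a difference quotient vanishes by translation invariance; the mean value
  theorem provides the domination for the limit.\<close>
lemma integral_partial_derivative_eq_0:
  fixes \<phi> :: "'a::euclidean_space \<Rightarrow> real"
  assumes sm: "smooth_on \<phi> UNIV" and K: "compact K" "\<And>x. x \<notin> K \<Longrightarrow> \<phi> x = 0" "\<And>x v. x \<notin> K \<Longrightarrow> frechet_derivative \<phi> (at x) v = 0"
    and b: "b \<in> Basis"
  shows "(LINT x|lborel. frechet_derivative \<phi> (at x) b) = 0"
proof -
  note c = smooth_on_imp_continuous[OF sm] continuous_frechet[OF sm, of b]
  have [measurable]: "\<phi> \<in> borel_measurable borel" "(\<lambda>x. frechet_derivative \<phi> (at x) b) \<in> borel_measurable borel"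
    using c by (auto intro: borel_if_continuous)
  obtain C where C: "\<And>x. \<bar>frechet_derivative \<phi> (at x) b\<bar> \<le> C" "C \<ge> 0"
    using bounded_if_compact_support[OF c(2) K(1) K(3)[of _ b]] by metis
  obtain R where R: "\<And>x. x \<in> K \<Longrightarrow> norm x \<le> R" using compact_imp_bounded[OF K(1)] by (auto simp: bounded_iff)
  have i: "integrable lborel \<phi>" by (rule integrable_compact_support[OF c(1) K(1,2)])
  have "(\<lambda>n. LINT x|lborel. diffq b n \<phi> x) \<longlonglongrightarrow> (LINT x|lborel. frechet_derivative \<phi> (at x) b)"
  proof (rule integral_dominated_convergence[where w="\<lambda>x. C * indicator (cball 0 (R + 1)) x"])
    show "integrable lborel (\<lambda>x::'a. C * indicator (cball 0 (R + 1)) x)"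
      using emeasure_lborel_cball_finite[of "0::'a" "R + 1"] by (intro integrable_mult_right integrable_real_indicator) auto
    show "AE x in lborel. (\<lambda>n. diffq b n \<phi> x) \<longlonglongrightarrow> frechet_derivative \<phi> (at x) b"
    proof (rule AE_I2)
      fix x :: 'a
      have "((\<lambda>t. (\<phi> (x + t *\<^sub>R b) - \<phi> x) / t) \<longlongrightarrow> frechet_derivative \<phi> (at x) b) (at 0)"
        using line_derivative[OF sm, of x b 0] by (simp add: DERIV_def)
      moreover have "filterlim stp (at 0) sequentially"
        using tendsto_stp by (auto simp: filterlim_at)
      ultimately show "(\<lambda>n. diffq b n \<phi> x) \<longlonglongrightarrow> frechet_derivative \<phi> (at x) b"
        unfolding diffq_def by (rule filterlim_compose)
    qed
    show "AE x in lborel. norm (diffq b n \<phi> x) \<le> C * indicator (cball 0 (R + 1)) x" for n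
    proof (rule AE_I2)
      fix x :: 'a
      have "\<exists>z. 0 < z \<and> z < stp n \<and> \<phi> (x + stp n *\<^sub>R b) - \<phi> (x + 0 *\<^sub>R b) = (stp n - 0) * frechet_derivative \<phi> (at (x + z *\<^sub>R b)) b"
        by (rule MVT2[where f="\<lambda>t. \<phi> (x + t *\<^sub>R b)"]) (use line_derivative[OF sm] in auto)
      then obtain z where z: "0 < z" "z < stp n" "diffq b n \<phi> x = frechet_derivative \<phi> (at (x + z *\<^sub>R b)) b"
        by (auto simp: diffq_def)
      show "norm (diffq b n \<phi> x) \<le> C * indicator (cball 0 (R + 1)) x"
      proof (cases "x \<in> cball 0 (R + 1)")
        case False
        have "stp n \<le> 1" by (simp add: stp_def)
        then have "norm (z *\<^sub>R b) \<le> 1" using z b by simp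
        then have "norm (x + z *\<^sub>R b) > R" using False norm_triangle_ineq4[of "x + z *\<^sub>R b" "z *\<^sub>R b"] by auto
        then have "x + z *\<^sub>R b \<notin> K" using R by force
        then show ?thesis using z K(3) C(2) by simp
      qed (use z C(1) in simp)
    qed
  qed auto
  moreover have "(LINT x|lborel. diffq b n \<phi> x) = 0" for n
    unfolding diffq_def using i integrable_translate[OF i] integral_translate[of \<phi>] by simp
  ultimately show ?thesis by (simp add: LIMSEQ_const_iff)
qed

definition grad :: "('a::euclidean_space \<Rightarrow> real) \<Rightarrow> 'a \<Rightarrow> 'a" where
  "grad \<phi> x = (\<Sum>b\<in>Basis. frechet_derivative \<phi> (at x) b *\<^sub>R b)"

lemma grad_inner: "b \<in> Basis \<Longrightarrow> grad \<phi> x \<bullet> b = frechet_derivative \<phi> (at x) b"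
  unfolding grad_def by (simp add: inner_sum_left inner_Basis if_distrib cong: if_cong)

lemma continuous_grad: "smooth_on \<phi> UNIV \<Longrightarrow> continuous_on UNIV (grad \<phi>)"
  unfolding grad_def by (intro continuous_intros continuous_frechet)

lemma L1_loc_continuous:
  fixes f :: "'a::euclidean_space \<Rightarrow> 'b::euclidean_space"
  assumes f: "continuous_on UNIV f" shows "f \<in> L1_loc \<Omega>"
  unfolding L1_loc_def set_integrable_def
proof (intro CollectI allI impI)
  fix K :: "'a set" assume K: "compact K \<and> K \<subseteq> \<Omega>"
  have "integrable lborel (\<lambda>x. indicator K x *\<^sub>R f x)"
    by (rule borel_integrable_compact) (use K f continuous_on_subset in auto)
  then show "integrable lebesgue (\<lambda>x. indicator K x *\<^sub>R f x)"
    by (subst integrable_completion) auto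
qed

text \<open>Integration by parts: the partial derivatives of the product of the two test functions have
  integral 0.\<close>
lemma test_weak_gradient:
  fixes \<phi> :: "'a::euclidean_space \<Rightarrow> real"
  assumes \<phi>: "\<phi> \<in> test_functions \<Omega>"
  shows "is_weak_gradient \<Omega> \<phi> (grad \<phi>)"
proof -
  obtain K where K: "compact K" "K \<subseteq> \<Omega>" "smooth_on \<phi> UNIV" "\<And>x. x \<notin> K \<Longrightarrow> \<phi> x = 0"
    "\<And>x v. x \<notin> K \<Longrightarrow> frechet_derivative \<phi> (at x) v = 0" using test_functionsE[OF \<phi>] by metis
  show ?thesis unfolding is_weak_gradient_def
  proof (intro conjI ballI)
    show "\<phi> \<in> L1_loc \<Omega>" "grad \<phi> \<in> L1_loc \<Omega>"
      using K(3) by (auto intro!: L1_loc_continuous smooth_on_imp_continuous continuous_grad)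
    fix \<psi> and i :: 'a assume \<psi>: "\<psi> \<in> test_functions \<Omega>" and i: "i \<in> Basis"
    have sp: "smooth_on \<psi> UNIV" using \<psi> by (simp add: test_functions_def)
    have d: "frechet_derivative (\<lambda>x. \<phi> x * \<psi> x) (at x) v = \<phi> x * frechet_derivative \<psi> (at x) v + frechet_derivative \<phi> (at x) v * \<psi> x" for x v
      using frechet_derivative_at[OF has_derivative_mult[OF smooth_on_imp_has_derivative[OF K(3)] smooth_on_imp_has_derivative[OF sp]], of x]
      by (metis)
    note c = smooth_on_imp_continuous[OF K(3)] smooth_on_imp_continuous[OF sp] continuous_frechet[OF K(3), of i] continuous_frechet[OF sp, of i]
    have i1: "integrable lborel (\<lambda>x. \<phi> x * frechet_derivative \<psi> (at x) i)" and i2: "integrable lborel (\<lambda>x. frechet_derivative \<phi> (at x) i * \<psi> x)"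
      by (rule integrable_compact_support[OF _ K(1)]; use K(4,5) c in \<open>auto intro!: continuous_intros\<close>)+
    have "(LINT x|lborel. frechet_derivative (\<lambda>x. \<phi> x * \<psi> x) (at x) i) = 0"
      by (rule integral_partial_derivative_eq_0[OF smooth_on_mult[OF K(3) sp] K(1) _ _ i]) (auto simp: d K(4,5))
    then have z: "(LINT x|lborel. \<phi> x * frechet_derivative \<psi> (at x) i) = - (LINT x|lborel. frechet_derivative \<phi> (at x) i * \<psi> x)"
      unfolding d using i1 i2 by simp
    have "(LINT x:\<Omega>|lebesgue. \<phi> x * frechet_derivative \<psi> (at x) i) = (LINT x|lborel. \<phi> x * frechet_derivative \<psi> (at x) i)"
      by (subst set_lebesgue_integral_eq_if_support) (use i1 in \<open>auto simp: test_functions_zero[OF \<phi>] integral_completion\<close>)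
    also have "\<dots> = - (LINT x:\<Omega>|lebesgue. (grad \<phi> x \<bullet> i) * \<psi> x)"
      unfolding z grad_inner[OF i]
      by (subst set_lebesgue_integral_eq_if_support) (use i2 in \<open>auto simp: test_functions_zero[OF \<phi>] integral_completion\<close>)
    finally show "(LINT x:\<Omega>|lebesgue. \<phi> x * frechet_derivative \<psi> (at x) i) = - (LINT x:\<Omega>|lebesgue. (grad \<phi> x \<bullet> i) * \<psi> x)" .
  qed
qed

text \<open>The difference quotient is an average of directional derivatives along a segment. Jensen's
  inequality for the square and translation invariance of the integral give the bound.\<close>
lemma diffq_test_le:
  fixes \<phi> :: "'a::euclidean_space \<Rightarrow> real"
  assumes sm: "smooth_on \<phi> UNIV"
  shows "(\<integral>\<^sup>+x. ennreal ((diffq b n \<phi> x)\<^sup>2) \<partial>lborel) \<le> (\<integral>\<^sup>+x. ennreal ((frechet_derivative \<phi> (at x) b)\<^sup>2) \<partial>lborel)"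
proof -
  define h where "h = stp n"
  have h: "h > 0" by (simp add: h_def)
  define D where "D x = frechet_derivative \<phi> (at x) b" for x
  have Dc: "continuous_on UNIV D" unfolding D_def by (rule continuous_frechet[OF sm])
  have [measurable]: "D \<in> borel_measurable borel" by (rule borel_if_continuous[OF Dc])
  have pw: "ennreal ((diffq b n \<phi> x)\<^sup>2) \<le> (\<integral>\<^sup>+t. ennreal (1 / h) * (indicator {0..h} t * ennreal ((D (x + t *\<^sub>R b))\<^sup>2)) \<partial>lborel)" for x
  proof -
    define p where "p t = D (x + t *\<^sub>R b)" for t
    have pc: "continuous_on A p" for A unfolding p_def
      by (rule continuous_on_compose2[OF Dc]) (auto intro!: continuous_intros)
    define d where "d = diffq b n \<phi> x"
    have I1: "(p has_integral (d * h)) {0..h}"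
    proof -
      have "(p has_integral (\<phi> (x + h *\<^sub>R b) - \<phi> (x + 0 *\<^sub>R b))) {0..h}"
        unfolding p_def D_def
        by (rule fundamental_theorem_of_calculus)
           (use h line_derivative[OF sm] in \<open>auto simp: has_real_derivative_iff_has_vector_derivative[symmetric] intro: has_field_derivative_at_within\<close>)
      then show ?thesis using h by (simp add: d_def diffq_def h_def)
    qed
    have I2: "((\<lambda>t. (p t)\<^sup>2) has_integral (integral {0..h} (\<lambda>t. (p t)\<^sup>2))) {0..h}"
      by (intro integrable_integral integrable_continuous_interval continuous_intros pc)
    \<comment> \<open>Jensen's inequality by integrating \<open>(p t - d)\<^sup>2 \<ge> 0\<close>, where \<open>d\<close> is the mean of
        \<open>p\<close>.\<close>
    have "((\<lambda>t. (p t)\<^sup>2 - 2 * d * p t + d\<^sup>2) has_integral (integral {0..h} (\<lambda>t. (p t)\<^sup>2) - 2 * d * (d * h) + h *\<^sub>R d\<^sup>2)) {0..h}"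
      using h by (intro has_integral_add has_integral_diff I2 has_integral_mult_right I1) (use has_integral_const_real[of "d\<^sup>2" 0 h] h in auto)
    then have "0 \<le> integral {0..h} (\<lambda>t. (p t)\<^sup>2) - 2 * d * (d * h) + h *\<^sub>R d\<^sup>2"
    proof (rule has_integral_nonneg)
      fix t
      have "(p t)\<^sup>2 - 2 * d * p t + d\<^sup>2 = (p t - d)\<^sup>2" by (simp add: power2_eq_square algebra_simps)
      then show "0 \<le> (p t)\<^sup>2 - 2 * d * p t + d\<^sup>2" by simp
    qed
    then have "d\<^sup>2 \<le> 1 / h * integral {0..h} (\<lambda>t. (p t)\<^sup>2)" using h by (simp add: field_simps power2_eq_square)
    then have "ennreal (d\<^sup>2) \<le> ennreal (1 / h) * ennreal (integral {0..h} (\<lambda>t. (p t)\<^sup>2))"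
      using h by (simp add: ennreal_mult'[symmetric] ennreal_leI)
    also have "ennreal (integral {0..h} (\<lambda>t. (p t)\<^sup>2)) = (\<integral>\<^sup>+t. indicator {0..h} t * ennreal ((p t)\<^sup>2) \<partial>lborel)"
    proof -
      have si: "set_integrable lborel {0..h} (\<lambda>t. (p t)\<^sup>2)"
        unfolding set_integrable_def by (rule borel_integrable_compact) (auto intro!: continuous_intros pc)
      have "ennreal (integral {0..h} (\<lambda>t. (p t)\<^sup>2)) = ennreal (LINT t|lborel. indicator {0..h} t *\<^sub>R (p t)\<^sup>2)"
        using set_borel_integral_eq_integral(2)[OF si] by (simp add: set_lebesgue_integral_def)
      also have "\<dots> = (\<integral>\<^sup>+t. ennreal (indicator {0..h} t *\<^sub>R (p t)\<^sup>2) \<partial>lborel)"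
        using si by (intro nn_integral_eq_integral[symmetric]) (auto simp: set_integrable_def)
      also have "\<dots> = (\<integral>\<^sup>+t. indicator {0..h} t * ennreal ((p t)\<^sup>2) \<partial>lborel)"
        by (intro nn_integral_cong) (auto simp: indicator_def)
      finally show ?thesis .
    qed
    also have "ennreal (1 / h) * \<dots> = (\<integral>\<^sup>+t. ennreal (1 / h) * (indicator {0..h} t * ennreal ((p t)\<^sup>2)) \<partial>lborel)"
      by (rule nn_integral_cmult[symmetric]) (simp add: p_def)
    finally show ?thesis by (simp add: d_def p_def)
  qed
  have "(\<integral>\<^sup>+x. ennreal ((diffq b n \<phi> x)\<^sup>2) \<partial>lborel)
    \<le> (\<integral>\<^sup>+x. (\<integral>\<^sup>+t. ennreal (1 / h) * (indicator {0..h} t * ennreal ((D (x + t *\<^sub>R b))\<^sup>2)) \<partial>lborel) \<partial>lborel)"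
    by (intro nn_integral_mono pw)
  also have "\<dots> = (\<integral>\<^sup>+t. (\<integral>\<^sup>+x. ennreal (1 / h) * (indicator {0..h} t * ennreal ((D (x + t *\<^sub>R b))\<^sup>2)) \<partial>lborel) \<partial>lborel)"
    by (rule lborel_pair.Fubini') measurable
  also have "\<dots> = (\<integral>\<^sup>+t. (ennreal (1 / h) * (\<integral>\<^sup>+x. ennreal ((D x)\<^sup>2) \<partial>lborel)) * indicator {0..h} t \<partial>lborel)"
  proof (rule nn_integral_cong)
    fix t :: real
    have "(\<integral>\<^sup>+x. ennreal (1 / h) * (indicator {0..h} t * ennreal ((D (x + t *\<^sub>R b))\<^sup>2)) \<partial>lborel)
      = ennreal (1 / h) * (indicator {0..h} t * (\<integral>\<^sup>+x. ennreal ((D (x + t *\<^sub>R b))\<^sup>2) \<partial>lborel))"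
      by (simp add: nn_integral_cmult)
    also have "(\<integral>\<^sup>+x. ennreal ((D (x + t *\<^sub>R b))\<^sup>2) \<partial>lborel) = (\<integral>\<^sup>+x. ennreal ((D x)\<^sup>2) \<partial>lborel)"
      by (rule nn_integral_translate) measurable
    finally show "(\<integral>\<^sup>+x. ennreal (1 / h) * (indicator {0..h} t * ennreal ((D (x + t *\<^sub>R b))\<^sup>2)) \<partial>lborel)
      = (ennreal (1 / h) * (\<integral>\<^sup>+x. ennreal ((D x)\<^sup>2) \<partial>lborel)) * indicator {0..h} t" by (simp add: mult_ac)
  qed
  also have "\<dots> = ennreal (1 / h) * (\<integral>\<^sup>+x. ennreal ((D x)\<^sup>2) \<partial>lborel) * ennreal h"
    using h by (subst nn_integral_cmult_indicator) auto
  also have "\<dots> = (\<integral>\<^sup>+x. ennreal ((D x)\<^sup>2) \<partial>lborel)"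
  proof -
    have "ennreal (1 / h) * ennreal h = 1" using h by (simp add: ennreal_mult'[symmetric])
    then show ?thesis by (metis mult.assoc mult.commute mult.left_neutral)
  qed
  finally show ?thesis by (simp add: D_def)
qed

lemma L1_loc_measurable:
  fixes g :: "'a::euclidean_space \<Rightarrow> 'b::euclidean_space"
  assumes \<Omega>: "open \<Omega>" and g: "g \<in> L1_loc \<Omega>"
  shows "(\<lambda>x. indicator \<Omega> x *\<^sub>R g x) \<in> borel_measurable lebesgue"
proof -
  obtain C where C: "\<And>n. compact (C n)" "\<And>n. C n \<subseteq> \<Omega>" "\<And>n. C n \<subseteq> interior (C (Suc n))" "\<Union>(range C) = \<Omega>"
    using open_Union_compact_subsets[OF \<Omega>] by metis
  have inc: "C m \<subseteq> C n" if "m \<le> n" for m n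
    by (rule lift_Suc_mono_le[OF _ that]) (use C(3) interior_subset in blast)
  show ?thesis
  proof (rule borel_measurable_LIMSEQ_metric)
    show "(\<lambda>x. indicator (C n) x *\<^sub>R g x) \<in> borel_measurable lebesgue" for n
      using g C(1,2)[of n] unfolding L1_loc_def set_integrable_def by (auto intro: borel_measurable_integrable)
    show "(\<lambda>n. indicator (C n) x *\<^sub>R g x) \<longlonglongrightarrow> indicator \<Omega> x *\<^sub>R g x" for x
    proof (rule tendsto_eventually, cases "x \<in> \<Omega>")
      case True
      then obtain m where "x \<in> C m" using C(4) by blast
      then show "eventually (\<lambda>n. indicator (C n) x *\<^sub>R g x = indicator \<Omega> x *\<^sub>R g x) sequentially"
        by (intro eventually_mono[OF eventually_ge_at_top[of m]]) (use inc[of m] True in \<open>auto simp: indicator_def\<close>)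
    next
      case False
      then show "eventually (\<lambda>n. indicator (C n) x *\<^sub>R g x = indicator \<Omega> x *\<^sub>R g x) sequentially"
      proof -
        have "x \<notin> C n" for n using False C(2) by blast
        then show ?thesis using False by (simp add: indicator_def)
      qed
    qed
  qed
qed

lemma norm_sq_eq_sum: "(norm (x::'a::euclidean_space))\<^sup>2 = (\<Sum>b\<in>Basis. (x \<bullet> b)\<^sup>2)"
  by (subst power2_norm_eq_inner, subst euclidean_inner) (simp add: power2_eq_square)

section \<open>Functions in the Sobolev space extended by zero\<close>

text \<open>Membership in \<open>H1\<close> provides some square integrable weak gradient; uniqueness transfers this to
  the chosen one.\<close>
lemma H1D:
  fixes \<Omega> :: "'a::euclidean_space set"
  assumes \<Omega>: "open \<Omega>" and u: "u \<in> H1 \<Omega>"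
  shows "is_weak_gradient \<Omega> u (weak_gradient \<Omega> u)"
    and "set_integrable lebesgue \<Omega> (\<lambda>x. (norm (weak_gradient \<Omega> u x))\<^sup>2)"
    and "set_integrable lebesgue \<Omega> (\<lambda>x. (u x)\<^sup>2)"
    and "(\<lambda>x. indicator \<Omega> x *\<^sub>R u x) \<in> borel_measurable lebesgue"
    and "(\<lambda>x. indicator \<Omega> x *\<^sub>R weak_gradient \<Omega> u x) \<in> borel_measurable lebesgue"
proof -
  obtain g where g: "is_weak_gradient \<Omega> u g" "set_integrable lebesgue \<Omega> (\<lambda>x. (norm (g x))\<^sup>2)"
    using u unfolding H1_def by blast
  note W = weak_gradient_eq[OF \<Omega> g(1)]
  show w: "is_weak_gradient \<Omega> u (weak_gradient \<Omega> u)" by (rule W(2))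
  show "set_integrable lebesgue \<Omega> (\<lambda>x. (u x)\<^sup>2)" using u unfolding H1_def by blast
  show "(\<lambda>x. indicator \<Omega> x *\<^sub>R u x) \<in> borel_measurable lebesgue"
    by (rule L1_loc_measurable[OF \<Omega>]) (use u in \<open>simp add: H1_def\<close>)
  show m: "(\<lambda>x. indicator \<Omega> x *\<^sub>R weak_gradient \<Omega> u x) \<in> borel_measurable lebesgue"
    by (rule L1_loc_measurable[OF \<Omega>]) (use w in \<open>simp add: is_weak_gradient_def\<close>)
  have eq: "(\<lambda>x. indicator \<Omega> x *\<^sub>R (norm (weak_gradient \<Omega> u x))\<^sup>2) = (\<lambda>x. (norm (indicator \<Omega> x *\<^sub>R weak_gradient \<Omega> u x))\<^sup>2)"
    by (auto simp: fun_eq_iff indicator_def)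
  show "set_integrable lebesgue \<Omega> (\<lambda>x. (norm (weak_gradient \<Omega> u x))\<^sup>2)"
    unfolding set_integrable_def
  proof (subst integrable_cong_AE)
    show "(\<lambda>x. indicator \<Omega> x *\<^sub>R (norm (weak_gradient \<Omega> u x))\<^sup>2) \<in> borel_measurable lebesgue"
      unfolding eq by (intro borel_measurable_power measurable_compose[OF _ borel_measurable_norm] m)
    show "(\<lambda>x. indicator \<Omega> x *\<^sub>R (norm (g x))\<^sup>2) \<in> borel_measurable lebesgue"
      using g(2) unfolding set_integrable_def by (rule borel_measurable_integrable)
    show "AE x in lebesgue. indicator \<Omega> x *\<^sub>R (norm (weak_gradient \<Omega> u x))\<^sup>2 = indicator \<Omega> x *\<^sub>R (norm (g x))\<^sup>2"
      using W(1) by eventually_elim (auto simp: indicator_def)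
    show "integrable lebesgue (\<lambda>x. indicator \<Omega> x *\<^sub>R (norm (g x))\<^sup>2)" using g(2) unfolding set_integrable_def .
  qed
qed

lemma set_integrable_norm_sq_combine:
  fixes g h :: "'a::euclidean_space \<Rightarrow> 'b::euclidean_space"
  assumes m: "(\<lambda>x. indicator \<Omega> x *\<^sub>R g x) \<in> borel_measurable lebesgue" "(\<lambda>x. indicator \<Omega> x *\<^sub>R h x) \<in> borel_measurable lebesgue"
    and g: "set_integrable lebesgue \<Omega> (\<lambda>x. (norm (g x))\<^sup>2)" and h: "set_integrable lebesgue \<Omega> (\<lambda>x. (norm (h x))\<^sup>2)"
  shows "set_integrable lebesgue \<Omega> (\<lambda>x. (norm (a *\<^sub>R g x + b *\<^sub>R h x))\<^sup>2)"
  unfolding set_integrable_def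
proof (rule Bochner_Integration.integrable_bound)
  show "integrable lebesgue (\<lambda>x. 2 * a\<^sup>2 * (indicator \<Omega> x *\<^sub>R (norm (g x))\<^sup>2) + 2 * b\<^sup>2 * (indicator \<Omega> x *\<^sub>R (norm (h x))\<^sup>2))"
    using g h unfolding set_integrable_def by (intro Bochner_Integration.integrable_add integrable_mult_right)
  have eq: "(\<lambda>x. indicator \<Omega> x *\<^sub>R (norm (a *\<^sub>R g x + b *\<^sub>R h x))\<^sup>2)
     = (\<lambda>x. (norm (a *\<^sub>R (indicator \<Omega> x *\<^sub>R g x) + b *\<^sub>R (indicator \<Omega> x *\<^sub>R h x)))\<^sup>2)"
    by (auto simp: fun_eq_iff indicator_def)
  show "(\<lambda>x. indicator \<Omega> x *\<^sub>R (norm (a *\<^sub>R g x + b *\<^sub>R h x))\<^sup>2) \<in> borel_measurable lebesgue"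
    unfolding eq by (intro borel_measurable_power measurable_compose[OF _ borel_measurable_norm] borel_measurable_add borel_measurable_scaleR borel_measurable_const m)
  show "AE x in lebesgue. norm (indicator \<Omega> x *\<^sub>R (norm (a *\<^sub>R g x + b *\<^sub>R h x))\<^sup>2)
     \<le> norm (2 * a\<^sup>2 * (indicator \<Omega> x *\<^sub>R (norm (g x))\<^sup>2) + 2 * b\<^sup>2 * (indicator \<Omega> x *\<^sub>R (norm (h x))\<^sup>2))"
  proof (rule AE_I2)
    fix x
    have "norm (a *\<^sub>R g x + b *\<^sub>R h x) \<le> \<bar>a\<bar> * norm (g x) + \<bar>b\<bar> * norm (h x)"
      using norm_triangle_ineq[of "a *\<^sub>R g x" "b *\<^sub>R h x"] by simp
    then have "(norm (a *\<^sub>R g x + b *\<^sub>R h x))\<^sup>2 \<le> (\<bar>a\<bar> * norm (g x) + \<bar>b\<bar> * norm (h x))\<^sup>2"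
      by (rule power_mono) simp
    also have "\<dots> \<le> 2 * (\<bar>a\<bar> * norm (g x))\<^sup>2 + 2 * (\<bar>b\<bar> * norm (h x))\<^sup>2"
      using zero_le_power2[of "\<bar>a\<bar> * norm (g x) - \<bar>b\<bar> * norm (h x)"] by (simp add: power2_eq_square algebra_simps)
    finally have "(norm (a *\<^sub>R g x + b *\<^sub>R h x))\<^sup>2 \<le> 2 * a\<^sup>2 * (norm (g x))\<^sup>2 + 2 * b\<^sup>2 * (norm (h x))\<^sup>2"
      by (simp add: power_mult_distrib)
    then show "norm (indicator \<Omega> x *\<^sub>R (norm (a *\<^sub>R g x + b *\<^sub>R h x))\<^sup>2)
     \<le> norm (2 * a\<^sup>2 * (indicator \<Omega> x *\<^sub>R (norm (g x))\<^sup>2) + 2 * b\<^sup>2 * (indicator \<Omega> x *\<^sub>R (norm (h x))\<^sup>2))"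
      by (cases "x \<in> \<Omega>") auto
  qed
qed

lemma H1_combine:
  fixes \<Omega> :: "'a::euclidean_space set"
  assumes \<Omega>: "open \<Omega>" and u: "u \<in> H1 \<Omega>" and v: "v \<in> H1 \<Omega>"
  shows "(\<lambda>x. a * u x + b * v x) \<in> H1 \<Omega>"
    and "AE x in lebesgue. x \<in> \<Omega> \<longrightarrow> weak_gradient \<Omega> (\<lambda>x. a * u x + b * v x) x = a *\<^sub>R weak_gradient \<Omega> u x + b *\<^sub>R weak_gradient \<Omega> v x"
proof -
  note U = H1D[OF \<Omega> u] and V = H1D[OF \<Omega> v]
  note W = is_weak_gradient_combine[OF U(1) V(1), of a b]
  show "AE x in lebesgue. x \<in> \<Omega> \<longrightarrow> weak_gradient \<Omega> (\<lambda>x. a * u x + b * v x) x = a *\<^sub>R weak_gradient \<Omega> u x + b *\<^sub>R weak_gradient \<Omega> v x"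
    by (rule weak_gradient_eq(1)[OF \<Omega> W])
  have "set_integrable lebesgue \<Omega> (\<lambda>x. (norm (a *\<^sub>R u x + b *\<^sub>R v x))\<^sup>2)"
    by (rule set_integrable_norm_sq_combine[OF U(4) V(4)]) (use U(3) V(3) in simp_all)
  then have "set_integrable lebesgue \<Omega> (\<lambda>x. (a * u x + b * v x)\<^sup>2)" by simp
  then show "(\<lambda>x. a * u x + b * v x) \<in> H1 \<Omega>"
    using W set_integrable_norm_sq_combine[OF U(5) V(5) U(2) V(2), of a b] unfolding H1_def is_weak_gradient_def by blast
qed

lemma set_integrable_compact_support:
  fixes h :: "'a::euclidean_space \<Rightarrow> real"
  assumes "open \<Omega>" "continuous_on UNIV h" "compact K" "\<And>x. x \<notin> K \<Longrightarrow> h x = 0" "K \<subseteq> \<Omega>"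
  shows "set_integrable lebesgue \<Omega> h" "(LINT x:\<Omega>|lebesgue. h x) = (LINT x|lborel. h x)"
proof -
  have eq: "(\<lambda>x. indicator \<Omega> x *\<^sub>R h x) = h" using assms(4,5) by (auto simp: fun_eq_iff indicator_def)
  have i: "integrable lborel h" by (rule integrable_compact_support[OF assms(2-4)])
  show "set_integrable lebesgue \<Omega> h" unfolding set_integrable_def eq using i by (subst integrable_completion) auto
  show "(LINT x:\<Omega>|lebesgue. h x) = (LINT x|lborel. h x)" unfolding set_lebesgue_integral_def eq using i by (subst integral_completion) auto
qed

lemma test_H1:
  fixes \<Omega> :: "'a::euclidean_space set"
  assumes \<Omega>: "open \<Omega>" and \<phi>: "\<phi> \<in> test_functions \<Omega>"
  shows "\<phi> \<in> H1 \<Omega>" "AE x in lebesgue. x \<in> \<Omega> \<longrightarrow> weak_gradient \<Omega> \<phi> x = grad \<phi> x"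
proof -
  obtain K where K: "compact K" "K \<subseteq> \<Omega>" "smooth_on \<phi> UNIV" "\<And>x. x \<notin> K \<Longrightarrow> \<phi> x = 0"
    "\<And>x v. x \<notin> K \<Longrightarrow> frechet_derivative \<phi> (at x) v = 0" using test_functionsE[OF \<phi>] by metis
  note w = test_weak_gradient[OF \<phi>]
  show "AE x in lebesgue. x \<in> \<Omega> \<longrightarrow> weak_gradient \<Omega> \<phi> x = grad \<phi> x" by (rule weak_gradient_eq(1)[OF \<Omega> w])
  have "set_integrable lebesgue \<Omega> (\<lambda>x. (\<phi> x)\<^sup>2)"
    by (rule set_integrable_compact_support(1)[OF \<Omega> _ K(1) _ K(2)]) (use K smooth_on_imp_continuous in \<open>auto intro!: continuous_intros\<close>)
  moreover have gz: "grad \<phi> x = 0" if "x \<notin> K" for x using K(5)[OF that] by (simp add: grad_def)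
  have "set_integrable lebesgue \<Omega> (\<lambda>x. (norm (grad \<phi> x))\<^sup>2)"
    by (rule set_integrable_compact_support(1)[OF \<Omega> _ K(1) _ K(2)])
       (use K continuous_grad[OF K(3)] gz in \<open>auto intro!: continuous_intros\<close>)
  ultimately show "\<phi> \<in> H1 \<Omega>" using w unfolding H1_def is_weak_gradient_def by blast
qed

definition Dir :: "'a::euclidean_space set \<Rightarrow> ('a \<Rightarrow> real) \<Rightarrow> real" where
  "Dir \<Omega> u = (LINT x:\<Omega>|lebesgue. (norm (weak_gradient \<Omega> u x))\<^sup>2)"

definition Mass :: "'a::euclidean_space set \<Rightarrow> ('a \<Rightarrow> real) \<Rightarrow> real" where
  "Mass \<Omega> u = (LINT x:\<Omega>|lebesgue. (u x)\<^sup>2)"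

lemma Dir_nonneg: "0 \<le> Dir \<Omega> u" and Mass_nonneg: "0 \<le> Mass \<Omega> u"
  unfolding Dir_def Mass_def set_lebesgue_integral_def by (auto intro!: integral_nonneg_AE)

lemma H1_quadratic:
  fixes \<Omega> :: "'a::euclidean_space set"
  assumes "open \<Omega>" "u \<in> H1 \<Omega>"
  shows "(LINT x:\<Omega>|lebesgue. (norm (weak_gradient \<Omega> u x))\<^sup>2 + 2 * (u x)\<^sup>2) = Dir \<Omega> u + 2 * Mass \<Omega> u"
  unfolding Dir_def Mass_def using H1D(2,3)[OF assms] by (subst set_integral_add(2)) auto

lemma H_norm_sq:
  fixes \<Omega> :: "'a::euclidean_space set"
  assumes "open \<Omega>" "u \<in> H1 \<Omega>"
  shows "(H_norm \<Omega> u)\<^sup>2 = Dir \<Omega> u + 2 * Mass \<Omega> u"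
  unfolding H_norm_def H1_quadratic[OF assms] using Dir_nonneg[of \<Omega> u] Mass_nonneg[of \<Omega> u] by simp

lemma H_norm_nonneg: "open \<Omega> \<Longrightarrow> u \<in> H1 \<Omega> \<Longrightarrow> 0 \<le> H_norm \<Omega> u"
  unfolding H_norm_def by (simp add: H1_quadratic Dir_nonneg Mass_nonneg)

lemma test_H10:
  fixes \<Omega> :: "'a::euclidean_space set"
  assumes \<Omega>: "open \<Omega>" and \<phi>: "\<phi> \<in> test_functions \<Omega>"
  shows "\<phi> \<in> H10 \<Omega>"
proof -
  have z: "AE x in lebesgue. x \<in> \<Omega> \<longrightarrow> weak_gradient \<Omega> (\<lambda>x. 1 * \<phi> x + (-1) * \<phi> x) x = 1 *\<^sub>R weak_gradient \<Omega> \<phi> x + (-1) *\<^sub>R weak_gradient \<Omega> \<phi> x"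
    by (rule H1_combine(2)[OF \<Omega> test_H1(1)[OF \<Omega> \<phi>] test_H1(1)[OF \<Omega> \<phi>]])
  have h: "(\<lambda>x. 1 * \<phi> x + (-1) * \<phi> x) \<in> H1 \<Omega>" by (rule H1_combine(1)[OF \<Omega> test_H1(1)[OF \<Omega> \<phi>] test_H1(1)[OF \<Omega> \<phi>]])
  have "Dir \<Omega> (\<lambda>x. 1 * \<phi> x + (-1) * \<phi> x) = 0"
    unfolding Dir_def set_lebesgue_integral_def
    by (rule integral_eq_zero_AE) (use z in eventually_elim, auto simp: indicator_def)
  moreover have "Mass \<Omega> (\<lambda>x. 1 * \<phi> x + (-1) * \<phi> x) = 0" by (simp add: Mass_def)
  ultimately have "(H_norm \<Omega> (\<lambda>x. 1 * \<phi> x + (-1) * \<phi> x))\<^sup>2 = 0" using H_norm_sq[OF \<Omega> h] by simp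
  then have "H_norm \<Omega> (\<lambda>x. \<phi> x - \<phi> x) = 0" by simp
  then show ?thesis unfolding H10_def using test_H1[OF \<Omega> \<phi>] \<phi> by (auto intro!: bexI[of _ \<phi>])
qed

text \<open>A crude bound, useful because for a fixed step size it tends to 0 with the \<open>L\<^sup>2\<close> norm.\<close>
lemma nn_integral_diffq_le:
  fixes v :: "'a::euclidean_space \<Rightarrow> real"
  assumes [measurable]: "v \<in> borel_measurable borel"
  shows "(\<integral>\<^sup>+x. ennreal ((diffq b n v x)\<^sup>2) \<partial>lborel) \<le> ennreal (4 / (stp n)\<^sup>2) * (\<integral>\<^sup>+x. ennreal ((v x)\<^sup>2) \<partial>lborel)"
proof -
  let ?c = "2 / (stp n)\<^sup>2"
  have "(diffq b n v x)\<^sup>2 \<le> ?c * (v (x + stp n *\<^sub>R b))\<^sup>2 + ?c * (v x)\<^sup>2" for x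
  proof -
    have "(v (x + stp n *\<^sub>R b) - v x)\<^sup>2 \<le> 2 * (v (x + stp n *\<^sub>R b))\<^sup>2 + 2 * (v x)\<^sup>2"
      using zero_le_power2[of "v (x + stp n *\<^sub>R b) + v x"] by (simp add: power2_eq_square algebra_simps)
    then have "(v (x + stp n *\<^sub>R b) - v x)\<^sup>2 / (stp n)\<^sup>2 \<le> (2 * (v (x + stp n *\<^sub>R b))\<^sup>2 + 2 * (v x)\<^sup>2) / (stp n)\<^sup>2"
      by (rule divide_right_mono) simp
    then show ?thesis by (simp add: diffq_def power_divide add_divide_distrib)
  qed
  then have "(\<integral>\<^sup>+x. ennreal ((diffq b n v x)\<^sup>2) \<partial>lborel)
     \<le> (\<integral>\<^sup>+x. ennreal ?c * ennreal ((v (x + stp n *\<^sub>R b))\<^sup>2) + ennreal ?c * ennreal ((v x)\<^sup>2) \<partial>lborel)"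
    by (intro nn_integral_mono) (auto simp: ennreal_mult'[symmetric] ennreal_plus[symmetric] simp del: ennreal_plus intro!: ennreal_leI)
  also have "\<dots> = ennreal ?c * (\<integral>\<^sup>+x. ennreal ((v (x + stp n *\<^sub>R b))\<^sup>2) \<partial>lborel) + ennreal ?c * (\<integral>\<^sup>+x. ennreal ((v x)\<^sup>2) \<partial>lborel)"
    by (subst nn_integral_add) (auto simp: nn_integral_cmult)
  also have "(\<integral>\<^sup>+x. ennreal ((v (x + stp n *\<^sub>R b))\<^sup>2) \<partial>lborel) = (\<integral>\<^sup>+x. ennreal ((v x)\<^sup>2) \<partial>lborel)"
    by (rule nn_integral_translate[of "\<lambda>x. ennreal ((v x)\<^sup>2)"]) measurable
  also have "ennreal ?c * (\<integral>\<^sup>+x. ennreal ((v x)\<^sup>2) \<partial>lborel) + ennreal ?c * (\<integral>\<^sup>+x. ennreal ((v x)\<^sup>2) \<partial>lborel)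
     = ennreal (4 / (stp n)\<^sup>2) * (\<integral>\<^sup>+x. ennreal ((v x)\<^sup>2) \<partial>lborel)"
    by (simp add: distrib_right[symmetric] ennreal_plus[symmetric] del: ennreal_plus)
  finally show ?thesis .
qed

lemma H1_component_integrable:
  fixes \<Omega> :: "'a::euclidean_space set"
  assumes "open \<Omega>" "u \<in> H1 \<Omega>" "b \<in> Basis"
  shows "set_integrable lebesgue \<Omega> (\<lambda>x. (weak_gradient \<Omega> u x \<bullet> b)\<^sup>2)"
  unfolding set_integrable_def
proof (rule Bochner_Integration.integrable_bound)
  show "integrable lebesgue (\<lambda>x. indicator \<Omega> x *\<^sub>R (norm (weak_gradient \<Omega> u x))\<^sup>2)"
    using H1D(2)[OF assms(1,2)] unfolding set_integrable_def .
  have eq: "(\<lambda>x. indicator \<Omega> x *\<^sub>R (weak_gradient \<Omega> u x \<bullet> b)\<^sup>2) = (\<lambda>x. ((indicator \<Omega> x *\<^sub>R weak_gradient \<Omega> u x) \<bullet> b)\<^sup>2)"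
    by (auto simp: fun_eq_iff indicator_def)
  show "(\<lambda>x. indicator \<Omega> x *\<^sub>R (weak_gradient \<Omega> u x \<bullet> b)\<^sup>2) \<in> borel_measurable lebesgue"
    unfolding eq by (intro borel_measurable_power borel_measurable_inner borel_measurable_const H1D(5)[OF assms(1,2)])
  show "AE x in lebesgue. norm (indicator \<Omega> x *\<^sub>R (weak_gradient \<Omega> u x \<bullet> b)\<^sup>2) \<le> norm (indicator \<Omega> x *\<^sub>R (norm (weak_gradient \<Omega> u x))\<^sup>2)"
    using Basis_le_norm[OF assms(3)] by (intro AE_I2) (auto simp: indicator_def abs_le_square_iff[symmetric])
qed

lemma sum_components_eq_Dir:
  fixes \<Omega> :: "'a::euclidean_space set"
  assumes "open \<Omega>" "u \<in> H1 \<Omega>"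
  shows "(\<Sum>b\<in>Basis. LINT x:\<Omega>|lebesgue. (weak_gradient \<Omega> u x \<bullet> b)\<^sup>2) = Dir \<Omega> u"
proof -
  have "Dir \<Omega> u = (LINT x|lebesgue. (\<Sum>b\<in>Basis. indicator \<Omega> x *\<^sub>R (weak_gradient \<Omega> u x \<bullet> b)\<^sup>2))"
    unfolding Dir_def set_lebesgue_integral_def by (simp add: norm_sq_eq_sum sum_distrib_left)
  also have "\<dots> = (\<Sum>b\<in>Basis. LINT x:\<Omega>|lebesgue. (weak_gradient \<Omega> u x \<bullet> b)\<^sup>2)"
    unfolding set_lebesgue_integral_def
    by (rule Bochner_Integration.integral_sum) (use H1_component_integrable[OF assms] in \<open>auto simp: set_integrable_def\<close>)
  finally show ?thesis by simp
qed

lemma component_le_Dir: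
  fixes \<Omega> :: "'a::euclidean_space set"
  assumes "open \<Omega>" "u \<in> H1 \<Omega>" "b \<in> Basis"
  shows "(LINT x:\<Omega>|lebesgue. (weak_gradient \<Omega> u x \<bullet> b)\<^sup>2) \<le> Dir \<Omega> u"
  unfolding sum_components_eq_Dir[OF assms(1,2), symmetric]
  by (rule member_le_sum) (use assms(3) in \<open>auto simp: set_lebesgue_integral_def intro!: integral_nonneg_AE\<close>)

text \<open>The extension \<open>w\<close> of \<open>u\<close> by zero is compared with a test function \<open>\<phi>\<close>. The difference quotient
  of \<open>\<phi>\<close> is controlled by its gradient, that of the rest only by the crude bound, which for a
  fixed step size is small with the distance \<open>\<sigma>\<close>.\<close>
lemma H10_diffq_approx:
  fixes \<Omega> :: "'a::euclidean_space set"
  assumes \<Omega>: "open \<Omega>" and u: "u \<in> H1 \<Omega>" and \<phi>: "\<phi> \<in> test_functions \<Omega>" and near: "H_norm \<Omega> (\<lambda>x. u x - \<phi> x) < \<sigma>" and s: "s > 0"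
    and w[measurable]: "w \<in> borel_measurable borel" and wu: "AE x in lebesgue. w x = indicator \<Omega> x * u x" and b: "b \<in> Basis"
  defines "E \<equiv> LINT x:\<Omega>|lebesgue. (weak_gradient \<Omega> u x \<bullet> b)\<^sup>2"
  shows "(\<integral>\<^sup>+x. ennreal ((diffq b n w x)\<^sup>2) \<partial>lborel)
    \<le> ennreal ((1 + s) * ((1 + s) * E + (1 + 1 / s) * \<sigma>\<^sup>2) + (1 + 1 / s) * (4 / (stp n)\<^sup>2 * \<sigma>\<^sup>2))"
proof -
  define v where "v = (\<lambda>x. u x - \<phi> x)"
  have t: "\<phi> \<in> H1 \<Omega>" by (rule test_H1(1)[OF \<Omega> \<phi>])
  have v: "v \<in> H1 \<Omega>" and gv: "AE x in lebesgue. x \<in> \<Omega> \<longrightarrow> weak_gradient \<Omega> v x = weak_gradient \<Omega> u x - weak_gradient \<Omega> \<phi> x"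
    using H1_combine[OF \<Omega> u t, of 1 "-1"] by (simp_all add: v_def)
  have "(H_norm \<Omega> v)\<^sup>2 \<le> \<sigma>\<^sup>2" using near H_norm_nonneg[OF \<Omega> v] by (intro power_mono) (auto simp: v_def)
  then have Dv: "Dir \<Omega> v \<le> \<sigma>\<^sup>2" and Mv: "Mass \<Omega> v \<le> \<sigma>\<^sup>2"
    using H_norm_sq[OF \<Omega> v] Dir_nonneg[of \<Omega> v] Mass_nonneg[of \<Omega> v] by auto
  have sp: "smooth_on \<phi> UNIV" using \<phi> by (simp add: test_functions_def)
  have [measurable]: "\<phi> \<in> borel_measurable borel" "(\<lambda>x. frechet_derivative \<phi> (at x) b) \<in> borel_measurable borel"
    by (auto intro: borel_if_continuous smooth_on_imp_continuous[OF sp] continuous_frechet[OF sp])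
  let ?z = "\<lambda>x. w x - \<phi> x"
  have E0: "0 \<le> E" unfolding E_def set_lebesgue_integral_def by (intro integral_nonneg_AE AE_I2) simp
  have "(\<integral>\<^sup>+x. ennreal ((?z x)\<^sup>2) \<partial>lborel) = (\<integral>\<^sup>+x. ennreal ((?z x)\<^sup>2) \<partial>lebesgue)" by (simp add: nn_integral_completion)
  also have "\<dots> = (\<integral>\<^sup>+x. ennreal (indicator \<Omega> x *\<^sub>R (v x)\<^sup>2) \<partial>lebesgue)"
    by (rule nn_integral_cong_AE) (use wu in eventually_elim, auto simp: v_def indicator_def test_functions_zero[OF \<phi>])
  also have "\<dots> = ennreal (Mass \<Omega> v)"
    unfolding Mass_def set_lebesgue_integral_def
    by (rule nn_integral_eq_integral) (use H1D(3)[OF \<Omega> v] in \<open>auto simp: set_integrable_def\<close>)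
  \<comment> \<open>Off the domain both \<open>w\<close> and \<open>\<phi>\<close> vanish, so no mass is lost.\<close>
  finally have zm: "(\<integral>\<^sup>+x. ennreal ((?z x)\<^sup>2) \<partial>lborel) \<le> ennreal (\<sigma>\<^sup>2)" using Mv by (simp add: ennreal_leI)
  have iE: "integrable lebesgue (\<lambda>x. indicator \<Omega> x *\<^sub>R (weak_gradient \<Omega> u x \<bullet> b)\<^sup>2)"
    and iv: "integrable lebesgue (\<lambda>x. indicator \<Omega> x *\<^sub>R (weak_gradient \<Omega> v x \<bullet> b)\<^sup>2)"
    using H1_component_integrable[OF \<Omega> _ b] u v by (auto simp: set_integrable_def)
  have "(\<integral>\<^sup>+x. ennreal ((frechet_derivative \<phi> (at x) b)\<^sup>2) \<partial>lborel) = (\<integral>\<^sup>+x. ennreal ((frechet_derivative \<phi> (at x) b)\<^sup>2) \<partial>lebesgue)"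
    by (simp add: nn_integral_completion)
  also have "\<dots> \<le> (\<integral>\<^sup>+x. ennreal ((1 + s) * (indicator \<Omega> x *\<^sub>R (weak_gradient \<Omega> u x \<bullet> b)\<^sup>2) + (1 + 1 / s) * (indicator \<Omega> x *\<^sub>R (weak_gradient \<Omega> v x \<bullet> b)\<^sup>2)) \<partial>lebesgue)"
  proof (rule nn_integral_mono_AE)
    show "AE x in lebesgue. ennreal ((frechet_derivative \<phi> (at x) b)\<^sup>2)
      \<le> ennreal ((1 + s) * (indicator \<Omega> x *\<^sub>R (weak_gradient \<Omega> u x \<bullet> b)\<^sup>2) + (1 + 1 / s) * (indicator \<Omega> x *\<^sub>R (weak_gradient \<Omega> v x \<bullet> b)\<^sup>2))"
      using gv test_H1(2)[OF \<Omega> \<phi>]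
    proof eventually_elim
      case (elim x)
      show ?case
      proof (cases "x \<in> \<Omega>")
        case True
        then have "frechet_derivative \<phi> (at x) b = (weak_gradient \<Omega> u x \<bullet> b) + - (weak_gradient \<Omega> v x \<bullet> b)"
          using elim grad_inner[OF b, of \<phi> x] by (simp add: inner_diff_left)
        then show ?thesis using young_sq[OF s, of "weak_gradient \<Omega> u x \<bullet> b" "- (weak_gradient \<Omega> v x \<bullet> b)"] True
          by (intro ennreal_leI) simp
      qed (simp add: test_functions_zero[OF \<phi>])
    qed
  qed
  also have "\<dots> = ennreal ((1 + s) * E + (1 + 1 / s) * (LINT x:\<Omega>|lebesgue. (weak_gradient \<Omega> v x \<bullet> b)\<^sup>2))"
    unfolding E_def set_lebesgue_integral_def using iE iv s
    by (subst nn_integral_eq_integral) auto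
  also have "\<dots> \<le> ennreal ((1 + s) * E + (1 + 1 / s) * \<sigma>\<^sup>2)"
    using component_le_Dir[OF \<Omega> v b] Dv s by (intro ennreal_leI add_left_mono mult_left_mono) auto
  \<comment> \<open>The gradient of \<open>\<phi>\<close> is close to that of \<open>u\<close>.\<close>
  finally have pm: "(\<integral>\<^sup>+x. ennreal ((frechet_derivative \<phi> (at x) b)\<^sup>2) \<partial>lborel) \<le> ennreal ((1 + s) * E + (1 + 1 / s) * \<sigma>\<^sup>2)" .
  have "(diffq b n w x)\<^sup>2 \<le> (1 + s) * (diffq b n \<phi> x)\<^sup>2 + (1 + 1 / s) * (diffq b n ?z x)\<^sup>2" for x
    using young_sq[OF s, of "diffq b n \<phi> x" "diffq b n ?z x"] by (simp add: diffq_def add_divide_distrib[symmetric])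
  then have "(\<integral>\<^sup>+x. ennreal ((diffq b n w x)\<^sup>2) \<partial>lborel)
     \<le> (\<integral>\<^sup>+x. ennreal (1 + s) * ennreal ((diffq b n \<phi> x)\<^sup>2) + ennreal (1 + 1 / s) * ennreal ((diffq b n ?z x)\<^sup>2) \<partial>lborel)"
    using s by (intro nn_integral_mono) (auto simp: ennreal_mult'[symmetric] ennreal_plus[symmetric] simp del: ennreal_plus intro!: ennreal_leI)
  also have "\<dots> = ennreal (1 + s) * (\<integral>\<^sup>+x. ennreal ((diffq b n \<phi> x)\<^sup>2) \<partial>lborel) + ennreal (1 + 1 / s) * (\<integral>\<^sup>+x. ennreal ((diffq b n ?z x)\<^sup>2) \<partial>lborel)"
    by (subst nn_integral_add) (auto simp: nn_integral_cmult)
  also have "\<dots> \<le> ennreal (1 + s) * ennreal ((1 + s) * E + (1 + 1 / s) * \<sigma>\<^sup>2) + ennreal (1 + 1 / s) * (ennreal (4 / (stp n)\<^sup>2) * ennreal (\<sigma>\<^sup>2))"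
    by (intro add_mono mult_left_mono order_trans[OF diffq_test_le[OF sp] pm] order_trans[OF nn_integral_diffq_le mult_left_mono[OF zm]]) auto
  also have "\<dots> = ennreal ((1 + s) * ((1 + s) * E + (1 + 1 / s) * \<sigma>\<^sup>2) + (1 + 1 / s) * (4 / (stp n)\<^sup>2 * \<sigma>\<^sup>2))"
    using s E0 by (simp add: ennreal_mult'[symmetric] ennreal_plus[symmetric] del: ennreal_plus)
  finally show ?thesis .
qed

text \<open>The extension of \<open>\<bar>u\<bar>\<close> by zero is a function on the whole space whose difference quotients are
  bounded by the weak gradient of \<open>u\<close> on the domain. For a fixed step, first the distance \<open>\<sigma>\<close> of
  the approximating test function and then the parameter in Young's inequality tend to 0.\<close>
lemma H10_extension:
  fixes \<Omega> :: "'a::euclidean_space set"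
  assumes \<Omega>: "open \<Omega>" and u: "u \<in> H10 \<Omega>"
  obtains f where "f \<in> borel_measurable borel" "\<And>x. 0 \<le> f x" "\<And>x. x \<notin> \<Omega> \<Longrightarrow> f x = 0"
    "AE x in lebesgue. x \<in> \<Omega> \<longrightarrow> f x = \<bar>u x\<bar>"
    "\<And>b n. b \<in> Basis \<Longrightarrow> (\<integral>\<^sup>+x. ennreal ((diffq b n f x)\<^sup>2) \<partial>lborel) \<le> ennreal (LINT x:\<Omega>|lebesgue. (weak_gradient \<Omega> u x \<bullet> b)\<^sup>2)"
proof -
  have uH: "u \<in> H1 \<Omega>" using u by (simp add: H10_def)
  obtain w0 where w0: "w0 \<in> borel_measurable lborel" "AE x in lborel. indicator \<Omega> x *\<^sub>R u x = w0 x"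
    using completion_ex_borel_measurable_real[OF H1D(4)[OF \<Omega> uH]] by blast
  define w where "w x = indicator \<Omega> x * w0 x" for x
  have [measurable]: "\<Omega> \<in> sets borel" using \<Omega> by simp
  have w[measurable]: "w \<in> borel_measurable borel" unfolding w_def using w0(1) by simp
  have wu: "AE x in lebesgue. w x = indicator \<Omega> x * u x"
    unfolding AE_completion_iff using w0(2) by eventually_elim (auto simp: w_def indicator_def split: if_splits)
  show ?thesis
  proof (rule that[of "\<lambda>x. \<bar>w x\<bar>"])
    show "(\<lambda>x. \<bar>w x\<bar>) \<in> borel_measurable borel" by measurable
    show "\<bar>w x\<bar> = 0" if "x \<notin> \<Omega>" for x using that by (simp add: w_def)
    show "AE x in lebesgue. x \<in> \<Omega> \<longrightarrow> \<bar>w x\<bar> = \<bar>u x\<bar>" using wu by eventually_elim auto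
    fix b :: 'a and n assume b: "b \<in> Basis"
    define E where "E = (LINT x:\<Omega>|lebesgue. (weak_gradient \<Omega> u x \<bullet> b)\<^sup>2)"
    let ?L = "\<integral>\<^sup>+x. ennreal ((diffq b n w x)\<^sup>2) \<partial>lborel"
    have "?L \<le> ennreal ((1 + stp j) * ((1 + stp j) * E))" for j
    proof (rule LIMSEQ_le_const)
      let ?s = "stp j"
      have "(\<lambda>k. ennreal ((1 + ?s) * ((1 + ?s) * E + (1 + 1 / ?s) * (stp k)\<^sup>2) + (1 + 1 / ?s) * (4 / (stp n)\<^sup>2 * (stp k)\<^sup>2)))
        \<longlonglongrightarrow> ennreal ((1 + ?s) * ((1 + ?s) * E + (1 + 1 / ?s) * 0\<^sup>2) + (1 + 1 / ?s) * (4 / (stp n)\<^sup>2 * 0\<^sup>2))"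
        by (intro tendsto_ennrealI tendsto_intros tendsto_stp)
      then show "(\<lambda>k. ennreal ((1 + ?s) * ((1 + ?s) * E + (1 + 1 / ?s) * (stp k)\<^sup>2) + (1 + 1 / ?s) * (4 / (stp n)\<^sup>2 * (stp k)\<^sup>2)))
        \<longlonglongrightarrow> ennreal ((1 + ?s) * ((1 + ?s) * E))" by simp
      have "?L \<le> ennreal ((1 + ?s) * ((1 + ?s) * E + (1 + 1 / ?s) * (stp k)\<^sup>2) + (1 + 1 / ?s) * (4 / (stp n)\<^sup>2 * (stp k)\<^sup>2))" for k
      proof -
        obtain \<phi> where "\<phi> \<in> test_functions \<Omega>" "H_norm \<Omega> (\<lambda>x. u x - \<phi> x) < stp k"
          using u stp_pos(1)[of k] unfolding H10_def by blast
        then show ?thesis unfolding E_def by (intro H10_diffq_approx[OF \<Omega> uH _ _ _ w wu b]) auto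
      qed
      then show "\<exists>N. \<forall>k\<ge>N. ?L \<le> ennreal ((1 + ?s) * ((1 + ?s) * E + (1 + 1 / ?s) * (stp k)\<^sup>2) + (1 + 1 / ?s) * (4 / (stp n)\<^sup>2 * (stp k)\<^sup>2))" by blast
    qed
    moreover have "(\<lambda>j. ennreal ((1 + stp j) * ((1 + stp j) * E))) \<longlonglongrightarrow> ennreal ((1 + 0) * ((1 + 0) * E))"
      by (intro tendsto_ennrealI tendsto_intros tendsto_stp)
    ultimately have "?L \<le> ennreal E" using LIMSEQ_le_const[of _ "ennreal E" ?L] by auto
    moreover have "(diffq b n (\<lambda>x. \<bar>w x\<bar>) x)\<^sup>2 \<le> (diffq b n w x)\<^sup>2" for x
    proof -
      have "\<bar>\<bar>w (x + stp n *\<^sub>R b)\<bar> - \<bar>w x\<bar>\<bar> \<le> \<bar>w (x + stp n *\<^sub>R b) - w x\<bar>" by linarith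
      then have "\<bar>diffq b n (\<lambda>x. \<bar>w x\<bar>) x\<bar> \<le> \<bar>diffq b n w x\<bar>" by (simp add: diffq_def divide_right_mono)
      then show ?thesis by (simp add: abs_le_square_iff)
    qed
    then have "(\<integral>\<^sup>+x. ennreal ((diffq b n (\<lambda>x. \<bar>w x\<bar>) x)\<^sup>2) \<partial>lborel) \<le> ?L"
      by (intro nn_integral_mono ennreal_leI)
    ultimately show "(\<integral>\<^sup>+x. ennreal ((diffq b n (\<lambda>x. \<bar>w x\<bar>) x)\<^sup>2) \<partial>lborel) \<le> ennreal (LINT x:\<Omega>|lebesgue. (weak_gradient \<Omega> u x \<bullet> b)\<^sup>2)"
      unfolding E_def by (rule order_trans[rotated])
  qed simp
qed

lemma extension_integral:
  fixes \<Omega> :: "'a::euclidean_space set" and F :: "real \<Rightarrow> real"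
  assumes f[measurable]: "f \<in> borel_measurable borel" and z: "\<And>x. x \<notin> \<Omega> \<Longrightarrow> f x = 0" and ae: "AE x in lebesgue. x \<in> \<Omega> \<longrightarrow> f x = \<bar>u x\<bar>"
    and F[measurable]: "F \<in> borel_measurable borel" and F0: "F 0 = 0" and Fa: "\<And>s. F \<bar>s\<bar> = F s"
    and um: "(\<lambda>x. indicator \<Omega> x *\<^sub>R u x) \<in> borel_measurable lebesgue"
  shows "(LINT x|lborel. F (f x)) = (LINT x:\<Omega>|lebesgue. F (u x))"
    and "integrable lborel (\<lambda>x. F (f x)) \<longleftrightarrow> set_integrable lebesgue \<Omega> (\<lambda>x. F (u x))"
proof -
  have [measurable]: "F \<in> borel_measurable borel" by fact
  have m1: "(\<lambda>x. F (f x)) \<in> borel_measurable lebesgue" by (intro measurable_lebesgueI) measurable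
  have eq: "(\<lambda>x. indicator \<Omega> x *\<^sub>R F (u x)) = (\<lambda>x. F (indicator \<Omega> x *\<^sub>R u x))"
    by (auto simp: fun_eq_iff indicator_def F0)
  have m2: "(\<lambda>x. indicator \<Omega> x *\<^sub>R F (u x)) \<in> borel_measurable lebesgue"
    unfolding eq using measurable_compose[OF um F] .
  have ae': "AE x in lebesgue. F (f x) = indicator \<Omega> x *\<^sub>R F (u x)"
    using ae
  proof eventually_elim
    case (elim x) then show ?case using z[of x] F0 Fa[of "u x"] by (cases "x \<in> \<Omega>") auto
  qed
  have "(LINT x|lborel. F (f x)) = (LINT x|lebesgue. F (f x))" by (simp add: integral_completion)
  also have "\<dots> = (LINT x:\<Omega>|lebesgue. F (u x))"
    unfolding set_lebesgue_integral_def by (rule integral_cong_AE[OF m1 m2 ae'])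
  finally show "(LINT x|lborel. F (f x)) = (LINT x:\<Omega>|lebesgue. F (u x))" .
  have "integrable lborel (\<lambda>x. F (f x)) \<longleftrightarrow> integrable lebesgue (\<lambda>x. F (f x))" by (simp add: integrable_completion)
  also have "\<dots> \<longleftrightarrow> set_integrable lebesgue \<Omega> (\<lambda>x. F (u x))"
    unfolding set_integrable_def by (rule integrable_cong_AE[OF m1 m2 ae'])
  finally show "integrable lborel (\<lambda>x. F (f x)) \<longleftrightarrow> set_integrable lebesgue \<Omega> (\<lambda>x. F (u x))" .
qed

text \<open>The logarithmic Sobolev inequality for the extension by zero, with the strict version for a
  domain that misses a ball and contains a neighbourhood of infinity.\<close>
theorem H10_log_sobolev:
  fixes \<Omega> :: "'a::euclidean_space set"
  assumes \<Omega>: "open \<Omega>" and u: "u \<in> H10 \<Omega>" and neg: "set_integrable lebesgue \<Omega> (\<lambda>x. max 0 (- ent (u x)))"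
  shows "set_integrable lebesgue \<Omega> (\<lambda>x. ent (u x))"
    and "(LINT x:\<Omega>|lebesgue. ent (u x)) + (1 + ln pi / 2) * DIM('a) * Mass \<Omega> u \<le> Dir \<Omega> u + Mass \<Omega> u * ln (Mass \<Omega> u)"
    and "r > 0 \<Longrightarrow> ball p r \<inter> \<Omega> = {} \<Longrightarrow> bounded (- \<Omega>) \<Longrightarrow> positive_on \<Omega> u \<Longrightarrow>
      (LINT x:\<Omega>|lebesgue. ent (u x)) + (1 + ln pi / 2) * DIM('a) * Mass \<Omega> u < Dir \<Omega> u + Mass \<Omega> u * ln (Mass \<Omega> u)"
proof -
  have uH: "u \<in> H1 \<Omega>" using u by (simp add: H10_def)
  obtain f where f: "f \<in> borel_measurable borel" "\<And>x. 0 \<le> f x" "\<And>x. x \<notin> \<Omega> \<Longrightarrow> f x = 0"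
    "AE x in lebesgue. x \<in> \<Omega> \<longrightarrow> f x = \<bar>u x\<bar>"
    and fE: "\<And>b n. b \<in> Basis \<Longrightarrow> (\<integral>\<^sup>+x. ennreal ((diffq b n f x)\<^sup>2) \<partial>lborel) \<le> ennreal (LINT x:\<Omega>|lebesgue. (weak_gradient \<Omega> u x \<bullet> b)\<^sup>2)"
    using H10_extension[OF \<Omega> u] by blast
  note ext = extension_integral[OF f(1,3,4) _ _ _ H1D(4)[OF \<Omega> uH]]
  have E0: "0 \<le> (LINT x:\<Omega>|lebesgue. (weak_gradient \<Omega> u x \<bullet> b)\<^sup>2)" for b
    unfolding set_lebesgue_integral_def by (intro integral_nonneg_AE AE_I2) simp
  have ea: "ent \<bar>s\<bar> = ent s" for s by (simp add: ent_def)
  have sq: "(LINT x|lborel. (f x)\<^sup>2) = Mass \<Omega> u" "integrable lborel (\<lambda>x. (f x)\<^sup>2)"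
    using ext[of "\<lambda>s. s\<^sup>2"] H1D(3)[OF \<Omega> uH] by (simp_all add: Mass_def)
  have en: "(LINT x|lborel. ent (f x)) = (LINT x:\<Omega>|lebesgue. ent (u x))"
    "integrable lborel (\<lambda>x. ent (f x)) \<longleftrightarrow> set_integrable lebesgue \<Omega> (\<lambda>x. ent (u x))"
    using ext[of ent] by (simp_all add: ea)
  have ng: "integrable lborel (\<lambda>x. max 0 (- ent (f x)))"
    using ext(2)[of "\<lambda>s. max 0 (- ent s)"] neg by (simp add: ea)
  note LS = log_sobolev[OF f(1,2) sq(2) ng fE E0]
  show "set_integrable lebesgue \<Omega> (\<lambda>x. ent (u x))" using LS(1) en by simp
  show "(LINT x:\<Omega>|lebesgue. ent (u x)) + (1 + ln pi / 2) * DIM('a) * Mass \<Omega> u \<le> Dir \<Omega> u + Mass \<Omega> u * ln (Mass \<Omega> u)"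
    using LS(2) en sq sum_components_eq_Dir[OF \<Omega> uH] by simp
  assume r: "r > 0" and B: "ball p r \<inter> \<Omega> = {}" and bd: "bounded (- \<Omega>)" and pos: "positive_on \<Omega> u"
  obtain s where s: "\<And>x. x \<in> - \<Omega> \<Longrightarrow> norm x \<le> s" using bd by (auto simp: bounded_iff)
  have gap: "f x = 0" if "norm (x - p) < r" for x
  proof (rule f(3))
    have "x \<in> ball p r" using that by (simp add: dist_norm norm_minus_commute)
    then show "x \<notin> \<Omega>" using B by blast
  qed
  have ps: "AE x in lborel. norm (x - p) > s + norm p \<longrightarrow> f x > 0"
  proof -
    have "AE x in lebesgue. norm (x - p) > s + norm p \<longrightarrow> f x > 0"
      using pos[unfolded positive_on_def] f(4)
    proof eventually_elim
      case (elim x)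
      show ?case
      proof
        assume "norm (x - p) > s + norm p"
        then have "norm x > s" using norm_triangle_ineq4[of x p] by linarith
        then have "x \<in> \<Omega>" using s by force
        then show "f x > 0" using elim by simp
      qed
    qed
    then show ?thesis by (simp add: AE_completion_iff)
  qed
  show "(LINT x:\<Omega>|lebesgue. ent (u x)) + (1 + ln pi / 2) * DIM('a) * Mass \<Omega> u < Dir \<Omega> u + Mass \<Omega> u * ln (Mass \<Omega> u)"
    using log_sobolev_strict[OF f(1,2) sq(2) ng fE E0 r gap ps] en sq sum_components_eq_Dir[OF \<Omega> uH] by simp
qed

section \<open>The energy as an entropy functional and the Orlicz space\<close>

text \<open>Comparable with \<open>F1 \<delta>\<close> up to constants (see \<open>F1_bounds\<close>), but of a simpler form and
  independent of \<open>\<delta>\<close>.\<close>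
definition Psi :: "real \<Rightarrow> real" where
  "Psi s = s\<^sup>2 * (1 + max 0 (- ln \<bar>s\<bar>))"

lemma Psi_0 [simp]: "Psi 0 = 0" and Psi_abs [simp]: "Psi \<bar>s\<bar> = Psi s" and Psi_nonneg: "0 \<le> Psi s"
  by (simp_all add: Psi_def)

lemma borel_measurable_Psi [measurable]: "Psi \<in> borel_measurable borel"
  unfolding Psi_def by measurable

lemma borel_measurable_F1 [measurable]: "F1 \<delta> \<in> borel_measurable borel"
  unfolding F1_def by measurable

lemma sq_le_Psi: "s\<^sup>2 \<le> Psi s"
  unfolding Psi_def using mult_left_mono[of 1 "1 + max 0 (- ln \<bar>s\<bar>)" "s\<^sup>2"] by simp

lemma ln_sq: "ln (s\<^sup>2) = 2 * ln \<bar>s::real\<bar>"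
  using ln_realpow[of "\<bar>s\<bar>" 2] by (cases "s = 0") auto

lemma ent_eq: "ent s = 2 * s\<^sup>2 * ln \<bar>s\<bar>"
  unfolding ent_def ln_sq by simp

lemma neg_ent_le_Psi: "max 0 (- ent s) \<le> 2 * Psi s"
proof -
  have "s\<^sup>2 * (- ln \<bar>s\<bar>) \<le> s\<^sup>2 * (1 + max 0 (- ln \<bar>s\<bar>))" by (rule mult_left_mono) auto
  then have "- (s\<^sup>2 * ln \<bar>s\<bar>) \<le> Psi s" by (simp only: Psi_def mult_minus_right)
  moreover have "ent s = 2 * (s\<^sup>2 * ln \<bar>s\<bar>)" by (simp only: ent_eq mult.assoc)
  ultimately show ?thesis using Psi_nonneg[of s] by linarith
qed

lemma Psi_le: "Psi s \<le> s\<^sup>2 + \<bar>s\<bar>"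
proof (cases "s = 0")
  case False
  have "max 0 (- ln \<bar>s\<bar>) \<le> 1 / \<bar>s\<bar>"
    using ln_le_minus_one[of "1 / \<bar>s\<bar>"] False by (simp add: ln_div)
  then have "s\<^sup>2 * max 0 (- ln \<bar>s\<bar>) \<le> s\<^sup>2 * (1 / \<bar>s\<bar>)" by (rule mult_left_mono) simp
  also have "\<dots> = \<bar>s\<bar>" using False by (simp add: power2_eq_square field_simps abs_if)
  finally show ?thesis by (simp add: Psi_def distrib_left)
qed simp

text \<open>Bounds the growth of \<open>Psi\<close> under multiplication of the argument by \<open>c\<close>. That it is of order
  less than \<open>c\<close> for small \<open>c\<close> makes integrals of \<open>Psi\<close> negligible compared with the Luxemburg
  norm.\<close>
definition Psi_factor :: "real \<Rightarrow> real" where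
  "Psi_factor c = c\<^sup>2 * (1 + max 0 (- ln c))"

lemma Psi_scale: assumes "c > 0" shows "Psi (c * t) \<le> Psi_factor c * Psi t"
proof (cases "t = 0")
  case False
  have "1 + max 0 (- ln \<bar>c * t\<bar>) \<le> (1 + max 0 (- ln c)) * (1 + max 0 (- ln \<bar>t\<bar>))"
  proof -
    have "ln \<bar>c * t\<bar> = ln c + ln \<bar>t\<bar>" using assms False by (simp add: abs_mult ln_mult)
    moreover have "0 \<le> max 0 (- ln c) * max 0 (- ln \<bar>t\<bar>)" by simp
    moreover have "(1 + max 0 (- ln c)) * (1 + max 0 (- ln \<bar>t\<bar>)) = 1 + max 0 (- ln c) + max 0 (- ln \<bar>t\<bar>) + max 0 (- ln c) * max 0 (- ln \<bar>t\<bar>)"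
      by (simp add: algebra_simps)
    ultimately show ?thesis by linarith
  qed
  then have "(c * t)\<^sup>2 * (1 + max 0 (- ln \<bar>c * t\<bar>)) \<le> (c * t)\<^sup>2 * ((1 + max 0 (- ln c)) * (1 + max 0 (- ln \<bar>t\<bar>)))"
    by (rule mult_left_mono) simp
  then show ?thesis by (simp add: Psi_def Psi_factor_def power_mult_distrib mult_ac)
qed simp

lemma Psi_factor_nonneg: "0 \<le> Psi_factor c" by (simp add: Psi_factor_def)

lemma Psi_factor_small: assumes "0 < c" "c \<le> 1" shows "Psi_factor c \<le> c * (3 * sqrt c)"
proof -
  have "- ln (sqrt c) \<le> 1 / sqrt c" using ln_le_minus_one[of "1 / sqrt c"] assms by (simp add: ln_div)
  then have "- ln c \<le> 2 * (1 / sqrt c)" using assms by (simp add: ln_sqrt)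
  then have "max 0 (- ln c) \<le> 2 / sqrt c" using assms by simp
  then have "c * max 0 (- ln c) \<le> c * (2 / sqrt c)" using assms by (intro mult_left_mono) auto
  also have "\<dots> = 2 * sqrt c" using assms by (metis mult.commute mult.left_commute real_div_sqrt less_imp_le times_divide_eq_right)
  finally have "c * (1 + max 0 (- ln c)) \<le> c + 2 * sqrt c" by (simp add: distrib_left)
  moreover have "c \<le> sqrt c" using assms by (intro real_le_rsqrt) (simp add: power2_eq_square mult_left_le)
  ultimately have "c * (1 + max 0 (- ln c)) \<le> 3 * sqrt c" by linarith
  then have "c * (c * (1 + max 0 (- ln c))) \<le> c * (3 * sqrt c)" using assms by (intro mult_left_mono) auto
  then show ?thesis by (simp add: Psi_factor_def power2_eq_square mult.assoc)
qed

definition F1_const :: "real \<Rightarrow> real" where "F1_const \<delta> = 1 / (2 * (1 - ln \<delta>))"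

text \<open>The condition \<open>\<delta> < exp (-2)\<close> makes the coefficient \<open>- ln \<delta> - 3 / 2\<close> of \<open>s\<^sup>2\<close> in the outer
  branch of \<open>F1\<close> at least \<open>1 / 2\<close>.\<close>
lemma F1_bounds:
  assumes d: "0 < \<delta>" "\<delta> < exp (-2)"
  shows "0 < F1_const \<delta>" "F1_const \<delta> * Psi s \<le> F1 \<delta> s" "F1 \<delta> s \<le> (1 - ln \<delta>) * Psi s"
proof -
  have ld: "ln \<delta> < -2" using d by (metis exp_less_cancel_iff exp_ln)
  show c: "0 < F1_const \<delta>" using ld by (simp add: F1_const_def)
  have c1: "F1_const \<delta> \<le> 1 / 2" using ld by (simp add: F1_const_def field_simps)
  have lsq: "ln (\<delta>\<^sup>2) = 2 * ln \<delta>" using d by (simp add: ln_sq)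
  have "F1_const \<delta> * Psi s \<le> F1 \<delta> s \<and> F1 \<delta> s \<le> (1 - ln \<delta>) * Psi s"
  proof (cases "s = 0")
    case True then show ?thesis by (simp add: F1_def)
  next
    case s0: False
    show ?thesis
    proof (cases "\<bar>s\<bar> < \<delta>")
      case True
      define L where "L = - ln \<bar>s\<bar>"
      have "ln \<bar>s\<bar> < ln \<delta>" using True s0 d by simp
      then have L: "L > 2" using ld by (simp add: L_def)
      have F: "F1 \<delta> s = s\<^sup>2 * L" using True s0 by (simp add: F1_def ln_sq L_def)
      have P: "Psi s = s\<^sup>2 * (1 + L)" using L by (simp add: Psi_def L_def)
      have "F1_const \<delta> * Psi s \<le> 1 / 2 * Psi s" by (rule mult_right_mono[OF c1 Psi_nonneg])
      also have "\<dots> \<le> s\<^sup>2 * L" unfolding P using mult_left_mono[of 1 L "s\<^sup>2"] L by (simp add: algebra_simps)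
      finally have 1: "F1_const \<delta> * Psi s \<le> F1 \<delta> s" using F by simp
      have "F1 \<delta> s \<le> 1 * Psi s" unfolding F P by (simp add: mult_left_mono)
      also have "\<dots> \<le> (1 - ln \<delta>) * Psi s" using ld by (intro mult_right_mono Psi_nonneg) auto
      finally show ?thesis using 1 by simp
    next
      case False
      define r where "r = \<bar>s\<bar>"
      have r: "r \<ge> \<delta>" "r > 0" "r\<^sup>2 = s\<^sup>2" using False s0 by (auto simp: r_def)
      have F: "F1 \<delta> s = r\<^sup>2 * (- ln \<delta> - 3 / 2) + 2 * \<delta> * r - \<delta>\<^sup>2 / 2"
        using False s0 r by (simp add: F1_def lsq r_def algebra_simps)
      have dr: "\<delta> * \<delta> \<le> \<delta> * r" "\<delta> * r \<le> r * r" using r d by (auto intro: mult_left_mono mult_right_mono)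
      have lr: "max 0 (- ln r) \<le> - ln \<delta>" 
      proof -
        have "ln \<delta> \<le> ln r" using r d by simp
        then show ?thesis using ld by simp
      qed
      have "Psi s \<le> r\<^sup>2 * (1 - ln \<delta>)"
        unfolding Psi_def r(3)[symmetric] r_def[symmetric] using lr by (intro mult_left_mono) auto
      then have "F1_const \<delta> * Psi s \<le> F1_const \<delta> * (r\<^sup>2 * (1 - ln \<delta>))" using c by (intro mult_left_mono) auto
      also have "\<dots> = r\<^sup>2 * (1 / 2)"
      proof -
        define q where "q = 1 - ln \<delta>"
        have "q \<noteq> 0" using ld by (simp add: q_def)
        then show ?thesis unfolding F1_const_def q_def[symmetric] by simp
      qed
      also have "\<dots> \<le> r\<^sup>2 * (- ln \<delta> - 3 / 2)" using ld by (intro mult_left_mono) auto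
      also have "\<dots> \<le> F1 \<delta> s" unfolding F using dr d r mult_pos_pos[OF d(1) d(1)] unfolding power2_eq_square by linarith
      finally have 1: "F1_const \<delta> * Psi s \<le> F1 \<delta> s" .
      have "F1 \<delta> s \<le> r\<^sup>2 * (- ln \<delta> - 3 / 2) + 2 * r\<^sup>2" unfolding F using dr mult_pos_pos[OF d(1) d(1)] unfolding power2_eq_square by linarith
      also have "\<dots> \<le> (1 - ln \<delta>) * r\<^sup>2" by (simp add: algebra_simps)
      also have "\<dots> \<le> (1 - ln \<delta>) * Psi s" using ld sq_le_Psi[of s] r by (intro mult_left_mono) auto
      finally show ?thesis using 1 by simp
    qed
  qed
  then show "F1_const \<delta> * Psi s \<le> F1 \<delta> s" "F1 \<delta> s \<le> (1 - ln \<delta>) * Psi s" by auto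
qed

lemma F1_abs [simp]: "F1 \<delta> \<bar>s\<bar> = F1 \<delta> s" by (simp add: F1_def)

lemma F2_eq: "\<delta> > 0 \<Longrightarrow> F2 \<delta> s = F1 \<delta> s + ent s / 2"
  using F2_minus_F1[of \<delta> s] by (simp add: ent_def)

abbreviation EntI :: "'a::euclidean_space set \<Rightarrow> ('a \<Rightarrow> real) \<Rightarrow> real" where
  "EntI \<Omega> u \<equiv> LINT x:\<Omega>|lebesgue. ent (u x)"

abbreviation PsiI :: "'a::euclidean_space set \<Rightarrow> ('a \<Rightarrow> real) \<Rightarrow> real" where
  "PsiI \<Omega> u \<equiv> LINT x:\<Omega>|lebesgue. Psi (u x)"

definition finite_energy :: "'a::euclidean_space set \<Rightarrow> ('a \<Rightarrow> real) \<Rightarrow> bool" where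
  "finite_energy \<Omega> u \<longleftrightarrow> u \<in> H1 \<Omega> \<and> set_integrable lebesgue \<Omega> (\<lambda>x. Psi (u x)) \<and> set_integrable lebesgue \<Omega> (\<lambda>x. ent (u x))"

lemma measurable_comp_indicator:
  fixes F :: "real \<Rightarrow> real"
  assumes um: "(\<lambda>x. indicator \<Omega> x *\<^sub>R u x) \<in> borel_measurable M" and F: "F \<in> borel_measurable borel" "F 0 = 0"
  shows "(\<lambda>x. indicator \<Omega> x *\<^sub>R F (u x)) \<in> borel_measurable M"
proof -
  have "(\<lambda>x. indicator \<Omega> x *\<^sub>R F (u x)) = (\<lambda>x. F (indicator \<Omega> x *\<^sub>R u x))"
    using F(2) by (auto simp: fun_eq_iff indicator_def)
  then show ?thesis using measurable_compose[OF um F(1)] by simp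
qed

lemma set_integrable_dominated:
  fixes F :: "'a \<Rightarrow> real"
  assumes "set_integrable M \<Omega> G" "(\<lambda>x. indicator \<Omega> x *\<^sub>R F x) \<in> borel_measurable M" "\<And>x. x \<in> \<Omega> \<Longrightarrow> \<bar>F x\<bar> \<le> (G x :: real)"
  shows "set_integrable M \<Omega> F"
  unfolding set_integrable_def
proof (rule Bochner_Integration.integrable_bound[OF assms(1)[unfolded set_integrable_def] assms(2)], rule AE_I2)
  fix x show "norm (indicator \<Omega> x *\<^sub>R F x) \<le> norm (indicator \<Omega> x *\<^sub>R G x)"
    using assms(3)[of x] by (cases "x \<in> \<Omega>") auto
qed

text \<open>The splitting into \<open>F1\<close> and \<open>F2\<close> disappears once both integrals converge.\<close>
lemma energy_eq_entropy:
  fixes \<Omega> :: "'a::euclidean_space set"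
  assumes d: "0 < \<delta>" "\<delta> < exp (-2)" and \<Omega>: "open \<Omega>" and u: "finite_energy \<Omega> u"
  shows "energy \<delta> \<Omega> u = Dir \<Omega> u / 2 + Mass \<Omega> u - EntI \<Omega> u / 2"
proof -
  have uH: "u \<in> H1 \<Omega>" and P: "set_integrable lebesgue \<Omega> (\<lambda>x. Psi (u x))" and e: "set_integrable lebesgue \<Omega> (\<lambda>x. ent (u x))"
    using u by (auto simp: finite_energy_def)
  have F1i: "set_integrable lebesgue \<Omega> (\<lambda>x. F1 \<delta> (u x))"
  proof (rule set_integrable_dominated[where G="\<lambda>x. (1 - ln \<delta>) * Psi (u x)"])
    show "set_integrable lebesgue \<Omega> (\<lambda>x. (1 - ln \<delta>) * Psi (u x))" using P by simp
    show "(\<lambda>x. indicator \<Omega> x *\<^sub>R F1 \<delta> (u x)) \<in> borel_measurable lebesgue"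
      by (rule measurable_comp_indicator[OF H1D(4)[OF \<Omega> uH]]) (auto simp: F1_def[of _ 0])
    fix x
    have "0 \<le> F1_const \<delta> * Psi (u x)" using F1_bounds(1)[OF d] Psi_nonneg by simp
    then show "\<bar>F1 \<delta> (u x)\<bar> \<le> (1 - ln \<delta>) * Psi (u x)"
      using F1_bounds(2,3)[OF d, of "u x"] by linarith
  qed
  have "(LINT x:\<Omega>|lebesgue. F2 \<delta> (u x)) = (LINT x:\<Omega>|lebesgue. F1 \<delta> (u x) + ent (u x) / 2)"
    using d by (simp add: F2_eq)
  also have "\<dots> = (LINT x:\<Omega>|lebesgue. F1 \<delta> (u x)) + EntI \<Omega> u / 2"
    using F1i e by (subst set_integral_add(2)) auto
  finally show ?thesis unfolding energy_def H1_quadratic[OF \<Omega> uH] by simp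
qed

lemma modular_eq:
  "modular \<delta> \<Omega> u = (\<integral>\<^sup>+x. ennreal (indicator \<Omega> x *\<^sub>R F1 \<delta> (u x)) \<partial>lebesgue)"
  unfolding modular_def by (intro nn_integral_cong) (auto simp: indicator_def)

lemma Psi_integrable_if_modular:
  fixes \<Omega> :: "'a::euclidean_space set"
  assumes d: "0 < \<delta>" "\<delta> < exp (-2)" and um: "(\<lambda>x. indicator \<Omega> x *\<^sub>R u x) \<in> borel_measurable lebesgue"
    and c: "c > 0" and le: "modular \<delta> \<Omega> (\<lambda>x. u x / c) \<le> ennreal B" and B: "B \<ge> 0"
  shows "set_integrable lebesgue \<Omega> (\<lambda>x. Psi (u x))" "PsiI \<Omega> u \<le> Psi_factor c / F1_const \<delta> * B"
proof -
  note Fc = F1_bounds[OF d]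
  let ?k = "Psi_factor c / F1_const \<delta>"
  have k0: "0 \<le> ?k" using Psi_factor_nonneg Fc(1) by simp
  have pw: "Psi (u x) \<le> ?k * F1 \<delta> (u x / c)" for x
  proof -
    have "Psi (u x) \<le> Psi_factor c * Psi (u x / c)" using Psi_scale[OF c, of "u x / c"] c by simp
    also have "\<dots> \<le> Psi_factor c * (F1 \<delta> (u x / c) / F1_const \<delta>)"
      using Fc(2)[of "u x / c"] Fc(1) by (intro mult_left_mono Psi_factor_nonneg) (simp add: pos_le_divide_eq mult.commute)
    finally show ?thesis by simp
  qed
  have m: "(\<lambda>x. indicator \<Omega> x *\<^sub>R Psi (u x)) \<in> borel_measurable lebesgue"
    by (rule measurable_comp_indicator[OF um]) auto
  have uc: "(\<lambda>x. indicator \<Omega> x *\<^sub>R (u x / c)) \<in> borel_measurable lebesgue"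
    by (rule measurable_comp_indicator[OF um, of "\<lambda>s. s / c"]) auto
  have m': "(\<lambda>x. indicator \<Omega> x *\<^sub>R F1 \<delta> (u x / c)) \<in> borel_measurable lebesgue"
    by (rule measurable_comp_indicator[OF uc]) (auto simp: F1_def[of _ 0])
  have "(\<integral>\<^sup>+x. ennreal (indicator \<Omega> x *\<^sub>R Psi (u x)) \<partial>lebesgue)
      \<le> (\<integral>\<^sup>+x. ennreal ?k * ennreal (indicator \<Omega> x *\<^sub>R F1 \<delta> (u x / c)) \<partial>lebesgue)"
    using pw k0 by (intro nn_integral_mono) (auto simp: ennreal_mult'[symmetric] indicator_def intro!: ennreal_leI)
  also have "\<dots> = ennreal ?k * modular \<delta> \<Omega> (\<lambda>x. u x / c)"
    unfolding modular_eq using m' by (intro nn_integral_cmult) simp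
  also have "\<dots> \<le> ennreal ?k * ennreal B" by (intro mult_left_mono le) simp
  also have "\<dots> = ennreal (?k * B)" using k0 by (simp add: ennreal_mult'[symmetric])
  finally have bd: "(\<integral>\<^sup>+x. ennreal (indicator \<Omega> x *\<^sub>R Psi (u x)) \<partial>lebesgue) \<le> ennreal (?k * B)" .
  have nn: "0 \<le> indicator \<Omega> x *\<^sub>R Psi (u x)" for x using Psi_nonneg by simp
  have i: "integrable lebesgue (\<lambda>x. indicator \<Omega> x *\<^sub>R Psi (u x))"
    by (rule integrableI_nonneg[OF m]) (use bd nn in \<open>auto intro: le_less_trans\<close>)
  then show "set_integrable lebesgue \<Omega> (\<lambda>x. Psi (u x))" unfolding set_integrable_def .
  have "ennreal (PsiI \<Omega> u) \<le> ennreal (?k * B)"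
    unfolding set_lebesgue_integral_def using bd nn_integral_eq_integral[OF i] nn by simp
  then show "PsiI \<Omega> u \<le> ?k * B" using k0 B by (metis ennreal_le_iff mult_nonneg_nonneg)
qed

text \<open>The modular controls only the negative part of the entropy density. Integrability of the
  positive part is supplied by the logarithmic Sobolev inequality.\<close>
lemma X_facts:
  fixes \<Omega> :: "'a::euclidean_space set"
  assumes d: "0 < \<delta>" "\<delta> < exp (-2)" and \<Omega>: "open \<Omega>" and u: "u \<in> X \<delta> \<Omega>"
  shows "u \<in> H10 \<Omega>" "u \<in> H1 \<Omega>" "finite_energy \<Omega> u"
    and "set_integrable lebesgue \<Omega> (\<lambda>x. Psi (u x))" "set_integrable lebesgue \<Omega> (\<lambda>x. max 0 (- ent (u x)))"
proof -
  show h: "u \<in> H10 \<Omega>" and uH: "u \<in> H1 \<Omega>" using u by (auto simp: X_def H10_def)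
  obtain c where c: "c > 0" "modular \<delta> \<Omega> (\<lambda>x. u x / c) < \<infinity>" using u by (auto simp: X_def Orlicz_def)
  then obtain B where B: "B \<ge> 0" "modular \<delta> \<Omega> (\<lambda>x. u x / c) = ennreal B"
    by (cases "modular \<delta> \<Omega> (\<lambda>x. u x / c)") auto
  show P: "set_integrable lebesgue \<Omega> (\<lambda>x. Psi (u x))"
    by (rule Psi_integrable_if_modular(1)[OF d H1D(4)[OF \<Omega> uH] c(1) _ B(1)]) (simp add: B)
  show n: "set_integrable lebesgue \<Omega> (\<lambda>x. max 0 (- ent (u x)))"
  proof (rule set_integrable_dominated[where G="\<lambda>x. 2 * Psi (u x)"])
    show "set_integrable lebesgue \<Omega> (\<lambda>x. 2 * Psi (u x))" using P by simp
    show "(\<lambda>x. indicator \<Omega> x *\<^sub>R max 0 (- ent (u x))) \<in> borel_measurable lebesgue"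
      by (rule measurable_comp_indicator[OF H1D(4)[OF \<Omega> uH], of "\<lambda>s. max 0 (- ent s)"]) auto
  qed (use neg_ent_le_Psi in auto)
  show "finite_energy \<Omega> u" unfolding finite_energy_def using uH P H10_log_sobolev(1)[OF \<Omega> h n] by blast
qed

lemma PsiI_nonneg: "0 \<le> PsiI \<Omega> u"
  unfolding set_lebesgue_integral_def by (intro integral_nonneg_AE AE_I2) (simp add: Psi_nonneg)

text \<open>The set in the definition of the Luxemburg norm is not empty, so the norm is a genuine
  infimum.\<close>
lemma modular_le_1_exists:
  fixes \<Omega> :: "'a::euclidean_space set"
  assumes d: "0 < \<delta>" "\<delta> < exp (-2)" and \<Omega>: "open \<Omega>" and u: "u \<in> X \<delta> \<Omega>"
  shows "\<exists>c>0. modular \<delta> \<Omega> (\<lambda>x. u x / c) \<le> 1"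
proof -
  note U = X_facts[OF d \<Omega> u] and Fc = F1_bounds[OF d]
  let ?C = "1 - ln \<delta>"
  have C: "?C > 0"
  proof -
    have "0 < 1 / (2 * ?C)" using Fc(1) by (simp only: F1_const_def)
    then show ?thesis by (simp add: zero_less_divide_iff)
  qed
  \<comment> \<open>Chosen so that \<open>3 ?C PsiI \<le> sqrt c\<close>, which compensates the bound \<open>3 / sqrt c\<close> for
      the factor of \<open>1 / c\<close>.\<close>
  define c where "c = max 1 ((?C * PsiI \<Omega> u)\<^sup>2 * 9)"
  have c: "c \<ge> 1" by (simp add: c_def)
  have pw: "F1 \<delta> (u x / c) \<le> ?C * (Psi_factor (1 / c) * Psi (u x))" for x
  proof -
    have "Psi (u x / c) \<le> Psi_factor (1 / c) * Psi (u x)" using Psi_scale[of "1 / c" "u x"] c by simp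
    then have "?C * Psi (u x / c) \<le> ?C * (Psi_factor (1 / c) * Psi (u x))" using C by (intro mult_left_mono) auto
    then show ?thesis using Fc(3)[of "u x / c"] by linarith
  qed
  have eq: "(\<lambda>x. indicator \<Omega> x *\<^sub>R (?C * (Psi_factor (1 / c) * Psi (u x)))) = (\<lambda>x. (?C * Psi_factor (1 / c)) * (indicator \<Omega> x *\<^sub>R Psi (u x)))"
    by (auto simp: fun_eq_iff)
  have i: "integrable lebesgue (\<lambda>x. indicator \<Omega> x *\<^sub>R (?C * (Psi_factor (1 / c) * Psi (u x))))"
    unfolding eq using U(4) unfolding set_integrable_def by (rule integrable_mult_right)
  have "modular \<delta> \<Omega> (\<lambda>x. u x / c) \<le> (\<integral>\<^sup>+x. ennreal (indicator \<Omega> x *\<^sub>R (?C * (Psi_factor (1 / c) * Psi (u x)))) \<partial>lebesgue)"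
    unfolding modular_eq using pw by (intro nn_integral_mono ennreal_leI) (auto simp: indicator_def)
  also have "\<dots> = ennreal (LINT x|lebesgue. indicator \<Omega> x *\<^sub>R (?C * (Psi_factor (1 / c) * Psi (u x))))"
    using C Psi_factor_nonneg Psi_nonneg by (intro nn_integral_eq_integral[OF i]) auto
  also have "(LINT x|lebesgue. indicator \<Omega> x *\<^sub>R (?C * (Psi_factor (1 / c) * Psi (u x)))) = ?C * (Psi_factor (1 / c) * PsiI \<Omega> u)"
    unfolding eq set_lebesgue_integral_def by (simp only: integral_mult_right_zero mult.assoc)
  also have "?C * (Psi_factor (1 / c) * PsiI \<Omega> u) \<le> 1"
  proof -
    have "Psi_factor (1 / c) \<le> 1 / c * (3 * sqrt (1 / c))" using c by (intro Psi_factor_small) auto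
    also have "\<dots> \<le> 1 * (3 * sqrt (1 / c))" using c by (intro mult_right_mono) auto
    finally have "Psi_factor (1 / c) \<le> 3 / sqrt c" by (simp add: real_sqrt_divide)
    then have "(?C * PsiI \<Omega> u) * Psi_factor (1 / c) \<le> (?C * PsiI \<Omega> u) * (3 / sqrt c)"
      by (rule mult_left_mono) (rule mult_nonneg_nonneg[OF less_imp_le[OF C] PsiI_nonneg])
    also have "\<dots> \<le> 1"
    proof -
      have "(3 * (?C * PsiI \<Omega> u))\<^sup>2 \<le> c" by (simp add: c_def power_mult_distrib)
      then have "3 * (?C * PsiI \<Omega> u) \<le> sqrt c" by (rule real_le_rsqrt)
      then show ?thesis using c by (simp add: pos_divide_le_eq mult.commute)
    qed
    finally show ?thesis by (simp add: mult_ac)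
  qed
  finally have "modular \<delta> \<Omega> (\<lambda>x. u x / c) \<le> 1" by (simp add: ennreal_leI)
  then show ?thesis using c by (intro exI[of _ c]) auto
qed

lemma Luxemburg_nonneg:
  fixes \<Omega> :: "'a::euclidean_space set"
  assumes "0 < \<delta>" "\<delta> < exp (-2)" "open \<Omega>" "u \<in> X \<delta> \<Omega>"
  shows "0 \<le> Luxemburg_norm \<delta> \<Omega> u"
  unfolding Luxemburg_norm_def using modular_le_1_exists[OF assms] by (intro cInf_greatest) auto

text \<open>The integral of \<open>Psi\<close> is of smaller order than the Luxemburg norm \<open>l\<close>, namely at most a
  multiple of \<open>l sqrt l\<close>.\<close>
lemma PsiI_small:
  fixes \<Omega> :: "'a::euclidean_space set"
  assumes d: "0 < \<delta>" "\<delta> < exp (-2)" and \<Omega>: "open \<Omega>" and \<epsilon>: "\<epsilon> > 0"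
  obtains \<eta> where "\<eta> > 0" "\<And>h. h \<in> X \<delta> \<Omega> \<Longrightarrow> Luxemburg_norm \<delta> \<Omega> h < \<eta> \<Longrightarrow> PsiI \<Omega> h \<le> \<epsilon> * Luxemburg_norm \<delta> \<Omega> h"
proof -
  note Fc = F1_bounds[OF d]
  define \<eta> where "\<eta> = min 1 ((\<epsilon> * F1_const \<delta> / 3)\<^sup>2)"
  have \<eta>: "\<eta> > 0" using \<epsilon> Fc(1) by (simp add: \<eta>_def)
  have "PsiI \<Omega> h \<le> \<epsilon> * Luxemburg_norm \<delta> \<Omega> h" if h: "h \<in> X \<delta> \<Omega>" and l: "Luxemburg_norm \<delta> \<Omega> h < \<eta>" for h
  proof -
    let ?l = "Luxemburg_norm \<delta> \<Omega> h"
    have key: "PsiI \<Omega> h \<le> \<epsilon> * c" if c: "?l < c" "c < \<eta>" for c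
    proof -
      have ne: "{c. c > 0 \<and> modular \<delta> \<Omega> (\<lambda>x. h x / c) \<le> 1} \<noteq> {}" using modular_le_1_exists[OF d \<Omega> h] by blast
      have bb: "bdd_below {c. c > 0 \<and> modular \<delta> \<Omega> (\<lambda>x. h x / c) \<le> 1}" by (rule bdd_belowI[of _ 0]) auto
      obtain c' where c': "c' > 0" "modular \<delta> \<Omega> (\<lambda>x. h x / c') \<le> 1" "c' < c"
        using c(1) cInf_less_iff[OF ne bb] unfolding Luxemburg_norm_def by auto
      have "PsiI \<Omega> h \<le> Psi_factor c' / F1_const \<delta> * 1"
        by (rule Psi_integrable_if_modular(2)[OF d H1D(4)[OF \<Omega> X_facts(2)[OF d \<Omega> h]] c'(1)]) (use c' in auto)
      also have "\<dots> \<le> c' * (3 * sqrt c') / F1_const \<delta>"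
        using Psi_factor_small[OF c'(1)] c' c Fc(1) by (auto simp: \<eta>_def intro!: divide_right_mono)
      also have "\<dots> \<le> c' * (\<epsilon> * F1_const \<delta>) / F1_const \<delta>"
      proof -
        have "c' \<le> (\<epsilon> * F1_const \<delta> / 3)\<^sup>2" using c c' by (simp add: \<eta>_def)
        then have "sqrt c' \<le> \<epsilon> * F1_const \<delta> / 3" using \<epsilon> Fc(1) by (intro real_le_lsqrt) auto
        then show ?thesis using c' Fc(1) by (intro divide_right_mono mult_left_mono) auto
      qed
      also have "\<dots> = \<epsilon> * c'" using Fc(1) by simp
      also have "\<dots> \<le> \<epsilon> * c" using \<epsilon> c' by simp
      finally show ?thesis .
    qed
    have "PsiI \<Omega> h / \<epsilon> \<le> ?l"
    proof (rule dense_ge_bounded[OF l])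
      fix c assume "?l < c" "c < \<eta>"
      then show "PsiI \<Omega> h / \<epsilon> \<le> c" using key[of c] \<epsilon> by (simp add: pos_divide_le_eq mult.commute)
    qed
    then show ?thesis using \<epsilon> by (simp add: pos_divide_le_eq mult.commute)
  qed
  then show ?thesis using that \<eta> by blast
qed

lemma Dir_scale:
  fixes \<Omega> :: "'a::euclidean_space set"
  assumes \<Omega>: "open \<Omega>" and v: "v \<in> H1 \<Omega>"
  shows "Dir \<Omega> (\<lambda>x. t * v x) = t\<^sup>2 * Dir \<Omega> v"
proof -
  have tv: "(\<lambda>x. t * v x) \<in> H1 \<Omega>" and g: "AE x in lebesgue. x \<in> \<Omega> \<longrightarrow> weak_gradient \<Omega> (\<lambda>x. t * v x) x = t *\<^sub>R weak_gradient \<Omega> v x"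
    using H1_combine[OF \<Omega> v v, of t 0] by simp_all
  have "Dir \<Omega> (\<lambda>x. t * v x) = (LINT x|lebesgue. t\<^sup>2 * (indicator \<Omega> x *\<^sub>R (norm (weak_gradient \<Omega> v x))\<^sup>2))"
    unfolding Dir_def set_lebesgue_integral_def
  proof (rule integral_cong_AE)
    show "AE x in lebesgue. indicator \<Omega> x *\<^sub>R (norm (weak_gradient \<Omega> (\<lambda>x. t * v x) x))\<^sup>2 = t\<^sup>2 * (indicator \<Omega> x *\<^sub>R (norm (weak_gradient \<Omega> v x))\<^sup>2)"
      using g by eventually_elim (auto simp: indicator_def power_mult_distrib)
  qed (use H1D(2)[OF \<Omega> v] H1D(2)[OF \<Omega> tv] in \<open>auto simp: set_integrable_def\<close>)
  also have "\<dots> = t\<^sup>2 * Dir \<Omega> v" by (simp add: Dir_def set_lebesgue_integral_def)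
  finally show "Dir \<Omega> (\<lambda>x. t * v x) = t\<^sup>2 * Dir \<Omega> v" .
qed

lemma X_scale:
  fixes \<Omega> :: "'a::euclidean_space set"
  assumes d: "0 < \<delta>" "\<delta> < exp (-2)" and \<Omega>: "open \<Omega>" and u: "u \<in> X \<delta> \<Omega>" and t: "t > 0"
  shows "(\<lambda>x. t * u x) \<in> X \<delta> \<Omega>"
    and "\<exists>C\<ge>0. \<forall>t>0. X_norm \<delta> \<Omega> (\<lambda>x. t * u x) \<le> C * t"
proof -
  note U = X_facts[OF d \<Omega> u]
  have hs: "H_norm \<Omega> (\<lambda>x. t * v x) = t * H_norm \<Omega> v" if v: "v \<in> H1 \<Omega>" and t: "t > 0" for v t
  proof -
    have tv: "(\<lambda>x. t * v x) \<in> H1 \<Omega>" using H1_combine(1)[OF \<Omega> v v, of t 0] by simp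
    have 1: "Dir \<Omega> (\<lambda>x. t * v x) = t\<^sup>2 * Dir \<Omega> v" by (rule Dir_scale[OF \<Omega> v])
    have 2: "Mass \<Omega> (\<lambda>x. t * v x) = t\<^sup>2 * Mass \<Omega> v"
      by (simp add: Mass_def power_mult_distrib)
    have "(H_norm \<Omega> (\<lambda>x. t * v x))\<^sup>2 = (t * H_norm \<Omega> v)\<^sup>2"
      unfolding H_norm_sq[OF \<Omega> tv] power_mult_distrib H_norm_sq[OF \<Omega> v] 1 2 by (simp add: algebra_simps)
    then show ?thesis using H_norm_nonneg[OF \<Omega> tv] H_norm_nonneg[OF \<Omega> v] t by (simp add: power2_eq_iff_nonneg)
  qed
  show "(\<lambda>x. t * u x) \<in> X \<delta> \<Omega>"
    unfolding X_def
  proof (intro IntI)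
    show "(\<lambda>x. t * u x) \<in> H10 \<Omega>"
      unfolding H10_def
    proof (intro CollectI conjI allI impI)
      show "(\<lambda>x. t * u x) \<in> H1 \<Omega>" using H1_combine(1)[OF \<Omega> U(2) U(2), of t 0] by simp
      fix \<epsilon> :: real assume "\<epsilon> > 0"
      then have "\<epsilon> / t > 0" using t by simp
      then obtain \<phi> where \<phi>: "\<phi> \<in> test_functions \<Omega>" "H_norm \<Omega> (\<lambda>x. u x - \<phi> x) < \<epsilon> / t" using U(1) unfolding H10_def by blast
      have "(\<lambda>x. u x - \<phi> x) \<in> H1 \<Omega>" using H1_combine(1)[OF \<Omega> U(2) test_H1(1)[OF \<Omega> \<phi>(1)], of 1 "-1"] by simp
      then have "H_norm \<Omega> (\<lambda>x. t * (u x - \<phi> x)) < \<epsilon>" using hs[of "\<lambda>x. u x - \<phi> x" t] t \<phi>(2) by (simp add: pos_less_divide_eq mult.commute)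
      moreover have "(\<lambda>x. t * \<phi> x) \<in> test_functions \<Omega>"
        using \<phi>(1) t smooth_on_mult[OF smooth_on_const[of t], of \<phi>] by (auto simp: test_functions_def)
      ultimately show "\<exists>\<phi>\<in>test_functions \<Omega>. H_norm \<Omega> (\<lambda>x. t * u x - \<phi> x) < \<epsilon>"
        by (intro bexI[of _ "\<lambda>x. t * \<phi> x"]) (simp_all add: right_diff_distrib)
    qed
    obtain c where c: "c > 0" "modular \<delta> \<Omega> (\<lambda>x. u x / c) < \<infinity>" "u \<in> L1_loc \<Omega>" using u by (auto simp: X_def Orlicz_def)
    have "(\<lambda>x. t * u x / (t * c)) = (\<lambda>x. u x / c)" using t by simp
    then show "(\<lambda>x. t * u x) \<in> Orlicz \<delta> \<Omega>"
      using c t L1_loc_combine[OF c(3) c(3), of t 0] unfolding Orlicz_def by (auto intro!: exI[of _ "t * c"])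
  qed
  obtain c where c: "c > 0" "modular \<delta> \<Omega> (\<lambda>x. u x / c) \<le> 1" using modular_le_1_exists[OF d \<Omega> u] by blast
  show "\<exists>C\<ge>0. \<forall>t>0. X_norm \<delta> \<Omega> (\<lambda>x. t * u x) \<le> C * t"
  proof (intro exI[of _ "H_norm \<Omega> u + c"] conjI allI impI)
    show "0 \<le> H_norm \<Omega> u + c" using H_norm_nonneg[OF \<Omega> U(2)] c by simp
    fix t :: real assume t: "t > 0"
    have "(\<lambda>x. t * u x / (t * c)) = (\<lambda>x. u x / c)" using t by simp
    then have "Luxemburg_norm \<delta> \<Omega> (\<lambda>x. t * u x) \<le> t * c"
      unfolding Luxemburg_norm_def using c t by (intro cInf_lower) (auto intro: bdd_belowI[of _ 0])
    then show "X_norm \<delta> \<Omega> (\<lambda>x. t * u x) \<le> (H_norm \<Omega> u + c) * t"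
      unfolding X_norm_def hs[OF U(2) t] by (simp add: algebra_simps)
  qed
qed

section \<open>Differentiability of the energy and the Nehari identity\<close>

lemma test_X:
  fixes \<Omega> :: "'a::euclidean_space set"
  assumes d: "0 < \<delta>" "\<delta> < exp (-2)" and \<Omega>: "open \<Omega>" and \<phi>: "\<phi> \<in> test_functions \<Omega>"
  shows "\<phi> \<in> X \<delta> \<Omega>"
proof -
  obtain K where K: "compact K" "K \<subseteq> \<Omega>" "smooth_on \<phi> UNIV" "\<And>x. x \<notin> K \<Longrightarrow> \<phi> x = 0"
    using test_functionsE[OF \<phi>] by metis
  have ld: "ln \<delta> < 1" using d by (metis exp_less_cancel_iff exp_ln less_trans neg_less_0_iff_less zero_less_numeral zero_less_one)
  have i: "set_integrable lebesgue \<Omega> (\<lambda>x. (1 - ln \<delta>) * ((\<phi> x)\<^sup>2 + \<bar>\<phi> x\<bar>))"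
    by (rule set_integrable_compact_support(1)[OF \<Omega> _ K(1) _ K(2)]) (use K(4) smooth_on_imp_continuous[OF K(3)] in \<open>auto intro!: continuous_intros\<close>)
  have nn: "0 \<le> (1 - ln \<delta>) * ((\<phi> x)\<^sup>2 + \<bar>\<phi> x\<bar>)" for x using ld by simp
  have pw: "F1 \<delta> (\<phi> x) \<le> (1 - ln \<delta>) * ((\<phi> x)\<^sup>2 + \<bar>\<phi> x\<bar>)" for x
    using F1_bounds(3)[OF d, of "\<phi> x"] mult_left_mono[OF Psi_le[of "\<phi> x"], of "1 - ln \<delta>"] ld by linarith
  have "modular \<delta> \<Omega> (\<lambda>x. \<phi> x / 1) \<le> (\<integral>\<^sup>+x. ennreal (indicator \<Omega> x *\<^sub>R ((1 - ln \<delta>) * ((\<phi> x)\<^sup>2 + \<bar>\<phi> x\<bar>))) \<partial>lebesgue)"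
    unfolding modular_eq using pw by (intro nn_integral_mono ennreal_leI) (auto simp: indicator_def)
  also have "\<dots> = ennreal (LINT x:\<Omega>|lebesgue. (1 - ln \<delta>) * ((\<phi> x)\<^sup>2 + \<bar>\<phi> x\<bar>))"
    unfolding set_lebesgue_integral_def using i nn by (intro nn_integral_eq_integral) (auto simp: set_integrable_def indicator_def)
  also have "\<dots> < \<infinity>" by simp
  finally have "\<exists>c>0. modular \<delta> \<Omega> (\<lambda>x. \<phi> x / c) < \<infinity>" by (intro exI[of _ 1]) auto
  moreover have "\<phi> \<in> L1_loc \<Omega>" using test_H1(1)[OF \<Omega> \<phi>] by (simp add: H1_def)
  ultimately show ?thesis using test_H10[OF \<Omega> \<phi>] by (simp add: X_def Orlicz_def)
qed

text \<open>The nonlinearity of the equation; the derivative of \<open>ent\<close> is \<open>2 (pln s + s)\<close>.\<close>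
definition pln :: "real \<Rightarrow> real" where "pln s = s * ln (s\<^sup>2)"

lemma ent_eq_pln: "ent s = s * pln s" by (simp add: ent_def pln_def power2_eq_square)

lemma abs_pln_le: "\<bar>pln s\<bar> \<le> 2 + \<bar>s\<bar> ^ 3"
proof (cases "s = 0")
  case False
  have "\<bar>s\<bar> * \<bar>pln s\<bar> = \<bar>ent s\<bar>" by (simp add: ent_eq_pln abs_mult)
  moreover have "\<bar>s\<bar> * (2 + \<bar>s\<bar> ^ 3) = s ^ 4 + 2 * \<bar>s\<bar>"
  proof -
    have "\<bar>s\<bar> * \<bar>s\<bar> ^ 3 = \<bar>s\<bar> ^ 4" by (simp add: numeral_eq_Suc)
    also have "\<dots> = s ^ 4" by simp
    finally show ?thesis by (simp only: distrib_left)
  qed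
  ultimately have "\<bar>s\<bar> * \<bar>pln s\<bar> \<le> \<bar>s\<bar> * (2 + \<bar>s\<bar> ^ 3)" using abs_ent_le[of s] by simp
  then show ?thesis using False by simp
qed (simp add: pln_def)

text \<open>For large \<open>t\<close> the mean value theorem applies, and near 0 the values are simply bounded; 60 is
  a convenient bound for the latter.\<close>
lemma pln_unit_step: "\<bar>pln (t + 1) - pln t\<bar> \<le> 60 + 2 * ln (1 + \<bar>t\<bar>)"
proof (cases "\<bar>t\<bar> \<le> 2")
  case True
  have "\<bar>t\<bar> ^ 3 \<le> 2 ^ 3" "\<bar>t + 1\<bar> ^ 3 \<le> 3 ^ 3" using True by (intro power_mono; simp)+
  moreover have "0 \<le> ln (1 + \<bar>t\<bar>)" by simp
  moreover have "(2::real) ^ 3 = 8" "(3::real) ^ 3 = 27" by simp_all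
  ultimately show ?thesis using abs_pln_le[of t] abs_pln_le[of "t + 1"] by linarith
next
  case False
  have d: "(pln has_real_derivative (ln (z\<^sup>2) + 2)) (at z)" if "z \<noteq> 0" for z
  proof -
    have "0 < z * z" using that by (metis not_real_square_gt_zero)
    then show ?thesis unfolding pln_def using that by (auto intro!: derivative_eq_intros simp: power2_eq_square)
  qed
  have "\<exists>z>t. z < t + 1 \<and> pln (t + 1) - pln t = (t + 1 - t) * (ln (z\<^sup>2) + 2)"
    by (rule MVT2) (use False d in auto)
  then obtain z where z: "t < z" "z < t + 1" "pln (t + 1) - pln t = ln (z\<^sup>2) + 2" by auto
  have a: "1 \<le> \<bar>z\<bar>" "\<bar>z\<bar> \<le> 1 + \<bar>t\<bar>" using z False by auto
  have "0 \<le> ln \<bar>z\<bar>" "ln \<bar>z\<bar> \<le> ln (1 + \<bar>t\<bar>)" using a by auto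
  then show ?thesis unfolding z(3) ln_sq by linarith
qed

lemma pln_scale: "pln (k * x) = x * (k * ln (k\<^sup>2)) + k * pln x"
  by (cases "k = 0 \<or> x = 0") (auto simp: pln_def power_mult_distrib ln_mult algebra_simps)

text \<open>The function \<open>pln\<close> has an unbounded derivative at 0, but its modulus of continuity is that of
  \<open>k ln k\<close>. By the scaling rule \<open>pln_scale\<close> an increment \<open>k\<close> reduces to an increment 1.\<close>
lemma pln_diff_le:
  assumes a: "\<bar>a\<bar> \<le> K" and K: "K \<ge> 1" and k: "k \<noteq> 0"
  shows "\<bar>pln (a + k) - pln a\<bar> \<le> (62 + 2 * ln K) * (\<bar>k\<bar> * (1 + \<bar>ln \<bar>k\<bar>\<bar>))"
proof -
  define t where "t = a / k"
  define l where "l = \<bar>ln \<bar>k\<bar>\<bar>"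
  have lK: "0 \<le> ln K" using K by simp
  have "pln (a + k) - pln a = pln (k * (t + 1)) - pln (k * t)" using k by (simp add: t_def distrib_left)
  also have "\<dots> = k * (ln (k\<^sup>2) + (pln (t + 1) - pln t))" unfolding pln_scale by (simp add: algebra_simps)
  finally have e: "\<bar>pln (a + k) - pln a\<bar> = \<bar>k\<bar> * \<bar>2 * ln \<bar>k\<bar> + (pln (t + 1) - pln t)\<bar>" by (simp add: abs_mult ln_sq)
  have "1 + \<bar>t\<bar> = (\<bar>k\<bar> + \<bar>a\<bar>) / \<bar>k\<bar>" using k by (simp add: t_def abs_divide field_simps)
  then have "ln (1 + \<bar>t\<bar>) = ln (\<bar>k\<bar> + \<bar>a\<bar>) - ln \<bar>k\<bar>" using k by (simp add: ln_div add_pos_nonneg)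
  also have "ln (\<bar>k\<bar> + \<bar>a\<bar>) \<le> ln (K * (2 * max 1 \<bar>k\<bar>))"
  proof -
    have "\<bar>k\<bar> * 1 \<le> max 1 \<bar>k\<bar> * K" "1 * \<bar>a\<bar> \<le> max 1 \<bar>k\<bar> * K" using K a by (intro mult_mono; simp)+
    then have "\<bar>k\<bar> + \<bar>a\<bar> \<le> K * (2 * max 1 \<bar>k\<bar>)" by (simp add: mult.commute)
    then show ?thesis using k by (intro ln_mono) auto
  qed
  also have "ln (K * (2 * max 1 \<bar>k\<bar>)) = ln K + (ln 2 + ln (max 1 \<bar>k\<bar>))" using K by (simp add: ln_mult)
  also have "ln (max 1 \<bar>k\<bar>) \<le> l" by (auto simp: l_def max_def)
  also have "ln (2::real) \<le> 1" using ln_le_minus_one[of 2] by simp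
  finally have "ln (1 + \<bar>t\<bar>) \<le> ln K + (1 + l) - ln \<bar>k\<bar>" by simp
  then have "ln (1 + \<bar>t\<bar>) \<le> ln K + 1 + 2 * l" by (simp add: l_def)
  then have "\<bar>2 * ln \<bar>k\<bar> + (pln (t + 1) - pln t)\<bar> \<le> 62 + 2 * ln K + 6 * l"
    using pln_unit_step[of t] l_def by linarith
  also have "\<dots> \<le> (62 + 2 * ln K) * (1 + l)"
  proof -
    have "6 * l \<le> (62 + 2 * ln K) * l" using lK by (intro mult_right_mono) (auto simp: l_def)
    then show ?thesis by (simp add: distrib_left)
  qed
  finally show ?thesis unfolding e l_def[symmetric] by (simp add: mult.left_commute mult_left_mono)
qed

lemma abs_ln_growth_mono:
  fixes x y :: real
  assumes "0 < x" "x \<le> y"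
  shows "x * (1 + \<bar>ln x\<bar>) \<le> 2 * (y * (1 + \<bar>ln y\<bar>))"
proof (cases "x \<ge> 1")
  case True
  then have "1 + \<bar>ln x\<bar> \<le> 1 + \<bar>ln y\<bar>" using assms by simp
  then have "x * (1 + \<bar>ln x\<bar>) \<le> y * (1 + \<bar>ln y\<bar>)" using assms by (intro mult_mono) auto
  moreover have "0 \<le> y * (1 + \<bar>ln y\<bar>)" using assms by simp
  ultimately show ?thesis by linarith
next
  case False
  have y: "y > 0" using assms by simp
  have "ln (y / x) \<le> y / x" using ln_le_minus_one[of "y / x"] assms y by simp
  then have "x * ln (y / x) \<le> x * (y / x)" using assms by (intro mult_left_mono) auto
  then have 1: "x * ln (y / x) \<le> y" using assms by simp
  have "- ln x = ln (y / x) + - ln y" using assms y by (simp add: ln_div)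
  then have "x * (- ln x) = x * ln (y / x) + x * (- ln y)" by (simp only: distrib_left)
  also have "x * (- ln y) \<le> x * \<bar>ln y\<bar>" using assms by (intro mult_left_mono) auto
  also have "x * \<bar>ln y\<bar> \<le> y * \<bar>ln y\<bar>" using assms by (intro mult_right_mono) auto
  finally have "x * (- ln x) \<le> y + y * \<bar>ln y\<bar>" using 1 by linarith
  moreover have "\<bar>ln x\<bar> = - ln x" using False assms by simp
  moreover have "0 \<le> y * \<bar>ln y\<bar>" using y by simp
  moreover have "x * (1 + \<bar>ln x\<bar>) = x + x * \<bar>ln x\<bar>" "2 * (y * (1 + \<bar>ln y\<bar>)) = 2 * y + 2 * (y * \<bar>ln y\<bar>)"
    by (simp_all add: distrib_left)
  ultimately show ?thesis using assms by (simp only:)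
qed

lemma ent_has_derivative: "(ent has_real_derivative (2 * (pln s + s))) (at s)"
proof (cases "s = 0")
  case False
  moreover have "0 < s * s" using False by (metis not_real_square_gt_zero)
  ultimately show ?thesis unfolding ent_def pln_def
    by (auto intro!: derivative_eq_intros simp: power2_eq_square field_simps)
next
  case True
  have "((\<lambda>h. ent h / h) \<longlongrightarrow> 0) (at 0)"
  proof (rule Lim_null_comparison)
    have "((\<lambda>h. 6 * sqrt \<bar>h\<bar>) \<longlongrightarrow> 6 * sqrt \<bar>0\<bar>) (at (0::real))" by (intro tendsto_intros)
    then show "((\<lambda>h. 6 * sqrt \<bar>h\<bar>) \<longlongrightarrow> 0) (at (0::real))" by simp
    have "eventually (\<lambda>h::real. h \<noteq> 0 \<and> \<bar>h\<bar> < 1) (at 0)"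
      unfolding eventually_at by (intro exI[of _ 1]) (auto simp: dist_real_def)
    then show "eventually (\<lambda>h. norm (ent h / h) \<le> 6 * sqrt \<bar>h\<bar>) (at 0)"
    proof eventually_elim
      case (elim h)
      have l: "ln \<bar>h\<bar> \<le> 0" using elim by simp
      define r where "r = - ln \<bar>h\<bar>"
      have "max 0 (- ln \<bar>h\<bar>) = r" using l by (simp add: r_def)
      then have k: "Psi_factor \<bar>h\<bar> = \<bar>h\<bar> * (\<bar>h\<bar> * (1 + r))" by (simp only: Psi_factor_def power2_eq_square mult.assoc)
      have "\<bar>h\<bar> * (\<bar>h\<bar> * (- ln \<bar>h\<bar>)) \<le> Psi_factor \<bar>h\<bar>"
        unfolding k r_def[symmetric] by (intro mult_left_mono) auto
      also have "\<dots> \<le> \<bar>h\<bar> * (3 * sqrt \<bar>h\<bar>)" using elim by (intro Psi_factor_small) auto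
      finally have "\<bar>h\<bar> * (- ln \<bar>h\<bar>) \<le> 3 * sqrt \<bar>h\<bar>" using elim by (metis mult_le_cancel_left_pos zero_less_abs_iff)
      moreover have "norm (ent h / h) = 2 * (\<bar>h\<bar> * (- ln \<bar>h\<bar>))"
        using elim l by (simp add: ent_eq power2_eq_square abs_mult abs_of_nonpos)
      ultimately show ?case by linarith
    qed
  qed
  then show ?thesis using True by (simp add: DERIV_def pln_def)
qed

text \<open>The remainder is of order \<open>h\<^sup>2 (1 + \<bar>ln \<bar>h\<bar>\<bar>)\<close>, uniformly for bounded \<open>w\<close>. On the right it is
  split into \<open>Psi h\<close>, which the modular controls, and a part that is present only for \<open>\<bar>h\<bar> > 1\<close>.\<close>
lemma ent_taylor_bound:
  assumes w: "\<bar>w\<bar> \<le> K" and K: "K \<ge> 1"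
  shows "\<bar>ent (w + h) - ent w - 2 * (pln w + w) * h\<bar> \<le> (252 + 8 * ln K) * (Psi h + max 0 (ent h) / 2)"
proof (cases "h = 0")
  case False
  define D where "D = 62 + 2 * ln K"
  have D: "D \<ge> 0" using K by (simp add: D_def)
  have "\<exists>z>0. z < 1 \<and> ent (w + 1 * h) - ent (w + 0 * h) = (1 - 0) * (h * (2 * (pln (w + z * h) + (w + z * h))))"
  proof (rule MVT2[where f="\<lambda>t. ent (w + t * h)"])
    fix t :: real
    have "((\<lambda>t. w + t * h) has_real_derivative h) (at t)" by (auto intro!: derivative_eq_intros)
    from DERIV_chain2[OF ent_has_derivative this]
    show "((\<lambda>t. ent (w + t * h)) has_real_derivative h * (2 * (pln (w + t * h) + (w + t * h)))) (at t)" by (simp add: mult.commute)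
  qed simp
  then obtain z where z: "0 < z" "z < 1" "ent (w + h) - ent w = h * (2 * (pln (w + z * h) + (w + z * h)))" by auto
  define k where "k = z * h"
  have k: "k \<noteq> 0" "\<bar>k\<bar> \<le> \<bar>h\<bar>" using z False by (auto simp: k_def abs_mult mult_left_le_one_le)
  have "ent (w + h) - ent w - 2 * (pln w + w) * h = h * (2 * (pln (w + k) - pln w) + 2 * k)"
    unfolding z(3) k_def[symmetric] by (simp add: algebra_simps)
  then have "\<bar>ent (w + h) - ent w - 2 * (pln w + w) * h\<bar> = \<bar>h\<bar> * \<bar>2 * (pln (w + k) - pln w) + 2 * k\<bar>" by (simp add: abs_mult)
  also have "\<dots> \<le> \<bar>h\<bar> * ((2 * D + 2) * (2 * (\<bar>h\<bar> * (1 + \<bar>ln \<bar>h\<bar>\<bar>))))"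
  proof (rule mult_left_mono)
    define g where "g = \<bar>k\<bar> * (1 + \<bar>ln \<bar>k\<bar>\<bar>)"
    have 1: "\<bar>k\<bar> \<le> g" unfolding g_def using mult_left_mono[of 1 "1 + \<bar>ln \<bar>k\<bar>\<bar>" "\<bar>k\<bar>"] by simp
    have 2: "\<bar>pln (w + k) - pln w\<bar> \<le> D * g"
      using pln_diff_le[OF w K k(1)] unfolding D_def g_def .
    have "\<bar>2 * (pln (w + k) - pln w) + 2 * k\<bar> \<le> 2 * \<bar>pln (w + k) - pln w\<bar> + 2 * \<bar>k\<bar>"
      using abs_triangle_ineq[of "2 * (pln (w + k) - pln w)" "2 * k"] by (simp only: abs_mult abs_numeral)
    also have "\<dots> \<le> 2 * (D * g) + 2 * g" using 1 2 by (intro add_mono mult_left_mono) auto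
    also have "\<dots> = (2 * D + 2) * g" by (simp add: algebra_simps)
    also have "\<dots> \<le> (2 * D + 2) * (2 * (\<bar>h\<bar> * (1 + \<bar>ln \<bar>h\<bar>\<bar>)))"
      unfolding g_def using abs_ln_growth_mono[of "\<bar>k\<bar>" "\<bar>h\<bar>"] k D by (intro mult_left_mono) auto
    finally show "\<bar>2 * (pln (w + k) - pln w) + 2 * k\<bar> \<le> (2 * D + 2) * (2 * (\<bar>h\<bar> * (1 + \<bar>ln \<bar>h\<bar>\<bar>)))" .
  qed simp
  also have "\<dots> = (4 * D + 4) * (h\<^sup>2 * (1 + \<bar>ln \<bar>h\<bar>\<bar>))"
  proof -
    have "a * ((2 * D + 2) * (2 * (a * (1 + b)))) = (4 * D + 4) * (a\<^sup>2 * (1 + b))" for a b :: real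
      by (simp add: power2_eq_square algebra_simps)
    from this[of "\<bar>h\<bar>" "\<bar>ln \<bar>h\<bar>\<bar>"] show ?thesis by simp
  qed
  also have "h\<^sup>2 * (1 + \<bar>ln \<bar>h\<bar>\<bar>) = Psi h + max 0 (ent h) / 2"
  proof (cases "ln \<bar>h\<bar> \<ge> 0")
    case True
    then have "max 0 (ent h) = 2 * h\<^sup>2 * ln \<bar>h\<bar>" by (simp add: ent_eq)
    then show ?thesis using True by (simp add: Psi_def distrib_left)
  next
    case False
    then have "max 0 (ent h) = 0" by (simp add: ent_eq mult_nonneg_nonpos)
    then show ?thesis using False by (simp add: Psi_def)
  qed
  finally show ?thesis by (simp add: D_def)
qed simp

text \<open>For functions of small mass the logarithmic Sobolev inequality bounds the entropy, in
  particular its superquadratic part, by the Dirichlet integral.\<close>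
lemma EntI_le_Dir:
  fixes \<Omega> :: "'a::euclidean_space set"
  assumes d: "0 < \<delta>" "\<delta> < exp (-2)" and \<Omega>: "open \<Omega>" and h: "h \<in> X \<delta> \<Omega>" and m: "Mass \<Omega> h \<le> 1"
  shows "EntI \<Omega> h \<le> Dir \<Omega> h"
proof -
  note H = X_facts[OF d \<Omega> h]
  have "EntI \<Omega> h + (1 + ln pi / 2) * DIM('a) * Mass \<Omega> h \<le> Dir \<Omega> h + Mass \<Omega> h * ln (Mass \<Omega> h)"
    by (rule H10_log_sobolev(2)[OF \<Omega> H(1,5)])
  moreover have "Mass \<Omega> h * ln (Mass \<Omega> h) \<le> 0"
    using Mass_nonneg[of \<Omega> h] m by (cases "Mass \<Omega> h = 0") (auto intro: mult_nonneg_nonpos)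
  moreover have "0 \<le> (1 + ln pi / 2) * DIM('a) * Mass \<Omega> h"
    using Mass_nonneg[of \<Omega> h] pi_ge_two by (intro mult_nonneg_nonneg) auto
  ultimately show ?thesis by linarith
qed

definition energy_density :: "'a::euclidean_space set \<Rightarrow> ('a \<Rightarrow> real) \<Rightarrow> 'a \<Rightarrow> real" where
  "energy_density \<Omega> u x = (norm (weak_gradient \<Omega> u x))\<^sup>2 / 2 + (u x)\<^sup>2 - ent (u x) / 2"

lemma energy_eq_integral_density:
  fixes \<Omega> :: "'a::euclidean_space set"
  assumes d: "0 < \<delta>" "\<delta> < exp (-2)" and \<Omega>: "open \<Omega>" and u: "finite_energy \<Omega> u"
  shows "set_integrable lebesgue \<Omega> (energy_density \<Omega> u)" "energy \<delta> \<Omega> u = (LINT x:\<Omega>|lebesgue. energy_density \<Omega> u x)"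
proof -
  have uH: "u \<in> H1 \<Omega>" and e: "set_integrable lebesgue \<Omega> (\<lambda>x. ent (u x))" using u by (auto simp: finite_energy_def)
  note i = H1D(2,3)[OF \<Omega> uH]
  show "set_integrable lebesgue \<Omega> (energy_density \<Omega> u)" unfolding energy_density_def using i e by (intro set_integral_diff(1) set_integral_add(1)) auto
  show "energy \<delta> \<Omega> u = (LINT x:\<Omega>|lebesgue. energy_density \<Omega> u x)"
  proof -
    have a: "set_integrable lebesgue \<Omega> (\<lambda>x. (norm (weak_gradient \<Omega> u x))\<^sup>2 / 2)" "set_integrable lebesgue \<Omega> (\<lambda>x. ent (u x) / 2)"
      using i e by auto
    show ?thesis unfolding energy_eq_entropy[OF d \<Omega> u] energy_density_def Dir_def Mass_def
      by (simp add: set_integral_diff(2)[OF set_integral_add(1)[OF a(1) i(2)] a(2)] set_integral_add(2)[OF a(1) i(2)])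
  qed
qed

text \<open>The integrand of the weak form of the equation for \<open>w\<close>, tested with \<open>v\<close>.\<close>
definition derivative_density :: "'a::euclidean_space set \<Rightarrow> ('a \<Rightarrow> real) \<Rightarrow> ('a \<Rightarrow> real) \<Rightarrow> 'a \<Rightarrow> real" where
  "derivative_density \<Omega> w v x = weak_gradient \<Omega> w x \<bullet> weak_gradient \<Omega> v x + 2 * w x * v x - (pln (w x) + w x) * v x"

lemma set_integral_cong_AE_integrable:
  fixes F G :: "'a::euclidean_space \<Rightarrow> real"
  assumes "set_integrable lebesgue \<Omega> F" "set_integrable lebesgue \<Omega> G" "AE x in lebesgue. x \<in> \<Omega> \<longrightarrow> F x = G x"
  shows "(LINT x:\<Omega>|lebesgue. F x) = (LINT x:\<Omega>|lebesgue. G x)"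
  unfolding set_lebesgue_integral_def
proof (rule integral_cong_AE)
  show "AE x in lebesgue. indicator \<Omega> x *\<^sub>R F x = indicator \<Omega> x *\<^sub>R G x"
    using assms(3) by eventually_elim (auto simp: indicator_def)
qed (use assms(1,2) in \<open>auto simp: set_integrable_def\<close>)

text \<open>A test function \<open>w\<close> is bounded, so \<open>ent_taylor_bound\<close> holds with one constant. The remainder
  of the energy at an increment \<open>h\<close> consists of the quadratic terms of \<open>h\<close> and the integral of
  the Taylor remainder of \<open>ent\<close>. The latter is at most a multiple of \<open>PsiI \<Omega> h\<close>, which is of
  smaller order than the Luxemburg norm of \<open>h\<close>, and of \<open>EntI \<Omega> h\<close>, which \<open>EntI_le_Dir\<close> bounds by
  the square of the norm.\<close>
lemma test_energy_derivative:
  fixes \<Omega> :: "'a::euclidean_space set"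
  assumes d: "0 < \<delta>" "\<delta> < exp (-2)" and \<Omega>: "open \<Omega>" and w: "w \<in> test_functions \<Omega>"
  shows "has_energy_derivative \<delta> \<Omega> w (\<lambda>v. LINT x:\<Omega>|lebesgue. derivative_density \<Omega> w v x)"
proof -
  obtain K where K: "compact K" "K \<subseteq> \<Omega>" "smooth_on w UNIV" "\<And>x. x \<notin> K \<Longrightarrow> w x = 0"
    using test_functionsE[OF w] by metis
  have wX: "w \<in> X \<delta> \<Omega>" by (rule test_X[OF d \<Omega> w])
  note W = X_facts[OF d \<Omega> wX] note WH = H1D[OF \<Omega> W(2)]
  obtain B0 where B0: "\<And>x. \<bar>w x\<bar> \<le> B0" using bounded_if_compact_support[OF smooth_on_imp_continuous[OF K(3)] K(1,4)] by metis
  define B where "B = max 1 B0"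
  have B: "B \<ge> 1" "\<And>x. \<bar>w x\<bar> \<le> B" using B0 by (auto simp: B_def le_max_iff_disj)
  define q where "q x = pln (w x) + w x" for x
  define Cq where "Cq = 2 + B ^ 3 + B"
  have qb: "\<bar>q x\<bar> \<le> Cq" for x
  proof -
    have "\<bar>w x\<bar> ^ 3 \<le> B ^ 3" using B by (intro power_mono) auto
    then show ?thesis using abs_pln_le[of "w x"] B(2)[of x] unfolding q_def Cq_def by linarith
  qed
  have qm: "q \<in> borel_measurable borel" unfolding q_def pln_def using borel_if_continuous[OF smooth_on_imp_continuous[OF K(3)]] by measurable
  have Kfin: "set_integrable lebesgue \<Omega> (indicator K :: 'a \<Rightarrow> real)"
  proof -
    have "integrable lborel (\<lambda>x. indicator K x *\<^sub>R (1::real))" by (rule borel_integrable_compact[OF K(1)]) simp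
    then have "integrable lebesgue (\<lambda>x. indicator K x *\<^sub>R (1::real))" by (subst integrable_completion) auto
    moreover have "(\<lambda>x. indicator \<Omega> x *\<^sub>R (indicator K x :: real)) = (\<lambda>x. indicator K x *\<^sub>R (1::real))"
      using K(2) by (auto simp: fun_eq_iff indicator_def)
    ultimately show ?thesis by (simp add: set_integrable_def)
  qed
  have \<Omega>m: "\<Omega> \<in> sets lebesgue" using \<Omega> by auto
  have indm: "(\<lambda>x. indicator \<Omega> x *\<^sub>R q x) \<in> borel_measurable lebesgue"
    using \<Omega> qm by (intro measurable_lebesgueI borel_measurable_scaleR borel_measurable_indicator) auto
  have q2: "set_integrable lebesgue \<Omega> (\<lambda>x. (q x)\<^sup>2)"
  proof (rule set_integrable_dominated[where G="\<lambda>x. Cq\<^sup>2 * indicator K x"])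
    show "set_integrable lebesgue \<Omega> (\<lambda>x. Cq\<^sup>2 * indicator K x)" using Kfin by simp
    show "(\<lambda>x. indicator \<Omega> x *\<^sub>R (q x)\<^sup>2) \<in> borel_measurable lebesgue"
      by (rule measurable_comp_indicator[OF indm, of "\<lambda>s. s\<^sup>2"]) auto
    fix x
    show "\<bar>(q x)\<^sup>2\<bar> \<le> Cq\<^sup>2 * indicator K x"
    proof (cases "x \<in> K")
      case True
      have "\<bar>q x\<bar> \<le> \<bar>Cq\<bar>" using qb[of x] by linarith
      then show ?thesis using True by (simp add: abs_le_square_iff)
    qed (simp add: q_def K(4) pln_def)
  qed
  let ?F = "derivative_density \<Omega> w"
  \<comment> \<open>The free parameter \<open>s\<close> turns this into a bound linear in the norm of \<open>v\<close> when \<open>s\<close>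
      is chosen as that norm.\<close>
  have pwF: "\<bar>?F v x\<bar> \<le> s / 2 * ((norm (weak_gradient \<Omega> w x))\<^sup>2 + 2 * (w x)\<^sup>2 + (q x)\<^sup>2) + 1 / (2 * s) * ((norm (weak_gradient \<Omega> v x))\<^sup>2 + 3 * (v x)\<^sup>2)"
    if s: "s > 0" for s v x
  proof -
    have y: "\<bar>a * b\<bar> \<le> s / 2 * a\<^sup>2 + 1 / (2 * s) * b\<^sup>2" for a b
    proof -
      have "0 \<le> (s * \<bar>a\<bar> - \<bar>b\<bar>)\<^sup>2 / (2 * s)" using s by simp
      also have "\<dots> = s / 2 * a\<^sup>2 + 1 / (2 * s) * b\<^sup>2 - \<bar>a * b\<bar>" using s by (simp add: power2_eq_square field_simps abs_mult)
      finally show ?thesis by simp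
    qed
    have "\<bar>weak_gradient \<Omega> w x \<bullet> weak_gradient \<Omega> v x\<bar> \<le> \<bar>norm (weak_gradient \<Omega> w x) * norm (weak_gradient \<Omega> v x)\<bar>"
      using Cauchy_Schwarz_ineq2[of "weak_gradient \<Omega> w x" "weak_gradient \<Omega> v x"] by simp
    also have "\<dots> \<le> s / 2 * (norm (weak_gradient \<Omega> w x))\<^sup>2 + 1 / (2 * s) * (norm (weak_gradient \<Omega> v x))\<^sup>2" by (rule y)
    finally have "\<bar>?F v x\<bar> \<le> s / 2 * (norm (weak_gradient \<Omega> w x))\<^sup>2 + 1 / (2 * s) * (norm (weak_gradient \<Omega> v x))\<^sup>2
       + 2 * (s / 2 * (w x)\<^sup>2 + 1 / (2 * s) * (v x)\<^sup>2) + (s / 2 * (q x)\<^sup>2 + 1 / (2 * s) * (v x)\<^sup>2)"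
    proof -
      assume a: "\<bar>weak_gradient \<Omega> w x \<bullet> weak_gradient \<Omega> v x\<bar> \<le> s / 2 * (norm (weak_gradient \<Omega> w x))\<^sup>2 + 1 / (2 * s) * (norm (weak_gradient \<Omega> v x))\<^sup>2"
      have t: "\<bar>a + 2 * b - c\<bar> \<le> \<bar>a\<bar> + 2 * \<bar>b\<bar> + \<bar>c\<bar>" for a b c :: real by linarith
      have "\<bar>?F v x\<bar> \<le> \<bar>weak_gradient \<Omega> w x \<bullet> weak_gradient \<Omega> v x\<bar> + 2 * \<bar>w x * v x\<bar> + \<bar>q x * v x\<bar>"
        unfolding derivative_density_def q_def[symmetric] mult.assoc by (rule t)
      also have "\<dots> \<le> s / 2 * (norm (weak_gradient \<Omega> w x))\<^sup>2 + 1 / (2 * s) * (norm (weak_gradient \<Omega> v x))\<^sup>2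
       + 2 * (s / 2 * (w x)\<^sup>2 + 1 / (2 * s) * (v x)\<^sup>2) + (s / 2 * (q x)\<^sup>2 + 1 / (2 * s) * (v x)\<^sup>2)"
        by (intro add_mono mult_left_mono a y) auto
      finally show ?thesis .
    qed
    then show ?thesis by (simp only: distrib_left mult.left_commute)
  qed
  have Fi: "set_integrable lebesgue \<Omega> (?F v)" if v: "v \<in> H1 \<Omega>" for v
  proof (rule set_integrable_dominated)
    note V = H1D[OF \<Omega> v]
    show "set_integrable lebesgue \<Omega> (\<lambda>x. 1 / 2 * ((norm (weak_gradient \<Omega> w x))\<^sup>2 + 2 * (w x)\<^sup>2 + (q x)\<^sup>2) + 1 / (2 * 1) * ((norm (weak_gradient \<Omega> v x))\<^sup>2 + 3 * (v x)\<^sup>2))"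
      using WH(2,3) q2 V(2,3) by (intro set_integral_add(1) set_integrable_mult_right) auto
    have "(\<lambda>x. indicator \<Omega> x *\<^sub>R ?F v x) = (\<lambda>x. (indicator \<Omega> x *\<^sub>R weak_gradient \<Omega> w x) \<bullet> (indicator \<Omega> x *\<^sub>R weak_gradient \<Omega> v x)
       + 2 * (indicator \<Omega> x *\<^sub>R w x) * (indicator \<Omega> x *\<^sub>R v x) - (indicator \<Omega> x *\<^sub>R q x) * (indicator \<Omega> x *\<^sub>R v x))"
      by (auto simp: fun_eq_iff indicator_def derivative_density_def q_def)
    then show "(\<lambda>x. indicator \<Omega> x *\<^sub>R ?F v x) \<in> borel_measurable lebesgue"
      by (simp only:) (intro borel_measurable_diff borel_measurable_add borel_measurable_inner borel_measurable_times borel_measurable_const WH(4,5) V(4,5) indm)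
    show "\<bar>?F v x\<bar> \<le> 1 / 2 * ((norm (weak_gradient \<Omega> w x))\<^sup>2 + 2 * (w x)\<^sup>2 + (q x)\<^sup>2) + 1 / (2 * 1) * ((norm (weak_gradient \<Omega> v x))\<^sup>2 + 3 * (v x)\<^sup>2)" for x
      using pwF[of 1 v x] by simp
  qed
  define Q where "Q = (LINT x:\<Omega>|lebesgue. (q x)\<^sup>2)"
  define A where "A = Dir \<Omega> w + 2 * Mass \<Omega> w + Q"
  have Q0: "Q \<ge> 0" unfolding Q_def set_lebesgue_integral_def by (intro integral_nonneg_AE AE_I2) simp
  have A0: "A \<ge> 0" using Dir_nonneg[of \<Omega> w] Mass_nonneg[of \<Omega> w] Q0 by (simp add: A_def)
  have Fb: "\<bar>LINT x:\<Omega>|lebesgue. ?F v x\<bar> \<le> s / 2 * A + 1 / s * (H_norm \<Omega> v)\<^sup>2" if v: "v \<in> H1 \<Omega>" and s: "s > 0" for v s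
  proof -
    note V = H1D[OF \<Omega> v]
    have "\<bar>LINT x:\<Omega>|lebesgue. ?F v x\<bar> \<le> (LINT x:\<Omega>|lebesgue. s / 2 * ((norm (weak_gradient \<Omega> w x))\<^sup>2 + 2 * (w x)\<^sup>2 + (q x)\<^sup>2) + 1 / (2 * s) * ((norm (weak_gradient \<Omega> v x))\<^sup>2 + 3 * (v x)\<^sup>2))"
      unfolding set_lebesgue_integral_def
    proof (rule integral_abs_bound_integral)
      show "integrable lebesgue (\<lambda>x. indicator \<Omega> x *\<^sub>R ?F v x)" using Fi[OF v] by (simp add: set_integrable_def)
      have "set_integrable lebesgue \<Omega> (\<lambda>x. s / 2 * ((norm (weak_gradient \<Omega> w x))\<^sup>2 + 2 * (w x)\<^sup>2 + (q x)\<^sup>2) + 1 / (2 * s) * ((norm (weak_gradient \<Omega> v x))\<^sup>2 + 3 * (v x)\<^sup>2))"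
        using WH(2,3) q2 V(2,3) by (intro set_integral_add(1) set_integrable_mult_right) auto
      then show "integrable lebesgue (\<lambda>x. indicator \<Omega> x *\<^sub>R (s / 2 * ((norm (weak_gradient \<Omega> w x))\<^sup>2 + 2 * (w x)\<^sup>2 + (q x)\<^sup>2) + 1 / (2 * s) * ((norm (weak_gradient \<Omega> v x))\<^sup>2 + 3 * (v x)\<^sup>2)))"
        by (simp add: set_integrable_def)
      show "\<bar>indicator \<Omega> x *\<^sub>R ?F v x\<bar> \<le> indicator \<Omega> x *\<^sub>R (s / 2 * ((norm (weak_gradient \<Omega> w x))\<^sup>2 + 2 * (w x)\<^sup>2 + (q x)\<^sup>2) + 1 / (2 * s) * ((norm (weak_gradient \<Omega> v x))\<^sup>2 + 3 * (v x)\<^sup>2))" for x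
        using pwF[OF s, of v x] by (cases "x \<in> \<Omega>") auto
    qed
    also have "\<dots> = s / 2 * A + 1 / (2 * s) * (Dir \<Omega> v + 3 * Mass \<Omega> v)"
    proof -
      have "(LINT x:\<Omega>|lebesgue. s / 2 * ((norm (weak_gradient \<Omega> w x))\<^sup>2 + 2 * (w x)\<^sup>2 + (q x)\<^sup>2) + 1 / (2 * s) * ((norm (weak_gradient \<Omega> v x))\<^sup>2 + 3 * (v x)\<^sup>2))
        = s / 2 * (LINT x:\<Omega>|lebesgue. (norm (weak_gradient \<Omega> w x))\<^sup>2 + 2 * (w x)\<^sup>2 + (q x)\<^sup>2) + 1 / (2 * s) * (LINT x:\<Omega>|lebesgue. (norm (weak_gradient \<Omega> v x))\<^sup>2 + 3 * (v x)\<^sup>2)"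
        using WH(2,3) q2 V(2,3) by (subst set_integral_add(2)) (auto intro!: set_integral_add(1))
      also have "(LINT x:\<Omega>|lebesgue. (norm (weak_gradient \<Omega> w x))\<^sup>2 + 2 * (w x)\<^sup>2 + (q x)\<^sup>2) = A"
        unfolding A_def Q_def H1_quadratic[OF \<Omega> W(2), symmetric] using WH(2,3) q2 by (subst set_integral_add(2)) (auto intro!: set_integral_add(1))
      also have "(LINT x:\<Omega>|lebesgue. (norm (weak_gradient \<Omega> v x))\<^sup>2 + 3 * (v x)\<^sup>2) = Dir \<Omega> v + 3 * Mass \<Omega> v"
        unfolding Dir_def Mass_def using V(2,3) by (subst set_integral_add(2)) auto
      finally show ?thesis .
    qed
    also have "\<dots> \<le> s / 2 * A + 1 / (2 * s) * (2 * (H_norm \<Omega> v)\<^sup>2)"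
      unfolding H_norm_sq[OF \<Omega> v] using s Dir_nonneg[of \<Omega> v] Mass_nonneg[of \<Omega> v] by (intro add_left_mono mult_left_mono) auto
    finally show ?thesis by simp
  qed
  show ?thesis unfolding has_energy_derivative_def
  proof (intro conjI)
    show "\<forall>v\<in>X \<delta> \<Omega>. \<forall>w'\<in>X \<delta> \<Omega>. \<forall>a b. (LINT x:\<Omega>|lebesgue. ?F (\<lambda>x. a * v x + b * w' x) x) = a * (LINT x:\<Omega>|lebesgue. ?F v x) + b * (LINT x:\<Omega>|lebesgue. ?F w' x)"
    proof (intro ballI allI)
      fix v w' a b assume "v \<in> X \<delta> \<Omega>" "w' \<in> X \<delta> \<Omega>"
      then have v: "v \<in> H1 \<Omega>" "w' \<in> H1 \<Omega>" using X_facts(2)[OF d \<Omega>] by auto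
      note C = H1_combine[OF \<Omega> v, of a b]
      have "(LINT x:\<Omega>|lebesgue. ?F (\<lambda>x. a * v x + b * w' x) x) = (LINT x:\<Omega>|lebesgue. a * ?F v x + b * ?F w' x)"
      proof (rule set_integral_cong_AE_integrable)
        show "set_integrable lebesgue \<Omega> (\<lambda>x. a * ?F v x + b * ?F w' x)" using Fi v by (intro set_integral_add(1)) auto
        show "AE x in lebesgue. x \<in> \<Omega> \<longrightarrow> ?F (\<lambda>x. a * v x + b * w' x) x = a * ?F v x + b * ?F w' x"
          using C(2) by eventually_elim (auto simp: derivative_density_def inner_add_right algebra_simps)
      qed (rule Fi[OF C(1)])
      also have "\<dots> = a * (LINT x:\<Omega>|lebesgue. ?F v x) + b * (LINT x:\<Omega>|lebesgue. ?F w' x)"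
        using Fi v by (subst set_integral_add(2)) auto
      finally show "(LINT x:\<Omega>|lebesgue. ?F (\<lambda>x. a * v x + b * w' x) x) = a * (LINT x:\<Omega>|lebesgue. ?F v x) + b * (LINT x:\<Omega>|lebesgue. ?F w' x)" .
    qed
    show "\<exists>C. \<forall>v\<in>X \<delta> \<Omega>. \<bar>LINT x:\<Omega>|lebesgue. ?F v x\<bar> \<le> C * X_norm \<delta> \<Omega> v"
    proof (intro exI[of _ "A / 2 + 1"] ballI)
      fix v assume v: "v \<in> X \<delta> \<Omega>"
      note vH = X_facts(2)[OF d \<Omega> v]
      \<comment> \<open>If the norm vanishes, \<open>s\<close> tends to 0 instead.\<close>
      have "\<bar>LINT x:\<Omega>|lebesgue. ?F v x\<bar> \<le> (A / 2 + 1) * H_norm \<Omega> v"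
      proof (cases "H_norm \<Omega> v = 0")
        case True
        have "\<bar>LINT x:\<Omega>|lebesgue. ?F v x\<bar> \<le> 0"
        proof (rule LIMSEQ_le_const)
          have "(\<lambda>n. stp n / 2 * A) \<longlonglongrightarrow> 0 / 2 * A" by (intro tendsto_intros tendsto_stp) simp
          then show "(\<lambda>n. stp n / 2 * A) \<longlonglongrightarrow> 0" by simp
          show "\<exists>N. \<forall>n\<ge>N. \<bar>LINT x:\<Omega>|lebesgue. ?F v x\<bar> \<le> stp n / 2 * A"
            using Fb[OF vH stp_pos(1)] True by auto
        qed
        then show ?thesis using True by simp
      next
        case False
        then have p: "H_norm \<Omega> v > 0" using H_norm_nonneg[OF \<Omega> vH] by simp
        show ?thesis using Fb[OF vH p] p by (simp add: power2_eq_square algebra_simps)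
      qed
      also have "\<dots> \<le> (A / 2 + 1) * X_norm \<delta> \<Omega> v"
        unfolding X_norm_def using Luxemburg_nonneg[OF d \<Omega> v] A0 by (intro mult_left_mono) auto
      finally show "\<bar>LINT x:\<Omega>|lebesgue. ?F v x\<bar> \<le> (A / 2 + 1) * X_norm \<delta> \<Omega> v" .
    qed
    show "\<forall>\<epsilon>>0. \<exists>\<eta>>0. \<forall>h\<in>X \<delta> \<Omega>. X_norm \<delta> \<Omega> h < \<eta> \<longrightarrow>
        \<bar>energy \<delta> \<Omega> (\<lambda>x. w x + h x) - energy \<delta> \<Omega> w - (LINT x:\<Omega>|lebesgue. ?F h x)\<bar> \<le> \<epsilon> * X_norm \<delta> \<Omega> h"
    proof (intro allI impI)
      fix \<epsilon> :: real assume \<epsilon>: "\<epsilon> > 0"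
      define C where "C = 252 + 8 * ln B"
      have C: "C > 0" using B by (simp add: C_def add_pos_nonneg)
      obtain \<eta>1 where \<eta>1: "\<eta>1 > 0" "\<And>h. h \<in> X \<delta> \<Omega> \<Longrightarrow> Luxemburg_norm \<delta> \<Omega> h < \<eta>1 \<Longrightarrow> PsiI \<Omega> h \<le> (\<epsilon> / (2 * C)) * Luxemburg_norm \<delta> \<Omega> h"
        using PsiI_small[OF d \<Omega>, of "\<epsilon> / (2 * C)"] \<epsilon> C by auto
      define \<eta> where "\<eta> = min 1 (min \<eta>1 (\<epsilon> / (1 + C)))"
      have \<eta>: "\<eta> > 0" using \<eta>1 \<epsilon> C by (simp add: \<eta>_def)
      have "\<bar>energy \<delta> \<Omega> (\<lambda>x. w x + h x) - energy \<delta> \<Omega> w - (LINT x:\<Omega>|lebesgue. ?F h x)\<bar> \<le> \<epsilon> * X_norm \<delta> \<Omega> h"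
        if h: "h \<in> X \<delta> \<Omega>" and hn: "X_norm \<delta> \<Omega> h < \<eta>" for h
      proof -
        note Hh = X_facts[OF d \<Omega> h] note HH = H1D[OF \<Omega> Hh(2)]
        let ?N = "X_norm \<delta> \<Omega> h"
        have hle: "0 \<le> H_norm \<Omega> h" "0 \<le> Luxemburg_norm \<delta> \<Omega> h"
          using H_norm_nonneg[OF \<Omega> Hh(2)] Luxemburg_nonneg[OF d \<Omega> h] by auto
        have Nn: "H_norm \<Omega> h \<le> ?N" "Luxemburg_norm \<delta> \<Omega> h \<le> ?N" "0 \<le> ?N" using hle by (auto simp: X_norm_def)
        have ei: "set_integrable lebesgue \<Omega> (\<lambda>x. ent (h x))" using Hh(3) by (simp add: finite_energy_def)
        define S where "S = (\<lambda>x. w x + h x)"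
        have SH: "S \<in> H1 \<Omega>" and Sg: "AE x in lebesgue. x \<in> \<Omega> \<longrightarrow> weak_gradient \<Omega> S x = weak_gradient \<Omega> w x + weak_gradient \<Omega> h x"
          using H1_combine[OF \<Omega> W(2) Hh(2), of 1 1] by (simp_all add: S_def)
        note Sm = H1D(4)[OF \<Omega> SH]
        define \<rho> where "\<rho> x = ent (S x) - ent (w x) - 2 * q x * h x" for x
        \<comment> \<open>Here \<open>max 0 (ent h)\<close> is replaced by the larger \<open>ent h + 2 Psi h\<close>, whose
            integral is accessible.\<close>
        define M where "M x = C * (Psi (h x) + (ent (h x) + 2 * Psi (h x)) / 2)" for x
        have rb: "\<bar>\<rho> x\<bar> \<le> M x" for x
        proof -
          have "max 0 (ent (h x)) \<le> ent (h x) + 2 * Psi (h x)" using neg_ent_le_Psi[of "h x"] by linarith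
          then have "C * (Psi (h x) + max 0 (ent (h x)) / 2) \<le> M x" unfolding M_def using C by (intro mult_left_mono) auto
          then show ?thesis using ent_taylor_bound[OF B(2) B(1), of x "h x"] unfolding \<rho>_def S_def q_def C_def by linarith
        qed
        have Mi: "set_integrable lebesgue \<Omega> M"
          unfolding M_def using Hh(4) ei by (intro set_integrable_mult_right set_integral_add(1) set_integrable_divide) auto
        have qh: "set_integrable lebesgue \<Omega> (\<lambda>x. 2 * q x * h x)"
        proof (rule set_integrable_dominated[where G="\<lambda>x. (q x)\<^sup>2 + (h x)\<^sup>2"])
          show "set_integrable lebesgue \<Omega> (\<lambda>x. (q x)\<^sup>2 + (h x)\<^sup>2)" using q2 HH(3) by (intro set_integral_add(1))
          have "(\<lambda>x. indicator \<Omega> x *\<^sub>R (2 * q x * h x)) = (\<lambda>x. 2 * (indicator \<Omega> x *\<^sub>R q x) * (indicator \<Omega> x *\<^sub>R h x))"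
            by (auto simp: fun_eq_iff indicator_def)
          then show "(\<lambda>x. indicator \<Omega> x *\<^sub>R (2 * q x * h x)) \<in> borel_measurable lebesgue"
            by (simp only:) (intro borel_measurable_times borel_measurable_const indm HH(4))
          show "\<bar>2 * q x * h x\<bar> \<le> (q x)\<^sup>2 + (h x)\<^sup>2" for x
            using sum_squares_bound[of "\<bar>q x\<bar>" "\<bar>h x\<bar>"] by (simp add: abs_mult)
        qed
        have rm: "(\<lambda>x. indicator \<Omega> x *\<^sub>R \<rho> x) \<in> borel_measurable lebesgue"
        proof -
          have "(\<lambda>x. indicator \<Omega> x *\<^sub>R \<rho> x) = (\<lambda>x. indicator \<Omega> x *\<^sub>R ent (S x) - indicator \<Omega> x *\<^sub>R ent (w x) - indicator \<Omega> x *\<^sub>R (2 * q x * h x))"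
            by (auto simp: fun_eq_iff indicator_def \<rho>_def)
          then show ?thesis
            using measurable_comp_indicator[OF Sm, of ent] measurable_comp_indicator[OF WH(4), of ent] qh
            by (simp only:) (intro borel_measurable_diff, auto simp: set_integrable_def)
        qed
        have \<rho>i: "set_integrable lebesgue \<Omega> \<rho>" by (rule set_integrable_dominated[OF Mi rm rb])
        have eS: "set_integrable lebesgue \<Omega> (\<lambda>x. ent (S x))"
        proof -
          have "set_integrable lebesgue \<Omega> (\<lambda>x. \<rho> x + ent (w x) + 2 * q x * h x)"
            using \<rho>i W(3) qh by (intro set_integral_add(1)) (auto simp: finite_energy_def)
          then show ?thesis by (simp add: \<rho>_def)
        qed
        have PS: "set_integrable lebesgue \<Omega> (\<lambda>x. Psi (S x))"
        proof (rule set_integrable_dominated[where G="\<lambda>x. Psi (h x) + 4 * (w x)\<^sup>2 + 4 * (h x)\<^sup>2 + indicator K x"])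
          show "set_integrable lebesgue \<Omega> (\<lambda>x. Psi (h x) + 4 * (w x)\<^sup>2 + 4 * (h x)\<^sup>2 + indicator K x)"
            using Hh(4) WH(3) HH(3) Kfin by (intro set_integral_add(1)) auto
          show "(\<lambda>x. indicator \<Omega> x *\<^sub>R Psi (S x)) \<in> borel_measurable lebesgue"
            by (rule measurable_comp_indicator[OF Sm]) auto
          fix x
          show "\<bar>Psi (S x)\<bar> \<le> Psi (h x) + 4 * (w x)\<^sup>2 + 4 * (h x)\<^sup>2 + indicator K x"
          proof (cases "x \<in> K")
            case True
            have "\<bar>S x\<bar> \<le> (S x)\<^sup>2 + 1"
            proof -
              have "0 \<le> (\<bar>S x\<bar> - 1)\<^sup>2" by simp
              then have "2 * \<bar>S x\<bar> \<le> (S x)\<^sup>2 + 1" by (simp add: power2_diff)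
              moreover have "0 \<le> (S x)\<^sup>2 + 1" by simp
              ultimately show ?thesis by linarith
            qed
            moreover have "(S x)\<^sup>2 \<le> 2 * (w x)\<^sup>2 + 2 * (h x)\<^sup>2"
              using zero_le_power2[of "w x - h x"] by (simp add: S_def power2_eq_square algebra_simps)
            ultimately have "Psi (S x) \<le> 4 * (w x)\<^sup>2 + 4 * (h x)\<^sup>2 + 1" using Psi_le[of "S x"] by linarith
            then show ?thesis using True Psi_nonneg[of "S x"] Psi_nonneg[of "h x"] by simp
          next
            case False
            then have "S x = h x" by (simp add: S_def K(4))
            then show ?thesis using False Psi_nonneg[of "h x"] by simp
          qed
        qed
        have Sgood: "finite_energy \<Omega> S" using SH PS eS by (simp add: finite_energy_def)
        note eW = energy_eq_integral_density[OF d \<Omega> W(3)] note eS' = energy_eq_integral_density[OF d \<Omega> Sgood]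
        have R1: "set_integrable lebesgue \<Omega> (\<lambda>x. energy_density \<Omega> S x - energy_density \<Omega> w x - ?F h x)"
          by (intro set_integral_diff(1) eW(1) eS'(1) Fi Hh(2))
        have R2: "set_integrable lebesgue \<Omega> (\<lambda>x. (norm (weak_gradient \<Omega> h x))\<^sup>2 / 2 + (h x)\<^sup>2 - \<rho> x / 2)"
          using HH(2,3) \<rho>i by (intro set_integral_diff(1) set_integral_add(1)) auto
        have "energy \<delta> \<Omega> S - energy \<delta> \<Omega> w - (LINT x:\<Omega>|lebesgue. ?F h x) = (LINT x:\<Omega>|lebesgue. energy_density \<Omega> S x - energy_density \<Omega> w x - ?F h x)"
          unfolding eW(2) eS'(2)
          by (simp add: set_integral_diff(2)[OF set_integral_diff(1)[OF eS'(1) eW(1)] Fi[OF Hh(2)]] set_integral_diff(2)[OF eS'(1) eW(1)])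
        also have "\<dots> = (LINT x:\<Omega>|lebesgue. (norm (weak_gradient \<Omega> h x))\<^sup>2 / 2 + (h x)\<^sup>2 - \<rho> x / 2)"
        proof (rule set_integral_cong_AE_integrable[OF R1 R2])
          show "AE x in lebesgue. x \<in> \<Omega> \<longrightarrow> energy_density \<Omega> S x - energy_density \<Omega> w x - ?F h x = (norm (weak_gradient \<Omega> h x))\<^sup>2 / 2 + (h x)\<^sup>2 - \<rho> x / 2"
            using Sg
          proof eventually_elim
            case (elim x)
            show ?case
            proof
              assume "x \<in> \<Omega>"
              then have g: "weak_gradient \<Omega> S x = weak_gradient \<Omega> w x + weak_gradient \<Omega> h x" using elim by blast
              show "energy_density \<Omega> S x - energy_density \<Omega> w x - ?F h x = (norm (weak_gradient \<Omega> h x))\<^sup>2 / 2 + (h x)\<^sup>2 - \<rho> x / 2"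
                unfolding energy_density_def g derivative_density_def \<rho>_def q_def[symmetric] power2_norm_eq_inner
                by (simp add: S_def inner_add_left inner_add_right inner_commute power2_eq_square algebra_simps add_divide_distrib diff_divide_distrib)
            qed
          qed
        qed
        also have "\<dots> = Dir \<Omega> h / 2 + Mass \<Omega> h - (LINT x:\<Omega>|lebesgue. \<rho> x) / 2"
        proof -
          have a: "set_integrable lebesgue \<Omega> (\<lambda>x. (norm (weak_gradient \<Omega> h x))\<^sup>2 / 2)" "set_integrable lebesgue \<Omega> (\<lambda>x. \<rho> x / 2)"
            using HH(2) \<rho>i by auto
          show ?thesis unfolding Dir_def Mass_def
            by (simp add: set_integral_diff(2)[OF set_integral_add(1)[OF a(1) HH(3)] a(2)] set_integral_add(2)[OF a(1) HH(3)])
        qed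
        finally have E: "energy \<delta> \<Omega> S - energy \<delta> \<Omega> w - (LINT x:\<Omega>|lebesgue. ?F h x) = Dir \<Omega> h / 2 + Mass \<Omega> h - (LINT x:\<Omega>|lebesgue. \<rho> x) / 2" .
        have "\<bar>LINT x:\<Omega>|lebesgue. \<rho> x\<bar> \<le> (LINT x:\<Omega>|lebesgue. M x)"
          unfolding set_lebesgue_integral_def
        proof (rule integral_abs_bound_integral)
          show "\<bar>indicator \<Omega> x *\<^sub>R \<rho> x\<bar> \<le> indicator \<Omega> x *\<^sub>R M x" for x using rb[of x] by (cases "x \<in> \<Omega>") auto
        qed (use \<rho>i Mi in \<open>auto simp: set_integrable_def\<close>)
        also have "(LINT x:\<Omega>|lebesgue. M x) = C * (2 * PsiI \<Omega> h + EntI \<Omega> h / 2)"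
        proof -
          have "M x = C * (2 * Psi (h x) + ent (h x) / 2)" for x by (simp add: M_def algebra_simps add_divide_distrib)
          then show ?thesis using Hh(4) ei by (simp add: set_integral_add(2))
        qed
        finally have rI: "\<bar>LINT x:\<Omega>|lebesgue. \<rho> x\<bar> \<le> C * (2 * PsiI \<Omega> h + EntI \<Omega> h / 2)" .
        have "(H_norm \<Omega> h)\<^sup>2 \<le> ?N\<^sup>2" using Nn hle by (intro power_mono) auto
        then have DM: "Dir \<Omega> h + 2 * Mass \<Omega> h \<le> ?N\<^sup>2" using H_norm_sq[OF \<Omega> Hh(2)] by simp
        have N1: "?N \<le> 1" "?N < \<eta>1" "?N \<le> \<epsilon> / (1 + C)" using hn by (auto simp: \<eta>_def)
        have "?N\<^sup>2 \<le> 1" using N1 Nn by (simp add: power_le_one)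
        then have "Mass \<Omega> h \<le> 1" using DM Dir_nonneg[of \<Omega> h] Mass_nonneg[of \<Omega> h] by linarith
        then have "EntI \<Omega> h \<le> Dir \<Omega> h" by (rule EntI_le_Dir[OF d \<Omega> h])
        then have En: "EntI \<Omega> h \<le> ?N\<^sup>2" using DM Mass_nonneg[of \<Omega> h] by linarith
        have Pn: "PsiI \<Omega> h \<le> (\<epsilon> / (2 * C)) * ?N"
        proof -
          have "PsiI \<Omega> h \<le> (\<epsilon> / (2 * C)) * Luxemburg_norm \<delta> \<Omega> h" using \<eta>1(2)[OF h] Nn N1 by linarith
          also have "\<dots> \<le> (\<epsilon> / (2 * C)) * ?N" using Nn \<epsilon> C by (intro mult_left_mono) auto
          finally show ?thesis .
        qed
        have "C * (2 * PsiI \<Omega> h + EntI \<Omega> h / 2) \<le> C * (2 * ((\<epsilon> / (2 * C)) * ?N) + ?N\<^sup>2 / 2)"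
          using Pn En C by (intro mult_left_mono) auto
        also have "\<dots> = \<epsilon> * ?N + C * ?N\<^sup>2 / 2" using C by (simp add: field_simps)
        finally have r2: "\<bar>LINT x:\<Omega>|lebesgue. \<rho> x\<bar> \<le> \<epsilon> * ?N + C * ?N\<^sup>2 / 2" using rI by linarith
        have "?N\<^sup>2 * (1 + C) \<le> \<epsilon> * ?N"
        proof -
          have "?N * (1 + C) \<le> \<epsilon>" using N1(3) C by (simp add: pos_le_divide_eq)
          then have "?N * (?N * (1 + C)) \<le> ?N * \<epsilon>" using Nn by (intro mult_left_mono) auto
          then show ?thesis by (simp add: power2_eq_square mult_ac)
        qed
        then have "?N\<^sup>2 + C * ?N\<^sup>2 \<le> \<epsilon> * ?N" by (simp add: algebra_simps)
        moreover have "0 \<le> C * ?N\<^sup>2" using C by simp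
        ultimately have "\<bar>energy \<delta> \<Omega> S - energy \<delta> \<Omega> w - (LINT x:\<Omega>|lebesgue. ?F h x)\<bar> \<le> \<epsilon> * ?N"
          unfolding E using r2 DM Dir_nonneg[of \<Omega> h] Mass_nonneg[of \<Omega> h] by linarith
        then show ?thesis by (simp add: S_def)
      qed
      then show "\<exists>\<eta>>0. \<forall>h\<in>X \<delta> \<Omega>. X_norm \<delta> \<Omega> h < \<eta> \<longrightarrow>
        \<bar>energy \<delta> \<Omega> (\<lambda>x. w x + h x) - energy \<delta> \<Omega> w - (LINT x:\<Omega>|lebesgue. ?F h x)\<bar> \<le> \<epsilon> * X_norm \<delta> \<Omega> h"
        using \<eta> by blast
    qed
  qed
qed

text \<open>The entropy density is homogeneous of degree 2 up to a logarithmic term proportional to \<open>u\<^sup>2\<close>.\<close>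
lemma energy_scale:
  fixes \<Omega> :: "'a::euclidean_space set"
  assumes d: "0 < \<delta>" "\<delta> < exp (-2)" and \<Omega>: "open \<Omega>" and u: "u \<in> X \<delta> \<Omega>" and t: "t > 0"
  shows "Dir \<Omega> (\<lambda>x. t * u x) = t\<^sup>2 * Dir \<Omega> u" "Mass \<Omega> (\<lambda>x. t * u x) = t\<^sup>2 * Mass \<Omega> u"
    "EntI \<Omega> (\<lambda>x. t * u x) = t\<^sup>2 * (EntI \<Omega> u + ln (t\<^sup>2) * Mass \<Omega> u)"
    "energy \<delta> \<Omega> (\<lambda>x. t * u x) = t\<^sup>2 * (energy \<delta> \<Omega> u - ln t * Mass \<Omega> u)"
proof -
  note U = X_facts[OF d \<Omega> u] and T = X_facts[OF d \<Omega> X_scale(1)[OF d \<Omega> u t]]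
  show M: "Mass \<Omega> (\<lambda>x. t * u x) = t\<^sup>2 * Mass \<Omega> u" by (simp add: Mass_def power_mult_distrib)
  show D: "Dir \<Omega> (\<lambda>x. t * u x) = t\<^sup>2 * Dir \<Omega> u" by (rule Dir_scale[OF \<Omega> U(2)])
  have e: "ent (t * s) = t\<^sup>2 * ent s + (t\<^sup>2 * ln (t\<^sup>2)) * s\<^sup>2" for s
    using t by (cases "s = 0") (auto simp: ent_def power_mult_distrib ln_mult algebra_simps)
  show E: "EntI \<Omega> (\<lambda>x. t * u x) = t\<^sup>2 * (EntI \<Omega> u + ln (t\<^sup>2) * Mass \<Omega> u)"
    unfolding e Mass_def using U(3) H1D(3)[OF \<Omega> U(2)]
    by (subst set_integral_add(2)) (auto simp: finite_energy_def algebra_simps)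
  show "energy \<delta> \<Omega> (\<lambda>x. t * u x) = t\<^sup>2 * (energy \<delta> \<Omega> u - ln t * Mass \<Omega> u)"
    unfolding energy_eq_entropy[OF d \<Omega> U(3)] energy_eq_entropy[OF d \<Omega> T(3)] D M E using t
    by (simp add: ln_sq algebra_simps add_divide_distrib diff_divide_distrib)
qed

text \<open>The derivative of \<open>t \<mapsto> energy (t u)\<close> at \<open>t = 1\<close> is \<open>2 energy u - Mass u\<close> by the scaling
  formula, and equals \<open>L u\<close>.\<close>
lemma Nehari_energy:
  fixes \<Omega> :: "'a::euclidean_space set"
  assumes d: "0 < \<delta>" "\<delta> < exp (-2)" and \<Omega>: "open \<Omega>" and u: "u \<in> X \<delta> \<Omega>" and L: "has_energy_derivative \<delta> \<Omega> u L" "L u = 0"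
  shows "2 * energy \<delta> \<Omega> u = Mass \<Omega> u"
proof -
  obtain C where C: "C \<ge> 0" "\<And>t. t > 0 \<Longrightarrow> X_norm \<delta> \<Omega> (\<lambda>x. t * u x) \<le> C * t" using X_scale(2)[OF d \<Omega> u zero_less_one] by blast
  define e where "e = energy \<delta> \<Omega> u" define m where "m = Mass \<Omega> u"
  define f where "f t = (1 + t)\<^sup>2 * (e - ln (1 + t) * m)" for t
  have "(f has_real_derivative (2 * e - m)) (at 0)"
    unfolding f_def by (auto intro!: derivative_eq_intros)
  then have "((\<lambda>t. (f t - e) / t) \<longlongrightarrow> 2 * e - m) (at 0)" by (simp add: DERIV_def f_def)
  moreover have "filterlim stp (at 0) sequentially" using tendsto_stp by (auto simp: filterlim_at)
  ultimately have lim: "(\<lambda>n. (f (stp n) - e) / stp n) \<longlonglongrightarrow> 2 * e - m" by (rule filterlim_compose)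
  have Lt: "L (\<lambda>x. t * u x) = 0" for t
  proof -
    have "L (\<lambda>x. t * u x + 0 * u x) = t * L u + 0 * L u" using L(1) u unfolding has_energy_derivative_def by blast
    then show ?thesis using L(2) by simp
  qed
  have "\<bar>2 * e - m\<bar> \<le> \<epsilon> * C" if \<epsilon>: "\<epsilon> > 0" for \<epsilon>
  proof -
    obtain \<eta> where \<eta>: "\<eta> > 0" "\<And>h. h \<in> X \<delta> \<Omega> \<Longrightarrow> X_norm \<delta> \<Omega> h < \<eta> \<Longrightarrow> \<bar>energy \<delta> \<Omega> (\<lambda>x. u x + h x) - energy \<delta> \<Omega> u - L h\<bar> \<le> \<epsilon> * X_norm \<delta> \<Omega> h"
      using L(1) \<epsilon> unfolding has_energy_derivative_def by meson
    have "(\<lambda>n. C * stp n) \<longlonglongrightarrow> C * 0" by (intro tendsto_intros tendsto_stp)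
    then have "eventually (\<lambda>n. C * stp n < \<eta>) sequentially" using \<eta>(1) by (intro order_tendstoD) auto
    then have "eventually (\<lambda>n. \<bar>(f (stp n) - e) / stp n\<bar> \<le> \<epsilon> * C) sequentially"
    proof eventually_elim
      case (elim n)
      let ?t = "stp n"
      have "X_norm \<delta> \<Omega> (\<lambda>x. ?t * u x) < \<eta>" using C(2)[of ?t] elim by simp
      then have "\<bar>energy \<delta> \<Omega> (\<lambda>x. u x + ?t * u x) - energy \<delta> \<Omega> u - L (\<lambda>x. ?t * u x)\<bar> \<le> \<epsilon> * X_norm \<delta> \<Omega> (\<lambda>x. ?t * u x)"
        using X_scale(1)[OF d \<Omega> u, of ?t] by (intro \<eta>(2)) auto
      also have "\<dots> \<le> \<epsilon> * (C * ?t)" using \<epsilon> C(2)[of ?t] by (intro mult_left_mono) auto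
      finally have "\<bar>energy \<delta> \<Omega> (\<lambda>x. u x + ?t * u x) - e\<bar> \<le> \<epsilon> * C * ?t" by (simp add: Lt e_def mult.assoc)
      moreover have "(\<lambda>x. u x + ?t * u x) = (\<lambda>x. (1 + ?t) * u x)" by (simp add: distrib_right)
      moreover have "energy \<delta> \<Omega> (\<lambda>x. (1 + ?t) * u x) = f ?t"
        using energy_scale(4)[OF d \<Omega> u, of "1 + ?t"] by (simp add: f_def e_def m_def add_pos_pos)
      ultimately have "\<bar>f ?t - e\<bar> \<le> \<epsilon> * C * ?t" by simp
      then show ?case by (simp add: abs_divide pos_divide_le_eq)
    qed
    then show ?thesis using tendsto_rabs[OF lim] by (intro tendsto_upperbound) auto
  qed
  note key = this
  have "\<bar>2 * e - m\<bar> \<le> 0"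
  proof (rule LIMSEQ_le_const)
    have "(\<lambda>n. stp n * C) \<longlonglongrightarrow> 0 * C" by (intro tendsto_intros tendsto_stp)
    then show "(\<lambda>n. stp n * C) \<longlonglongrightarrow> 0" by simp
    show "\<exists>N. \<forall>n\<ge>N. \<bar>2 * e - m\<bar> \<le> stp n * C" using key[OF stp_pos(1)] by blast
  qed
  then show ?thesis by (simp add: e_def m_def)
qed

section \<open>The Gaussian bound for the Nehari level\<close>

text \<open>The ray through a test function \<open>\<psi>\<close> meets the Nehari set at \<open>t \<psi>\<close>, where \<open>t\<close> is the solution
  of \<open>2 energy (t \<psi>) = Mass (t \<psi>)\<close>.\<close>
lemma d0_le_test:
  fixes \<Omega> :: "'a::euclidean_space set"
  assumes d: "0 < \<delta>" "\<delta> < exp (-2)" and \<Omega>: "open \<Omega>" and \<psi>: "\<psi> \<in> test_functions \<Omega>" and m: "Mass \<Omega> \<psi> > 0"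
  shows "d0 \<delta> \<Omega> \<le> Mass \<Omega> \<psi> / 2 * exp ((Dir \<Omega> \<psi> - EntI \<Omega> \<psi>) / Mass \<Omega> \<psi> + 1)"
proof -
  have \<psi>X: "\<psi> \<in> X \<delta> \<Omega>" by (rule test_X[OF d \<Omega> \<psi>])
  note P = X_facts[OF d \<Omega> \<psi>X]
  define M where "M = Mass \<Omega> \<psi>" define e where "e = energy \<delta> \<Omega> \<psi>"
  define t where "t = exp (e / M - 1 / 2)"
  have t: "t > 0" by (simp add: t_def)
  define w where "w = (\<lambda>x. t * \<psi> x)"
  have w: "w \<in> test_functions \<Omega>"
    using \<psi> t smooth_on_mult[OF smooth_on_const[of t], of \<psi>] by (auto simp: test_functions_def w_def)
  have wX: "w \<in> X \<delta> \<Omega>" by (rule test_X[OF d \<Omega> w])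
  note W = X_facts[OF d \<Omega> wX]
  note sc = energy_scale[OF d \<Omega> \<psi>X t, folded w_def M_def e_def]
  have "M > 0" using m by (simp add: M_def)
  then have lt: "ln t * M = e - M / 2" by (simp add: t_def field_simps)
  have en: "energy \<delta> \<Omega> w = t\<^sup>2 * M / 2" unfolding sc(4) lt by simp
  let ?L = "\<lambda>v. LINT x:\<Omega>|lebesgue. derivative_density \<Omega> w v x"
  have "?L w = (LINT x:\<Omega>|lebesgue. 2 * energy_density \<Omega> w x - (w x)\<^sup>2)"
    by (intro arg_cong[where f="\<lambda>g. set_lebesgue_integral lebesgue \<Omega> g"] ext)
       (simp add: derivative_density_def energy_density_def ent_eq_pln dot_square_norm power2_eq_square algebra_simps)
  also have "\<dots> = 2 * energy \<delta> \<Omega> w - Mass \<Omega> w"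
    using energy_eq_integral_density[OF d \<Omega> W(3)] H1D(3)[OF \<Omega> W(2)] by (subst set_integral_diff(2)) (auto simp: Mass_def)
  also have "\<dots> = 0" unfolding en sc(2) by simp
  finally have L0: "?L w = 0" .
  have "\<not> (AE x in lebesgue. x \<in> \<Omega> \<longrightarrow> w x = 0)"
  proof
    assume ae: "AE x in lebesgue. x \<in> \<Omega> \<longrightarrow> w x = 0"
    have "Mass \<Omega> w = 0" unfolding Mass_def set_lebesgue_integral_def
      by (rule integral_eq_zero_AE) (use ae in eventually_elim, auto simp: indicator_def)
    then show False using sc(2) t \<open>M > 0\<close> by simp
  qed
  then have N: "w \<in> Nehari \<delta> \<Omega>" unfolding Nehari_def using wX test_energy_derivative[OF d \<Omega> w] L0 by blast
  \<comment> \<open>Without a lower bound the infimum of a set of reals would be unspecified.\<close>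
  have bb: "bdd_below (energy \<delta> \<Omega> ` Nehari \<delta> \<Omega>)"
  proof (rule bdd_belowI2[of _ 0])
    fix u assume "u \<in> Nehari \<delta> \<Omega>"
    then have "2 * energy \<delta> \<Omega> u = Mass \<Omega> u" unfolding Nehari_def using Nehari_energy[OF d \<Omega>] by blast
    then show "0 \<le> energy \<delta> \<Omega> u" using Mass_nonneg[of \<Omega> u] by linarith
  qed
  have "d0 \<delta> \<Omega> \<le> energy \<delta> \<Omega> w" unfolding d0_def by (rule cINF_lower[OF bb N])
  also have "\<dots> = M / 2 * exp (2 * (e / M - 1 / 2))" unfolding en t_def by (simp add: power2_eq_square exp_add[symmetric])
  also have "2 * (e / M - 1 / 2) = (Dir \<Omega> \<psi> - EntI \<Omega> \<psi>) / M + 1"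
    using \<open>M > 0\<close> unfolding e_def energy_eq_entropy[OF d \<Omega> P(3)] M_def[symmetric] by (simp add: field_simps)
  finally show ?thesis by (simp add: M_def)
qed

lemma integral_prod_Basis:
  fixes f :: "'a::euclidean_space \<Rightarrow> real \<Rightarrow> real"
  assumes f: "\<And>b. b \<in> Basis \<Longrightarrow> integrable lborel (f b)"
  shows "(LINT x|lborel. (\<Prod>b\<in>Basis. f b (x \<bullet> b))) = (\<Prod>b\<in>(Basis::'a set). LINT t|lborel. f b t)"
proof -
  interpret product_sigma_finite "\<lambda>_::'a. lborel :: real measure" by standard
  have "(\<lambda>x::'a. f b (x \<bullet> b)) \<in> borel_measurable borel" if b: "b \<in> Basis" for b
    using borel_measurable_integrable[OF f[OF b]] by measurable
  then have "(LINT x|lborel. (\<Prod>b\<in>Basis. f b (x \<bullet> b))) = (LINT y|LL Basis. (\<Prod>b\<in>(Basis::'a set). f b (vec y \<bullet> b)))"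
    by (intro integral_vec borel_measurable_prod)
  also have "\<dots> = (LINT y|LL Basis. (\<Prod>b\<in>(Basis::'a set). f b (y b)))"
    by (intro Bochner_Integration.integral_cong prod.cong) (auto simp: vec_inner)
  also have "\<dots> = (\<Prod>b\<in>(Basis::'a set). LINT t|lborel. f b t)"
    by (rule product_integral_prod) (use f in auto)
  finally show ?thesis .
qed

text \<open>The logarithm turns the product into a sum, with one factor \<open>ent\<close> and squares otherwise.\<close>
lemma ent_prod:
  assumes "finite I"
  shows "ent (\<Prod>b\<in>I. f b) = (\<Sum>i\<in>I. \<Prod>b\<in>I. if b = i then ent (f b) else (f b)\<^sup>2)"
  using assms
proof (induction I)
  case (insert a I)
  have "ent (f a * (\<Prod>b\<in>I. f b)) = ent (f a) * (\<Prod>b\<in>I. f b)\<^sup>2 + (f a)\<^sup>2 * ent (\<Prod>b\<in>I. f b)"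
    by (cases "f a = 0 \<or> (\<Prod>b\<in>I. f b) = 0") (auto simp: ent_def power_mult_distrib ln_mult algebra_simps)
  also have "ent (f a) * (\<Prod>b\<in>I. f b)\<^sup>2 = (\<Prod>b\<in>insert a I. if b = a then ent (f b) else (f b)\<^sup>2)"
    using insert.hyps by (simp add: prod_power_distrib) (intro disjI2 prod.cong, auto)
  also have "(f a)\<^sup>2 * ent (\<Prod>b\<in>I. f b) = (\<Sum>i\<in>I. \<Prod>b\<in>insert a I. if b = i then ent (f b) else (f b)\<^sup>2)"
    unfolding insert.IH sum_distrib_left using insert.hyps by (intro sum.cong) auto
  finally show ?case using insert.hyps by simp
qed (simp add: ent_def)

text \<open>For products of functions of one variable all integrals factorize.\<close>
lemma product_test_function:
  fixes \<Omega> :: "'a::euclidean_space set" and p :: 'a and \<theta> \<theta>' :: "real \<Rightarrow> real" and m A B :: real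
  assumes \<Omega>: "open \<Omega>" and sm: "smooth_on \<theta> UNIV" and der: "\<And>s. (\<theta> has_real_derivative \<theta>' s) (at s)"
    and supp: "\<And>s. \<bar>s\<bar> > R \<Longrightarrow> \<theta> s = 0" and cube: "\<And>x. (\<And>b. b \<in> Basis \<Longrightarrow> \<bar>(x - p) \<bullet> b\<bar> \<le> R) \<Longrightarrow> x \<in> \<Omega>"
  defines "\<psi> \<equiv> \<lambda>x. \<Prod>b\<in>Basis. \<theta> (x \<bullet> b - p \<bullet> b)"
    and "m \<equiv> LINT s|lborel. (\<theta> s)\<^sup>2" and "A \<equiv> LINT s|lborel. (\<theta>' s)\<^sup>2" and "B \<equiv> LINT s|lborel. ent (\<theta> s)"
  shows "\<psi> \<in> test_functions \<Omega>"
    and "Mass \<Omega> \<psi> = m ^ DIM('a)"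
    and "Dir \<Omega> \<psi> = DIM('a) * (A * m ^ (DIM('a) - 1))"
    and "EntI \<Omega> \<psi> = DIM('a) * (B * m ^ (DIM('a) - 1))"
proof -
  define K where "K = cbox (p - R *\<^sub>R One) (p + R *\<^sub>R (One::'a))"
  have Kin: "x \<in> K \<longleftrightarrow> (\<forall>b\<in>Basis. \<bar>(x - p) \<bullet> b\<bar> \<le> R)" for x
    unfolding K_def by (auto simp: mem_box inner_diff_left inner_add_left abs_le_iff)
  have K: "compact K" "K \<subseteq> \<Omega>" using cube by (auto simp: K_def[symmetric] Kin) (simp add: K_def)
  have \<psi>z: "\<psi> x = 0" if nK: "x \<notin> K" for x
  proof -
    obtain b where b: "b \<in> Basis" "\<bar>(x - p) \<bullet> b\<bar> > R" using nK by (metis Kin not_le)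
    then have "\<theta> (x \<bullet> b - p \<bullet> b) = 0" by (intro supp) (simp add: inner_diff_left)
    then show ?thesis unfolding \<psi>_def using b by (intro prod_zero) auto
  qed
  have lin: "smooth_on (\<lambda>x::'a. x \<bullet> b - p \<bullet> b) UNIV" for b
    by (intro smooth_on_diff_real smooth_on_const smooth_on_bounded_linear bounded_linear_inner_left)
  have \<psi>sm: "smooth_on \<psi> UNIV" unfolding \<psi>_def by (intro smooth_on_prod smooth_on_compose_real[OF sm] lin)
  show \<psi>: "\<psi> \<in> test_functions \<Omega>" by (rule test_functionsI[OF \<psi>sm K \<psi>z])
  have \<theta>c: "continuous_on UNIV \<theta>" by (rule smooth_on_imp_continuous[OF sm])
  have \<theta>'c: "continuous_on UNIV \<theta>'"
  proof -
    have "\<theta>' = (\<lambda>s. frechet_derivative \<theta> (at s) 1)"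
      using frechet_derivative_at[OF der[unfolded has_field_derivative_def]] by (metis mult.right_neutral)
    then show ?thesis using continuous_frechet[OF sm, of 1] by simp
  qed
  have \<theta>'z: "\<theta>' s = 0" if "\<bar>s\<bar> > R" for s
  proof (rule DERIV_unique[OF der])
    have "((\<lambda>_. 0) has_real_derivative 0) (at s)" by simp
    then show "(\<theta> has_real_derivative 0) (at s)"
    proof (rule has_field_derivative_transform_within_open[where S="- {-R..R}"])
      show "s \<in> - {-R..R}" using that by auto
      show "0 = \<theta> t" if "t \<in> - {-R..R}" for t using supp[of t] that by (auto simp: abs_le_iff not_le[symmetric])
    qed (rule open_Compl, rule closed_atLeastAtMost)
  qed
  have entc: "continuous_on UNIV ent" using ent_has_derivative DERIV_isCont by (blast intro: continuous_at_imp_continuous_on)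
  have z: "s \<notin> {-R..R} \<Longrightarrow> \<theta> s = 0 \<and> \<theta>' s = 0" for s using supp[of s] \<theta>'z[of s] by (auto simp: abs_le_iff not_le[symmetric])
  have i0: "integrable lborel (\<lambda>s. (\<theta> s)\<^sup>2)" and i1: "integrable lborel (\<lambda>s. (\<theta>' s)\<^sup>2)" and i2: "integrable lborel (\<lambda>s. ent (\<theta> s))"
    by (rule integrable_compact_support[of _ "{-R..R}"]; use z \<theta>c \<theta>'c continuous_on_compose2[OF entc \<theta>c] in \<open>auto intro!: continuous_intros\<close>)+
  have pr: "(\<Prod>b\<in>(Basis::'a set). if b = i then c else m) = c * m ^ (DIM('a) - 1)" if "i \<in> Basis" for i c
    using that by (subst prod.remove[of _ i]) (auto simp: prod.If_cases card_Diff_singleton intro!: prod.cong[THEN trans])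
  have cube_int: "(LINT x|lborel. (\<Prod>b\<in>(Basis::'a set). f b (x \<bullet> b - p \<bullet> b))) = (\<Prod>b\<in>(Basis::'a set). LINT t|lborel. f b t)"
    if f: "\<And>b. b \<in> Basis \<Longrightarrow> integrable lborel (f b)" for f :: "'a \<Rightarrow> real \<Rightarrow> real"
  proof -
    have "(LINT x|lborel. (\<Prod>b\<in>(Basis::'a set). (\<lambda>t. f b (t - p \<bullet> b)) (x \<bullet> b))) = (\<Prod>b\<in>(Basis::'a set). LINT t|lborel. f b (t - p \<bullet> b))"
      by (rule integral_prod_Basis) (use translate_integral(2)[of "f _" "- (p \<bullet> _)"] f in auto)
    then show ?thesis using translate_integral(1)[of "f _" "- (p \<bullet> _)"] by simp
  qed
  have cont2: "continuous_on UNIV (\<lambda>x. (\<psi> x)\<^sup>2)" "continuous_on UNIV (\<lambda>x. ent (\<psi> x))" "continuous_on UNIV (\<lambda>x. (norm (grad \<psi> x))\<^sup>2)"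
    using smooth_on_imp_continuous[OF \<psi>sm] continuous_grad[OF \<psi>sm] continuous_on_compose2[OF entc] by (auto intro!: continuous_intros)
  have \<psi>g: "frechet_derivative \<psi> (at x) i = (\<Prod>b\<in>Basis. if b = i then \<theta>' (x \<bullet> b - p \<bullet> b) else \<theta> (x \<bullet> b - p \<bullet> b))" if i: "i \<in> Basis" for x i
  proof -
    have "((\<lambda>x. \<theta> (x \<bullet> b - p \<bullet> b)) has_derivative (\<lambda>y. \<theta>' (x \<bullet> b - p \<bullet> b) * (y \<bullet> b))) (at x)" for b
    proof -
      have "((\<lambda>x. x \<bullet> b - p \<bullet> b) has_derivative (\<lambda>y. y \<bullet> b)) (at x)" by (auto intro!: derivative_eq_intros)
      from has_derivative_compose[OF this der[unfolded has_field_derivative_def]] show ?thesis by (simp add: mult.commute)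
    qed
    then have "(\<psi> has_derivative (\<lambda>y. \<Sum>b\<in>Basis. \<theta>' (x \<bullet> b - p \<bullet> b) * (y \<bullet> b) * (\<Prod>c\<in>Basis - {b}. \<theta> (x \<bullet> c - p \<bullet> c)))) (at x)"
      unfolding \<psi>_def by (intro has_derivative_prod) auto
    then have "frechet_derivative \<psi> (at x) i = (\<Sum>b\<in>Basis. \<theta>' (x \<bullet> b - p \<bullet> b) * (i \<bullet> b) * (\<Prod>c\<in>Basis - {b}. \<theta> (x \<bullet> c - p \<bullet> c)))"
      by (simp add: frechet_derivative_at[symmetric])
    also have "\<dots> = (\<Sum>b\<in>Basis. if b = i then \<theta>' (x \<bullet> i - p \<bullet> i) * (\<Prod>c\<in>Basis - {i}. \<theta> (x \<bullet> c - p \<bullet> c)) else 0)"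
      using i by (intro sum.cong) (auto simp: inner_Basis)
    also have "\<dots> = \<theta>' (x \<bullet> i - p \<bullet> i) * (\<Prod>c\<in>Basis - {i}. \<theta> (x \<bullet> c - p \<bullet> c))" using i by simp
    also have "\<dots> = (\<Prod>b\<in>Basis. if b = i then \<theta>' (x \<bullet> b - p \<bullet> b) else \<theta> (x \<bullet> b - p \<bullet> b))"
      using i by (subst (2) prod.remove[of _ i]) (auto intro!: prod.cong)
    finally show ?thesis .
  qed
  have gz: "grad \<psi> x = 0" if x: "x \<notin> K" for x
  proof (rule euclidean_eqI)
    fix i :: 'a assume i: "i \<in> Basis"
    obtain b where b: "b \<in> Basis" "\<bar>(x - p) \<bullet> b\<bar> > R" using x by (metis Kin not_le)
    then have "\<theta> (x \<bullet> b - p \<bullet> b) = 0" "\<theta>' (x \<bullet> b - p \<bullet> b) = 0" by (auto intro!: supp \<theta>'z simp: inner_diff_left)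
    then show "grad \<psi> x \<bullet> i = 0 \<bullet> i" unfolding grad_inner[OF i] \<psi>g[OF i] by (subst prod_zero[OF _ bexI[OF _ b(1)]]) auto
  qed
  show "Mass \<Omega> \<psi> = m ^ DIM('a)"
  proof -
    have "Mass \<Omega> \<psi> = (LINT x|lborel. (\<psi> x)\<^sup>2)"
      unfolding Mass_def by (rule set_integrable_compact_support(2)[OF \<Omega> cont2(1) K(1) _ K(2)]) (simp add: \<psi>z)
    also have "\<dots> = (LINT x|lborel. (\<Prod>b\<in>(Basis::'a set). (\<theta> (x \<bullet> b - p \<bullet> b))\<^sup>2))" by (simp add: \<psi>_def prod_power_distrib)
    also have "\<dots> = m ^ DIM('a)" using cube_int[of "\<lambda>_ s. (\<theta> s)\<^sup>2"] i0 by (simp add: m_def)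
    finally show ?thesis .
  qed
  show "EntI \<Omega> \<psi> = DIM('a) * (B * m ^ (DIM('a) - 1))"
  proof -
    have "EntI \<Omega> \<psi> = (LINT x|lborel. ent (\<psi> x))"
      by (rule set_integrable_compact_support(2)[OF \<Omega> cont2(2) K(1) _ K(2)]) (simp add: \<psi>z)
    also have "\<dots> = (LINT x|lborel. (\<Sum>i\<in>Basis. \<Prod>b\<in>(Basis::'a set). (if b = i then ent (\<theta> (x \<bullet> b - p \<bullet> b)) else (\<theta> (x \<bullet> b - p \<bullet> b))\<^sup>2)))"
      by (simp add: \<psi>_def ent_prod)
    also have "\<dots> = (\<Sum>i\<in>(Basis::'a set). LINT x|lborel. (\<Prod>b\<in>(Basis::'a set). (if b = i then ent (\<theta> (x \<bullet> b - p \<bullet> b)) else (\<theta> (x \<bullet> b - p \<bullet> b))\<^sup>2)))"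
    proof (rule Bochner_Integration.integral_sum)
      fix i :: 'a assume i: "i \<in> Basis"
      show "integrable lborel (\<lambda>x. \<Prod>b\<in>(Basis::'a set). (if b = i then ent (\<theta> (x \<bullet> b - p \<bullet> b)) else (\<theta> (x \<bullet> b - p \<bullet> b))\<^sup>2))"
      proof (rule integrable_compact_support[OF _ K(1)])
        show "continuous_on UNIV (\<lambda>x. \<Prod>b\<in>(Basis::'a set). (if b = i then ent (\<theta> (x \<bullet> b - p \<bullet> b)) else (\<theta> (x \<bullet> b - p \<bullet> b))\<^sup>2))"
        proof (rule continuous_on_prod)
          fix b show "continuous_on UNIV (\<lambda>x::'a. (if b = i then ent (\<theta> (x \<bullet> b - p \<bullet> b)) else (\<theta> (x \<bullet> b - p \<bullet> b))\<^sup>2))"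
            by (cases "b = i") (auto intro!: continuous_intros continuous_on_compose2[OF entc] continuous_on_compose2[OF \<theta>c])
        qed
        fix x assume "x \<notin> K"
        then obtain b where b: "b \<in> Basis" "\<bar>(x - p) \<bullet> b\<bar> > R" by (metis Kin not_le)
        then have "\<theta> (x \<bullet> b - p \<bullet> b) = 0" by (intro supp) (simp add: inner_diff_left)
        then show "(\<Prod>b\<in>(Basis::'a set). (if b = i then ent (\<theta> (x \<bullet> b - p \<bullet> b)) else (\<theta> (x \<bullet> b - p \<bullet> b))\<^sup>2)) = 0"
          by (intro prod_zero bexI[OF _ b(1)]) auto
      qed
    qed
    also have "\<dots> = (\<Sum>i\<in>(Basis::'a set). B * m ^ (DIM('a) - 1))"
    proof (rule sum.cong[OF refl])
      fix i :: 'a assume i: "i \<in> Basis"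
      have "(LINT x|lborel. (\<Prod>b\<in>(Basis::'a set). (if b = i then ent (\<theta> (x \<bullet> b - p \<bullet> b)) else (\<theta> (x \<bullet> b - p \<bullet> b))\<^sup>2)))
         = (\<Prod>b\<in>(Basis::'a set). LINT t|lborel. (if b = i then ent (\<theta> t) else (\<theta> t)\<^sup>2))"
      proof (rule cube_int[of "\<lambda>b t. if b = i then ent (\<theta> t) else (\<theta> t)\<^sup>2"])
        fix b show "integrable lborel (\<lambda>t. if b = i then ent (\<theta> t) else (\<theta> t)\<^sup>2)" by (cases "b = i") (simp_all add: i0 i2)
      qed
      also have "\<dots> = (\<Prod>b\<in>(Basis::'a set). if b = i then B else m)" by (intro prod.cong) (auto simp: B_def m_def)
      finally show "(LINT x|lborel. (\<Prod>b\<in>(Basis::'a set). (if b = i then ent (\<theta> (x \<bullet> b - p \<bullet> b)) else (\<theta> (x \<bullet> b - p \<bullet> b))\<^sup>2))) = B * m ^ (DIM('a) - 1)"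
        unfolding pr[OF i] .
    qed
    finally show ?thesis by simp
  qed
  show "Dir \<Omega> \<psi> = DIM('a) * (A * m ^ (DIM('a) - 1))"
  proof -
    have gi: "set_integrable lebesgue \<Omega> (\<lambda>x. (norm (grad \<psi> x))\<^sup>2)" and gI: "(LINT x:\<Omega>|lebesgue. (norm (grad \<psi> x))\<^sup>2) = (LINT x|lborel. (norm (grad \<psi> x))\<^sup>2)"
      using set_integrable_compact_support[OF \<Omega> cont2(3) K(1) _ K(2)] gz by auto
    have "Dir \<Omega> \<psi> = (LINT x:\<Omega>|lebesgue. (norm (grad \<psi> x))\<^sup>2)"
      unfolding Dir_def
    proof (rule set_integral_cong_AE_integrable[OF H1D(2)[OF \<Omega> test_H1(1)[OF \<Omega> \<psi>]] gi])
      show "AE x in lebesgue. x \<in> \<Omega> \<longrightarrow> (norm (weak_gradient \<Omega> \<psi> x))\<^sup>2 = (norm (grad \<psi> x))\<^sup>2"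
        using test_H1(2)[OF \<Omega> \<psi>] by eventually_elim auto
    qed
    also have "\<dots> = (LINT x|lborel. (\<Sum>i\<in>Basis. \<Prod>b\<in>(Basis::'a set). (if b = i then (\<theta>' (x \<bullet> b - p \<bullet> b))\<^sup>2 else (\<theta> (x \<bullet> b - p \<bullet> b))\<^sup>2)))"
      unfolding gI unfolding norm_sq_eq_sum
      by (intro Bochner_Integration.integral_cong sum.cong refl) (auto simp: grad_inner \<psi>g prod_power_distrib intro!: prod.cong)
    also have "\<dots> = (\<Sum>i\<in>(Basis::'a set). LINT x|lborel. (\<Prod>b\<in>(Basis::'a set). (if b = i then (\<theta>' (x \<bullet> b - p \<bullet> b))\<^sup>2 else (\<theta> (x \<bullet> b - p \<bullet> b))\<^sup>2)))"
    proof (rule Bochner_Integration.integral_sum)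
      fix i :: 'a assume i: "i \<in> Basis"
      show "integrable lborel (\<lambda>x. \<Prod>b\<in>(Basis::'a set). (if b = i then (\<theta>' (x \<bullet> b - p \<bullet> b))\<^sup>2 else (\<theta> (x \<bullet> b - p \<bullet> b))\<^sup>2))"
      proof (rule integrable_compact_support[OF _ K(1)])
        show "continuous_on UNIV (\<lambda>x. \<Prod>b\<in>(Basis::'a set). (if b = i then (\<theta>' (x \<bullet> b - p \<bullet> b))\<^sup>2 else (\<theta> (x \<bullet> b - p \<bullet> b))\<^sup>2))"
        proof (rule continuous_on_prod)
          fix b show "continuous_on UNIV (\<lambda>x::'a. (if b = i then (\<theta>' (x \<bullet> b - p \<bullet> b))\<^sup>2 else (\<theta> (x \<bullet> b - p \<bullet> b))\<^sup>2))"
            by (cases "b = i") (auto intro!: continuous_intros continuous_on_compose2[OF \<theta>'c] continuous_on_compose2[OF \<theta>c])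
        qed
        fix x assume "x \<notin> K"
        then obtain b where b: "b \<in> Basis" "\<bar>(x - p) \<bullet> b\<bar> > R" by (metis Kin not_le)
        then have "\<theta> (x \<bullet> b - p \<bullet> b) = 0" "\<theta>' (x \<bullet> b - p \<bullet> b) = 0" by (auto intro!: supp \<theta>'z simp: inner_diff_left)
        then show "(\<Prod>b\<in>(Basis::'a set). (if b = i then (\<theta>' (x \<bullet> b - p \<bullet> b))\<^sup>2 else (\<theta> (x \<bullet> b - p \<bullet> b))\<^sup>2)) = 0"
          by (intro prod_zero bexI[OF _ b(1)]) auto
      qed
    qed
    also have "\<dots> = (\<Sum>i\<in>(Basis::'a set). A * m ^ (DIM('a) - 1))"
    proof (rule sum.cong[OF refl])
      fix i :: 'a assume i: "i \<in> Basis"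
      have "(LINT x|lborel. (\<Prod>b\<in>(Basis::'a set). (if b = i then (\<theta>' (x \<bullet> b - p \<bullet> b))\<^sup>2 else (\<theta> (x \<bullet> b - p \<bullet> b))\<^sup>2)))
         = (\<Prod>b\<in>(Basis::'a set). LINT t|lborel. (if b = i then (\<theta>' t)\<^sup>2 else (\<theta> t)\<^sup>2))"
      proof (rule cube_int[of "\<lambda>b t. if b = i then (\<theta>' t)\<^sup>2 else (\<theta> t)\<^sup>2"])
        fix b show "integrable lborel (\<lambda>t. if b = i then (\<theta>' t)\<^sup>2 else (\<theta> t)\<^sup>2)" by (cases "b = i") (simp_all add: i0 i1)
      qed
      also have "\<dots> = (\<Prod>b\<in>(Basis::'a set). if b = i then A else m)" by (intro prod.cong) (auto simp: A_def m_def)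
      finally show "(LINT x|lborel. (\<Prod>b\<in>(Basis::'a set). (if b = i then (\<theta>' (x \<bullet> b - p \<bullet> b))\<^sup>2 else (\<theta> (x \<bullet> b - p \<bullet> b))\<^sup>2))) = A * m ^ (DIM('a) - 1)"
        unfolding pr[OF i] .
    qed
    finally show ?thesis by simp
  qed
qed

text \<open>Smooth cut-offs of \<open>exp (- s\<^sup>2 / 2)\<close>; the limits are the corresponding Gaussian integrals,
  obtained by dominated convergence.\<close>
lemma gauss_cutoffs:
  obtains \<theta> \<theta>' :: "nat \<Rightarrow> real \<Rightarrow> real" where
    "\<And>k. smooth_on (\<theta> k) UNIV" "\<And>k s. (\<theta> k has_real_derivative \<theta>' k s) (at s)"
    "\<And>k s. \<bar>s\<bar> > real k + 1 \<Longrightarrow> \<theta> k s = 0"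
    "(\<lambda>k. LINT s|lborel. (\<theta> k s)\<^sup>2) \<longlonglongrightarrow> sqrt pi"
    "(\<lambda>k. LINT s|lborel. (\<theta>' k s)\<^sup>2) \<longlonglongrightarrow> sqrt pi / 2"
    "(\<lambda>k. LINT s|lborel. ent (\<theta> k s)) \<longlonglongrightarrow> - sqrt pi / 2"
proof -
  obtain S S' :: "real \<Rightarrow> real" and C where S: "smooth_on S UNIV" "\<And>t. t \<le> 0 \<Longrightarrow> S t = 0" "\<And>t. t \<ge> 1 \<Longrightarrow> S t = 1"
    "\<And>t. 0 \<le> S t" "\<And>t. S t \<le> 1" "\<And>t. (S has_real_derivative S' t) (at t)" "\<And>t. \<bar>S' t\<bar> \<le> C" "continuous_on UNIV S'"
    using smooth_step by blast
  define g where "g s = exp (- (s\<^sup>2 / 2))" for s :: real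
  define cu where "cu k s = S (real k + 1 - s) * S (real k + 1 + s)" for k s
  define cu' where "cu' k s = S (real k + 1 - s) * S' (real k + 1 + s) - S' (real k + 1 - s) * S (real k + 1 + s)" for k s
  define \<theta> where "\<theta> k s = g s * cu k s" for k s
  define \<theta>' where "\<theta>' k s = g s * (cu' k s - s * cu k s)" for k s
  have g2: "(g s)\<^sup>2 = exp (- s\<^sup>2)" for s by (simp add: g_def power2_eq_square exp_add[symmetric])
  have gd: "(g has_real_derivative - s * g s) (at s)" for s
    unfolding g_def by (auto intro!: derivative_eq_intros)
  have gs: "smooth_on g UNIV"
  proof -
    have "smooth_on (\<lambda>s::real. exp (- (1 / 2) * (s * s))) UNIV"
      by (intro smooth_on_compose_real[OF smooth_on_exp] smooth_on_mult smooth_on_const smooth_on_bounded_linear bounded_linear_ident)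
    then show ?thesis by (simp add: g_def[abs_def] power2_eq_square)
  qed
  have cus: "smooth_on (cu k) UNIV" for k
    unfolding cu_def
    by (intro smooth_on_mult smooth_on_compose_real[OF S(1)] smooth_on_diff_real smooth_on_add smooth_on_const smooth_on_bounded_linear bounded_linear_ident)
  have cud: "(cu k has_real_derivative cu' k s) (at s)" for k s
  proof -
    have "((\<lambda>s. S (real k + 1 - s)) has_real_derivative - S' (real k + 1 - s)) (at s)"
    proof -
      have "((\<lambda>s. real k + 1 - s) has_real_derivative -1) (at s)" by (auto intro!: derivative_eq_intros)
      from DERIV_chain2[OF S(6) this] show ?thesis by simp
    qed
    moreover have "((\<lambda>s. S (real k + 1 + s)) has_real_derivative S' (real k + 1 + s)) (at s)"
    proof -
      have "((\<lambda>s. real k + 1 + s) has_real_derivative 1) (at s)" by (auto intro!: derivative_eq_intros)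
      from DERIV_chain2[OF S(6) this] show ?thesis by simp
    qed
    ultimately show ?thesis unfolding cu_def cu'_def by (auto intro!: derivative_eq_intros)
  qed
  have cu01: "0 \<le> cu k s" "cu k s \<le> 1" for k s unfolding cu_def using S(4,5) by (auto intro: mult_le_one)
  have C0: "C \<ge> 0" using S(7)[of 0] abs_ge_zero order_trans by blast
  have cu'b: "\<bar>cu' k s\<bar> \<le> 2 * C" for k s
  proof -
    have "\<bar>S a * S' b\<bar> \<le> 1 * C" for a b unfolding abs_mult using S(4,5,7) C0 by (intro mult_mono) auto
    from this[of "real k + 1 - s" "real k + 1 + s"] this[of "real k + 1 + s" "real k + 1 - s"]
    show ?thesis unfolding cu'_def by (simp add: mult.commute)
  qed
  have S'0: "S' t = 0" if "t > 1" for t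
  proof (rule DERIV_unique[OF S(6)])
    have "((\<lambda>_. 1) has_real_derivative 0) (at t)" by simp
    then show "(S has_real_derivative 0) (at t)"
      by (rule has_field_derivative_transform_within_open[where S="{1<..}"]) (use that S(3) in auto)
  qed
  have ev: "eventually (\<lambda>k. cu k s = 1 \<and> cu' k s = 0) sequentially" for s
  proof -
    obtain n :: nat where n: "\<bar>s\<bar> < real n" using reals_Archimedean2 by blast
    show ?thesis using eventually_ge_at_top[of n]
    proof eventually_elim
      case (elim k)
      then have "real k + 1 - s > 1" "real k + 1 + s > 1" using n by auto
      then show ?case by (simp add: cu_def cu'_def S(3) S'0)
    qed
  qed
  have [measurable]: "\<theta> k \<in> borel_measurable borel" "\<theta>' k \<in> borel_measurable borel" for k
  proof -
    have c: "continuous_on UNIV S" by (rule smooth_on_imp_continuous[OF S(1)])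
    show "\<theta> k \<in> borel_measurable borel" "\<theta>' k \<in> borel_measurable borel"
      unfolding \<theta>_def \<theta>'_def cu_def cu'_def g_def
      by (intro borel_if_continuous continuous_intros continuous_on_compose2[OF c] continuous_on_compose2[OF S(8)]; simp)+
  qed
  note G = has_bochner_integral_gauss[unfolded has_bochner_integral_iff] has_bochner_integral_gauss_sq[unfolded has_bochner_integral_iff]
  show ?thesis
  proof (rule that[of \<theta> \<theta>'])
    show "smooth_on (\<theta> k) UNIV" for k unfolding \<theta>_def by (intro smooth_on_mult gs cus)
    show "(\<theta> k has_real_derivative \<theta>' k s) (at s)" for k s
      unfolding \<theta>_def \<theta>'_def using DERIV_mult[OF gd[of s] cud[of k s]] by (simp add: algebra_simps)
    show "\<theta> k s = 0" if "\<bar>s\<bar> > real k + 1" for k s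
      using that S(2)[of "real k + 1 - s"] S(2)[of "real k + 1 + s"] by (cases "s \<ge> 0") (auto simp: \<theta>_def cu_def)
    have "(\<lambda>k. LINT s|lborel. (\<theta> k s)\<^sup>2) \<longlonglongrightarrow> (LINT s|lborel. exp (- s\<^sup>2))"
    proof (rule integral_dominated_convergence[where w="\<lambda>s. exp (- s\<^sup>2)"])
      show "AE s in lborel. (\<lambda>k. (\<theta> k s)\<^sup>2) \<longlonglongrightarrow> exp (- s\<^sup>2)"
      proof (intro AE_I2 tendsto_eventually)
        fix s :: real
        show "eventually (\<lambda>k. (\<theta> k s)\<^sup>2 = exp (- s\<^sup>2)) sequentially"
          using ev[of s] by eventually_elim (simp add: \<theta>_def g2)
      qed
      show "AE s in lborel. norm ((\<theta> k s)\<^sup>2) \<le> exp (- s\<^sup>2)" for k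
        using cu01 by (intro AE_I2) (simp add: \<theta>_def power_mult_distrib g2 mult_left_le power_le_one)
    qed (use G in auto)
    then show "(\<lambda>k. LINT s|lborel. (\<theta> k s)\<^sup>2) \<longlonglongrightarrow> sqrt pi" using G by simp
    have "(\<lambda>k. LINT s|lborel. (\<theta>' k s)\<^sup>2) \<longlonglongrightarrow> (LINT s|lborel. exp (- s\<^sup>2) * s\<^sup>2)"
    proof (rule integral_dominated_convergence[where w="\<lambda>s. 8 * C\<^sup>2 * exp (- s\<^sup>2) + 2 * (exp (- s\<^sup>2) * s\<^sup>2)"])
      show "AE s in lborel. (\<lambda>k. (\<theta>' k s)\<^sup>2) \<longlonglongrightarrow> exp (- s\<^sup>2) * s\<^sup>2"
      proof (intro AE_I2 tendsto_eventually)
        fix s :: real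
        show "eventually (\<lambda>k. (\<theta>' k s)\<^sup>2 = exp (- s\<^sup>2) * s\<^sup>2) sequentially"
          using ev[of s] by eventually_elim (simp add: \<theta>'_def power_mult_distrib g2)
      qed
      show "AE s in lborel. norm ((\<theta>' k s)\<^sup>2) \<le> 8 * C\<^sup>2 * exp (- s\<^sup>2) + 2 * (exp (- s\<^sup>2) * s\<^sup>2)" for k
      proof (rule AE_I2)
        fix s :: real
        have "(cu' k s - s * cu k s)\<^sup>2 \<le> 2 * (cu' k s)\<^sup>2 + 2 * (s * cu k s)\<^sup>2"
          using zero_le_power2[of "cu' k s + s * cu k s"] by (simp add: power2_eq_square algebra_simps)
        also have "(cu' k s)\<^sup>2 \<le> (2 * C)\<^sup>2" using cu'b[of k s] C0 by (intro abs_le_square_iff[THEN iffD1]) simp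
        also have "(s * cu k s)\<^sup>2 \<le> s\<^sup>2"
          using cu01[of k s] by (simp add: power_mult_distrib mult_left_le power_le_one)
        finally have "(cu' k s - s * cu k s)\<^sup>2 \<le> 8 * C\<^sup>2 + 2 * s\<^sup>2" by (simp add: power_mult_distrib)
        then have "exp (- s\<^sup>2) * (cu' k s - s * cu k s)\<^sup>2 \<le> exp (- s\<^sup>2) * (8 * C\<^sup>2 + 2 * s\<^sup>2)" by (rule mult_left_mono) simp
        moreover have "(\<theta>' k s)\<^sup>2 = exp (- s\<^sup>2) * (cu' k s - s * cu k s)\<^sup>2"
          by (simp add: \<theta>'_def power_mult_distrib g2)
        ultimately show "norm ((\<theta>' k s)\<^sup>2) \<le> 8 * C\<^sup>2 * exp (- s\<^sup>2) + 2 * (exp (- s\<^sup>2) * s\<^sup>2)"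
          by (simp add: algebra_simps)
      qed
    qed (use G in auto)
    then show "(\<lambda>k. LINT s|lborel. (\<theta>' k s)\<^sup>2) \<longlonglongrightarrow> sqrt pi / 2" using G by simp
    have eg: "ent (g s * c) = exp (- s\<^sup>2) * (ent c - s\<^sup>2 * c\<^sup>2)" for s c
    proof (cases "c = 0")
      case False
      have "ln ((g s * c)\<^sup>2) = - s\<^sup>2 + ln (c\<^sup>2)" using False by (simp add: power_mult_distrib g2 ln_mult)
      then have "ent (g s * c) = (g s * c)\<^sup>2 * (- s\<^sup>2 + ln (c\<^sup>2))" by (simp add: ent_def)
      then show ?thesis by (simp add: ent_def[of c] power_mult_distrib g2 algebra_simps)
    qed simp
    have "ent 1 = 0" by (simp add: ent_def)
    then have eg1: "ent (g s) = - (exp (- s\<^sup>2) * s\<^sup>2)" for s using eg[of s 1] by simp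
    have "(\<lambda>k. LINT s|lborel. ent (\<theta> k s)) \<longlonglongrightarrow> (LINT s|lborel. - (exp (- s\<^sup>2) * s\<^sup>2))"
    proof (rule integral_dominated_convergence[where w="\<lambda>s. 3 * exp (- s\<^sup>2) + exp (- s\<^sup>2) * s\<^sup>2"])
      show "AE s in lborel. (\<lambda>k. ent (\<theta> k s)) \<longlonglongrightarrow> - (exp (- s\<^sup>2) * s\<^sup>2)"
      proof (intro AE_I2 tendsto_eventually)
        fix s :: real
        show "eventually (\<lambda>k. ent (\<theta> k s) = - (exp (- s\<^sup>2) * s\<^sup>2)) sequentially"
          using ev[of s] by eventually_elim (simp add: \<theta>_def eg1)
      qed
      show "AE s in lborel. norm (ent (\<theta> k s)) \<le> 3 * exp (- s\<^sup>2) + exp (- s\<^sup>2) * s\<^sup>2" for k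
      proof (rule AE_I2)
        fix s :: real
        have "(cu k s) ^ 4 \<le> 1" "(cu k s)\<^sup>2 \<le> 1" using cu01[of k s] by (auto intro: power_le_one)
        moreover have "\<bar>ent (cu k s)\<bar> \<le> (cu k s) ^ 4 + 2 * cu k s" using abs_ent_le[of "cu k s"] cu01[of k s] by simp
        moreover have "s\<^sup>2 * (cu k s)\<^sup>2 \<le> s\<^sup>2 * 1" using \<open>(cu k s)\<^sup>2 \<le> 1\<close> by (intro mult_left_mono) auto
        moreover have "0 \<le> s\<^sup>2 * (cu k s)\<^sup>2" by simp
        ultimately have "\<bar>ent (cu k s) - s\<^sup>2 * (cu k s)\<^sup>2\<bar> \<le> 3 + s\<^sup>2" using cu01[of k s] by linarith
        then have "exp (- s\<^sup>2) * \<bar>ent (cu k s) - s\<^sup>2 * (cu k s)\<^sup>2\<bar> \<le> exp (- s\<^sup>2) * (3 + s\<^sup>2)" by (rule mult_left_mono) simp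
        then show "norm (ent (\<theta> k s)) \<le> 3 * exp (- s\<^sup>2) + exp (- s\<^sup>2) * s\<^sup>2"
          by (simp add: \<theta>_def eg abs_mult distrib_left mult.commute)
      qed
    qed (use G in auto)
    then show "(\<lambda>k. LINT s|lborel. ent (\<theta> k s)) \<longlonglongrightarrow> - sqrt pi / 2" using G by simp
  qed
qed

text \<open>The cube on which the cut-off Gaussian lives is moved away from the bounded complement of the
  domain. In the limit its three integrals are those of the Gaussian, for which the exponent in
  \<open>d0_le_test\<close> is \<open>N + 1\<close>.\<close>
lemma d0_le_gauss:
  fixes \<Omega> :: "'a::euclidean_space set"
  assumes d: "0 < \<delta>" "\<delta> < exp (-2)" and \<Omega>: "open \<Omega>" "bounded (- \<Omega>)"
  shows "d0 \<delta> \<Omega> \<le> sqrt pi ^ DIM('a) / 2 * exp (DIM('a) + 1)"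
proof -
  obtain \<theta> \<theta>' :: "nat \<Rightarrow> real \<Rightarrow> real" where \<theta>:
    "\<And>k. smooth_on (\<theta> k) UNIV" "\<And>k s. (\<theta> k has_real_derivative \<theta>' k s) (at s)"
    "\<And>k s. \<bar>s\<bar> > real k + 1 \<Longrightarrow> \<theta> k s = 0"
    "(\<lambda>k. LINT s|lborel. (\<theta> k s)\<^sup>2) \<longlonglongrightarrow> sqrt pi"
    "(\<lambda>k. LINT s|lborel. (\<theta>' k s)\<^sup>2) \<longlonglongrightarrow> sqrt pi / 2"
    "(\<lambda>k. LINT s|lborel. ent (\<theta> k s)) \<longlonglongrightarrow> - sqrt pi / 2"
    using gauss_cutoffs by blast
  define m where "m k = (LINT s|lborel. (\<theta> k s)\<^sup>2)" for k
  define A where "A k = (LINT s|lborel. (\<theta>' k s)\<^sup>2)" for k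
  define B where "B k = (LINT s|lborel. ent (\<theta> k s))" for k
  obtain \<rho> where \<rho>: "\<And>x. x \<in> - \<Omega> \<Longrightarrow> norm x \<le> \<rho>" using \<Omega>(2) by (auto simp: bounded_iff)
  let ?N = "DIM('a)"
  have "eventually (\<lambda>k. m k > 0) sequentially"
    using order_tendstoD(1)[OF \<theta>(4), of 0] by (simp add: m_def)
  then have ev: "eventually (\<lambda>k. d0 \<delta> \<Omega> \<le> m k ^ ?N / 2 * exp (?N * ((A k - B k) / m k) + 1)) sequentially"
  proof eventually_elim
    case (elim k)
    define R where "R = real k + 1"
    define p where "p = (\<bar>\<rho>\<bar> + R + 1) *\<^sub>R (One::'a)"
    have cube: "x \<in> \<Omega>" if x: "\<And>b. b \<in> Basis \<Longrightarrow> \<bar>(x - p) \<bullet> b\<bar> \<le> R" for x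
    proof (rule ccontr)
      assume "x \<notin> \<Omega>"
      then have n: "norm x \<le> \<rho>" using \<rho> by simp
      obtain b :: 'a where b: "b \<in> Basis" using nonempty_Basis by blast
      have "\<bar>(x - p) \<bullet> b\<bar> \<le> R" by (rule x[OF b])
      moreover have "p \<bullet> b = \<bar>\<rho>\<bar> + R + 1" using b by (simp add: p_def)
      ultimately have "x \<bullet> b > \<rho>" by (simp add: inner_diff_left abs_le_iff) linarith
      then show False using Basis_le_norm[OF b, of x] n by linarith
    qed
    define \<psi> where "\<psi> x = (\<Prod>b\<in>Basis. \<theta> k (x \<bullet> b - p \<bullet> b))" for x :: 'a
    note P = product_test_function[OF \<Omega>(1) \<theta>(1,2) \<theta>(3)[of k, folded R_def] cube, folded \<psi>_def m_def A_def B_def]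
    have P': "\<psi> \<in> test_functions \<Omega>" "Mass \<Omega> \<psi> = m k ^ ?N" "Dir \<Omega> \<psi> = ?N * (A k * m k ^ (?N - 1))" "EntI \<Omega> \<psi> = ?N * (B k * m k ^ (?N - 1))"
      using P by (auto simp: \<psi>_def[abs_def])
    have mp: "m k ^ ?N = m k * m k ^ (?N - 1)" by (metis DIM_positive power_eq_if less_numeral_extra(3))
    have "(Dir \<Omega> \<psi> - EntI \<Omega> \<psi>) / Mass \<Omega> \<psi> = ?N * ((A k - B k) / m k)"
      unfolding P'(2-4) mp using elim by (simp add: field_simps)
    then show ?case using d0_le_test[OF d \<Omega>(1) P'(1)] elim by (simp add: P'(2))
  qed
  have "(\<lambda>k. m k ^ ?N / 2 * exp (?N * ((A k - B k) / m k) + 1)) \<longlonglongrightarrow> sqrt pi ^ ?N / 2 * exp (?N * ((sqrt pi / 2 - - sqrt pi / 2) / sqrt pi) + 1)"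
    using \<theta>(4-6) unfolding m_def[symmetric] A_def[symmetric] B_def[symmetric] by (intro tendsto_intros) auto
  then have "d0 \<delta> \<Omega> \<le> sqrt pi ^ ?N / 2 * exp (?N * ((sqrt pi / 2 - - sqrt pi / 2) / sqrt pi) + 1)"
    by (rule tendsto_lowerbound) (use ev in auto)
  also have "(sqrt pi / 2 - - sqrt pi / 2) / sqrt pi = 1" by (simp add: field_simps)
  finally show ?thesis by (simp add: add.commute)
qed

section \<open>Nonexistence of a ground state\<close>

theorem theorem3p7:
  assumes "DIM('a::euclidean_space) \<ge> 3"
  shows "\<exists>\<delta>\<^sub>0>0. \<forall>\<delta>. 0 < \<delta> \<and> \<delta> < \<delta>\<^sub>0 \<longrightarrow>
    (\<forall>\<Omega>::'a set. exterior_domain \<Omega> \<longrightarrow>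
      \<not> (\<exists>u\<^sub>0. is_solution \<delta> \<Omega> u\<^sub>0 \<and> positive_on \<Omega> u\<^sub>0 \<and> energy \<delta> \<Omega> u\<^sub>0 = d0 \<delta> \<Omega>))"
proof (intro exI[of _ "exp (-2)"] conjI allI impI notI)
  \<comment> \<open>The witness \<open>exp (-2)\<close> is the threshold in \<open>F1_bounds\<close>.\<close>
  fix \<delta> :: real and \<Omega> :: "'a set"
  assume "0 < \<delta> \<and> \<delta> < exp (-2)" and ex: "exterior_domain \<Omega>"
    and "\<exists>u\<^sub>0. is_solution \<delta> \<Omega> u\<^sub>0 \<and> positive_on \<Omega> u\<^sub>0 \<and> energy \<delta> \<Omega> u\<^sub>0 = d0 \<delta> \<Omega>"
  then obtain u where d: "0 < \<delta>" "\<delta> < exp (-2)" and u: "is_solution \<delta> \<Omega> u" "positive_on \<Omega> u" "energy \<delta> \<Omega> u = d0 \<delta> \<Omega>" by blast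
  obtain D where \<Omega>: "open \<Omega>" and D: "open D" "D \<noteq> {}" "bounded D" "- \<Omega> = closure D"
    using ex unfolding exterior_domain_def bounded_smooth_domain_def by blast
  have bd: "bounded (- \<Omega>)" using D by (simp add: bounded_closure)
  \<comment> \<open>The ball that the domain misses makes the inequality for \<open>u\<close> strict.\<close>
  obtain p r where r: "r > 0" "ball p r \<subseteq> D" using D(1,2) by (meson ex_in_conv openE)
  have B: "ball p r \<inter> \<Omega> = {}" using r(2) D(4) closure_subset[of D] by blast
  have uX: "u \<in> X \<delta> \<Omega>" and L: "has_energy_derivative \<delta> \<Omega> u (\<lambda>v. 0)" using u(1) by (auto simp: is_solution_def)
  note U = X_facts[OF d \<Omega> uX]
  define m where "m = Mass \<Omega> u"
  have e: "2 * energy \<delta> \<Omega> u = m" unfolding m_def by (rule Nehari_energy[OF d \<Omega> uX L refl])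
  have "EntI \<Omega> u + (1 + ln pi / 2) * DIM('a) * m < Dir \<Omega> u + m * ln m"
    unfolding m_def by (rule H10_log_sobolev(3)[OF \<Omega> U(1,5) r(1) B bd u(2)])
  then have lt: "m * (1 + (1 + ln pi / 2) * DIM('a)) < m * ln m"
    using e unfolding energy_eq_entropy[OF d \<Omega> U(3)] m_def[symmetric] by (simp add: algebra_simps)
  have "m > 0"
  proof -
    have "m \<noteq> 0" using lt by auto
    then show ?thesis using Mass_nonneg[of \<Omega> u] by (simp add: m_def)
  qed
  then have "1 + (1 + ln pi / 2) * DIM('a) < ln m" using lt by (simp add: mult_less_cancel_left_pos)
  then have "exp (1 + (1 + ln pi / 2) * DIM('a)) < m" using \<open>m > 0\<close> by (metis exp_less_mono exp_ln)
  moreover have "exp (1 + (1 + ln pi / 2) * DIM('a)) = sqrt pi ^ DIM('a) * exp (DIM('a) + 1)"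
  proof -
    have "sqrt pi = exp (ln pi / 2)" by (simp add: ln_sqrt[symmetric])
    then have "sqrt pi ^ DIM('a) = exp (DIM('a) * (ln pi / 2))" by (simp only: exp_of_nat_mult)
    then show ?thesis by (simp add: exp_add[symmetric] algebra_simps)
  qed
  moreover have "m / 2 \<le> sqrt pi ^ DIM('a) / 2 * exp (DIM('a) + 1)"
    using d0_le_gauss[OF d \<Omega> bd] e u(3) by simp
  ultimately show False by simp
qed simp

end
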